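(* Let $d\ge1$ be an integer and $\varepsilon\in(0,1)$. There exist constants $\delta_0\in(0,1)$ and $C\ge 1$, depending only on $d$ (and $\varepsilon$), such that for all $e\in\mathbb{S}^d$, $\alpha\in(0,\pi-\varepsilon]$, all positive integers $n$, all $\delta\in(0,\delta_0)$ and every maximal $(\delta/n,\rho)$-separable subset $\Lambda$ of $B(e,\alpha)$, there exists a family of positive numbers $\lambda_\omega$, $\omega\in\Lambda$, satisfying $$\lambda_\omega\sim\triangle_{\delta/n}(\omega)\sim|B_\rho(\omega,\delta/n)|,\qquad \omega\in\Lambda,$$ with constant of equivalence $C$, such that $$\int_{B(e,\alpha)}f(y)\,d\sigma(y)=\sum_{\omega\in\Lambda}\lambda_\omega f(\omega)\qquad\text{for all } f\in\Pi_n^d.$$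
   Context: $\mathbb{S}^d$ is the unit sphere of $\mathbb{R}^{d+1}$ with the usual rotation invariant (Lebesgue surface) measure $d\sigma$; $|E|$ denotes the $\sigma$-measure of $E\subset\mathbb{S}^d$. $d(x,y)=\arccos (x\cdot y)$ is the geodesic distance, and $B(e,\alpha)=\{x\in\mathbb{S}^d: d(x,e)\le\alpha\}$. $\Pi_n^d$ is the space of spherical polynomials of degree at most $n$, i.e. restrictions to $\mathbb{S}^d$ of polynomials in $d+1$ variables of total degree at most $n$. For $x,y\in B(e,\alpha)$ put $b_x=\alpha-d(x,e)$ and $$\rho(x,y)=\frac1\alpha\sqrt{(d(x,y))^2+\alpha\bigl(b_x^{1/2}-b_y^{1/2}\bigr)^2},$$ which is a metric on $B(e,\alpha)$; $B_\rho(x,r)=\{y\in B(e,\alpha):\rho(x,y)\le r\}$. For $r>0$, $x\in B(e,\alpha)$, $$\triangle_r(x)=\alpha^d\Bigl(r^{d+1}+r^d\sqrt{1-\tfrac{d(x,e)}{\alpha}}\Bigr).$$ A finite subset $A\subset B(e,\alpha)$ is $(s,\rho)$-separable if $\rho(\xi,\xi')\ge s$ for all distinct $\xi,\xi'\in A$; it is maximal $(s,\rho)$-separable if in addition $B(e,\alpha)=\bigcup_{\xi\in A}B_\rho(\xi,s)$. $A\sim B$ with constant of equivalence $C$ means $C^{-1}B\le A\le CB$. *)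

theory Defs
  imports "HOL-Analysis.Analysis"
begin

text \<open>
  Surface measure on the unit sphere of \<open>real ^ 'n\<close>, obtained from Lebesgue measure through polar
  coordinates: \<open>\<sigma> E = CARD('n) * vol {x. 0 < norm x < 1 \<and> x / norm x \<in> E}\<close>, the volume of the
  cone over \<open>E\<close> times the dimension.  This is the usual normalisation; for example the total mass
  is \<open>2 * pi\<close> on the circle and \<open>4 * pi\<close> on the two-sphere.
\<close>

definition surface_measure :: "(real ^ 'n) measure" where
  "surface_measure = scale_measure (of_nat CARD('n))
     (distr (restrict_space lborel (ball 0 1 - {0})) (restrict_space borel (sphere 0 1))
       (\<lambda>x. x /\<^sub>R norm x))"

lemma space_surface_measure: "space (surface_measure :: (real ^ 'n) measure) = sphere 0 1"
  by (simp add: surface_measure_def space_restrict_space space_scale_measure)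

lemma sets_surface_measure:
  "sets (surface_measure :: (real ^ 'n) measure) = sets (restrict_space borel (sphere 0 1))"
  by (simp add: surface_measure_def)

lemma radial_projection_measurable:
  "(\<lambda>x :: real ^ 'n. x /\<^sub>R norm x)
     \<in> restrict_space lborel (ball 0 1 - {0}) \<rightarrow>\<^sub>M restrict_space borel (sphere 0 1)"
  by (rule measurable_restrict_space2)
    (auto simp: space_restrict_space intro!: measurable_restrict_space1)

lemma emeasure_surface_measure:
  fixes E :: "(real ^ 'n) set"
  assumes "E \<in> sets surface_measure"
  shows "emeasure surface_measure E =
    of_nat CARD('n) * emeasure lborel {x \<in> ball 0 1 - {0}. x /\<^sub>R norm x \<in> E}"
proof -
  have E: "E \<in> sets (restrict_space borel (sphere 0 1))"
    using assms by (simp add: sets_surface_measure)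
  have "(\<lambda>x. x /\<^sub>R norm x) -` E \<inter> (ball 0 1 - {0}) = {x \<in> ball 0 1 - {0}. x /\<^sub>R norm x \<in> E}"
    by auto
  then show ?thesis
    by (simp add: surface_measure_def emeasure_scale_measure space_restrict_space
        emeasure_distr[OF radial_projection_measurable E] emeasure_restrict_space subset_eq)
qed

lemma emeasure_surface_measure_sphere:
  "emeasure surface_measure (sphere 0 1 :: (real ^ 'n) set) =
     ennreal (CARD('n) * unit_ball_vol CARD('n))"
proof -
  have S: "(sphere 0 1 :: (real ^ 'n) set) \<in> sets surface_measure"
    by (metis sets.top space_surface_measure)
  have "{x \<in> ball 0 1 - {0 :: real ^ 'n}. x /\<^sub>R norm x \<in> sphere 0 1} = ball 0 1 - {0}"
    by auto
  moreover have "emeasure lborel (ball 0 1 - {0 :: real ^ 'n}) = emeasure lborel (ball 0 1 :: (real ^ 'n) set)"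
    by (rule emeasure_Diff_null_set) auto
  ultimately show ?thesis
    by (simp add: emeasure_surface_measure[OF S] emeasure_ball ennreal_mult ennreal_of_nat_eq_real_of_nat)
qed

definition geod_dist :: "real ^ 'n \<Rightarrow> real ^ 'n \<Rightarrow> real" where
  "geod_dist x y = arccos (x \<bullet> y)"

definition cap :: "real ^ 'n \<Rightarrow> real \<Rightarrow> (real ^ 'n) set" where
  "cap e \<alpha> = {x \<in> sphere 0 1. geod_dist x e \<le> \<alpha>}"

text \<open>
  Membership depends only on the values on the sphere; the exponents \<open>k\<close> range over the finitely
  many multi-indices of total degree at most \<open>n\<close>.
\<close>

definition spherical_polys :: "nat \<Rightarrow> (real ^ 'n \<Rightarrow> real) set" where
  "spherical_polys n = {f. \<exists>c :: ('n \<Rightarrow> nat) \<Rightarrow> real. \<forall>x \<in> sphere 0 1.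
     f x = (\<Sum>k | (\<Sum>i\<in>UNIV. k i) \<le> n. c k * (\<Prod>i\<in>UNIV. (x $ i) ^ k i))}"

lemma finite_multi_indices: "finite {k :: 'n :: finite \<Rightarrow> nat. (\<Sum>i\<in>UNIV. k i) \<le> n}"
proof (rule finite_subset)
  show "{k :: 'n \<Rightarrow> nat. (\<Sum>i\<in>UNIV. k i) \<le> n} \<subseteq> Pi\<^sub>E UNIV (\<lambda>_. {..n})"
  proof
    fix k :: "'n \<Rightarrow> nat" assume k: "k \<in> {k. (\<Sum>i\<in>UNIV. k i) \<le> n}"
    have "k i \<le> (\<Sum>i\<in>UNIV. k i)" for i
      by (rule member_le_sum) auto
    with k show "k \<in> Pi\<^sub>E UNIV (\<lambda>_. {..n})"
      by (auto intro: order_trans)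
  qed
qed (simp add: finite_PiE)

definition bdist :: "real ^ 'n \<Rightarrow> real \<Rightarrow> real ^ 'n \<Rightarrow> real" where
  "bdist e \<alpha> x = \<alpha> - geod_dist x e"

definition cap_metric :: "real ^ 'n \<Rightarrow> real \<Rightarrow> real ^ 'n \<Rightarrow> real ^ 'n \<Rightarrow> real" where
  "cap_metric e \<alpha> x y =
     (1 / \<alpha>) * sqrt ((geod_dist x y)\<^sup>2 + \<alpha> * (sqrt (bdist e \<alpha> x) - sqrt (bdist e \<alpha> y))\<^sup>2)"

definition cap_metric_ball :: "real ^ 'n \<Rightarrow> real \<Rightarrow> real ^ 'n \<Rightarrow> real \<Rightarrow> (real ^ 'n) set" where
  "cap_metric_ball e \<alpha> x r = {y \<in> cap e \<alpha>. cap_metric e \<alpha> x y \<le> r}"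

definition tri :: "nat \<Rightarrow> real ^ 'n \<Rightarrow> real \<Rightarrow> real \<Rightarrow> real ^ 'n \<Rightarrow> real" where
  "tri d e \<alpha> r x = \<alpha> ^ d * (r ^ (d + 1) + r ^ d * sqrt (1 - geod_dist x e / \<alpha>))"

definition separable :: "real ^ 'n \<Rightarrow> real \<Rightarrow> real \<Rightarrow> (real ^ 'n) set \<Rightarrow> bool" where
  "separable e \<alpha> s A \<longleftrightarrow> finite A \<and> A \<subseteq> cap e \<alpha> \<and>
     (\<forall>\<xi>\<in>A. \<forall>\<xi>'\<in>A. \<xi> \<noteq> \<xi>' \<longrightarrow> cap_metric e \<alpha> \<xi> \<xi>' \<ge> s)"

definition maximal_separable :: "real ^ 'n \<Rightarrow> real \<Rightarrow> real \<Rightarrow> (real ^ 'n) set \<Rightarrow> bool" where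
  "maximal_separable e \<alpha> s A \<longleftrightarrow>
     separable e \<alpha> s A \<and> cap e \<alpha> = (\<Union>\<xi>\<in>A. cap_metric_ball e \<alpha> \<xi> s)"

definition equiv_with_const :: "real \<Rightarrow> real \<Rightarrow> real \<Rightarrow> bool" where
  "equiv_with_const C a b \<longleftrightarrow> inverse C * b \<le> a \<and> a \<le> C * b"

end

theory Submission
  imports Defs
begin

text \<open>
  Composing the orthogonal projection of a hemisphere onto a ball with the inverse of Lambert's azimuthal
  projection gives a map from the hemisphere \<open>x \<bullet> e \<ge> 0\<close> onto the cap that is bi-Lipschitz from the
  Euclidean distance to the metric of the cap and carries the measure \<open>(x \<bullet> e) d\<sigma>\<close> to a multiple of
  surface measure up to bounded factors. Any two nearby points of the sphere are joined by a chain of small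
  rotations in coordinate planes, along which a polynomial of degree \<open>n\<close> is a trigonometric polynomial, and
  sampling these with a rapidly decaying kernel bounds its oscillation in the weighted \<open>L\<^sup>1\<close> norm.
  Therefore, with \<open>\<mu>\<^sub>\<omega>\<close> the measure of the Voronoi cell of \<open>\<omega>\<close>, the error of the quadrature
  \<open>\<Sum> \<mu>\<^sub>\<omega> f \<omega>\<close> is at most \<open>\<Sum> \<mu>\<^sub>\<omega> \<bar>f \<omega>\<bar> / 2\<close> on polynomials of degree \<open>n\<close>. By the
  Hahn--Banach theorem in finite dimension the error functional is itself \<open>\<Sum> \<nu>\<^sub>\<omega> f \<omega>\<close> with
  \<open>\<bar>\<nu>\<^sub>\<omega>\<bar> \<le> \<mu>\<^sub>\<omega> / 2\<close>, so that \<open>\<mu>\<^sub>\<omega> + \<nu>\<^sub>\<omega> \<ge> \<mu>\<^sub>\<omega> / 2\<close> are the required weights.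
\<close>

text \<open>The obstacle is the boundary of the cap: the metric contains the square root of the
  boundary distance there and balls lose volume. In the hemisphere coordinate \<open>x\<close> this
  root is comparable to the height \<open>x \<bullet> e\<close>, and the factor
  \<open>r + sqrt (1 - geod_dist x e / \<alpha>)\<close> of \<open>tri\<close> is the size of the
  density \<open>x \<bullet> e\<close> at scale \<open>r\<close>. Since \<open>capmap\<close>
  depends only on the component orthogonal to \<open>e\<close>, everything extends evenly to the
  whole sphere, which has no boundary and on which rotations act; what remains is an inequality for
  the weight \<open>\<bar>x \<bullet> e\<bar>\<close>, degenerate on the equator alone. The price is
  the square root \<open>cfac\<close>: the pullback of a polynomial is no longer a polynomial, but
  it is described by two polynomials of degree \<open>3 * n\<close>. Uniformity in \<alpha> is a
  matter of scaling: apart from the height, the Jacobian is of order (2\<kappa>)^d with \<kappa> =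
  sin(\<alpha>/2), and this factor cancels. The bound \<open>\<alpha> \<le> pi - \<epsilon>\<close>
  serves to keep \<open>cfac\<close> away from 0.\<close>

lemma finite_Hahn_Banach:
  fixes V :: "('a \<Rightarrow> real) set" and l :: "('a \<Rightarrow> real) \<Rightarrow> real"
  assumes "finite A" and m: "\<And>x. x \<in> A \<Longrightarrow> 0 \<le> m x"
    and add: "\<And>f g. f \<in> V \<Longrightarrow> g \<in> V \<Longrightarrow> (\<lambda>x. f x + g x) \<in> V"
    and scale: "\<And>c f. f \<in> V \<Longrightarrow> (\<lambda>x. c * f x) \<in> V"
    and ladd: "\<And>f g. f \<in> V \<Longrightarrow> g \<in> V \<Longrightarrow> l (\<lambda>x. f x + g x) = l f + l g"
    and lscale: "\<And>c f. f \<in> V \<Longrightarrow> l (\<lambda>x. c * f x) = c * l f"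
    and bound: "\<And>f. f \<in> V \<Longrightarrow> \<bar>l f\<bar> \<le> (\<Sum>x\<in>A. m x * \<bar>f x\<bar>)"
  shows "\<exists>\<nu>. (\<forall>x\<in>A. \<bar>\<nu> x\<bar> \<le> m x) \<and> (\<forall>f\<in>V. l f = (\<Sum>x\<in>A. \<nu> x * f x))"
  using assms(1) m ladd lscale bound
proof (induction A arbitrary: l rule: finite_induct)
  case empty
  then show ?case by force
next
  case (insert a A)
  define q where "q f = (\<Sum>x\<in>A. m x * \<bar>f x\<bar>)" for f
  have bd: "\<bar>l f\<bar> \<le> m a * \<bar>f a\<bar> + q f" if "f \<in> V" for f
    using insert.prems(4)[OF that] insert.hyps by (simp add: q_def)
  have ma: "0 \<le> m a" using insert.prems by auto
  \<comment> \<open>\<open>t\<close> will be the coefficient at \<open>a\<close>. For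
    \<open>f a = 1\<close> the condition says that \<open>l f - t\<close> is dominated by
    \<open>q f\<close>, the share of the remaining nodes. Homogeneity gives all \<open>f\<close>
    with \<open>f a \<noteq> 0\<close>, and for \<open>f a = 0\<close> the bound \<open>bd\<close>
    suffices.\<close>
  have key: "\<exists>t. \<bar>t\<bar> \<le> m a \<and> (\<forall>f\<in>V. f a = 1 \<longrightarrow> l f - q f \<le> t \<and> t \<le> l f + q f)"
  proof (cases "\<exists>f\<in>V. f a = 1")
    case False
    then show ?thesis using ma by (intro exI[of _ 0]) auto
  next
    case True
    define S where "S = (\<lambda>f. l f - q f) ` {f\<in>V. f a = 1}"
    have ne: "S \<noteq> {}" using True by (auto simp: S_def)
    \<comment> \<open>The difference of two functions normalised at \<open>a\<close> vanishes there,
      so its bound contains no \<open>m a\<close>; hence every lower bound for \<open>t\<close> lies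
      below every upper bound.\<close>
    have cross: "l f - q f \<le> l g + q g" if "f \<in> V" "f a = 1" "g \<in> V" "g a = 1" for f g
    proof -
      have g': "(\<lambda>x. (-1) * g x) \<in> V" by (rule scale) fact
      have h: "(\<lambda>x. f x + (-1) * g x) \<in> V" by (rule add) (use that g' in auto)
      have "l (\<lambda>x. f x + (-1) * g x) = l f - l g"
        using insert.prems(2)[OF that(1) g'] insert.prems(3)[OF that(3), of "-1"] by simp
      with bd[OF h] that have "l f - l g \<le> q (\<lambda>x. f x + (-1) * g x)" by simp
      also have "\<dots> \<le> q f + q g"
        unfolding q_def sum.distrib[symmetric]
      proof (rule sum_mono)
        fix x assume "x \<in> A"
        then have "0 \<le> m x" using insert.prems by auto
        then have "m x * \<bar>f x + - 1 * g x\<bar> \<le> m x * (\<bar>f x\<bar> + \<bar>g x\<bar>)"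
          by (intro mult_left_mono) auto
        then show "m x * \<bar>f x + - 1 * g x\<bar> \<le> m x * \<bar>f x\<bar> + m x * \<bar>g x\<bar>"
          by (simp add: algebra_simps)
      qed
      finally show ?thesis by simp
    qed
    have up: "s \<le> m a" if "s \<in> S" for s
      using that bd by (force simp: S_def)
    have bdd: "bdd_above S" using up by (auto simp: bdd_above_def)
    have lo: "- m a \<le> l g + q g" if "g \<in> V" "g a = 1" for g
      using bd[OF that(1)] that by auto
    have "Sup S \<le> m a" using up ne by (intro cSup_least) auto
    moreover have "Sup S \<le> l g + q g" if "g \<in> V" "g a = 1" for g
      using ne cross that by (intro cSup_least) (auto simp: S_def)
    moreover have "l f - q f \<le> Sup S" if "f \<in> V" "f a = 1" for f
      using that bdd by (intro cSup_upper) (auto simp: S_def)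
    \<comment> \<open>\<open>Sup S\<close> may fall below \<open>- m a\<close>; the maximum repairs
      this and, by \<open>lo\<close>, still stays below every \<open>l g + q g\<close>.\<close>
    ultimately show ?thesis
      using ma lo by (intro exI[of _ "max (- m a) (Sup S)"]) (auto simp: le_max_iff_disj)
  qed
  then obtain t where t: "\<bar>t\<bar> \<le> m a"
    "\<And>f. f \<in> V \<Longrightarrow> f a = 1 \<Longrightarrow> l f - q f \<le> t \<and> t \<le> l f + q f" by blast
  have new: "\<bar>l f - t * f a\<bar> \<le> q f" if f: "f \<in> V" for f
  proof (cases "f a = 0")
    case True
    then show ?thesis using bd[OF f] by simp
  next
    case False
    define g where "g x = inverse (f a) * f x" for x
    have g: "g \<in> V" unfolding g_def by (rule scale) fact
    have "g a = 1" using False by (simp add: g_def)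
    from t(2)[OF g this] have "\<bar>l g - t\<bar> \<le> q g" by auto
    then have "\<bar>f a\<bar> * \<bar>l g - t\<bar> \<le> \<bar>f a\<bar> * q g" by (intro mult_left_mono) auto
    moreover have "l f = f a * l g"
      using insert.prems(3)[OF f, of "inverse (f a)"] False by (simp add: g_def[abs_def])
    moreover have "q f = \<bar>f a\<bar> * q g"
      using False by (simp add: q_def g_def sum_distrib_left abs_mult field_simps)
    ultimately show ?thesis by (simp add: abs_mult[symmetric] algebra_simps)
  qed
  have "\<exists>\<nu>. (\<forall>x\<in>A. \<bar>\<nu> x\<bar> \<le> m x) \<and> (\<forall>f\<in>V. l f - t * f a = (\<Sum>x\<in>A. \<nu> x * f x))"
  proof (rule insert.IH)
    fix f assume "f \<in> V"
    then show "\<bar>l f - t * f a\<bar> \<le> (\<Sum>x\<in>A. m x * \<bar>f x\<bar>)"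
      using new by (simp add: q_def)
  qed (use insert.prems in \<open>auto simp: algebra_simps\<close>)
  then obtain \<nu> where \<nu>: "\<And>x. x \<in> A \<Longrightarrow> \<bar>\<nu> x\<bar> \<le> m x"
    "\<And>f. f \<in> V \<Longrightarrow> l f - t * f a = (\<Sum>x\<in>A. \<nu> x * f x)" by blast
  have "(\<Sum>x\<in>A. (\<nu>(a := t)) x * f x) = (\<Sum>x\<in>A. \<nu> x * f x)" for f
    using insert.hyps by (intro sum.cong) auto
  then show ?case
    using \<nu> t insert.hyps by (intro exI[of _ "\<nu>(a := t)"]) (auto simp: algebra_simps)
qed

subsection \<open>Sampling of trigonometric polynomials\<close>

text \<open>Generated by exponentials with frequencies in \<open>{- m..m}\<close> instead of
  described by coefficients: products, reflections and the interpolation identity are linear in each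
  argument, so rule induction reduces them to single exponentials.\<close>

inductive trig_poly :: "int \<Rightarrow> (real \<Rightarrow> complex) \<Rightarrow> bool" for m where
  base: "\<bar>k\<bar> \<le> m \<Longrightarrow> trig_poly m (\<lambda>t. c * cis (of_int k * t))"
| add: "trig_poly m f \<Longrightarrow> trig_poly m g \<Longrightarrow> trig_poly m (\<lambda>t. f t + g t)"

lemma trig_poly_mult:
  assumes "trig_poly m f" "trig_poly l g" "m + l \<le> r"
  shows "trig_poly r (\<lambda>t. f t * g t)"
  using assms(1)
proof induction
  case (base k c)
  show ?case using assms(2)
  proof induction
    case (base j d)
    have "trig_poly r (\<lambda>t. (c * d) * cis (of_int (k + j) * t))"
      using \<open>\<bar>k\<bar> \<le> m\<close> base assms(3) by (intro trig_poly.base) auto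
    moreover have "(c * d) * cis (of_int (k + j) * t) = c * cis (of_int k * t) * (d * cis (of_int j * t))" for t
    proof -
      have "c * cis (of_int k * t) * (d * cis (of_int j * t)) = (c * d) * (cis (of_int k * t) * cis (of_int j * t))"
        by (simp only: mult_ac)
      then show ?thesis by (simp only: cis_mult of_int_add distrib_right)
    qed
    ultimately show ?case by (simp only:)
  next
    case (add f g)
    from trig_poly.add[OF add.IH] show ?case by (simp only: distrib_left)
  qed
next
  case (add f g)
  from trig_poly.add[OF add.IH] show ?case by (simp only: distrib_right)
qed

lemma trig_poly_const: "0 \<le> m \<Longrightarrow> trig_poly m (\<lambda>t. c)"
  using trig_poly.base[of 0 m c] by simp

lemma trig_poly_cos_sin:
  assumes "1 \<le> m"
  shows "trig_poly m (\<lambda>t. of_real (u + v * cos t + w * sin t))"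
proof -
  have "trig_poly m (\<lambda>t. of_real u + (((of_real v - \<i> * of_real w) / 2) * cis (of_int 1 * t)
      + ((of_real v + \<i> * of_real w) / 2) * cis (of_int (-1) * t)))"
    using assms by (intro trig_poly.add trig_poly_const trig_poly.base) auto
  moreover have "of_real u + (((of_real v - \<i> * of_real w) / 2) * cis (of_int 1 * t)
      + ((of_real v + \<i> * of_real w) / 2) * cis (of_int (-1) * t)) = of_real (u + v * cos t + w * sin t)" for t
    by (simp add: complex_eq_iff field_simps)
  ultimately show ?thesis by (simp only:)
qed

lemma trig_poly_reflect: "trig_poly m f \<Longrightarrow> trig_poly m (\<lambda>t. f (s - t))"
proof (induction rule: trig_poly.induct)
  case (base k c)
  have "trig_poly m (\<lambda>t. (c * cis (of_int k * s)) * cis (of_int (- k) * t))"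
    using base by (intro trig_poly.base) auto
  then show ?case by (simp add: cis_mult mult.assoc right_diff_distrib)
qed (rule trig_poly.add)

section \<open>The Dirichlet kernel: interpolation at equispaced nodes, and decay\<close>

definition dirichlet :: "nat \<Rightarrow> real \<Rightarrow> real" where
  "dirichlet m x = 1 + 2 * (\<Sum>k<m. cos (real (Suc k) * x))"

lemma dirichlet_Suc: "dirichlet (Suc m) x = dirichlet m x + 2 * cos (real (Suc m) * x)"
  by (simp add: dirichlet_def algebra_simps)

lemma of_real_dirichlet:
  "complex_of_real (dirichlet m x) = (\<Sum>k\<in>{- int m..int m}. cis (of_int k * x))"
proof (induction m)
  case 0
  then show ?case by (simp add: dirichlet_def)
next
  case (Suc m)
  have "{- int (Suc m)..int (Suc m)} = insert (- int (Suc m)) (insert (int (Suc m)) {- int m..int m})"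
    by auto
  moreover have "cis (of_int (- int (Suc m)) * x) + cis (of_int (int (Suc m)) * x)
      = of_real (2 * cos (real (Suc m) * x))"
  proof -
    have "of_int (- int (Suc m)) * x = - (real (Suc m) * x)" "of_int (int (Suc m)) * x = real (Suc m) * x"
      by (auto simp: algebra_simps)
    then show ?thesis by (simp only: complex_eq_iff) simp
  qed
  ultimately show ?case using Suc by (simp add: dirichlet_Suc)
qed

lemma trig_poly_sum:
  "finite A \<Longrightarrow> 0 \<le> m \<Longrightarrow> (\<And>k. k \<in> A \<Longrightarrow> trig_poly m (f k)) \<Longrightarrow> trig_poly m (\<lambda>t. \<Sum>k\<in>A. f k t)"
  by (induction A rule: finite_induct) (auto intro: trig_poly_const trig_poly.add)

lemma trig_poly_dirichlet: "trig_poly (int m) (\<lambda>t. of_real (dirichlet m t))"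
  unfolding of_real_dirichlet
  using trig_poly.base[of _ "int m" 1] by (intro trig_poly_sum) auto

lemma dirichlet_sin: "dirichlet m x * sin (x / 2) = sin ((real m + 1/2) * x)"
proof (induction m)
  case 0
  then show ?case by (simp add: dirichlet_def)
next
  case (Suc m)
  have "2 * cos (real (Suc m) * x) * sin (x / 2)
      = sin (real (Suc m) * x + x / 2) - sin (real (Suc m) * x - x / 2)"
    by (simp add: sin_add sin_diff)
  moreover have "real (Suc m) * x + x / 2 = (real (Suc m) + 1/2) * x"
    "real (Suc m) * x - x / 2 = (real m + 1/2) * x" by (auto simp: algebra_simps)
  ultimately show ?case using Suc by (simp add: dirichlet_Suc algebra_simps)
qed

text \<open>Exactness at \<open>2 * m + 1\<close> equispaced nodes rests on discrete orthogonality: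
  the sum over the nodes of \<open>cis\<close> with frequency \<open>l - k\<close> is again a value
  of the Dirichlet kernel, and by \<open>dirichlet_sin\<close> this value is 0 for
  \<open>l \<noteq> k\<close>.\<close>

lemma dirichlet_interpolation:
  assumes "trig_poly (int m) f"
  shows "f s = (\<Sum>j\<in>{- int m..int m}. f (2 * pi * of_int j / (2 * real m + 1)) *
    of_real (dirichlet m (s - 2 * pi * of_int j / (2 * real m + 1)))) / (2 * of_nat m + 1)"
  using assms
proof induction
  case (base l c)
  define M where "M = 2 * real m + 1"
  have M: "M > 0" by (simp add: M_def)
  have orth: "(\<Sum>j\<in>{- int m..int m}. cis (of_int (l - k) * (2 * pi * of_int j / M)))
      = (if k = l then of_real M else 0)" if "k \<in> {- int m..int m}" for k
  proof (cases "k = l")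
    case True
    then show ?thesis by (simp add: M_def)
  next
    case False
    define x where "x = 2 * pi * of_int (l - k) / M"
    have "(\<Sum>j\<in>{- int m..int m}. cis (of_int (l - k) * (2 * pi * of_int j / M)))
        = of_real (dirichlet m x)"
      unfolding of_real_dirichlet by (intro sum.cong) (auto simp: x_def algebra_simps)
    moreover have "dirichlet m x * sin (x / 2) = 0"
    proof -
      have "(real m + 1/2) * x = of_int (l - k) * pi"
        using M by (simp add: x_def M_def field_simps)
      then show ?thesis unfolding dirichlet_sin by (simp add: sin_times_pi_eq_0)
    qed
    \<comment> \<open>A zero would make \<open>l - k\<close> a multiple of \<open>2 * m + 1\<close>,
      but it is nonzero and at most \<open>2 * m\<close> in absolute value.\<close>
    moreover have "sin (x / 2) \<noteq> 0"
    proof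
      assume "sin (x / 2) = 0"
      then obtain i :: int where "x / 2 = of_int i * pi" by (auto simp: sin_zero_iff_int2)
      then have "of_int (l - k) * pi = (of_int i * M) * pi" using M by (simp add: x_def field_simps)
      then have "of_int (l - k) = of_int i * M" using pi_neq_zero by (metis mult_right_cancel)
      then have "real_of_int (l - k) = real_of_int (i * (2 * int m + 1))" by (simp add: M_def)
      then have *: "l - k = i * (2 * int m + 1)" by (simp only: of_int_eq_iff)
      moreover have "\<bar>l - k\<bar> \<le> 2 * int m" using base that by auto
      moreover have "i \<noteq> 0" using * False by auto
      then have "\<bar>i\<bar> * (2 * int m + 1) \<ge> 1 * (2 * int m + 1)" by (intro mult_right_mono) auto
      moreover have "\<bar>l - k\<bar> = \<bar>i\<bar> * (2 * int m + 1)" unfolding * abs_mult by simp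
      ultimately have "1 * (2 * int m + 1) \<le> 2 * int m" by (metis order_trans)
      then show False by simp
    qed
    ultimately show ?thesis using False by auto
  qed
  have "(\<Sum>j\<in>{- int m..int m}. (c * cis (of_int l * (2 * pi * of_int j / M))) *
      of_real (dirichlet m (s - 2 * pi * of_int j / M)))
    = (\<Sum>j\<in>{- int m..int m}. \<Sum>k\<in>{- int m..int m}. c * cis (of_int k * s) *
        cis (of_int (l - k) * (2 * pi * of_int j / M)))"
    unfolding of_real_dirichlet sum_distrib_left
  proof (intro sum.cong refl)
    fix j k :: int
    define y where "y = 2 * pi * of_int j / M"
    have "of_int l * y + of_int k * (s - y) = of_int k * s + of_int (l - k) * y"
      by (simp add: algebra_simps)
    then have "cis (of_int l * y) * cis (of_int k * (s - y)) = cis (of_int k * s) * cis (of_int (l - k) * y)"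
      by (simp only: cis_mult)
    then show "c * cis (of_int l * (2 * pi * of_int j / M)) * cis (of_int k * (s - 2 * pi * of_int j / M))
        = c * cis (of_int k * s) * cis (of_int (l - k) * (2 * pi * of_int j / M))"
      unfolding y_def by (simp only: mult.assoc)
  qed
  also have "\<dots> = (\<Sum>k\<in>{- int m..int m}. c * cis (of_int k * s) * (if k = l then of_real M else 0))"
    by (subst sum.swap, intro sum.cong refl) (simp only: orth flip: sum_distrib_left)
  also have "\<dots> = (\<Sum>k\<in>{- int m..int m}. if k = l then c * cis (of_int l * s) * of_real M else 0)"
    by (intro sum.cong) auto
  also have "\<dots> = c * cis (of_int l * s) * of_real M" using base by auto
  finally have *: "(\<Sum>j\<in>{- int m..int m}. (c * cis (of_int l * (2 * pi * of_int j / M))) *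
      of_real (dirichlet m (s - 2 * pi * of_int j / M))) = c * cis (of_int l * s) * of_real M" .
  have "complex_of_real M \<noteq> 0" using M by simp
  moreover have "complex_of_real M = 2 * of_nat m + 1" by (simp add: M_def)
  ultimately show ?case using * unfolding M_def by (simp add: field_simps)
next
  case (add f g)
  show ?case
    unfolding distrib_right sum.distrib add_divide_distrib
    by (rule arg_cong2[where f = "(+)"]) (rule add.IH)+
qed


text \<open>Concavity: on [0, pi] the sine lies above its chord from the origin to (b, sin b). With
  \<open>b = pi / 2\<close> this is the source of most linear lower bounds for the sine below, with
  \<open>b = pi - \<epsilon>\<close> that of \<open>sin_lower\<close>.\<close>

lemma sin_ge_chord:
  assumes "0 \<le> x" "x \<le> b" "b \<le> pi" "0 < b"
  shows "x / b * sin b \<le> sin x"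
proof -
  have "convex_on {0..pi} (\<lambda>x. - sin x)"
  proof (rule f''_ge0_imp_convex)
    show "DERIV (\<lambda>x. - sin x) x :> - cos x" for x :: real
      by (auto intro!: derivative_eq_intros)
    show "DERIV (\<lambda>x. - cos x) x :> sin x" for x :: real
      by (auto intro!: derivative_eq_intros)
  qed (auto intro: sin_ge_zero)
  from convex_onD[OF this, of "x / b" 0 b] show ?thesis
    using assms by (auto simp: field_simps)
qed

text \<open>The range exceeds pi by 1 because the kernels are evaluated at \<open>s\<close> minus a
  node, where the node lies in [-pi, pi] and \<open>\<bar>s\<bar> \<le> 1\<close>. At the end of the
  range \<open>sin b = cos (1/2)\<close> is still at least 1/2; together with
  \<open>2 * b \<le> 5\<close> this gives the constant 10.\<close>

lemma abs_sin_half_ge: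
  assumes "\<bar>x\<bar> \<le> pi + 1"
  shows "\<bar>x\<bar> / 10 \<le> \<bar>sin (x / 2)\<bar>"
proof -
  define b where "b = (pi + 1) / 2"
  have b: "0 < b" "b \<le> pi" "2 * b \<le> 5" using pi_gt3 pi_less_4 by (auto simp: b_def)
  have "pi / 2 - b = - (1/2)" by (simp add: b_def field_simps)
  then have "sin b = cos (1/2)" using sin_cos_eq[of b] by simp
  moreover have "cos (pi / 3) \<le> cos (1/2)" using pi_gt3 by (intro cos_monotone_0_pi_le) auto
  ultimately have sb: "1/2 \<le> sin b" by (simp add: cos_60)
  define y where "y = \<bar>x\<bar> / 2"
  have y: "0 \<le> y" "y \<le> b" using assms by (auto simp: y_def b_def)
  have "y / 5 \<le> y / b * (1/2)" using y b divide_left_mono[of "2 * b" 5 y] by (simp add: mult.commute)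
  also have "\<dots> \<le> y / b * sin b" using y b sb by (intro mult_left_mono) auto
  also have "\<dots> \<le> sin y" using sin_ge_chord[of y b] y b by auto
  also have "sin y \<le> \<bar>sin (x / 2)\<bar>"
    by (cases "0 \<le> x") (auto simp: y_def)
  finally show ?thesis by (simp add: y_def)
qed

definition dirichlet_deriv :: "nat \<Rightarrow> real \<Rightarrow> real" where
  "dirichlet_deriv m x = - 2 * (\<Sum>k<m. real (Suc k) * sin (real (Suc k) * x))"

lemma has_field_derivative_dirichlet:
  "(dirichlet m has_field_derivative dirichlet_deriv m x) (at x)"
  unfolding dirichlet_def[abs_def] dirichlet_deriv_def
  by (auto intro!: derivative_eq_intros simp: sum_negf sum_distrib_left mult.commute)

lemma abs_dirichlet_le: "\<bar>dirichlet m x\<bar> \<le> 2 * real m + 1"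
proof -
  have "\<bar>\<Sum>k<m. cos (real (Suc k) * x)\<bar> \<le> (\<Sum>k<m. 1)"
    by (intro order_trans[OF sum_abs] sum_mono) auto
  then show ?thesis by (simp add: dirichlet_def)
qed

lemma abs_dirichlet_deriv_le: "\<bar>dirichlet_deriv m x\<bar> \<le> real m * (real m + 1)"
proof -
  have "\<bar>\<Sum>k<m. real (Suc k) * sin (real (Suc k) * x)\<bar> \<le> (\<Sum>k<m. real (Suc k) * 1)"
    by (intro order_trans[OF sum_abs] sum_mono) (auto simp: abs_mult intro!: mult_left_mono)
  also have "2 * (\<Sum>k<m. real (Suc k) * 1) = real m * (real m + 1)"
    by (induction m) (auto simp: algebra_simps)
  finally show ?thesis by (simp add: dirichlet_deriv_def abs_mult)
qed

text \<open>Multiplied by \<open>sin (x / 2)\<close> the kernel is bounded by 1, which yields the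
  gain \<open>m * \<bar>x\<bar>\<close>; the summand 1 of the weight comes from the trivial bounds
  \<open>abs_dirichlet_le\<close> and \<open>abs_dirichlet_deriv_le\<close>. The derivative is
  treated alike, after differentiating both sides of \<open>dirichlet_sin\<close>.\<close>

lemma dirichlet_decay:
  assumes "\<bar>x\<bar> \<le> pi + 1" "1 \<le> m"
  shows "\<bar>dirichlet m x\<bar> * (1 + real m * \<bar>x\<bar>) \<le> 13 * real m"
    and "\<bar>dirichlet_deriv m x\<bar> * (1 + real m * \<bar>x\<bar>) \<le> 32 * (real m)\<^sup>2"
proof -
  note s = abs_sin_half_ge[OF assms(1)]
  have "\<bar>dirichlet m x\<bar> * (\<bar>x\<bar> / 10) \<le> \<bar>dirichlet m x\<bar> * \<bar>sin (x / 2)\<bar>"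
    by (intro mult_left_mono s) auto
  also have "\<dots> \<le> 1" by (simp add: dirichlet_sin flip: abs_mult)
  finally have "\<bar>dirichlet m x\<bar> * \<bar>x\<bar> \<le> 10" by simp
  then have *: "real m * (\<bar>dirichlet m x\<bar> * \<bar>x\<bar>) \<le> real m * 10" by (intro mult_left_mono) auto
  show "\<bar>dirichlet m x\<bar> * (1 + real m * \<bar>x\<bar>) \<le> 13 * real m"
  proof -
    have "1 \<le> real m" using assms by simp
    moreover have "\<bar>dirichlet m x\<bar> * (1 + real m * \<bar>x\<bar>) = \<bar>dirichlet m x\<bar> + real m * (\<bar>dirichlet m x\<bar> * \<bar>x\<bar>)"
      by (simp add: algebra_simps)
    ultimately show ?thesis using abs_dirichlet_le[of m x] * by linarith
  qed
  have "((\<lambda>x. dirichlet m x * sin (x / 2)) has_field_derivative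
      (dirichlet_deriv m x * sin (x / 2) + cos (x / 2) * (1/2) * dirichlet m x)) (at x)"
    by (auto intro!: derivative_eq_intros has_field_derivative_dirichlet)
  moreover have "((\<lambda>x. dirichlet m x * sin (x / 2)) has_field_derivative
      (cos ((real m + 1/2) * x) * (real m + 1/2))) (at x)"
    unfolding dirichlet_sin by (auto intro!: derivative_eq_intros)
  ultimately have eq: "dirichlet_deriv m x * sin (x / 2) =
      cos ((real m + 1/2) * x) * (real m + 1/2) - cos (x / 2) * (1/2) * dirichlet m x"
    using DERIV_unique by fastforce
  have a: "\<bar>cos ((real m + 1/2) * x) * (real m + 1/2)\<bar> \<le> 1 * (real m + 1/2)"
    unfolding abs_mult by (intro mult_mono) auto
  have b: "\<bar>cos (x / 2) * (1/2) * dirichlet m x\<bar> \<le> 1 * (1/2) * (2 * real m + 1)"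
    unfolding abs_mult by (intro mult_mono abs_dirichlet_le) auto
  have c: "\<bar>dirichlet_deriv m x * sin (x / 2)\<bar> \<le> 2 * real m + 1"
    unfolding eq by (rule order_trans[OF abs_triangle_ineq4]) (use a b in simp)
  have "\<bar>dirichlet_deriv m x\<bar> * (\<bar>x\<bar> / 10) \<le> \<bar>dirichlet_deriv m x\<bar> * \<bar>sin (x / 2)\<bar>"
    by (intro mult_left_mono s) auto
  also have "\<dots> \<le> 2 * real m + 1" using c by (simp add: abs_mult)
  finally have "\<bar>dirichlet_deriv m x\<bar> * \<bar>x\<bar> \<le> 30 * real m" using assms by simp
  then have "real m * (\<bar>dirichlet_deriv m x\<bar> * \<bar>x\<bar>) \<le> real m * (30 * real m)" by (intro mult_left_mono) auto
  moreover have "real m \<le> real m * real m" using assms by simp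
  ultimately show "\<bar>dirichlet_deriv m x\<bar> * (1 + real m * \<bar>x\<bar>) \<le> 32 * (real m)\<^sup>2"
    using abs_dirichlet_deriv_le[of m x] by (simp add: algebra_simps power2_eq_square)
qed

text \<open>The Dirichlet kernel damped by a squared normalised Dirichlet kernel: it still reproduces
  trigonometric polynomials of degree \<open>N\<close>, and it is integrable at scale \<open>1 / N\<close> with a moment to spare.\<close>

definition damped :: "nat \<Rightarrow> real \<Rightarrow> real" where
  "damped N x = dirichlet (3 * N) x * (dirichlet N x / (2 * real N + 1))\<^sup>2"

definition damped_deriv :: "nat \<Rightarrow> real \<Rightarrow> real" where
  "damped_deriv N x = dirichlet_deriv (3 * N) x * (dirichlet N x / (2 * real N + 1))\<^sup>2
    + 2 * dirichlet (3 * N) x * (dirichlet N x / (2 * real N + 1)) * (dirichlet_deriv N x / (2 * real N + 1))"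

lemma has_field_derivative_damped:
  "(damped N has_field_derivative damped_deriv N x) (at x)"
  unfolding damped_def[abs_def] damped_deriv_def
  by (auto intro!: derivative_eq_intros has_field_derivative_dirichlet)

text \<open>Each of the three kernel factors absorbs one power of \<open>r\<close>; for the factor
  of degree \<open>3 * N\<close> this is possible because \<open>r\<close> is below its own weight.
  In the product rule one factor is replaced by its derivative, at the cost of \<open>N\<close>. The
  constants are 1911 = 39 * 7 * 7 and 22848 = 288 * 49 + 2 * 39 * 7 * 16.\<close>

lemma damped_decay:
  assumes x: "\<bar>x\<bar> \<le> pi + 1" and N: "1 \<le> N"
  shows "\<bar>damped N x\<bar> * (1 + real N * \<bar>x\<bar>) ^ 3 \<le> 1911 * real N"
    and "\<bar>damped_deriv N x\<bar> * (1 + real N * \<bar>x\<bar>) ^ 3 \<le> 22848 * (real N)\<^sup>2"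
proof -
  define r where "r = 1 + real N * \<bar>x\<bar>"
  define a where "a = \<bar>dirichlet (3 * N) x\<bar> * r"
  define a' where "a' = \<bar>dirichlet_deriv (3 * N) x\<bar> * r"
  define b where "b = \<bar>dirichlet N x\<bar> / (2 * real N + 1) * r"
  define b' where "b' = \<bar>dirichlet_deriv N x\<bar> / (2 * real N + 1) * r"
  have r: "0 \<le> r" "r \<le> 1 + real (3 * N) * \<bar>x\<bar>"
    by (auto simp: r_def)
  have n: "0 \<le> a" "0 \<le> a'" "0 \<le> b" "0 \<le> b'" using r by (auto simp: a_def a'_def b_def b'_def)
  have "a \<le> \<bar>dirichlet (3 * N) x\<bar> * (1 + real (3 * N) * \<bar>x\<bar>)"
    unfolding a_def by (intro mult_left_mono r) auto
  also have "\<dots> \<le> 39 * real N" using dirichlet_decay(1)[OF x, of "3 * N"] N by simp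
  finally have a: "a \<le> 39 * real N" .
  have "a' \<le> \<bar>dirichlet_deriv (3 * N) x\<bar> * (1 + real (3 * N) * \<bar>x\<bar>)"
    unfolding a'_def by (intro mult_left_mono r) auto
  also have "\<dots> \<le> 288 * (real N)\<^sup>2" using dirichlet_decay(2)[OF x, of "3 * N"] N
    by (simp add: power_mult_distrib)
  finally have a': "a' \<le> 288 * (real N)\<^sup>2" .
  have "b \<le> 13 * real N / (2 * real N + 1)"
    using dirichlet_decay(1)[OF x N] by (simp add: b_def r_def divide_right_mono)
  also have "\<dots> \<le> 7" by (simp add: field_simps)
  finally have b: "b \<le> 7" .
  have "b' \<le> 32 * (real N)\<^sup>2 / (2 * real N + 1)"
    using dirichlet_decay(2)[OF x N] by (simp add: b'_def r_def divide_right_mono)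
  also have "\<dots> \<le> 16 * real N" by (simp add: field_simps power2_eq_square)
  finally have b': "b' \<le> 16 * real N" .
  have "\<bar>damped N x\<bar> * r ^ 3 = a * b\<^sup>2"
    by (simp add: damped_def a_def b_def abs_mult power_mult_distrib power_divide power2_eq_square power3_eq_cube)
  also have "\<dots> \<le> (39 * real N) * 7\<^sup>2"
    using a b n by (intro mult_mono power_mono) auto
  finally show "\<bar>damped N x\<bar> * (1 + real N * \<bar>x\<bar>) ^ 3 \<le> 1911 * real N" by (simp add: r_def)
  have "\<bar>damped_deriv N x\<bar> * r ^ 3 \<le> (\<bar>dirichlet_deriv (3 * N) x * (dirichlet N x / (2 * real N + 1))\<^sup>2\<bar>
    + \<bar>2 * dirichlet (3 * N) x * (dirichlet N x / (2 * real N + 1)) * (dirichlet_deriv N x / (2 * real N + 1))\<bar>) * r ^ 3"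
    unfolding damped_deriv_def using r by (intro mult_right_mono abs_triangle_ineq) auto
  also have "\<dots> = a' * b\<^sup>2 + 2 * a * b * b'"
  proof -
    define X Y where "X = dirichlet N x / (2 * real N + 1)" and "Y = dirichlet_deriv N x / (2 * real N + 1)"
    have "b = \<bar>X\<bar> * r" "b' = \<bar>Y\<bar> * r" by (simp_all add: b_def b'_def X_def Y_def)
    then show ?thesis
      unfolding a_def a'_def X_def[symmetric] Y_def[symmetric] abs_mult power_abs
      by (simp add: power2_eq_square power3_eq_cube algebra_simps)
  qed
  also have "\<dots> \<le> (288 * (real N)\<^sup>2) * 7\<^sup>2 + 2 * (39 * real N) * 7 * (16 * real N)"
    using a a' b b' n by (intro add_mono mult_mono power_mono) auto
  also have "\<dots> = 22848 * (real N)\<^sup>2" by (simp add: power2_eq_square)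
  finally show "\<bar>damped_deriv N x\<bar> * (1 + real N * \<bar>x\<bar>) ^ 3 \<le> 22848 * (real N)\<^sup>2" by (simp add: r_def)
qed

section \<open>Sampling of trigonometric polynomials of degree \<open>N\<close> at scale
  \<open>1 / N\<close>\<close>

definition samp_node :: "nat \<Rightarrow> int \<Rightarrow> real" where
  "samp_node N k = 2 * pi * of_int k / (2 * real (3 * N) + 1)"

text \<open>Majorant of the normalised kernel for all \<open>s\<close> with
  \<open>N * \<bar>s\<bar> \<le> 1\<close> at once. The constant is 8 * 22848 / 6: the 8 pays for
  measuring the distance to the node from 0 instead of \<open>s\<close>, the 6 comes from the
  normalisation \<open>6 * N + 1\<close>. It is dictated by the derivative and ample for the
  values.\<close>

definition samp_wt :: "nat \<Rightarrow> int \<Rightarrow> real" where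
  "samp_wt N k = 30464 / (1 + real N * \<bar>samp_node N k\<bar>) ^ 3"

abbreviation samp_set :: "nat \<Rightarrow> int set" where
  "samp_set N \<equiv> {- int (3 * N)..int (3 * N)}"

lemma samp_node_0 [simp]: "samp_node N 0 = 0" by (simp add: samp_node_def)
lemma samp_wt_0: "1 \<le> samp_wt N 0" by (simp add: samp_wt_def)
lemma samp_wt_nonneg: "0 \<le> samp_wt N k" by (simp add: samp_wt_def)

lemma samp_node_le: "k \<in> samp_set N \<Longrightarrow> \<bar>samp_node N k\<bar> \<le> pi"
proof -
  assume "k \<in> samp_set N"
  then have "\<bar>of_int k\<bar> \<le> (3 * real N)"
    by (auto simp: abs_le_iff)
  then have "2 * pi * \<bar>of_int k\<bar> \<le> 2 * pi * (3 * real N)" by (intro mult_left_mono) auto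
  also have "\<dots> \<le> pi * (2 * (3 * real N) + 1)" by (simp add: algebra_simps)
  finally show ?thesis by (simp add: samp_node_def abs_mult field_simps)
qed

text \<open>The subtracted \<open>2 / (m + 1)\<close> closes the induction: the two new summands
  together are at most the decrease of this correction.\<close>

lemma sum_inverse_squares_le:
  "(\<Sum>k\<in>{- int m..int m}. 1 / (1 + \<bar>of_int k\<bar>)\<^sup>2) \<le> 4 - 2 / (real m + 1)"
proof (induction m)
  case 0
  then show ?case by simp
next
  case (Suc m)
  have *: "{- int (Suc m)..int (Suc m)} = insert (- int (Suc m)) (insert (int (Suc m)) {- int m..int m})"
    by auto
  have "2 / (real m + 2)\<^sup>2 \<le> 2 / (real m + 1) - 2 / (real m + 2)"
  proof -
    have "2 / (real m + 1) - 2 / (real m + 2) = 2 / ((real m + 1) * (real m + 2))"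
      by (simp add: field_simps)
    moreover have "2 / (real m + 2)\<^sup>2 \<le> 2 / ((real m + 1) * (real m + 2))"
      unfolding power2_eq_square by (intro divide_left_mono mult_right_mono) auto
    ultimately show ?thesis by simp
  qed
  moreover have "(\<Sum>k\<in>{- int (Suc m)..int (Suc m)}. 1 / (1 + \<bar>of_int k\<bar>)\<^sup>2)
     = (\<Sum>k\<in>{- int m..int m}. 1 / (1 + \<bar>of_int k\<bar>)\<^sup>2) + 2 / (real m + 2)\<^sup>2"
    unfolding * by (simp add: add.commute)
  ultimately show ?case using Suc by (simp add: algebra_simps)
qed

text \<open>The spacing of the nodes gives
  \<open>N * \<bar>samp_node N k\<bar> \<ge> \<bar>k\<bar> / 2\<close>. One of the three powers of
  \<open>r\<close> in the weight is given up, and the remaining \<open>1 / r\<^sup>2\<close> is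
  summable in \<open>k\<close>. The power given up pays later for the growth of
  \<open>\<bar>x \<bullet> e\<bar> + 1 / N\<close> under a rotation by the node.\<close>

lemma sum_samp_wt:
  assumes "1 \<le> N"
  shows "(\<Sum>k\<in>samp_set N. samp_wt N k * (1 + real N * \<bar>samp_node N k\<bar>)) \<le> 487424"
proof -
  have "(\<Sum>k\<in>samp_set N. samp_wt N k * (1 + real N * \<bar>samp_node N k\<bar>))
      \<le> (\<Sum>k\<in>samp_set N. 121856 * (1 / (1 + \<bar>of_int k\<bar>)\<^sup>2))"
  proof (rule sum_mono)
    fix k
    define r where "r = 1 + real N * \<bar>samp_node N k\<bar>"
    have r: "1 \<le> r" by (simp add: r_def)
    have "real N * \<bar>samp_node N k\<bar> = (2 * pi) * real N * \<bar>of_int k\<bar> / (6 * real N + 1)"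
      by (simp add: samp_node_def abs_mult)
    moreover have "6 * real N * \<bar>of_int k\<bar> / (6 * real N + 1) \<le> (2 * pi) * real N * \<bar>of_int k\<bar> / (6 * real N + 1)"
      using pi_gt3 by (intro divide_right_mono mult_right_mono) auto
    moreover have "\<bar>of_int k\<bar> / 2 \<le> 6 * real N * \<bar>of_int k\<bar> / (6 * real N + 1)"
    proof -
      have "(6 * real N + 1) * \<bar>of_int k\<bar> \<le> (12 * real N) * \<bar>of_int k :: real\<bar>"
        using assms by (intro mult_right_mono) auto
      then show ?thesis by (simp add: field_simps)
    qed
    ultimately have h: "(1 + \<bar>of_int k\<bar>) / 2 \<le> r" by (simp add: r_def)
    have "samp_wt N k * r = 30464 / r\<^sup>2"
      using r by (simp add: samp_wt_def flip: r_def) (simp add: power2_eq_square power3_eq_cube)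
    also have "\<dots> \<le> 30464 / ((1 + \<bar>of_int k\<bar>) / 2)\<^sup>2"
      using h r by (intro divide_left_mono power_mono mult_pos_pos zero_less_power) auto
    also have "\<dots> = 121856 * (1 / (1 + \<bar>of_int k\<bar>)\<^sup>2)" by (simp add: power_divide)
    finally show "samp_wt N k * (1 + real N * \<bar>samp_node N k\<bar>) \<le> 121856 * (1 / (1 + \<bar>of_int k\<bar>)\<^sup>2)"
      by (simp add: r_def)
  qed
  also have "\<dots> \<le> 121856 * (4 - 2 / (real (3 * N) + 1))"
    unfolding sum_distrib_left[symmetric] by (intro mult_left_mono sum_inverse_squares_le) auto
  also have "\<dots> \<le> 487424" by simp
  finally show ?thesis .
qed

text \<open>With \<open>s\<close> fixed, \<open>T\<close> is multiplied by \<open>Q\<close>, the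
  squared normalised Dirichlet kernel centred at \<open>s\<close>. The product has degree at most
  \<open>N + 2 * N\<close> and \<open>Q s = 1\<close>, so exact interpolation of the product at
  \<open>s\<close> returns \<open>T s\<close>, with \<open>Q\<close> absorbed into the
  kernel.\<close>

lemma damped_reproducing:
  assumes "trig_poly (int N) T"
  shows "T s = (\<Sum>k\<in>samp_set N. T (samp_node N k) * of_real (damped N (s - samp_node N k) / (6 * real N + 1)))"
proof -
  define Q where "Q t = (complex_of_real (dirichlet N (s - t)) * of_real (dirichlet N (s - t))) *
     of_real (1 / (2 * real N + 1)\<^sup>2)" for t
  have Q: "trig_poly (2 * int N) Q"
  proof -
    have *: "trig_poly (int N) (\<lambda>t. of_real (dirichlet N (s - t)))"
      by (rule trig_poly_reflect[OF trig_poly_dirichlet])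
    show ?thesis unfolding Q_def
      by (rule trig_poly_mult[OF trig_poly_mult[OF * * order_refl] trig_poly_const[of 0]]) auto
  qed
  have f: "trig_poly (int (3 * N)) (\<lambda>t. T t * Q t)"
    by (rule trig_poly_mult[OF assms Q]) auto
  have "dirichlet N 0 = 2 * real N + 1" by (simp add: dirichlet_def)
  then have "Q s = of_real ((2 * real N + 1) * (2 * real N + 1) * (1 / (2 * real N + 1)\<^sup>2))"
    by (simp only: Q_def diff_self of_real_mult)
  also have "(2 * real N + 1) * (2 * real N + 1) * (1 / (2 * real N + 1)\<^sup>2) = 1"
    by (simp add: power2_eq_square flip: of_nat_Suc)
  finally have "Q s = 1" by simp
  then have "T s = T s * Q s" by simp
  also have "\<dots> = (\<Sum>k\<in>samp_set N. T (samp_node N k) * Q (samp_node N k) *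
      of_real (dirichlet (3 * N) (s - samp_node N k))) / (2 * of_nat (3 * N) + 1)"
    using dirichlet_interpolation[OF f, of s] unfolding samp_node_def .
  also have "2 * of_nat (3 * N) + 1 = complex_of_real (6 * real N + 1)" by simp
  finally show ?thesis
    by (simp only: sum_divide_distrib) (simp add: Q_def damped_def power2_eq_square mult_ac)
qed

text \<open>As \<open>N * \<bar>s\<bar> \<le> 1\<close>, moving the base point from 0 to
  \<open>s\<close> changes 1 plus \<open>N\<close> times the distance to a node by at most a factor
  2, hence its cube by at most 8. The difference estimate is the mean value inequality on an
  interval containing 0 and \<open>s\<close>.\<close>

lemma damped_samp_bounds:
  assumes N: "1 \<le> N" and k: "k \<in> samp_set N" and s: "\<bar>s\<bar> * real N \<le> 1"
  shows "\<bar>damped N (s - samp_node N k) / (6 * real N + 1)\<bar> \<le> samp_wt N k"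
    and "\<bar>damped N (s - samp_node N k) / (6 * real N + 1) - damped N (0 - samp_node N k) / (6 * real N + 1)\<bar>
      \<le> real N * \<bar>s\<bar> * samp_wt N k"
proof -
  define r where "r = 1 + real N * \<bar>samp_node N k\<bar>"
  have r: "1 \<le> r" by (simp add: r_def)
  have near: "\<bar>u - samp_node N k\<bar> \<le> pi + 1 \<and> r ^ 3 \<le> 8 * (1 + real N * \<bar>u - samp_node N k\<bar>) ^ 3"
    if u: "\<bar>u\<bar> * real N \<le> 1" for u
  proof
    have "\<bar>u\<bar> * 1 \<le> \<bar>u\<bar> * real N" using N by (intro mult_left_mono) auto
    then have "\<bar>u\<bar> \<le> 1" using u by simp
    then show "\<bar>u - samp_node N k\<bar> \<le> pi + 1" using samp_node_le[OF k] by linarith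
    have *: "real N * \<bar>samp_node N k\<bar> \<le> real N * (\<bar>u - samp_node N k\<bar> + \<bar>u\<bar>)"
      by (intro mult_left_mono) auto
    have "r \<le> 2 * (1 + real N * \<bar>u - samp_node N k\<bar>)"
    proof -
      have "1 + x \<le> 2 * (1 + a)" if "0 \<le> a" "x \<le> a + c" "c \<le> 1" for x a c :: real
        using that by simp
      moreover have "real N * (\<bar>u - samp_node N k\<bar> + \<bar>u\<bar>) = real N * \<bar>u - samp_node N k\<bar> + \<bar>u\<bar> * real N"
        by (simp add: algebra_simps)
      ultimately show ?thesis unfolding r_def using u * by (metis mult_nonneg_nonneg abs_ge_zero of_nat_0_le_iff)
    qed
    then have "r ^ 3 \<le> (2 * (1 + real N * \<bar>u - samp_node N k\<bar>)) ^ 3"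
      using r by (intro power_mono) auto
    also have "\<dots> = 8 * (1 + real N * \<bar>u - samp_node N k\<bar>) ^ 3" by (simp only: power_mult_distrib) simp
    finally show "r ^ 3 \<le> 8 * (1 + real N * \<bar>u - samp_node N k\<bar>) ^ 3" .
  qed
  have "\<bar>damped N (s - samp_node N k)\<bar> * r ^ 3
      \<le> \<bar>damped N (s - samp_node N k)\<bar> * (8 * (1 + real N * \<bar>s - samp_node N k\<bar>) ^ 3)"
    using near[OF s] by (intro mult_left_mono) auto
  also have "\<dots> \<le> 8 * (1911 * real N)" using damped_decay(1)[OF _ N, of "s - samp_node N k"] near[OF s] by auto
  also have "\<dots> \<le> 30464 * (6 * real N + 1)" by simp
  finally show "\<bar>damped N (s - samp_node N k) / (6 * real N + 1)\<bar> \<le> samp_wt N k"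
    using r by (simp add: samp_wt_def field_simps flip: r_def)
  have dv: "\<bar>damped_deriv N (u - samp_node N k)\<bar> \<le> 182784 * (real N)\<^sup>2 / r ^ 3" if u: "\<bar>u\<bar> * real N \<le> 1" for u
  proof -
    have "\<bar>damped_deriv N (u - samp_node N k)\<bar> * r ^ 3
      \<le> \<bar>damped_deriv N (u - samp_node N k)\<bar> * (8 * (1 + real N * \<bar>u - samp_node N k\<bar>) ^ 3)"
      using near[OF u] by (intro mult_left_mono) auto
    also have "\<dots> \<le> 8 * (22848 * (real N)\<^sup>2)" using damped_decay(2)[OF _ N, of "u - samp_node N k"] near[OF u] by auto
    finally show ?thesis using r by (simp add: field_simps)
  qed
  have "norm (damped N (s - samp_node N k) - damped N (0 - samp_node N k)) \<le> 182784 * (real N)\<^sup>2 / r ^ 3 * norm (s - 0)"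
  proof (rule field_differentiable_bound[where S = "{- \<bar>s\<bar>..\<bar>s\<bar>}" and f' = "\<lambda>u. damped_deriv N (u - samp_node N k)"])
    fix u assume u: "u \<in> {- \<bar>s\<bar>..\<bar>s\<bar>}"
    show "((\<lambda>u. damped N (u - samp_node N k)) has_field_derivative damped_deriv N (u - samp_node N k)) (at u within {- \<bar>s\<bar>..\<bar>s\<bar>})"
      by (rule DERIV_chain'[where g = "damped N" and E = "damped_deriv N (u - samp_node N k)" and D = 1, simplified])
        (auto intro!: derivative_eq_intros has_field_derivative_damped)
    have "\<bar>u\<bar> * real N \<le> \<bar>s\<bar> * real N" using u by (intro mult_right_mono) auto
    then show "norm (damped_deriv N (u - samp_node N k)) \<le> 182784 * (real N)\<^sup>2 / r ^ 3"
      using dv[of u] s by simp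
  qed auto
  then have "\<bar>damped N (s - samp_node N k) - damped N (0 - samp_node N k)\<bar> \<le> 182784 * (real N)\<^sup>2 / r ^ 3 * \<bar>s\<bar>" by simp
  also have "\<dots> \<le> real N * \<bar>s\<bar> * (30464 / r ^ 3) * (6 * real N + 1)"
    using r by (simp add: field_simps power2_eq_square)
  finally have "\<bar>damped N (s - samp_node N k) - damped N (0 - samp_node N k)\<bar> / (6 * real N + 1)
     \<le> real N * \<bar>s\<bar> * samp_wt N k"
    by (simp add: samp_wt_def r_def pos_divide_le_eq)
  then show "\<bar>damped N (s - samp_node N k) / (6 * real N + 1) - damped N (0 - samp_node N k) / (6 * real N + 1)\<bar>
      \<le> real N * \<bar>s\<bar> * samp_wt N k"
    by (simp add: diff_divide_distrib[symmetric] abs_divide)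
qed

text \<open>The samples on the right are taken at nodes that do not move with \<open>s\<close>: a
  single expression, with weights of sum bounded independently of \<open>N\<close>, controls
  \<open>T\<close> and its variation for all \<open>\<bar>s\<bar> \<le> 1 / N\<close>.\<close>

lemma trig_poly_sampling:
  assumes N: "1 \<le> N" and T: "trig_poly (int N) T" and s: "\<bar>s\<bar> * real N \<le> 1"
  shows "cmod (T s) \<le> (\<Sum>k\<in>samp_set N. samp_wt N k * cmod (T (samp_node N k)))"
    and "cmod (T s - T 0) \<le> real N * \<bar>s\<bar> * (\<Sum>k\<in>samp_set N. samp_wt N k * cmod (T (samp_node N k)))"
proof -
  have "cmod (T s) \<le> (\<Sum>k\<in>samp_set N. cmod (T (samp_node N k) * of_real (damped N (s - samp_node N k) / (6 * real N + 1))))"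
    by (subst damped_reproducing[OF T]) (rule norm_sum)
  also have "\<dots> \<le> (\<Sum>k\<in>samp_set N. samp_wt N k * cmod (T (samp_node N k)))"
    unfolding norm_mult norm_of_real
    by (intro sum_mono) (metis damped_samp_bounds(1)[OF N _ s] mult.commute mult_right_mono norm_ge_zero)
  finally show "cmod (T s) \<le> (\<Sum>k\<in>samp_set N. samp_wt N k * cmod (T (samp_node N k)))" .
  have "T s - T 0 = (\<Sum>k\<in>samp_set N. T (samp_node N k) * of_real (damped N (s - samp_node N k) / (6 * real N + 1)
     - damped N (0 - samp_node N k) / (6 * real N + 1)))"
    by (subst damped_reproducing[OF T, of s], subst damped_reproducing[OF T, of 0])
      (simp only: sum_subtractf[symmetric] right_diff_distrib of_real_diff)
  then have "cmod (T s - T 0) \<le> (\<Sum>k\<in>samp_set N. cmod (T (samp_node N k) * of_real (damped N (s - samp_node N k) / (6 * real N + 1)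
     - damped N (0 - samp_node N k) / (6 * real N + 1))))"
    by (simp only: norm_sum)
  also have "\<dots> \<le> (\<Sum>k\<in>samp_set N. (real N * \<bar>s\<bar> * samp_wt N k) * cmod (T (samp_node N k)))"
    unfolding norm_mult norm_of_real
    by (intro sum_mono) (metis damped_samp_bounds(2)[OF N _ s] mult.commute mult_right_mono norm_ge_zero)
  also have "\<dots> = real N * \<bar>s\<bar> * (\<Sum>k\<in>samp_set N. samp_wt N k * cmod (T (samp_node N k)))"
    by (simp add: sum_distrib_left mult_ac)
  finally show "cmod (T s - T 0) \<le> real N * \<bar>s\<bar> * (\<Sum>k\<in>samp_set N. samp_wt N k * cmod (T (samp_node N k)))" .
qed

subsection \<open>Oscillation of polynomials under rotations\<close>

text \<open>Coordinate free, with \<open>m\<close> only an upper bound for the degree. Stability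
  under linear maps and the passage to trigonometric polynomials along rotations become rule
  inductions.\<close>

inductive poly_deg :: "nat \<Rightarrow> ('a :: euclidean_space \<Rightarrow> real) \<Rightarrow> bool" where
  const: "poly_deg m (\<lambda>x. c)"
| lin: "1 \<le> m \<Longrightarrow> poly_deg m (\<lambda>x. x \<bullet> a)"
| add: "poly_deg m f \<Longrightarrow> poly_deg m g \<Longrightarrow> poly_deg m (\<lambda>x. f x + g x)"
| mult: "poly_deg k f \<Longrightarrow> poly_deg l g \<Longrightarrow> k + l \<le> m \<Longrightarrow> poly_deg m (\<lambda>x. f x * g x)"

lemma poly_deg_mono: "poly_deg k f \<Longrightarrow> k \<le> m \<Longrightarrow> poly_deg m f"
proof (induction arbitrary: m rule: poly_deg.induct)
  case (mult k f l g r)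
  then show ?case by (auto intro: poly_deg.mult[of k f l g])
qed (auto intro: poly_deg.intros)

lemma poly_deg_cmult: "poly_deg m f \<Longrightarrow> poly_deg m (\<lambda>x. c * f x)"
  by (rule poly_deg.mult[OF poly_deg.const[of 0]]) auto

lemma poly_deg_sum:
  "finite A \<Longrightarrow> (\<And>k. k \<in> A \<Longrightarrow> poly_deg m (f k)) \<Longrightarrow> poly_deg m (\<lambda>x. \<Sum>k\<in>A. f k x)"
  by (induction A rule: finite_induct) (auto intro: poly_deg.const poly_deg.add)

lemma continuous_on_poly_deg: "poly_deg m f \<Longrightarrow> continuous_on S f"
  by (induction rule: poly_deg.induct) (auto intro!: continuous_intros)

lemma poly_deg_linear:
  assumes "poly_deg m p" "linear T"
  shows "poly_deg m (\<lambda>x. p (T x))"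
  using assms(1)
proof induction
  case (lin m a)
  then show ?case using poly_deg.lin[of m "adjoint T a"]
    by (simp add: adjoint_works[OF \<open>linear T\<close>])
qed (auto intro: poly_deg.intros)

text \<open>For orthonormal \<open>a\<close>, \<open>b\<close> this is the rotation by the angle
  \<open>t\<close> in their plane, fixing the orthogonal complement. Written as a perturbation of
  the identity, it is visibly linear in \<open>x\<close> and of degree 1 in \<open>cos t\<close>,
  \<open>sin t\<close>; orthonormality enters with the metric statements.\<close>

definition rot :: "'a :: euclidean_space \<Rightarrow> 'a \<Rightarrow> real \<Rightarrow> 'a \<Rightarrow> 'a" where
  "rot a b t x = x + (((cos t - 1) * (x \<bullet> a) - sin t * (x \<bullet> b)) *\<^sub>R a
    + (sin t * (x \<bullet> a) + (cos t - 1) * (x \<bullet> b)) *\<^sub>R b)"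

lemma linear_rot: "linear (rot a b t)"
  by (rule linearI) (auto simp: rot_def algebra_simps inner_add_left scaleR_add_left)

lemma rot_0 [simp]: "rot a b 0 x = x" by (simp add: rot_def)

lemma trig_poly_rot:
  assumes "poly_deg m p"
  shows "trig_poly (int m) (\<lambda>t. of_real (p (rot a b t x)))"
  using assms
proof induction
  case (const m c)
  then show ?case by (auto intro: trig_poly_const)
next
  case (lin m c)
  define v where "v = (x \<bullet> a) * (a \<bullet> c) + (x \<bullet> b) * (b \<bullet> c)"
  have "rot a b t x \<bullet> c = (x \<bullet> c - v) + v * cos t + ((x \<bullet> a) * (b \<bullet> c) - (x \<bullet> b) * (a \<bullet> c)) * sin t" for t
    by (simp add: rot_def v_def inner_add_left algebra_simps)
  then show ?case using lin by (simp only:) (rule trig_poly_cos_sin, simp)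
next
  case (add m f g)
  then show ?case using trig_poly.add by fastforce
next
  case (mult k f l g m)
  from trig_poly_mult[OF mult.IH, of "int m"] mult.hyps show ?case by simp
qed

lemma poly_rot_sampling:
  assumes "1 \<le> N" "poly_deg N p" "\<bar>s\<bar> * real N \<le> 1"
  shows "\<bar>p (rot a b s x)\<bar> \<le> (\<Sum>k\<in>samp_set N. samp_wt N k * \<bar>p (rot a b (samp_node N k) x)\<bar>)"
    and "\<bar>p (rot a b s x) - p x\<bar> \<le> real N * \<bar>s\<bar> * (\<Sum>k\<in>samp_set N. samp_wt N k * \<bar>p (rot a b (samp_node N k) x)\<bar>)"
  using trig_poly_sampling[OF assms(1) trig_poly_rot[OF assms(2)] assms(3), of a b x]
  by (simp_all flip: of_real_diff)

text \<open>Iterates the majorant of \<open>poly_rot_sampling\<close>: a weighted sum of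
  \<open>F\<close> over all points reached from \<open>x\<close> by composing one sampled rotation
  per plane of the list. The head of the list is the outermost rotation, as in
  \<open>chain\<close>.\<close>

fun avg :: "nat \<Rightarrow> ('a :: euclidean_space \<times> 'a) list \<Rightarrow> ('a \<Rightarrow> real) \<Rightarrow> 'a \<Rightarrow> real" where
  "avg N [] F x = F x"
| "avg N ((a, b) # L) F x = (\<Sum>k\<in>samp_set N. samp_wt N k * avg N L (\<lambda>y. F (rot a b (samp_node N k) y)) x)"

fun chain :: "('a :: euclidean_space \<times> 'a) list \<Rightarrow> real list \<Rightarrow> 'a \<Rightarrow> 'a" where
  "chain ((a, b) # L) (s # ss) x = rot a b s (chain L ss x)"
| "chain _ _ x = x"

lemma avg_nonneg: "(\<And>y. 0 \<le> F y) \<Longrightarrow> 0 \<le> avg N L F x"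
  by (induction N L F x rule: avg.induct) (auto intro!: sum_nonneg mult_nonneg_nonneg samp_wt_nonneg)

text \<open>The node \<open>k = 0\<close> is the identity rotation and has weight at least 1, so
  this summand alone dominates the shorter average.\<close>

lemma avg_Cons_ge:
  assumes "\<And>y. 0 \<le> F y"
  shows "avg N L F x \<le> avg N ((a, b) # L) F x"
proof -
  have "avg N L F x \<le> samp_wt N 0 * avg N L F x"
    using mult_right_mono[OF samp_wt_0[of N] avg_nonneg[of F N L x]] assms by simp
  also have "\<dots> = (\<Sum>k\<in>{0}. samp_wt N k * avg N L (\<lambda>y. F (rot a b (samp_node N k) y)) x)" by simp
  also have "\<dots> \<le> avg N ((a, b) # L) F x"
    unfolding avg.simps
    by (rule sum_mono2) (auto intro!: mult_nonneg_nonneg samp_wt_nonneg avg_nonneg assms)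
  finally show ?thesis .
qed

lemma continuous_on_rot [continuous_intros]:
  "continuous_on S f \<Longrightarrow> continuous_on S (\<lambda>x. rot a b t (f x))"
  unfolding rot_def by (intro continuous_intros)

lemma continuous_on_avg:
  "continuous_on UNIV F \<Longrightarrow> continuous_on UNIV (avg N L F)"
proof (induction L arbitrary: F)
  case Nil
  then show ?case by (simp add: avg.simps[abs_def])
next
  case (Cons ab L)
  obtain a b where ab: "ab = (a, b)" by force
  have "continuous_on UNIV (\<lambda>y. F (rot a b t y))" for t
    by (rule continuous_on_compose2[OF Cons.prems]) (auto intro!: continuous_intros)
  then show ?case unfolding ab avg.simps[abs_def] by (intro continuous_intros Cons.IH)
qed

text \<open>Both bounds pass through the induction together, with \<open>p\<close> varying. Sampling
  the last rotation evaluates \<open>p\<close> at rotated copies of the intermediate point; the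
  value bound, applied to \<open>p\<close> composed with such a rotation, which still has degree at
  most \<open>N\<close>, leads back to \<open>x\<close>. The increments of the single rotations add
  up.\<close>

lemma chain_bound:
  assumes "1 \<le> N" "length ss = length L" "\<And>s. s \<in> set ss \<Longrightarrow> \<bar>s\<bar> \<le> \<eta>" "\<eta> * real N \<le> 1" "poly_deg N p"
  shows "\<bar>p (chain L ss x)\<bar> \<le> avg N L (\<lambda>y. \<bar>p y\<bar>) x"
    and "\<bar>p (chain L ss x) - p x\<bar> \<le> real (length L) * (\<eta> * real N) * avg N L (\<lambda>y. \<bar>p y\<bar>) x"
proof -
  have "\<bar>p (chain L ss x)\<bar> \<le> avg N L (\<lambda>y. \<bar>p y\<bar>) x \<and>
    \<bar>p (chain L ss x) - p x\<bar> \<le> real (length L) * (\<eta> * real N) * avg N L (\<lambda>y. \<bar>p y\<bar>) x"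
    using assms(2,3,5)
  proof (induction L arbitrary: ss p)
    case Nil
    then show ?case by simp
  next
    case (Cons ab L)
    obtain a b where ab: "ab = (a, b)" by force
    obtain s ss' where ss: "ss = s # ss'" using Cons.prems by (cases ss) auto
    have IH: "\<bar>q (chain L ss' x)\<bar> \<le> avg N L (\<lambda>y. \<bar>q y\<bar>) x"
      "\<bar>q (chain L ss' x) - q x\<bar> \<le> real (length L) * (\<eta> * real N) * avg N L (\<lambda>y. \<bar>q y\<bar>) x"
      if "poly_deg N q" for q
      using Cons.IH[of ss' q] Cons.prems that by (auto simp: ss)
    define z where "z = chain L ss' x"
    have s: "\<bar>s\<bar> \<le> \<eta>" using Cons.prems by (auto simp: ss)
    then have s1: "\<bar>s\<bar> * real N \<le> \<eta> * real N" by (intro mult_right_mono) auto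
    with assms have s2: "\<bar>s\<bar> * real N \<le> 1" by linarith
    have sm: "(\<Sum>k\<in>samp_set N. samp_wt N k * \<bar>p (rot a b (samp_node N k) z)\<bar>) \<le> avg N ((a, b) # L) (\<lambda>y. \<bar>p y\<bar>) x"
      unfolding avg.simps z_def
      by (intro sum_mono mult_left_mono IH(1) poly_deg_linear[OF Cons.prems(3)] linear_rot samp_wt_nonneg)
    note r = poly_rot_sampling[OF assms(1) Cons.prems(3) s2, of a b z]
    have A': "avg N L (\<lambda>y. \<bar>p y\<bar>) x \<le> avg N ((a, b) # L) (\<lambda>y. \<bar>p y\<bar>) x" by (rule avg_Cons_ge) simp
    have \<eta>: "0 \<le> \<eta>" using s by linarith
    have "\<bar>p (rot a b s z) - p z\<bar> \<le> (\<eta> * real N) * avg N ((a, b) # L) (\<lambda>y. \<bar>p y\<bar>) x"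
      by (rule order_trans[OF r(2) mult_mono]) (use s1 sm \<eta> in \<open>auto simp: mult.commute intro!: sum_nonneg mult_nonneg_nonneg samp_wt_nonneg\<close>)
    moreover have "\<bar>p z - p x\<bar> \<le> real (length L) * (\<eta> * real N) * avg N ((a, b) # L) (\<lambda>y. \<bar>p y\<bar>) x"
      unfolding z_def
      by (rule order_trans[OF IH(2)[OF Cons.prems(3)] mult_left_mono[OF A']]) (use \<eta> in auto)
    moreover have "\<bar>p (rot a b s z) - p x\<bar> \<le> \<bar>p (rot a b s z) - p z\<bar> + \<bar>p z - p x\<bar>" by simp
    ultimately have "\<bar>p (rot a b s z) - p x\<bar> \<le> (\<eta> * real N) * avg N ((a, b) # L) (\<lambda>y. \<bar>p y\<bar>) x
      + real (length L) * (\<eta> * real N) * avg N ((a, b) # L) (\<lambda>y. \<bar>p y\<bar>) x" by linarith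
    also have "\<dots> = real (length (ab # L)) * (\<eta> * real N) * avg N ((a, b) # L) (\<lambda>y. \<bar>p y\<bar>) x"
      by (simp add: distrib_right)
    finally have "\<bar>p (rot a b s z) - p x\<bar> \<le> real (length (ab # L)) * (\<eta> * real N) * avg N (ab # L) (\<lambda>y. \<bar>p y\<bar>) x"
      by (simp only: ab)
    moreover have "chain (ab # L) ss x = rot a b s z" by (simp add: ab ss z_def)
    ultimately show ?case using order_trans[OF r(1) sm] by (simp only: ab)
  qed
  then show "\<bar>p (chain L ss x)\<bar> \<le> avg N L (\<lambda>y. \<bar>p y\<bar>) x"
    and "\<bar>p (chain L ss x) - p x\<bar> \<le> real (length L) * (\<eta> * real N) * avg N L (\<lambda>y. \<bar>p y\<bar>) x" by auto
qed

section \<open>Joining nearby points of the sphere by small rotations in coordinate planes\<close>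

lemma
  assumes "norm a = 1" "norm b = 1" "a \<bullet> b = 0"
  shows inner_rot_fst: "rot a b t x \<bullet> a = cos t * (x \<bullet> a) - sin t * (x \<bullet> b)"
    and inner_rot_snd: "rot a b t x \<bullet> b = sin t * (x \<bullet> a) + cos t * (x \<bullet> b)"
proof -
  have "a \<bullet> a = 1" "b \<bullet> b = 1" "b \<bullet> a = 0"
    using assms by (auto simp: dot_square_norm inner_commute)
  then show "rot a b t x \<bullet> a = cos t * (x \<bullet> a) - sin t * (x \<bullet> b)"
    "rot a b t x \<bullet> b = sin t * (x \<bullet> a) + cos t * (x \<bullet> b)"
    using assms by (simp_all add: rot_def inner_add_left algebra_simps)
qed

lemma inner_rot_other: "a \<bullet> c = 0 \<Longrightarrow> b \<bullet> c = 0 \<Longrightarrow> rot a b t x \<bullet> c = x \<bullet> c"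
  by (simp add: rot_def inner_add_left)

lemma orthogonal_transformation_rot:
  assumes "norm a = 1" "norm b = 1" "a \<bullet> b = 0"
  shows "orthogonal_transformation (rot a b t)"
  unfolding orthogonal_transformation_def
proof (intro conjI allI linear_rot)
  fix v w :: 'a
  have ab: "a \<bullet> a = 1" "b \<bullet> b = 1" "b \<bullet> a = 0"
    using assms by (auto simp: dot_square_norm inner_commute)
  define c s where "c = cos t" and "s = sin t"
  have "rot a b t v \<bullet> rot a b t w = v \<bullet> w
    + (c\<^sup>2 + s\<^sup>2 - 1) * ((v \<bullet> a) * (w \<bullet> a) + (v \<bullet> b) * (w \<bullet> b))"
    using assms(3) ab unfolding rot_def c_def[symmetric] s_def[symmetric]
    by (simp add: inner_add_left inner_add_right inner_commute[of a w] inner_commute[of b w]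
        algebra_simps power2_eq_square)
  then show "rot a b t v \<bullet> rot a b t w = v \<bullet> w" by (simp add: c_def s_def)
qed

lemma norm_rot:
  assumes "norm a = 1" "norm b = 1" "a \<bullet> b = 0"
  shows "norm (rot a b t x) = norm x"
  using orthogonal_transformation_rot[OF assms] by (simp add: orthogonal_transformation)

text \<open>The displacement is \<open>cos t - 1\<close> times the projection of \<open>x\<close> to
  the plane plus \<open>sin t\<close> times a quarter turn of that projection, and both vectors have
  norm at most \<open>norm x\<close>.\<close>

lemma norm_rot_diff_le:
  assumes "norm a = 1" "norm b = 1" "a \<bullet> b = 0"
  shows "norm (rot a b t x - x) \<le> 2 * \<bar>t\<bar> * norm x"
proof -
  have c: "\<bar>cos t - 1\<bar> \<le> \<bar>t\<bar>" and s: "\<bar>sin t\<bar> \<le> \<bar>t\<bar>"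
  proof -
    have "(1 - cos t) = 2 * (sin (t / 2))\<^sup>2" using cos_double_sin[of "t / 2"] by simp
    moreover have "(sin (t / 2))\<^sup>2 = \<bar>sin (t / 2)\<bar> * \<bar>sin (t / 2)\<bar>" by (simp add: power2_eq_square)
    moreover have "\<bar>sin (t / 2)\<bar> * \<bar>sin (t / 2)\<bar> \<le> \<bar>t / 2\<bar> * 1"
      by (intro mult_mono abs_sin_x_le_abs_x) auto
    ultimately show "\<bar>cos t - 1\<bar> \<le> \<bar>t\<bar>" by simp
  qed (rule abs_sin_x_le_abs_x)
  have "norm ((cos t - 1) *\<^sub>R ((x \<bullet> a) *\<^sub>R a + (x \<bullet> b) *\<^sub>R b)) \<le> \<bar>t\<bar> * norm x"
    and "norm (sin t *\<^sub>R ((x \<bullet> a) *\<^sub>R b - (x \<bullet> b) *\<^sub>R a)) \<le> \<bar>t\<bar> * norm x"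
  proof -
    have ab: "a \<bullet> a = 1" "b \<bullet> b = 1" "b \<bullet> a = 0"
      using assms by (auto simp: dot_square_norm inner_commute)
    have "(norm (x - ((x \<bullet> a) *\<^sub>R a + (x \<bullet> b) *\<^sub>R b)))\<^sup>2 = (norm x)\<^sup>2 - ((x \<bullet> a)\<^sup>2 + (x \<bullet> b)\<^sup>2)"
      unfolding power2_norm_eq_inner using ab assms(3)
      by (simp add: inner_diff_left inner_diff_right inner_add_left inner_add_right inner_commute[of a x]
          inner_commute[of b x] power2_eq_square algebra_simps)
    then have le: "(x \<bullet> a)\<^sup>2 + (x \<bullet> b)\<^sup>2 \<le> (norm x)\<^sup>2"
      by (metis diff_ge_0_iff_ge zero_le_power2)
    have e1: "(norm ((x \<bullet> a) *\<^sub>R a + (x \<bullet> b) *\<^sub>R b))\<^sup>2 = (x \<bullet> a)\<^sup>2 + (x \<bullet> b)\<^sup>2"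
      unfolding power2_norm_eq_inner using ab assms(3)
      by (simp add: inner_add_left inner_add_right power2_eq_square)
    have e2: "(norm ((x \<bullet> a) *\<^sub>R b - (x \<bullet> b) *\<^sub>R a))\<^sup>2 = (x \<bullet> a)\<^sup>2 + (x \<bullet> b)\<^sup>2"
      unfolding power2_norm_eq_inner using ab assms(3)
      by (simp add: inner_diff_left inner_diff_right power2_eq_square)
    have n1: "norm ((x \<bullet> a) *\<^sub>R a + (x \<bullet> b) *\<^sub>R b) \<le> norm x"
      using le e1 by (metis norm_ge_zero power2_le_imp_le)
    have n2: "norm ((x \<bullet> a) *\<^sub>R b - (x \<bullet> b) *\<^sub>R a) \<le> norm x"
      using le e2 by (metis norm_ge_zero power2_le_imp_le)
    show "norm ((cos t - 1) *\<^sub>R ((x \<bullet> a) *\<^sub>R a + (x \<bullet> b) *\<^sub>R b)) \<le> \<bar>t\<bar> * norm x"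
      unfolding norm_scaleR by (intro mult_mono c n1) auto
    show "norm (sin t *\<^sub>R ((x \<bullet> a) *\<^sub>R b - (x \<bullet> b) *\<^sub>R a)) \<le> \<bar>t\<bar> * norm x"
      unfolding norm_scaleR by (intro mult_mono s n2) auto
  qed
  moreover have "rot a b t x - x = (cos t - 1) *\<^sub>R ((x \<bullet> a) *\<^sub>R a + (x \<bullet> b) *\<^sub>R b)
      + sin t *\<^sub>R ((x \<bullet> a) *\<^sub>R b - (x \<bullet> b) *\<^sub>R a)"
    by (simp add: rot_def algebra_simps)
  ultimately show ?thesis
    by (metis (no_types, lifting) norm_triangle_mono mult_2 mult.assoc)
qed

definition onb :: "'a :: euclidean_space set \<Rightarrow> bool" where
  "onb B \<longleftrightarrow> finite B \<and> span B = UNIV \<and> (\<forall>a\<in>B. \<forall>b\<in>B. a \<bullet> b = (if a = b then 1 else 0))"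

lemma onb_norm: "onb B \<Longrightarrow> a \<in> B \<Longrightarrow> norm a = 1"
  by (simp add: onb_def norm_eq_1)

lemma onb_orth: "onb B \<Longrightarrow> a \<in> B \<Longrightarrow> b \<in> B \<Longrightarrow> a \<noteq> b \<Longrightarrow> a \<bullet> b = 0"
  by (simp add: onb_def)

lemma onb_expand: "onb B \<Longrightarrow> (\<Sum>b\<in>B. (x \<bullet> b) *\<^sub>R b) = x"
  by (rule orthonormal_basis_expand) (auto simp: onb_def pairwise_def orthogonal_def norm_eq_1)

lemma onb_norm_power2: "onb B \<Longrightarrow> (norm x)\<^sup>2 = (\<Sum>b\<in>B. (x \<bullet> b)\<^sup>2)"
proof -
  assume B: "onb B"
  have "x \<bullet> x = x \<bullet> (\<Sum>b\<in>B. (x \<bullet> b) *\<^sub>R b)" by (simp add: onb_expand[OF B])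
  also have "\<dots> = (\<Sum>b\<in>B. (x \<bullet> b)\<^sup>2)" by (simp add: inner_sum_right power2_eq_square)
  finally show ?thesis by (simp add: power2_norm_eq_inner)
qed

lemma onb_eqI: "onb B \<Longrightarrow> (\<And>b. b \<in> B \<Longrightarrow> x \<bullet> b = y \<bullet> b) \<Longrightarrow> x = y"
  by (metis (no_types, lifting) onb_expand sum.cong)

lemma onb_exists:
  assumes "norm (e :: 'a :: euclidean_space) = 1"
  obtains B where "onb B" "e \<in> B" "card B = DIM('a)"
proof -
  obtain B where B: "e \<in> B" "pairwise orthogonal B" "\<And>x. x \<in> B \<Longrightarrow> norm x = 1" "independent B"
    "card B = DIM('a)" "span B = UNIV"
    using vector_in_orthonormal_basis[OF assms] by metis
  have "onb B"
    unfolding onb_def using B independent_imp_finite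
    by (auto simp: pairwise_def orthogonal_def norm_eq_1)
  with B that show ?thesis by blast
qed

text \<open>An intermediate value argument. At the extreme angle \<open>s0 = 4 * \<eta> / m\<close>
  the first order motion \<open>\<bar>q\<bar> * sin s0\<close> is at least
  \<open>2 * \<eta>\<close>, while the second order loss \<open>p * (1 - cos s0)\<close> is at most
  \<eta> because \<open>s0 \<le> m / 2\<close>. Thus the \<open>i\<close> coordinate can be moved by
  at least \<eta> in either direction.\<close>

lemma rot_step:
  assumes ij: "norm i = 1" "norm j = 1" "i \<bullet> j = 0" and x: "norm x = 1"
    and m: "0 < m" "m \<le> \<bar>x \<bullet> j\<bar>" and \<eta>: "0 \<le> \<eta>" "4 * \<eta> / m \<le> m / 2" and c: "\<bar>c - x \<bullet> i\<bar> \<le> \<eta>"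
  shows "\<exists>s. \<bar>s\<bar> \<le> 4 * \<eta> / m \<and> rot i j s x \<bullet> i = c"
proof -
  define p where "p = x \<bullet> i"
  define q where "q = x \<bullet> j"
  have p: "\<bar>p\<bar> \<le> 1" and q: "\<bar>q\<bar> \<le> 1"
    using Cauchy_Schwarz_ineq2[of x i] Cauchy_Schwarz_ineq2[of x j] ij x by (auto simp: p_def q_def)
  define s0 where "s0 = 4 * \<eta> / m"
  have m1: "m \<le> 1" using m q by (simp add: q_def)
  have s0: "0 \<le> s0" "s0 \<le> m / 2" "m * s0 = 4 * \<eta>" using \<eta> m by (auto simp: s0_def)
  have "s0 / (pi / 2) * sin (pi / 2) \<le> sin s0"
    using s0 m1 pi_gt3 by (intro sin_ge_chord) auto
  moreover have "s0 / 2 \<le> s0 / (pi / 2)"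
    using s0 pi_less_4 by (intro divide_left_mono) auto
  ultimately have sn: "s0 / 2 \<le> sin s0" by simp
  have cs: "1 - cos s0 \<le> s0\<^sup>2 / 2"
  proof -
    have "(1 - cos s0) = 2 * (sin (s0 / 2))\<^sup>2" using cos_double_sin[of "s0 / 2"] by simp
    also have "(sin (s0 / 2))\<^sup>2 \<le> (s0 / 2)\<^sup>2"
      using abs_sin_x_le_abs_x[of "s0 / 2"] by (metis abs_le_square_iff)
    finally show ?thesis by (simp add: power2_eq_square)
  qed
  define k where "k s = p * cos s - \<bar>q\<bar> * sin s" for s
  have "\<bar>p * (1 - cos s0)\<bar> \<le> 1 * (s0\<^sup>2 / 2)"
    unfolding abs_mult using p cs by (intro mult_mono) auto
  also have "s0\<^sup>2 \<le> s0 * (m / 2)" unfolding power2_eq_square using s0 by (intro mult_left_mono) auto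
  finally have pc: "\<bar>p * (1 - cos s0)\<bar> \<le> \<eta>" using s0 by (simp add: mult.commute)
  have "m * (s0 / 2) \<le> \<bar>q\<bar> * sin s0" using m sn s0 by (intro mult_mono) (auto simp: q_def)
  then have qs: "2 * \<eta> \<le> \<bar>q\<bar> * sin s0" using s0 by simp
  have "k s0 \<le> c" "c \<le> k (- s0)"
    using pc qs c by (auto simp: k_def p_def[symmetric] algebra_simps abs_le_iff)
  then have "\<exists>s\<ge>- s0. s \<le> s0 \<and> k s = c"
    using s0 by (intro IVT2) (auto simp: k_def intro!: continuous_intros)
  then obtain s where "- s0 \<le> s" "s \<le> s0" "k s = c" by blast
  then have s: "\<bar>s\<bar> \<le> s0" "k s = c" by auto
  \<comment> \<open>The sign of \<open>q\<close> decides in which direction a positive angle moves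
    the \<open>i\<close> coordinate.\<close>
  define s' where "s' = (if 0 \<le> q then s else - s)"
  have "rot i j s' x \<bullet> i = k s"
    unfolding inner_rot_fst[OF ij] by (auto simp: s'_def k_def p_def q_def)
  with s show ?thesis by (intro exI[of _ s']) (auto simp: s'_def s0_def)
qed

text \<open>The coordinates are corrected one at a time, always against the pivot \<open>j\<close>:
  a rotation in the plane of \<open>i\<close> and \<open>j\<close> leaves the others alone. Each
  step shifts the pivot by at most \<open>16 * \<eta> / m\<close>, and the budget
  \<open>m / 4\<close> keeps it above \<open>m / 2\<close>. Hence \<open>rot_step\<close> is used
  with \<open>m / 2\<close>, and the angles become \<open>8 * \<eta> / m\<close>.\<close>

lemma rot_chain:
  assumes B: "onb B" "j \<in> B" and "distinct is" "set is \<subseteq> B - {j}"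
    and x: "norm x = 1" and m: "0 < m" "m \<le> \<bar>x \<bullet> j\<bar>" and \<eta>: "0 \<le> \<eta>" "real (length is) * (16 * \<eta> / m) \<le> m / 4"
    and c: "\<And>i. i \<in> B \<Longrightarrow> \<bar>y \<bullet> i - x \<bullet> i\<bar> \<le> \<eta>"
  shows "\<exists>ss. length ss = length is \<and> (\<forall>s\<in>set ss. \<bar>s\<bar> \<le> 8 * \<eta> / m) \<and>
    norm (chain (map (\<lambda>i. (i, j)) is) ss x) = 1 \<and>
    (\<forall>i\<in>B - {j}. chain (map (\<lambda>i. (i, j)) is) ss x \<bullet> i = (if i \<in> set is then y \<bullet> i else x \<bullet> i)) \<and>
    \<bar>chain (map (\<lambda>i. (i, j)) is) ss x \<bullet> j - x \<bullet> j\<bar> \<le> real (length is) * (16 * \<eta> / m)"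
  using assms(3,4) \<eta>(2)
proof (induction "is")
  case Nil
  then show ?case using x by simp
next
  case (Cons i "is")
  have nn: "0 \<le> 16 * \<eta> / m" using \<eta> m by simp
  have le: "real (length is) * (16 * \<eta> / m) + 16 * \<eta> / m \<le> m / 4"
  proof -
    have "real (length (i # is)) * (16 * \<eta> / m) = real (length is) * (16 * \<eta> / m) + 16 * \<eta> / m"
      by (simp add: distrib_right add_divide_distrib)
    then show ?thesis using Cons.prems(3) by linarith
  qed
  then obtain ss where ss: "length ss = length is" "\<forall>s\<in>set ss. \<bar>s\<bar> \<le> 8 * \<eta> / m"
    "norm (chain (map (\<lambda>i. (i, j)) is) ss x) = 1"
    "\<forall>i\<in>B - {j}. chain (map (\<lambda>i. (i, j)) is) ss x \<bullet> i = (if i \<in> set is then y \<bullet> i else x \<bullet> i)"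
    "\<bar>chain (map (\<lambda>i. (i, j)) is) ss x \<bullet> j - x \<bullet> j\<bar> \<le> real (length is) * (16 * \<eta> / m)"
    using Cons nn by fastforce
  define z where "z = chain (map (\<lambda>i. (i, j)) is) ss x"
  have i: "i \<in> B" "i \<noteq> j" "i \<notin> set is" using Cons.prems by auto
  have ij: "norm i = 1" "norm j = 1" "i \<bullet> j = 0" using onb_norm[OF B(1)] onb_orth[OF B(1)] B i by auto
  have nz: "norm z = 1" by (simp add: z_def ss)
  have zi: "z \<bullet> i = x \<bullet> i" using ss(4) i by (simp add: z_def)
  have lb: "0 \<le> real (length is) * (16 * \<eta> / m)" using nn by (intro mult_nonneg_nonneg) auto
  have zj: "\<bar>z \<bullet> j - x \<bullet> j\<bar> \<le> real (length is) * (16 * \<eta> / m)" using ss(5) by (simp add: z_def)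
  then have "m / 2 \<le> \<bar>z \<bullet> j\<bar>" using le nn m by linarith
  moreover have "4 * \<eta> / (m / 2) \<le> m / 2 / 2" using le lb nn by simp
  ultimately obtain s where s: "\<bar>s\<bar> \<le> 4 * \<eta> / (m / 2)" "rot i j s z \<bullet> i = y \<bullet> i"
    using rot_step[OF ij nz, of "m / 2" \<eta> "y \<bullet> i"] m \<eta> c[of i] zi i by auto
  have s8: "\<bar>s\<bar> \<le> 8 * \<eta> / m" using s(1) by simp
  have "\<bar>(rot i j s z - z) \<bullet> j\<bar> \<le> norm (rot i j s z - z)"
    using Cauchy_Schwarz_ineq2[of "rot i j s z - z" j] ij by simp
  also have "\<dots> \<le> 2 * \<bar>s\<bar>" using norm_rot_diff_le[OF ij, of s z] nz by simp
  finally have d: "\<bar>rot i j s z \<bullet> j - z \<bullet> j\<bar> \<le> 16 * \<eta> / m" using s8 by (simp add: inner_diff_left)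
  have oth: "rot i j s z \<bullet> i' = z \<bullet> i'" if "i' \<in> B - {j}" "i' \<noteq> i" for i'
    using that i B onb_orth[OF B(1)] by (intro inner_rot_other) auto
  show ?case
  proof (intro exI[of _ "s # ss"] conjI ballI)
    show "length (s # ss) = length (i # is)" using ss by simp
    show "\<bar>t\<bar> \<le> 8 * \<eta> / m" if "t \<in> set (s # ss)" for t using that ss s8 by auto
    show "norm (chain (map (\<lambda>i. (i, j)) (i # is)) (s # ss) x) = 1"
      using nz norm_rot[OF ij] by (simp add: z_def)
    show "\<bar>chain (map (\<lambda>i. (i, j)) (i # is)) (s # ss) x \<bullet> j - x \<bullet> j\<bar> \<le> real (length (i # is)) * (16 * \<eta> / m)"
    proof -
      have "real (length (i # is)) * (16 * \<eta> / m) = real (length is) * (16 * \<eta> / m) + 16 * \<eta> / m"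
        by (simp add: distrib_right add_divide_distrib)
      then show ?thesis using d zj by (simp add: z_def)
    qed
    fix i' assume i': "i' \<in> B - {j}"
    show "chain (map (\<lambda>i. (i, j)) (i # is)) (s # ss) x \<bullet> i' = (if i' \<in> set (i # is) then y \<bullet> i' else x \<bullet> i')"
    proof (cases "i' = i")
      case True
      then show ?thesis using s(2) by (simp add: z_def)
    next
      case False
      then show ?thesis using oth[OF i'] ss(4) i' by (auto simp: z_def)
    qed
  qed
qed

text \<open>Depends on the pivot alone and not on the points to be joined, so that
  \<open>card B\<close> lists serve all pairs; \<open>SOME\<close> fixes an arbitrary order.\<close>

definition pivot_list :: "'a :: euclidean_space set \<Rightarrow> 'a \<Rightarrow> ('a \<times> 'a) list" where
  "pivot_list B j = map (\<lambda>i. (i, j)) (SOME xs. distinct xs \<and> set xs = B - {j})"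

lemma pivot_list:
  assumes "onb B" "j \<in> B"
  obtains xs where "pivot_list B j = map (\<lambda>i. (i, j)) xs" "distinct xs" "set xs = B - {j}" "length xs < card B"
proof -
  have fin: "finite B" using assms by (simp add: onb_def)
  then have "\<exists>xs. distinct xs \<and> set xs = B - {j}" using finite_distinct_list[of "B - {j}"] by auto
  from someI_ex[OF this] have *: "distinct (SOME xs. distinct xs \<and> set xs = B - {j})"
    "set (SOME xs. distinct xs \<and> set xs = B - {j}) = B - {j}" by auto
  have "length (SOME xs. distinct xs \<and> set xs = B - {j}) = card (B - {j})"
    using * distinct_card by metis
  also have "\<dots> < card B" using fin assms by (intro psubset_card_mono) auto
  finally show ?thesis using that * by (auto simp: pivot_list_def)
qed

text \<open>The pivot is a coordinate of \<open>x\<close> with square at least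
  \<open>1 / card B\<close>. Once the other coordinates agree with those of \<open>y\<close>,
  equality of norms leaves only the sign of the pivot coordinate open; it is right because both
  candidates are within \<open>m / 4\<close> of \<open>x \<bullet> j\<close>. The smallness
  condition is the budget of \<open>rot_chain\<close> for \<open>m = 1 / sqrt n\<close>.\<close>

lemma rot_connect:
  assumes B: "onb B" and x: "norm x = 1" and y: "norm y = 1" and d: "norm (x - y) \<le> \<eta>"
    and \<eta>: "64 * (real (card B))\<^sup>2 * \<eta> \<le> 1"
  shows "\<exists>j\<in>B. \<exists>ss. length ss = length (pivot_list B j) \<and> (\<forall>s\<in>set ss. \<bar>s\<bar> \<le> 8 * real (card B) * \<eta>) \<and>
    chain (pivot_list B j) ss x = y"
proof -
  define n where "n = card B"
  have fin: "finite B" using B by (simp add: onb_def)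
  have "B \<noteq> {}" using onb_norm_power2[OF B, of x] x by auto
  then have n: "1 \<le> n" using fin by (simp add: n_def Suc_le_eq card_gt_0_iff)
  have \<eta>0: "0 \<le> \<eta>" using d norm_ge_zero order_trans by blast
  have "\<exists>j\<in>B. 1 / real n \<le> (x \<bullet> j)\<^sup>2"
  proof (rule ccontr)
    assume "\<not> ?thesis"
    then have "(\<Sum>b\<in>B. (x \<bullet> b)\<^sup>2) < (\<Sum>b\<in>B. 1 / real n)"
      using \<open>B \<noteq> {}\<close> fin by (intro sum_strict_mono) auto
    then show False using onb_norm_power2[OF B, of x] x n by (simp add: n_def)
  qed
  then obtain j where j: "j \<in> B" "1 / real n \<le> (x \<bullet> j)\<^sup>2" by blast
  define m where "m = 1 / sqrt (real n)"
  have m: "0 < m" using n by (simp add: m_def)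
  have mj: "m \<le> \<bar>x \<bullet> j\<bar>"
    using real_sqrt_le_mono[OF j(2)] by (simp add: m_def real_sqrt_divide)
  have mm: "m * m = 1 / real n" using n by (simp add: m_def)
  have im: "1 / m \<le> real n"
  proof -
    have "sqrt (real n) * 1 \<le> sqrt (real n) * sqrt (real n)" using n by (intro mult_left_mono) auto
    then show ?thesis by (simp add: m_def)
  qed
  obtain xs where xs: "pivot_list B j = map (\<lambda>i. (i, j)) xs" "distinct xs" "set xs = B - {j}" "length xs < n"
    using pivot_list[OF B j(1)] by (auto simp: n_def)
  have bnd: "real n * (16 * \<eta> / m) \<le> m / 4"
  proof -
    have "real n * (16 * \<eta> / m) * (4 * m) = 64 * real n * \<eta>" using m by simp
    also have "\<dots> \<le> 1 / real n"
      using \<eta> n by (simp add: n_def[symmetric] power2_eq_square pos_le_divide_eq mult_ac)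
    also have "\<dots> = m / 4 * (4 * m)" using mm by simp
    finally show ?thesis using m by (simp only: mult_le_cancel_right)
  qed
  have bnd': "real (length xs) * (16 * \<eta> / m) \<le> real n * (16 * \<eta> / m)"
    using xs m \<eta>0 by (intro mult_right_mono) auto
  have c: "\<bar>y \<bullet> i - x \<bullet> i\<bar> \<le> \<eta>" if "i \<in> B" for i
    using Cauchy_Schwarz_ineq2[of "x - y" i] onb_norm[OF B that] d
    by (simp add: inner_diff_left abs_minus_commute)
  obtain ss where ss: "length ss = length xs" "\<forall>s\<in>set ss. \<bar>s\<bar> \<le> 8 * \<eta> / m"
    "norm (chain (pivot_list B j) ss x) = 1"
    "\<forall>i\<in>B - {j}. chain (pivot_list B j) ss x \<bullet> i = y \<bullet> i"
    "\<bar>chain (pivot_list B j) ss x \<bullet> j - x \<bullet> j\<bar> \<le> real (length xs) * (16 * \<eta> / m)"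
    using rot_chain[OF B j(1) xs(2) _ x m mj \<eta>0 _ c] bnd bnd' xs by force
  define z where "z = chain (pivot_list B j) ss x"
  have "(\<Sum>b\<in>B. (z \<bullet> b)\<^sup>2) = (\<Sum>b\<in>B. (y \<bullet> b)\<^sup>2)"
    using onb_norm_power2[OF B] ss(3) y unfolding z_def by metis
  then have "(z \<bullet> j)\<^sup>2 = (y \<bullet> j)\<^sup>2"
    using ss(4) fin j(1) by (simp add: sum.remove[of B j] z_def)
  moreover have "\<bar>z \<bullet> j - x \<bullet> j\<bar> \<le> m / 4" using ss(5) bnd bnd' by (simp add: z_def)
  moreover have "\<bar>y \<bullet> j - x \<bullet> j\<bar> \<le> m / 4"
  proof -
    have "1 * \<eta> \<le> real n * (16 * \<eta> / m)"
    proof -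
      have "m \<le> 1" using mj Cauchy_Schwarz_ineq2[of x j] onb_norm[OF B j(1)] x by simp
      then have "\<eta> * m \<le> \<eta> * (16 * real n)" using n \<eta>0 by (intro mult_left_mono) auto
      then show ?thesis using m by (simp add: field_simps)
    qed
    then show ?thesis using c[OF j(1)] bnd by simp
  qed
  ultimately have "z \<bullet> j = y \<bullet> j" using mj m by (auto simp: power2_eq_iff abs_if split: if_splits)
  then have "z = y" using ss(4) by (intro onb_eqI[OF B]) (auto simp: z_def)
  moreover have "8 * \<eta> / m \<le> 8 * real n * \<eta>"
    using mult_left_mono[OF im, of "8 * \<eta>"] \<eta>0 by (simp add: mult_ac)
  ultimately show ?thesis
    using j ss xs unfolding z_def n_def by (intro bexI[of _ j] exI[of _ ss]) force+
qed

text \<open>The pivot varies with the points; summing over all \<open>j\<close> in \<open>B\<close>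
  dominates every choice and leaves a majorant depending on \<open>x\<close> only and continuous in
  \<open>x\<close>. One factor \<open>card B\<close> is the length of the chain, the other comes
  from its angles.\<close>

lemma poly_osc_le:
  assumes B: "onb B" and x: "norm x = 1" and y: "norm y = 1" and d: "norm (x - y) \<le> \<eta>"
    and \<eta>: "64 * (real (card B))\<^sup>2 * \<eta> * real N \<le> 1" and N: "1 \<le> N" and p: "poly_deg N p"
  shows "\<bar>p y - p x\<bar> \<le> 8 * (real (card B))\<^sup>2 * \<eta> * real N * (\<Sum>j\<in>B. avg N (pivot_list B j) (\<lambda>x. \<bar>p x\<bar>) x)"
proof -
  define n where "n = card B"
  have fin: "finite B" using B by (simp add: onb_def)
  have \<eta>0: "0 \<le> \<eta>" using d norm_ge_zero order_trans by blast
  have "64 * (real n)\<^sup>2 * \<eta> * 1 \<le> 64 * (real n)\<^sup>2 * \<eta> * real N"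
    using N \<eta>0 by (intro mult_left_mono) auto
  then obtain j ss where j: "j \<in> B" "length ss = length (pivot_list B j)"
    "\<forall>s\<in>set ss. \<bar>s\<bar> \<le> 8 * real n * \<eta>" "chain (pivot_list B j) ss x = y"
    using rot_connect[OF B x y d] \<eta> by (auto simp: n_def)
  have len: "length (pivot_list B j) \<le> n"
    using pivot_list[OF B j(1)] by (metis length_map less_imp_le n_def)
  have n: "1 \<le> n" using j(1) fin by (auto simp: n_def Suc_le_eq card_gt_0_iff)
  have "8 * real n * \<eta> * real N \<le> 8 * (real n)\<^sup>2 * \<eta> * real N"
    using n \<eta>0 by (intro mult_right_mono) (auto simp: power2_eq_square)
  also have "\<dots> \<le> 64 * (real n)\<^sup>2 * \<eta> * real N"
    using \<eta>0 by (intro mult_right_mono) auto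
  finally have le: "(8 * real n * \<eta>) * real N \<le> 1" using \<eta>[folded n_def] by linarith
  have "\<bar>p y - p x\<bar> \<le> real (length (pivot_list B j)) * (8 * real n * \<eta> * real N) * avg N (pivot_list B j) (\<lambda>x. \<bar>p x\<bar>) x"
    using chain_bound(2)[OF N j(2) _ le p, of x] j(3,4) by auto
  also have "\<dots> \<le> real n * (8 * real n * \<eta> * real N) * avg N (pivot_list B j) (\<lambda>x. \<bar>p x\<bar>) x"
    using len \<eta>0 by (intro mult_right_mono avg_nonneg) auto
  also have "\<dots> \<le> real n * (8 * real n * \<eta> * real N) * (\<Sum>j\<in>B. avg N (pivot_list B j) (\<lambda>x. \<bar>p x\<bar>) x)"
    using \<eta>0 fin j(1) by (intro mult_left_mono member_le_sum avg_nonneg) auto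
  finally show ?thesis by (simp add: n_def power2_eq_square mult_ac)
qed

subsection \<open>Integration over the sphere\<close>

text \<open>A well-ordered copy of the index type: the library states the change of variables theorem only for
  such index types.\<close>

typedef ('n :: finite) idx = "{..<CARD('n)}"
  by (rule exI[of _ 0]) simp

instantiation idx :: (finite) wellorder
begin

definition less_eq_idx :: "'a idx \<Rightarrow> 'a idx \<Rightarrow> bool" where
  "less_eq_idx x y \<longleftrightarrow> Rep_idx x \<le> Rep_idx y"

definition less_idx :: "'a idx \<Rightarrow> 'a idx \<Rightarrow> bool" where
  "less_idx x y \<longleftrightarrow> Rep_idx x < Rep_idx y"

instance
proof
  fix P :: "'a idx \<Rightarrow> bool" and a
  assume *: "\<And>x. (\<And>y. y < x \<Longrightarrow> P y) \<Longrightarrow> P x"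
  show "P a"
    by (induction a rule: measure_induct_rule[of Rep_idx]) (use * in \<open>auto simp: less_idx_def\<close>)
qed (auto simp: less_eq_idx_def less_idx_def Rep_idx_inject)

end

lemma card_idx: "CARD('n idx) = CARD('n :: finite)"
  using type_definition.card[OF type_definition_idx] by simp

instance idx :: (finite) finite
proof
  show "finite (UNIV :: 'a idx set)"
    by (rule card_ge_0_finite) (simp add: card_idx)
qed

text \<open>A map that permutes the coordinate axes pulls boxes back to boxes with the same side
  lengths, and boxes determine Lebesgue measure.\<close>

lemma linear_isometry_Basis_lborel:
  fixes T :: "'a :: euclidean_space \<Rightarrow> 'b :: euclidean_space"
  assumes lin: "linear T" and inner: "\<And>x y. T x \<bullet> T y = x \<bullet> y" and bij: "bij_betw T Basis Basis"
  shows "distr lborel borel T = lborel"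
proof (rule lborel_eqI[symmetric])
  have cont: "continuous_on UNIV T" using lin by (simp add: linear_continuous_on linear_conv_bounded_linear)
  have meas: "T \<in> borel_measurable borel" using cont by (rule borel_measurable_continuous_onI)
  have T0: "(T x - l) \<bullet> T b = x \<bullet> b - l \<bullet> T b" for x l b
    by (simp add: inner_diff_left inner)
  fix l u :: 'b assume le: "\<And>b. b \<in> Basis \<Longrightarrow> l \<bullet> b \<le> u \<bullet> b"
  define l' u' where "l' = (\<Sum>b\<in>Basis. (l \<bullet> T b) *\<^sub>R b)" and "u' = (\<Sum>b\<in>Basis. (u \<bullet> T b) *\<^sub>R b)"
  have l': "l' \<bullet> b = l \<bullet> T b" "u' \<bullet> b = u \<bullet> T b" if "b \<in> Basis" for b
    using that by (simp_all add: l'_def u'_def inner_sum_left inner_Basis if_distrib sum.delta cong: if_cong)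
  have im: "Basis = T ` Basis" using bij by (simp add: bij_betw_def)
  have "T -` box l u = box l' u'"
  proof -
    have "x \<in> T -` box l u \<longleftrightarrow> x \<in> box l' u'" for x
      unfolding vimage_eq mem_box by (subst im) (auto simp: inner l')
    then show ?thesis by blast
  qed
  then have "emeasure (distr lborel borel T) (box l u) = emeasure lborel (box l' u')"
    using meas by (simp add: emeasure_distr)
  also have "\<dots> = (\<Prod>b\<in>Basis. (u' - l') \<bullet> b)"
    using le bij by (subst emeasure_lborel_box) (auto simp: l' bij_betw_def)
  also have "(\<Prod>b\<in>Basis. (u' - l') \<bullet> b) = (\<Prod>b\<in>Basis. (u - l) \<bullet> T b)"
    by (intro prod.cong) (auto simp: l' inner_diff_left)
  also have "\<dots> = (\<Prod>b\<in>Basis. (u - l) \<bullet> b)" using bij by (rule prod.reindex_bij_betw)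
  finally show "emeasure (distr lborel borel T) (box l u) = (\<Prod>b\<in>Basis. (u - l) \<bullet> b)" .
qed simp

lemma wellorder_isometry:
  obtains T :: "real ^ 'n :: finite \<Rightarrow> real ^ 'n idx" and T' where
    "linear T" "linear T'" "\<And>x. T' (T x) = x" "\<And>x. T (T' x) = x"
    "\<And>x y. T x \<bullet> T y = x \<bullet> y" "\<And>x y. T' x \<bullet> T' y = x \<bullet> y"
    "distr lborel borel T = lborel" "distr lborel borel T' = lborel"
proof -
  obtain h :: "'n \<Rightarrow> 'n idx" where h: "bij h"
    using finite_same_card_bij[of "UNIV :: 'n set" "UNIV :: 'n idx set"] by (auto simp: card_idx)
  define g where "g = inv h"
  have hg: "h (g i) = i" "g (h j) = j" for i j
    using h by (auto simp: g_def bij_is_surj surj_f_inv_f bij_is_inj)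
  have bg: "bij g" using h by (simp add: g_def bij_imp_bij_inv)
  define T :: "real ^ 'n \<Rightarrow> real ^ 'n idx" where "T x = (\<chi> i. x $ g i)" for x
  define T' :: "real ^ 'n idx \<Rightarrow> real ^ 'n" where "T' x = (\<chi> i. x $ h i)" for x
  have lin: "linear T" "linear T'" by (auto intro!: linearI simp: T_def T'_def vec_eq_iff)
  have inv: "T' (T x) = x" "T (T' y) = y" for x y by (auto simp: T_def T'_def vec_eq_iff hg)
  have inn: "T x \<bullet> T y = x \<bullet> y" for x y
    using sum.reindex_bij_betw[OF bg, of "\<lambda>i. x $ i * y $ i"] by (simp add: T_def inner_vec_def)
  have inn': "T' x \<bullet> T' y = x \<bullet> y" for x y
    using sum.reindex_bij_betw[OF h, of "\<lambda>i. x $ i * y $ i"] by (simp add: T'_def inner_vec_def)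
  have ax: "T (axis i 1) = axis (h i) 1" for i by (auto simp: T_def axis_def vec_eq_iff hg)
  have ax': "T' (axis i 1) = axis (g i) 1" for i by (auto simp: T'_def axis_def vec_eq_iff hg)
  have B: "T b \<in> Basis" if "b \<in> Basis" for b using that by (auto simp: Basis_vec_def ax)
  have B': "T' b \<in> Basis" if "b \<in> Basis" for b using that by (auto simp: Basis_vec_def ax')
  have "bij_betw T Basis Basis" "bij_betw T' Basis Basis"
    by (auto intro!: bij_betwI[where g = T'] bij_betwI[where g = T] simp: B B' inv)
  with that lin inv inn inn' show ?thesis by (metis linear_isometry_Basis_lborel)
qed

section \<open>Integrals over the sphere: rotation invariance and the size of small balls\<close>

lemma radial_measurable [measurable]: "(\<lambda>v :: real ^ 'n. v /\<^sub>R norm v) \<in> borel_measurable borel"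
  by measurable

lemma borel_measurable_surface:
  "f \<in> borel_measurable borel \<Longrightarrow> f \<in> borel_measurable (surface_measure :: (real ^ 'n) measure)"
  using measurable_cong_sets[OF sets_surface_measure refl] by (auto intro: measurable_restrict_space1)

lemma surface_measure_eq_density:
  "(surface_measure :: (real ^ 'n) measure) = density (distr (restrict_space lborel (ball 0 1 - {0}))
     (restrict_space borel (sphere 0 1)) (\<lambda>x. x /\<^sub>R norm x)) (\<lambda>_. ennreal (real CARD('n)))"
  by (rule measure_eqI) (auto simp: surface_measure_def emeasure_density nn_integral_cmult
      ennreal_of_nat_eq_real_of_nat)

lemma
  fixes f :: "real ^ 'n \<Rightarrow> real"
  assumes f: "f \<in> borel_measurable borel"
  shows integral_surface: "(LINT x|surface_measure. f x) =
    real CARD('n) * (LINT v|lborel. indicator (ball 0 1 - {0}) v * f (v /\<^sub>R norm v))"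
proof -
  have f': "f \<in> borel_measurable (restrict_space borel (sphere 0 1))"
    using f by (rule measurable_restrict_space1)
  show ?thesis
    unfolding surface_measure_eq_density
    by (subst integral_density) (auto simp: f' integral_distr[OF radial_projection_measurable f'] integral_restrict_space)
qed

interpretation surface: finite_measure "surface_measure :: (real ^ 'n) measure"
  by (rule finite_measureI) (simp add: space_surface_measure emeasure_surface_measure_sphere)

lemma integrable_surface_bounded:
  fixes f :: "real ^ 'n \<Rightarrow> real"
  assumes "f \<in> borel_measurable borel" "\<And>x. norm x = 1 \<Longrightarrow> \<bar>f x\<bar> \<le> C"
  shows "integrable surface_measure f"
  using assms by (intro surface.integrable_const_bound[where B = C] AE_I2 borel_measurable_surface)
    (auto simp: space_surface_measure)

lemma integrable_surface_continuous:
  fixes f :: "real ^ 'n \<Rightarrow> real"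
  assumes "continuous_on UNIV f"
  shows "integrable surface_measure f"
proof -
  have "compact (f ` sphere 0 1)"
    using assms by (intro compact_continuous_image compact_sphere) (rule continuous_on_subset, auto)
  then obtain C where "\<And>y. y \<in> f ` sphere 0 1 \<Longrightarrow> \<bar>y\<bar> \<le> C"
    using compact_imp_bounded bounded_iff by (metis real_norm_def)
  then show ?thesis
    using assms by (intro integrable_surface_bounded[where C = C] borel_measurable_continuous_onI) auto
qed

lemma lborel_distr_orthogonal_wellorder:
  fixes T :: "real ^ 'm :: {finite, wellorder} \<Rightarrow> real ^ 'm :: _"
  assumes T: "orthogonal_transformation T"
  shows "distr lborel borel T = lborel"
proof (rule lborel_eqI[symmetric])
  have T': "orthogonal_transformation (inv T)" by (rule orthogonal_transformation_inv) fact
  have meas: "T \<in> borel_measurable borel"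
    using T by (intro borel_measurable_continuous_onI linear_continuous_on)
      (simp add: orthogonal_transformation_def linear_conv_bounded_linear)
  fix l u :: "real ^ 'm :: {finite, wellorder}" assume le: "\<And>b. b \<in> Basis \<Longrightarrow> l \<bullet> b \<le> u \<bullet> b"
  have eq: "T -` box l u = inv T ` box l u"
    using T by (simp add: bij_vimage_eq_inv_image orthogonal_transformation_bij)
  have lm: "inv T ` box l u \<in> lmeasurable" by (rule measurable_orthogonal_image[OF T']) simp
  have b: "inv T ` box l u \<in> sets borel"
    unfolding eq[symmetric] using measurable_sets[OF meas, of "box l u"] by simp
  have "emeasure (distr lborel borel T) (box l u) = emeasure lebesgue (inv T ` box l u)"
    using meas b by (simp add: emeasure_distr eq)
  also have "\<dots> = ennreal (measure lebesgue (inv T ` box l u))"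
    by (rule emeasure_eq_ennreal_measure) (use fmeasurableD2[OF lm] in \<open>simp add: top_ennreal_def\<close>)
  also have "\<dots> = ennreal (measure lebesgue (box l u))"
    by (subst measure_orthogonal_image[OF T']) auto
  also have "\<dots> = (\<Prod>b\<in>Basis. (u - l) \<bullet> b)"
    using le by (simp add: measure_lborel_box_eq inner_diff_left)
  finally show "emeasure (distr lborel borel T) (box l u) = (\<Prod>b\<in>Basis. (u - l) \<bullet> b)" .
qed simp

text \<open>Conjugation with the coordinate permutation of \<open>wellorder_isometry\<close> reduces
  the claim to the well-ordered index type.\<close>

lemma lborel_distr_orthogonal:
  fixes T :: "real ^ 'n \<Rightarrow> real ^ 'n"
  assumes T: "orthogonal_transformation T"
  shows "distr lborel borel T = lborel"
proof -
  obtain \<phi> :: "real ^ 'n \<Rightarrow> real ^ 'n idx" and \<psi> where \<phi>: "linear \<phi>" "linear \<psi>" "\<And>x. \<psi> (\<phi> x) = x"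
    "\<And>x. \<phi> (\<psi> x) = x" "\<And>x y. \<phi> x \<bullet> \<phi> y = x \<bullet> y" "\<And>x y. \<psi> x \<bullet> \<psi> y = x \<bullet> y"
    "distr lborel borel \<phi> = lborel" "distr lborel borel \<psi> = lborel"
    using wellorder_isometry by blast
  define T' where "T' = \<phi> \<circ> T \<circ> \<psi>"
  have linT: "linear T" using T by (rule orthogonal_transformation_linear)
  have "orthogonal_transformation T'"
    unfolding orthogonal_transformation_def T'_def
    using T \<phi> by (auto intro!: linear_compose simp: linT orthogonal_transformation_def)
  then have d: "distr lborel borel T' = lborel" by (rule lborel_distr_orthogonal_wellorder)
  have m: "f \<in> borel_measurable borel" if "linear f" for f :: "real ^ 'b :: finite \<Rightarrow> real ^ 'c :: finite"
    using that by (intro borel_measurable_continuous_onI linear_continuous_on) (simp add: linear_conv_bounded_linear)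
  have "distr lborel borel T = distr lborel borel (\<psi> \<circ> (T' \<circ> \<phi>))"
    by (rule arg_cong[where f = "distr lborel borel"]) (auto simp: T'_def \<phi>)
  also have "\<dots> = distr (distr (distr lborel borel \<phi>) borel T') borel \<psi>"
    by (subst distr_distr distr_distr[symmetric]; simp add: m \<phi> linT T'_def linear_compose o_assoc)+
  also have "\<dots> = lborel" by (simp add: \<phi> d)
  finally show ?thesis .
qed

text \<open>An orthogonal map preserves the punctured ball and commutes with the radial projection,
  so the invariance is inherited from Lebesgue measure.\<close>

lemma integral_surface_orthogonal:
  fixes T :: "real ^ 'n \<Rightarrow> real ^ 'n"
  assumes T: "orthogonal_transformation T" and f: "f \<in> borel_measurable borel"
  shows "(LINT x|surface_measure. f (T x)) = (LINT x|surface_measure. f x :: real)"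
proof -
  have linT: "linear T" using T by (rule orthogonal_transformation_linear)
  have m: "T \<in> borel_measurable borel"
    using linT by (intro borel_measurable_continuous_onI linear_continuous_on) (simp add: linear_conv_bounded_linear)
  have n: "norm (T x) = norm x" for x using T by (simp add: orthogonal_transformation)
  have fT: "(\<lambda>x. f (T x)) \<in> borel_measurable borel" using f m by measurable
  define g where "g v = indicator (ball 0 1 - {0}) v * f (v /\<^sub>R norm v)" for v :: "real ^ 'n"
  have g: "g \<in> borel_measurable borel" unfolding g_def
    by (intro borel_measurable_times borel_measurable_indicator measurable_compose[OF radial_measurable f]) auto
  have "indicator (ball 0 1 - {0}) v * f (T (v /\<^sub>R norm v)) = g (T v)" for v
  proof -
    have "T v = 0 \<longleftrightarrow> v = 0" using n[of v] by (metis norm_eq_zero)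
    then show ?thesis by (simp add: g_def n linear_cmul[OF linT] indicator_def)
  qed
  then have "(LINT x|surface_measure. f (T x)) = real CARD('n) * (LINT v|lborel. g (T v))"
    by (simp add: integral_surface[OF fT])
  also have "(LINT v|lborel. g (T v)) = (LINT v|distr lborel borel T. g v)"
    using m g by (subst integral_distr) auto
  also have "\<dots> = (LINT v|lborel. g v)" by (simp add: lborel_distr_orthogonal[OF T])
  finally show ?thesis by (simp add: integral_surface[OF f] g_def)
qed

lemma integral_surface_transfer:
  fixes \<psi> :: "real ^ 'm \<Rightarrow> real ^ 'n"
  assumes lin: "linear \<psi>" and inner: "\<And>x y. \<psi> x \<bullet> \<psi> y = x \<bullet> y" and d: "distr lborel borel \<psi> = lborel"
    and f: "f \<in> borel_measurable borel" and card: "CARD('m) = CARD('n)"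
  shows "(LINT x|surface_measure. f x) = (LINT x|surface_measure. f (\<psi> x) :: real)"
proof -
  have m: "\<psi> \<in> borel_measurable borel"
    using lin by (intro borel_measurable_continuous_onI linear_continuous_on) (simp add: linear_conv_bounded_linear)
  have n: "norm (\<psi> x) = norm x" for x by (simp add: norm_eq_sqrt_inner inner)
  have fT: "(\<lambda>x. f (\<psi> x)) \<in> borel_measurable borel" using f m by measurable
  define g where "g v = indicator (ball 0 1 - {0}) v * f (v /\<^sub>R norm v)" for v :: "real ^ 'n"
  have g: "g \<in> borel_measurable borel" unfolding g_def
    by (intro borel_measurable_times borel_measurable_indicator measurable_compose[OF radial_measurable f]) auto
  have "indicator (ball 0 1 - {0}) v * f (\<psi> (v /\<^sub>R norm v)) = g (\<psi> v)" for v
  proof -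
    have "\<psi> v = 0 \<longleftrightarrow> v = 0" using n[of v] by (metis norm_eq_zero)
    then show ?thesis by (simp add: g_def n linear_cmul[OF lin] indicator_def)
  qed
  then have "(LINT x|surface_measure. f (\<psi> x)) = real CARD('m) * (LINT v|lborel. g (\<psi> v))"
    by (simp add: integral_surface[OF fT])
  also have "(LINT v|lborel. g (\<psi> v)) = (LINT v|distr lborel borel \<psi>. g v)"
    using m g by (subst integral_distr) auto
  also have "\<dots> = (LINT v|lborel. g v)" by (simp add: d)
  finally show ?thesis by (simp add: integral_surface[OF f] g_def card)
qed

text \<open>Rotation invariance moves the centre to a coordinate axis. The cone over the ball then
  lies in a box of length 2 along the axis and width \<open>2 * r\<close> across it, and contains a
  box of length 1/4 and width proportional to \<open>r\<close>. Only the transversal directions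
  shrink with \<open>r\<close>, whence the exponent.\<close>

lemma
  fixes a :: "real ^ 'n"
  assumes a: "norm a = 1" and r: "0 < r"
  shows surface_ball_upper: "(LINT x|surface_measure. indicator (cball a r) x)
      \<le> 2 * real CARD('n) * (2 * r) ^ (CARD('n) - 1)"
    and surface_ball_lower: "r \<le> 1 \<Longrightarrow>
      real CARD('n) / 4 * (r / (4 * real CARD('n))) ^ (CARD('n) - 1) \<le> (LINT x|surface_measure. indicator (cball a r) x)"
proof -
  define n where "n = CARD('n)"
  have n: "1 \<le> n" by (simp add: n_def Suc_le_eq)
  obtain k :: 'n where True by blast
  define b where "b = (axis k 1 :: real ^ 'n)"
  have b: "norm b = 1" by (simp add: b_def)
  obtain T where T: "orthogonal_transformation T" "T b = a"
    using orthogonal_transformation_exists_1[OF b a] by blast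
  have dT: "dist a (T x) = dist b x" for x
    using T orthogonal_transformation_isometry by metis
  have "(LINT x|surface_measure. indicator (cball a r) x :: real) = (LINT x|surface_measure. indicator (cball a r) (T x))"
    by (rule integral_surface_orthogonal[OF T(1), symmetric]) (rule borel_measurable_indicator, simp)
  also have "\<dots> = (LINT x|surface_measure. indicator (cball b r) x)"
    by (simp add: indicator_def dT)
  also have "\<dots> = real n * (LINT v|lborel. indicator (ball 0 1 - {0}) v * indicator (cball b r) (v /\<^sub>R norm v))"
    unfolding n_def by (rule integral_surface) (rule borel_measurable_indicator, simp)
  also have "(LINT v|lborel. indicator (ball 0 1 - {0}) v * indicator (cball b r) (v /\<^sub>R norm v))
     = measure lborel {v \<in> ball 0 1 - {0}. norm (v /\<^sub>R norm v - b) \<le> r}"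
  proof -
    have "(LINT v|lborel. indicator (ball 0 1 - {0}) v * indicator (cball b r) (v /\<^sub>R norm v) :: real)
      = (LINT v|lborel. indicator {v \<in> ball 0 1 - {0}. norm (v /\<^sub>R norm v - b) \<le> r} v)"
      by (intro Bochner_Integration.integral_cong) (auto simp: indicator_def dist_norm norm_minus_commute)
    then show ?thesis by simp
  qed
  finally have eq: "(LINT x|surface_measure. indicator (cball a r) x) =
    real n * measure lborel {v \<in> ball 0 1 - {0}. norm (v /\<^sub>R norm v - b) \<le> r}" .
  define A where "A = {v \<in> ball 0 1 - {0}. norm (v /\<^sub>R norm v - b) \<le> r}"
  have A: "A \<in> sets borel"
  proof -
    have "(\<lambda>v. norm (v /\<^sub>R norm v - b)) \<in> borel_measurable borel" by measurable
    from measurable_sets[OF this, of "{..r}"]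
    have "(\<lambda>v. norm (v /\<^sub>R norm v - b)) -` {..r} \<in> sets borel" by simp
    moreover have "A = (ball 0 1 - {0}) \<inter> (\<lambda>v. norm (v /\<^sub>R norm v - b)) -` {..r}" by (auto simp: A_def)
    ultimately show ?thesis by auto
  qed
  have Asub: "A \<subseteq> ball 0 1" by (auto simp: A_def)
  have Afin: "A \<in> fmeasurable lborel"
    by (rule fmeasurableI2[OF fmeasurableI[OF _ emeasure_lborel_ball_finite]]) (use A Asub in auto)
  have prodk: "(\<Prod>i\<in>UNIV. if i = k then c else e) = c * e ^ (n - 1)" for c e :: real
    by (subst prod.remove[of _ k]) (auto simp: n_def)
  have bi: "b $ i = (if i = k then 1 else 0)" for i by (simp add: b_def axis_def)
  define l u where "l = (\<chi> i. if i = k then -1 else (- r :: real))" and "u = (\<chi> i. if i = k then 1 else (r :: real))"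
  have "A \<subseteq> cbox l u"
  proof
    fix v assume v: "v \<in> A"
    then have vn: "v \<noteq> 0" "norm v < 1" "norm (v /\<^sub>R norm v - b) \<le> r" by (auto simp: A_def)
    have "\<bar>v $ k\<bar> \<le> 1" using component_le_norm_cart[of v k] vn by linarith
    moreover have "- r \<le> v $ i \<and> v $ i \<le> r" if "i \<noteq> k" for i
    proof -
      have "\<bar>(v /\<^sub>R norm v - b) $ i\<bar> \<le> r" using component_le_norm_cart vn(3) order_trans by blast
      then have "\<bar>v $ i\<bar> / norm v \<le> r" using that by (simp add: bi abs_mult divide_inverse mult.commute)
      then have "\<bar>v $ i\<bar> \<le> r * norm v" using vn by (simp add: divide_le_eq)
      also have "\<dots> \<le> r * 1" using vn r by (intro mult_left_mono) auto
      finally show ?thesis by auto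
    qed
    ultimately show "v \<in> cbox l u" by (auto simp: mem_box_cart l_def u_def)
  qed
  then have "measure lborel A \<le> measure lborel (cbox l u)"
    using A by (intro measure_mono_fmeasurable) auto
  also have "measure lborel (cbox l u) = (\<Prod>i\<in>UNIV. if i = k then 2 else 2 * r)"
  proof -
    have "0 \<in> cbox l u" using r by (auto simp: mem_box_cart l_def u_def)
    then show ?thesis by (subst content_cbox_cart) (auto simp: l_def u_def intro!: prod.cong)
  qed
  finally show "(LINT x|surface_measure. indicator (cball a r) x)
      \<le> 2 * real CARD('n) * (2 * r) ^ (CARD('n) - 1)"
    using n unfolding eq A_def[symmetric] n_def[symmetric] prodk by (simp add: mult_ac)
  show "real CARD('n) / 4 * (r / (4 * real CARD('n))) ^ (CARD('n) - 1) \<le> (LINT x|surface_measure. indicator (cball a r) x)"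
    if r1: "r \<le> 1"
  proof -
    \<comment> \<open>A point of the small box is off the axis by at most
      \<open>n * s = r / 8\<close>, and its norm differs from its axial coordinate by no more.
      Dividing the sum of both errors by that coordinate, which is at least 1/2, leaves at most
      \<open>r / 2\<close>.\<close>
    define s where "s = r / (8 * real n)"
    have s: "0 < s" "real n * s = r / 8" using r n by (auto simp: s_def)
    define l u where "l = (\<chi> i. if i = k then 1/2 else (- s :: real))" and "u = (\<chi> i. if i = k then 3/4 else (s :: real))"
    have "cbox l u \<subseteq> A"
    proof
      fix v assume v: "v \<in> cbox l u"
      have vk: "1/2 \<le> v $ k" "v $ k \<le> 3/4" using v by (auto simp: mem_box_cart l_def u_def dest!: spec[of _ k])
      have vi: "- s \<le> v $ i" "v $ i \<le> s" if "i \<noteq> k" for i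
        using v that by (auto simp: mem_box_cart l_def u_def dest!: spec[of _ i])
      define q where "q = v - (v $ k) *\<^sub>R b"
      have "norm q \<le> (\<Sum>i\<in>UNIV. \<bar>q $ i\<bar>)" by (rule norm_le_l1_cart)
      also have "\<dots> \<le> (\<Sum>i\<in>(UNIV :: 'n set). s)"
      proof (rule sum_mono)
        fix i show "\<bar>q $ i\<bar> \<le> s"
          using vi[of i] s(1) by (cases "i = k") (auto simp: q_def bi abs_le_iff)
      qed
      finally have q: "norm q \<le> r / 8" using s by (simp add: n_def)
      have nv: "\<bar>norm v - v $ k\<bar> \<le> norm q"
        using norm_triangle_ineq3[of v "(v $ k) *\<^sub>R b"] vk b by (simp add: q_def)
      have v1: "norm v < 1" and v0: "v \<noteq> 0" using nv q r1 vk by auto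
      have "v $ k *\<^sub>R (v /\<^sub>R norm v - b) = (v $ k / norm v) *\<^sub>R v - (v $ k) *\<^sub>R b"
        by (simp add: scaleR_diff_right divide_inverse)
      moreover have "((v $ k - norm v) / norm v) *\<^sub>R v = (v $ k / norm v) *\<^sub>R v - v"
        using v0 by (simp add: diff_divide_distrib scaleR_diff_left)
      ultimately have "v $ k *\<^sub>R (v /\<^sub>R norm v - b) = ((v $ k - norm v) / norm v) *\<^sub>R v + q"
        by (simp add: q_def)
      then have "(v $ k) * norm (v /\<^sub>R norm v - b) \<le> \<bar>v $ k - norm v\<bar> + norm q"
      proof -
        assume *: "v $ k *\<^sub>R (v /\<^sub>R norm v - b) = ((v $ k - norm v) / norm v) *\<^sub>R v + q"
        have "norm (v $ k *\<^sub>R (v /\<^sub>R norm v - b)) \<le> norm (((v $ k - norm v) / norm v) *\<^sub>R v) + norm q"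
          unfolding * by (rule norm_triangle_ineq)
        then show ?thesis using v0 vk by simp
      qed
      also have "\<dots> \<le> r / 4" using nv q by linarith
      finally have "(v $ k) * norm (v /\<^sub>R norm v - b) \<le> r / 4" .
      moreover have "1/2 * norm (v /\<^sub>R norm v - b) \<le> (v $ k) * norm (v /\<^sub>R norm v - b)"
        using vk by (intro mult_right_mono) auto
      ultimately have "norm (v /\<^sub>R norm v - b) \<le> r" using r by simp
      with v1 v0 show "v \<in> A" by (simp add: A_def)
    qed
    then have "measure lborel (cbox l u) \<le> measure lborel A"
      using Afin by (intro measure_mono_fmeasurable) auto
    moreover have "measure lborel (cbox l u) = (\<Prod>i\<in>UNIV. if i = k then 1/4 else 2 * s)"
    proof -
      have "l \<in> cbox l u" using s by (auto simp: mem_box_cart l_def u_def)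
      then show ?thesis by (subst content_cbox_cart) (auto simp: l_def u_def intro!: prod.cong)
    qed
    moreover have "2 * s = r / (4 * real n)" by (simp add: s_def)
    ultimately have "1/4 * (r / (4 * real n)) ^ (n - 1) \<le> measure lborel A" by (simp only: prodk)
    then have "real n * (1/4 * (r / (4 * real n)) ^ (n - 1)) \<le> real n * measure lborel A"
      by (intro mult_left_mono) auto
    then show ?thesis unfolding eq A_def[symmetric] n_def[symmetric] by simp
  qed
qed

subsection \<open>The parametrization of the cap by the hemisphere\<close>

text \<open>After a rotation taking \<open>e\<close> to a multiple of a coordinate vector, the
  matrix differs from the identity in a single row, and Cramer's rule gives the determinant.\<close>

lemma det_rank_one_update:
  fixes e \<alpha> :: "real ^ 'n"
  shows "det (matrix (\<lambda>w. w + (\<alpha> \<bullet> w) *\<^sub>R e)) = 1 + \<alpha> \<bullet> e"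
proof -
  obtain k :: 'n where True by blast
  have "norm (norm e *\<^sub>R axis k (1 :: real) :: real ^ 'n) = norm e" by simp
  then obtain T where T: "orthogonal_transformation T" "T (norm e *\<^sub>R axis k (1 :: real)) = e"
    by (rule orthogonal_transformation_exists)
  define a where "a = norm e"
  have linT: "linear T" using T(1) by (rule orthogonal_transformation_linear)
  define \<beta> where "\<beta> = inv T \<alpha>"
  have Tb: "T \<beta> = \<alpha>" using T(1) by (simp add: \<beta>_def orthogonal_transformation_surj surj_f_inv_f)
  have \<alpha>T: "\<alpha> \<bullet> T w = \<beta> \<bullet> w" for w
    using T(1) Tb by (metis orthogonal_transformation_def)
  define L' where "L' w = w + (\<beta> \<bullet> w) *\<^sub>R (a *\<^sub>R axis k 1)" for w :: "real ^ 'n"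
  define L where "L w = w + (\<alpha> \<bullet> w) *\<^sub>R e" for w
  have linL: "linear L" "linear L'"
    unfolding L_def L'_def by (auto intro!: linearI simp: inner_add_right algebra_simps)
  have "L \<circ> T = T \<circ> L'"
  proof
    fix w
    have "T (L' w) = T w + (\<beta> \<bullet> w) *\<^sub>R T (norm e *\<^sub>R axis k 1)"
      by (simp only: L'_def a_def linear_add[OF linT] linear_cmul[OF linT])
    then show "(L \<circ> T) w = (T \<circ> L') w" by (simp add: T(2)) (simp add: L_def \<alpha>T)
  qed
  then have "matrix L ** matrix T = matrix T ** matrix L'"
    using matrix_compose[OF linT linL(1)] matrix_compose[OF linL(2) linT] by simp
  then have "det (matrix L) * det (matrix T) = det (matrix T) * det (matrix L')"
    by (metis det_mul)
  moreover have "det (matrix T) \<noteq> 0"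
    using linT T(1) orthogonal_transformation_inj by (simp add: det_nz_iff_inj)
  ultimately have eq: "det (matrix L) = det (matrix L')" by simp
  define x where "x = axis k 1 + a *\<^sub>R \<beta>"
  have row1: "row i (mat 1) = axis i (1 :: real)" for i :: 'n
    by (auto simp: row_def mat_def axis_def vec_eq_iff)
  have sx: "(\<Sum>i\<in>UNIV. x $ i *s row i (mat 1)) = x"
    unfolding row1 by (rule basis_expansion)
  have "matrix L' = (\<chi> i. if i = k then (\<Sum>i\<in>UNIV. x $ i *s row i (mat 1)) else row i (mat 1))"
    unfolding sx unfolding row1
    by (simp add: vec_eq_iff matrix_def L'_def x_def inner_axis) (simp add: axis_def)
  then have "det (matrix L') = x $ k * det (mat 1 :: real ^ 'n ^ 'n)"
    using cramer_lemma_transpose[of k x "mat 1"] by simp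
  moreover have "\<alpha> \<bullet> e = a * \<beta> $ k"
    using \<alpha>T[of "norm e *\<^sub>R axis k 1"] T(2) by (simp add: a_def inner_axis)
  ultimately show ?thesis using eq by (simp add: x_def L_def[abs_def])
qed

lemma det_scaled_rank_one_update:
  fixes e \<alpha> :: "real ^ 'n"
  assumes "l \<noteq> 0"
  shows "det (matrix (\<lambda>w. l *\<^sub>R w + (\<alpha> \<bullet> w) *\<^sub>R e)) = l ^ (CARD('n) - 1) * (l + \<alpha> \<bullet> e)"
proof -
  define M where "M w = w + (\<alpha> \<bullet> w) *\<^sub>R (e /\<^sub>R l)" for w
  have lin: "linear M"
    unfolding M_def by (auto intro!: linearI simp: inner_add_right algebra_simps)
  have "(\<lambda>w. l *\<^sub>R w + (\<alpha> \<bullet> w) *\<^sub>R e) = (*\<^sub>R) l \<circ> M"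
    using assms by (auto simp: M_def fun_eq_iff algebra_simps)
  moreover have "matrix ((*\<^sub>R) l \<circ> M) = matrix ((*\<^sub>R) l) ** matrix M"
    by (rule matrix_compose[OF lin linear_scaleR])
  moreover have "det (matrix M) = 1 + \<alpha> \<bullet> (e /\<^sub>R l)"
    unfolding M_def[abs_def] by (rule det_rank_one_update)
  ultimately have "det (matrix (\<lambda>w. l *\<^sub>R w + (\<alpha> \<bullet> w) *\<^sub>R e)) = l ^ CARD('n) * (1 + \<alpha> \<bullet> (e /\<^sub>R l))"
    by (simp only: det_mul det_matrix_scaleR)
  also have "l ^ CARD('n) = l ^ (CARD('n) - 1) * l"
    by (rule power_minus_mult[symmetric]) simp
  finally have "det (matrix (\<lambda>w. l *\<^sub>R w + (\<alpha> \<bullet> w) *\<^sub>R e)) = l ^ (CARD('n) - 1) * (l * (1 + \<alpha> \<bullet> (e /\<^sub>R l)))"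
    by (simp only: mult.assoc)
  also have "l * (1 + \<alpha> \<bullet> (e /\<^sub>R l)) = l + \<alpha> \<bullet> e" using assms by (simp add: distrib_left)
  finally show ?thesis .
qed

text \<open>The map is the composition of the rank one update \<open>A\<close> with
  \<open>B\<close>, where \<open>g\<close> solves \<open>A g = f\<close>; solving for
  \<open>g\<close> is where \<open>l + \<alpha> \<bullet> e \<noteq> 0\<close> enters. Both
  determinants are known.\<close>

lemma det_rank_two_update:
  fixes e f \<alpha> \<beta> :: "real ^ 'n"
  assumes l: "l \<noteq> 0" and nz: "l + \<alpha> \<bullet> e \<noteq> 0" and n: "2 \<le> CARD('n)"
  shows "det (matrix (\<lambda>w. l *\<^sub>R w + (\<alpha> \<bullet> w) *\<^sub>R e + (\<beta> \<bullet> w) *\<^sub>R f))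
    = l ^ (CARD('n) - 2) * ((l + \<alpha> \<bullet> e) * (l + \<beta> \<bullet> f) - (\<alpha> \<bullet> f) * (\<beta> \<bullet> e))"
proof -
  define t where "t = (\<alpha> \<bullet> f) / (l + \<alpha> \<bullet> e)"
  define g where "g = (f - t *\<^sub>R e) /\<^sub>R l"
  define A where "A w = l *\<^sub>R w + (\<alpha> \<bullet> w) *\<^sub>R e" for w
  define B where "B w = w + (\<beta> \<bullet> w) *\<^sub>R g" for w
  have lin: "linear A" "linear B"
    unfolding A_def B_def by (auto intro!: linearI simp: inner_add_right algebra_simps)
  have t: "t * (l + \<alpha> \<bullet> e) = \<alpha> \<bullet> f" using nz by (simp add: t_def)
  have "\<alpha> \<bullet> g = t" using l t by (simp add: g_def inner_diff_right field_simps)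
  then have Ag: "A g = f" using l by (simp add: A_def) (simp add: g_def)
  have "A \<circ> B = (\<lambda>w. l *\<^sub>R w + (\<alpha> \<bullet> w) *\<^sub>R e + (\<beta> \<bullet> w) *\<^sub>R f)"
  proof
    fix w
    have "(A \<circ> B) w = A w + (\<beta> \<bullet> w) *\<^sub>R A g"
      by (simp add: B_def linear_add[OF lin(1)] linear_cmul[OF lin(1)])
    then show "(A \<circ> B) w = l *\<^sub>R w + (\<alpha> \<bullet> w) *\<^sub>R e + (\<beta> \<bullet> w) *\<^sub>R f" by (simp add: Ag) (simp add: A_def)
  qed
  then have "det (matrix (\<lambda>w. l *\<^sub>R w + (\<alpha> \<bullet> w) *\<^sub>R e + (\<beta> \<bullet> w) *\<^sub>R f)) = det (matrix A) * det (matrix B)"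
    using matrix_compose[OF lin(2,1)] by (simp add: det_mul)
  also have "\<dots> = l ^ (CARD('n) - 1) * (l + \<alpha> \<bullet> e) * (1 + \<beta> \<bullet> g)"
    using det_scaled_rank_one_update[OF l, of \<alpha> e] det_rank_one_update[of \<beta> g]
    by (simp only: A_def[abs_def] B_def[abs_def])
  also have "l ^ (CARD('n) - 1) = l ^ (CARD('n) - 2) * l"
  proof -
    obtain m where "CARD('n) = Suc (Suc m)" using n by (metis add_2_eq_Suc le_Suc_ex)
    then show ?thesis by simp
  qed
  also have "l ^ (CARD('n) - 2) * l * (l + \<alpha> \<bullet> e) * (1 + \<beta> \<bullet> g)
      = l ^ (CARD('n) - 2) * ((l + \<alpha> \<bullet> e) * (l + \<beta> \<bullet> f) - (t * (l + \<alpha> \<bullet> e)) * (\<beta> \<bullet> e))"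
  proof -
    have "l * (1 + \<beta> \<bullet> g) = l + \<beta> \<bullet> f - t * (\<beta> \<bullet> e)"
      using l by (simp add: g_def inner_diff_right distrib_left)
    then have "(l + \<alpha> \<bullet> e) * (l * (1 + \<beta> \<bullet> g)) = (l + \<alpha> \<bullet> e) * (l + \<beta> \<bullet> f) - (t * (l + \<alpha> \<bullet> e)) * (\<beta> \<bullet> e)"
      by (simp only:) (simp add: algebra_simps)
    moreover have "l ^ (CARD('n) - 2) * l * (l + \<alpha> \<bullet> e) * (1 + \<beta> \<bullet> g)
        = l ^ (CARD('n) - 2) * ((l + \<alpha> \<bullet> e) * (l * (1 + \<beta> \<bullet> g)))"
      by (simp only: mult_ac)
    ultimately show ?thesis by (simp only:)
  qed
  finally show ?thesis by (simp only: t)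
qed

section \<open>The map from the hemisphere onto the cap, its inverse and its density\<close>

definition perp :: "'a :: euclidean_space \<Rightarrow> 'a \<Rightarrow> 'a" where
  "perp e x = x - (x \<bullet> e) *\<^sub>R e"

text \<open>If \<theta> is the angle between \<open>capmap e \<kappa> x\<close> and
  \<open>e\<close>, then \<open>\<kappa> * norm (perp e x)\<close> is sin(\<theta>/2) and this is
  cos(\<theta>/2); \<open>capmap\<close> then consists of the double angle formulas for cos \<theta>
  and sin \<theta>.\<close>

definition cfac :: "'a :: euclidean_space \<Rightarrow> real \<Rightarrow> 'a \<Rightarrow> real" where
  "cfac e \<kappa> x = sqrt (1 - \<kappa>\<^sup>2 * (norm (perp e x))\<^sup>2)"

text \<open>Lambert's azimuthal projection identifies the cap \<open>{y. 1 - 2 * \<kappa>\<^sup>2 \<le> y \<bullet> e}\<close> with a ball in the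
  hyperplane orthogonal to \<open>e\<close>, and so does the orthogonal projection of the hemisphere
  \<open>{x. 0 \<le> x \<bullet> e}\<close>; \<open>capmap\<close> is the resulting map from the hemisphere onto the cap.\<close>

definition capmap :: "'a :: euclidean_space \<Rightarrow> real \<Rightarrow> 'a \<Rightarrow> 'a" where
  "capmap e \<kappa> x = (1 - 2 * \<kappa>\<^sup>2 * (norm (perp e x))\<^sup>2) *\<^sub>R e + (2 * \<kappa> * cfac e \<kappa> x) *\<^sub>R perp e x"

lemma linear_perp: "linear (perp e)"
  by (rule linearI) (auto simp: perp_def inner_add_left algebra_simps)

lemma perp_decomp: "x = (x \<bullet> e) *\<^sub>R e + perp e x" by (simp add: perp_def)

context
  fixes e :: "'a :: euclidean_space"
  assumes e: "norm e = 1"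
begin

lemma inner_perp_left: "perp e x \<bullet> e = 0"
  using e by (simp add: perp_def inner_diff_left dot_square_norm)

lemma inner_perp: "perp e x \<bullet> y = perp e x \<bullet> perp e y"
  using inner_perp_left[of x] by (simp add: perp_def[of e y] inner_diff_right)

lemma norm_perp_power2: "(norm (perp e x))\<^sup>2 = (norm x)\<^sup>2 - (x \<bullet> e)\<^sup>2"
proof -
  have "(norm (perp e x))\<^sup>2 = perp e x \<bullet> x" using inner_perp[of x x] by (simp only: power2_norm_eq_inner)
  also have "\<dots> = x \<bullet> x - (x \<bullet> e)\<^sup>2"
    by (simp add: perp_def inner_diff_left inner_commute[of e x] power2_eq_square)
  finally show ?thesis by (simp only: power2_norm_eq_inner)
qed

lemma norm_perp_le: "norm (perp e x) \<le> norm x"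
  using norm_perp_power2[of x] by (metis diff_ge_0_iff_ge diff_left_mono diff_zero norm_ge_zero power2_le_imp_le zero_le_power2)

lemma capmap_inner: "capmap e \<kappa> x \<bullet> e = 1 - 2 * \<kappa>\<^sup>2 * (norm (perp e x))\<^sup>2"
  using e by (simp add: capmap_def inner_add_left inner_perp_left dot_square_norm)

lemma perp_capmap: "perp e (capmap e \<kappa> x) = (2 * \<kappa> * cfac e \<kappa> x) *\<^sub>R perp e x"
  unfolding perp_def[of e "capmap e \<kappa> x"] capmap_inner by (simp add: capmap_def)

context
  fixes \<kappa> :: real
  assumes \<kappa>: "0 < \<kappa>" "\<kappa> < 1"
begin

lemma cfac_arg: assumes "norm x \<le> 1" shows "1 - \<kappa>\<^sup>2 \<le> 1 - \<kappa>\<^sup>2 * (norm (perp e x))\<^sup>2"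
proof -
  have "(norm (perp e x))\<^sup>2 \<le> 1" using norm_perp_le[of x] assms by (simp add: power_le_one_iff)
  then have "\<kappa>\<^sup>2 * (norm (perp e x))\<^sup>2 \<le> \<kappa>\<^sup>2 * 1" by (intro mult_left_mono) auto
  then show ?thesis by simp
qed

lemma kappa_sq: "0 < 1 - \<kappa>\<^sup>2" using \<kappa> by (simp add: power_less_one_iff abs_square_less_1)

lemma cfac_bounds:
  assumes "norm x \<le> 1"
  shows "sqrt (1 - \<kappa>\<^sup>2) \<le> cfac e \<kappa> x" "cfac e \<kappa> x \<le> 1" "0 < cfac e \<kappa> x"
    "(cfac e \<kappa> x)\<^sup>2 = 1 - \<kappa>\<^sup>2 * (norm (perp e x))\<^sup>2"
proof -
  show 1: "sqrt (1 - \<kappa>\<^sup>2) \<le> cfac e \<kappa> x"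
    unfolding cfac_def using cfac_arg[OF assms] by simp
  show "cfac e \<kappa> x \<le> 1" by (simp add: cfac_def)
  have "0 < sqrt (1 - \<kappa>\<^sup>2)" using kappa_sq by simp
  then show "0 < cfac e \<kappa> x" using 1 by linarith
  show "(cfac e \<kappa> x)\<^sup>2 = 1 - \<kappa>\<^sup>2 * (norm (perp e x))\<^sup>2"
    unfolding cfac_def using cfac_arg[OF assms] kappa_sq by (intro real_sqrt_pow2) linarith
qed

lemma norm_capmap:
  assumes "norm x \<le> 1"
  shows "norm (capmap e \<kappa> x) = 1"
proof -
  define p where "p = (norm (perp e x))\<^sup>2"
  have "(norm (capmap e \<kappa> x))\<^sup>2 = (capmap e \<kappa> x \<bullet> e)\<^sup>2 + (norm (perp e (capmap e \<kappa> x)))\<^sup>2"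
    by (simp add: norm_perp_power2)
  also have "\<dots> = (1 - 2 * \<kappa>\<^sup>2 * p)\<^sup>2 + 4 * \<kappa>\<^sup>2 * (cfac e \<kappa> x)\<^sup>2 * p"
    by (simp add: capmap_inner perp_capmap p_def power_mult_distrib)
  also have "\<dots> = 1" unfolding cfac_bounds(4)[OF assms] p_def[symmetric]
    by (simp add: power2_eq_square algebra_simps)
  finally show ?thesis by (simp only: abs_square_eq_1 abs_norm_cancel)
qed

lemma capmap_in_cap:
  assumes "norm x \<le> 1"
  shows "1 - 2 * \<kappa>\<^sup>2 \<le> capmap e \<kappa> x \<bullet> e"
  using cfac_arg[OF assms] by (simp add: capmap_inner)

lemma capmap_inj:
  assumes x: "norm x = 1" "0 \<le> x \<bullet> e" and y: "norm y = 1" "0 \<le> y \<bullet> e"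
    and eq: "capmap e \<kappa> x = capmap e \<kappa> y"
  shows "x = y"
proof -
  have "\<kappa>\<^sup>2 * (norm (perp e x))\<^sup>2 = \<kappa>\<^sup>2 * (norm (perp e y))\<^sup>2"
    using arg_cong[OF eq, of "\<lambda>z. z \<bullet> e"] by (simp add: capmap_inner)
  then have "cfac e \<kappa> x = cfac e \<kappa> y" by (simp add: cfac_def)
  then have p: "perp e x = perp e y"
    using arg_cong[OF eq, of "perp e"] cfac_bounds(3)[of y] y \<kappa> by (simp add: perp_capmap)
  then have "(x \<bullet> e)\<^sup>2 = (y \<bullet> e)\<^sup>2"
    using norm_perp_power2[of x] norm_perp_power2[of y] x y by simp
  then have "x \<bullet> e = y \<bullet> e" using x y by (simp add: power2_eq_iff_nonneg)
  then show ?thesis using p perp_decomp by metis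
qed

lemma capmap_surj:
  assumes y: "norm y = 1" "1 - 2 * \<kappa>\<^sup>2 \<le> y \<bullet> e"
  shows "\<exists>x. norm x = 1 \<and> 0 \<le> x \<bullet> e \<and> capmap e \<kappa> x = y"
proof -
  \<comment> \<open>\<open>s\<close> is twice the value of \<open>cfac\<close> at the preimage,
    expressed through \<open>y\<close>; it is positive since \<open>\<kappa> < 1\<close> keeps
    \<open>y\<close> away from \<open>- e\<close>. Division by \<open>\<kappa> * s\<close> inverts
    \<open>perp_capmap\<close>, and the height of \<open>x\<close> completes \<open>u\<close> to a
    unit vector.\<close>
  define s where "s = sqrt (2 * (1 + y \<bullet> e))"
  have "\<kappa>\<^sup>2 < 1" using kappa_sq by simp
  then have pos: "0 < 1 + y \<bullet> e" using y by simp
  then have s: "0 < s" "s\<^sup>2 = 2 * (1 + y \<bullet> e)" by (simp_all add: s_def)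
  have py: "(norm (perp e y))\<^sup>2 = (1 + y \<bullet> e) * (1 - y \<bullet> e)"
    using norm_perp_power2[of y] y by (simp add: power2_eq_square algebra_simps)
  define u where "u = (1 / (\<kappa> * s)) *\<^sub>R perp e y"
  have u2: "(norm u)\<^sup>2 = (1 - y \<bullet> e) / (2 * \<kappa>\<^sup>2)"
  proof -
    have "(norm u)\<^sup>2 = (1 + y \<bullet> e) * (1 - y \<bullet> e) / (\<kappa>\<^sup>2 * (2 * (1 + y \<bullet> e)))"
      unfolding u_def by (simp only: norm_scaleR power_mult_distrib py power2_abs power_divide s(2)) simp
    moreover have "w * (1 - y \<bullet> e) / (\<kappa>\<^sup>2 * (2 * w)) = (1 - y \<bullet> e) / (2 * \<kappa>\<^sup>2)" if "w \<noteq> 0" for w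
      using that by simp
    ultimately show ?thesis using pos by (metis less_irrefl)
  qed
  have u1: "(norm u)\<^sup>2 \<le> 1" unfolding u2 using y \<kappa> by (simp add: field_simps)
  have ue: "u \<bullet> e = 0" by (simp add: u_def inner_perp_left)
  define x where "x = u + sqrt (1 - (norm u)\<^sup>2) *\<^sub>R e"
  have xe: "x \<bullet> e = sqrt (1 - (norm u)\<^sup>2)" using e by (simp add: x_def inner_add_left ue dot_square_norm)
  have px: "perp e x = u" by (simp add: perp_def[of e x] xe) (simp add: x_def)
  have "(norm x)\<^sup>2 = (x \<bullet> e)\<^sup>2 + (norm (perp e x))\<^sup>2" by (simp add: norm_perp_power2)
  also have "\<dots> = 1" using u1 by (simp add: xe px)
  finally have nx: "norm x = 1" by (simp only: abs_square_eq_1 abs_norm_cancel)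
  have ku: "\<kappa>\<^sup>2 * (norm u)\<^sup>2 = (1 - y \<bullet> e) / 2" using \<kappa> by (simp add: u2)
  have "cfac e \<kappa> x = sqrt ((1 + y \<bullet> e) / 2)" unfolding cfac_def px ku by (simp add: field_simps)
  also have "(1 + y \<bullet> e) / 2 = (s / 2)\<^sup>2" using s by (simp add: power_divide)
  also have "sqrt ((s / 2)\<^sup>2) = s / 2" using s by simp
  finally have "2 * \<kappa> * cfac e \<kappa> x = \<kappa> * s" by simp
  moreover have "1 - 2 * \<kappa>\<^sup>2 * (norm u)\<^sup>2 = y \<bullet> e" using ku by simp
  ultimately have "capmap e \<kappa> x = (y \<bullet> e) *\<^sub>R e + (\<kappa> * s) *\<^sub>R u"
    by (simp only: capmap_def px)
  also have "\<dots> = y" using s \<kappa> perp_decomp[of y e] by (simp add: u_def)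
  finally show ?thesis using nx xe u1 by (intro exI[of _ x]) auto
qed

end

end

text \<open>The density of \<open>capmap\<close> is computed on its radial extension \<open>capmap_cone\<close>, a norm preserving map of
  the solid half ball; this turns it into a determinant.\<close>

definition capratio :: "'a :: euclidean_space \<Rightarrow> real \<Rightarrow> 'a \<Rightarrow> real" where
  "capratio e \<kappa> v = \<kappa>\<^sup>2 * (perp e v \<bullet> perp e v) / (norm v)\<^sup>2"

definition capmap_cone :: "'a :: euclidean_space \<Rightarrow> real \<Rightarrow> 'a \<Rightarrow> 'a" where
  "capmap_cone e \<kappa> v = (norm v * (1 - 2 * capratio e \<kappa> v)) *\<^sub>R e + (2 * \<kappa> * sqrt (1 - capratio e \<kappa> v)) *\<^sub>R perp e v"

text \<open>Arranged as a multiple of the identity plus two rank one terms, the form to which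
  \<open>det_rank_two_update\<close> applies. The local \<open>\<tau>\<close> is the gradient of
  \<open>capratio\<close>.\<close>

definition capmap_cone_deriv :: "'a :: euclidean_space \<Rightarrow> real \<Rightarrow> 'a \<Rightarrow> 'a \<Rightarrow> 'a" where
  "capmap_cone_deriv e \<kappa> v w = (let t = capratio e \<kappa> v; r = norm v; c = sqrt (1 - t);
     \<tau> = (2 / r\<^sup>2) *\<^sub>R (\<kappa>\<^sup>2 *\<^sub>R perp e v - t *\<^sub>R v) in
     (2 * \<kappa> * c) *\<^sub>R w + ((((1 - 2 * t) / r) *\<^sub>R v - (2 * r) *\<^sub>R \<tau> - (2 * \<kappa> * c) *\<^sub>R e) \<bullet> w) *\<^sub>R e
       + ((- (\<kappa> / c) *\<^sub>R \<tau>) \<bullet> w) *\<^sub>R perp e v)"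

text \<open>The Jacobian of \<open>capmap\<close> on the sphere is \<open>capdens\<close> times
  \<open>x \<bullet> e\<close>; the second factor, vanishing on the equator, is kept apart as the
  weight. The exponent of \<open>cfac\<close> is in effect \<open>DIM('a) - 3\<close>, written as a
  quotient because it is negative on the circle.\<close>

definition capdens :: "'a :: euclidean_space \<Rightarrow> real \<Rightarrow> 'a \<Rightarrow> real" where
  "capdens e \<kappa> x = (2 * \<kappa>) ^ (DIM('a) - 1) * (cfac e \<kappa> x ^ (DIM('a) - 2) / cfac e \<kappa> x)"

lemma borel_perp [measurable]: "perp e \<in> borel_measurable borel"
  using linear_perp[of e] by (intro borel_measurable_continuous_onI linear_continuous_on)
    (simp add: linear_conv_bounded_linear)

lemma borel_capratio [measurable]: "capratio e \<kappa> \<in> borel_measurable borel"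
  unfolding capratio_def[abs_def] by measurable

lemma borel_capmap_cone [measurable]: "capmap_cone e \<kappa> \<in> borel_measurable borel"
  unfolding capmap_cone_def[abs_def] by measurable

lemma borel_cfac [measurable]: "cfac e \<kappa> \<in> borel_measurable borel"
  unfolding cfac_def[abs_def] by measurable

lemma borel_capmap [measurable]: "capmap e \<kappa> \<in> borel_measurable borel"
  unfolding capmap_def[abs_def] by measurable

lemma borel_capdens [measurable]: "capdens e \<kappa> \<in> borel_measurable borel"
  unfolding capdens_def[abs_def] by measurable

lemma perp_scaleR: "perp e (c *\<^sub>R v) = c *\<^sub>R perp e v"
  by (rule linear_cmul[OF linear_perp])

context
  fixes e :: "'a :: euclidean_space" and \<kappa> :: real
  assumes e: "norm e = 1" and \<kappa>: "0 < \<kappa>" "\<kappa> < 1"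
begin

lemma capratio_radial:
  assumes "v \<noteq> 0"
  shows "capratio e \<kappa> v = \<kappa>\<^sup>2 * (norm (perp e (v /\<^sub>R norm v)))\<^sup>2"
  using assms by (simp add: capratio_def perp_scaleR power_mult_distrib dot_square_norm divide_inverse power_inverse)

lemma cfac_radial:
  assumes "v \<noteq> 0"
  shows "cfac e \<kappa> (v /\<^sub>R norm v) = sqrt (1 - capratio e \<kappa> v)"
  using capratio_radial[OF assms] by (simp add: cfac_def)

lemma capmap_cone_radial:
  assumes "v \<noteq> 0"
  shows "capmap_cone e \<kappa> v = norm v *\<^sub>R capmap e \<kappa> (v /\<^sub>R norm v)"
  using assms
  unfolding capmap_cone_def capmap_def cfac_radial[OF assms] mult.assoc capratio_radial[OF assms, symmetric]
  by (simp add: perp_scaleR scaleR_add_right)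

lemma capratio_lt:
  assumes "v \<noteq> 0"
  shows "0 < 1 - capratio e \<kappa> v"
  using cfac_arg[OF e \<kappa>, of "v /\<^sub>R norm v"] kappa_sq[OF e \<kappa>] assms by (simp add: capratio_radial)

lemma norm_capmap_cone: "norm (capmap_cone e \<kappa> v) = norm v"
proof (cases "v = 0")
  case True
  then show ?thesis by (simp add: capmap_cone_def perp_def)
next
  case False
  then show ?thesis using norm_capmap[OF e \<kappa>, of "v /\<^sub>R norm v"] by (simp add: capmap_cone_radial)
qed

lemma capmap_cone_has_derivative:
  assumes v: "v \<noteq> 0"
  shows "(capmap_cone e \<kappa> has_derivative capmap_cone_deriv e \<kappa> v) (at v within S)"
proof -
  define r where "r = norm v"
  define p where "p = perp e v"
  define t where "t = capratio e \<kappa> v"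
  define c where "c = sqrt (1 - t)"
  define \<tau> where "\<tau> = (2 / r\<^sup>2) *\<^sub>R (\<kappa>\<^sup>2 *\<^sub>R p - t *\<^sub>R v)"
  have r: "r \<noteq> 0" using v by (simp add: r_def)
  have c: "0 < c" using capratio_lt[OF v] by (simp add: c_def t_def)
  have dr: "(norm has_derivative (\<lambda>w. v \<bullet> w / r)) (at v within S)"
    using has_derivative_at_withinI[OF has_derivative_norm[OF v]]
    by (rule has_derivative_eq_rhs) (auto simp: fun_eq_iff sgn_div_norm r_def inner_commute divide_inverse)
  have dp: "(perp e has_derivative perp e) (at v within S)"
    using linear_perp[of e] by (intro bounded_linear_imp_has_derivative) (simp add: linear_conv_bounded_linear)
  have dq: "((\<lambda>v. perp e v \<bullet> perp e v) has_derivative (\<lambda>w. 2 * (p \<bullet> w))) (at v within S)"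
    by (rule has_derivative_eq_rhs[OF has_derivative_inner[OF dp dp]])
      (auto simp: fun_eq_iff p_def inner_commute[of _ "perp e v"] simp flip: inner_perp[OF e])
  have tr: "t * r\<^sup>2 = \<kappa>\<^sup>2 * (p \<bullet> p)" using r by (simp add: t_def capratio_def r_def p_def)
  have dt: "(capratio e \<kappa> has_derivative (\<lambda>w. \<tau> \<bullet> w)) (at v within S)"
  proof -
    have "((\<lambda>v. \<kappa>\<^sup>2 * (perp e v \<bullet> perp e v) / (norm v)\<^sup>2) has_derivative
      (\<lambda>w. - (\<kappa>\<^sup>2 * (p \<bullet> p)) * (inverse (r\<^sup>2) * (2 * r * (v \<bullet> w / r)) * inverse (r\<^sup>2)) + \<kappa>\<^sup>2 * (2 * (p \<bullet> w)) / r\<^sup>2))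
      (at v within S)"
      unfolding r_def p_def
      by (rule has_derivative_divide[where f = "\<lambda>v. \<kappa>\<^sup>2 * (perp e v \<bullet> perp e v)" and g = "\<lambda>v. (norm v)\<^sup>2",
          OF has_derivative_mult_right[OF dq[unfolded p_def]] has_derivative_eq_rhs[OF has_derivative_power[OF dr[unfolded r_def], of 2]], THEN has_derivative_eq_rhs])
        (use v in auto)
    then show ?thesis
      unfolding capratio_def[abs_def]
    proof (rule has_derivative_eq_rhs, intro ext)
      fix w
      show "- (\<kappa>\<^sup>2 * (p \<bullet> p)) * (inverse (r\<^sup>2) * (2 * r * (v \<bullet> w / r)) * inverse (r\<^sup>2)) + \<kappa>\<^sup>2 * (2 * (p \<bullet> w)) / r\<^sup>2
          = \<tau> \<bullet> w"
        unfolding tr[symmetric] using r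
        by (simp add: \<tau>_def inner_diff_left field_simps power2_eq_square)
    qed
  qed
  have dc: "((\<lambda>v. sqrt (1 - capratio e \<kappa> v)) has_derivative (\<lambda>w. - (\<tau> \<bullet> w) / (2 * c))) (at v within S)"
  proof -
    have "DERIV sqrt (1 - capratio e \<kappa> v) :> inverse c / 2"
      using DERIV_real_sqrt[OF capratio_lt[OF v]] by (simp add: c_def t_def)
    from DERIV_compose_FDERIV[OF this has_derivative_diff[OF has_derivative_const dt]]
    show ?thesis by (rule has_derivative_eq_rhs) (auto simp: fun_eq_iff field_simps)
  qed
  have "(capmap_cone e \<kappa> has_derivative (\<lambda>w.
      (r * - (2 * (\<tau> \<bullet> w)) + (v \<bullet> w / r) * (1 - 2 * t)) *\<^sub>R e
      + ((2 * \<kappa> * c) *\<^sub>R perp e w + (2 * \<kappa> * (- (\<tau> \<bullet> w) / (2 * c))) *\<^sub>R p))) (at v within S)"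
    unfolding capmap_cone_def[abs_def]
    by (rule has_derivative_eq_rhs,
        rule has_derivative_add[OF has_derivative_scaleR[OF has_derivative_mult[OF dr
          has_derivative_diff[OF has_derivative_const has_derivative_mult_right[OF dt]]] has_derivative_const]
          has_derivative_scaleR[OF has_derivative_mult_right[OF dc] dp]])
      (auto simp: fun_eq_iff r_def t_def c_def p_def)
  \<comment> \<open>Substituting \<open>perp e w = w - (w \<bullet> e) *\<^sub>R e\<close> turns the
    term along \<open>perp e w\<close> into the multiple of the identity and one more term along
    \<open>e\<close>.\<close>
  then show ?thesis
  proof (rule has_derivative_eq_rhs, intro ext)
    fix w
    have "capmap_cone_deriv e \<kappa> v w = (2 * \<kappa> * c) *\<^sub>R w
        + ((((1 - 2 * t) / r) *\<^sub>R v - (2 * r) *\<^sub>R \<tau> - (2 * \<kappa> * c) *\<^sub>R e) \<bullet> w) *\<^sub>R e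
        + ((- (\<kappa> / c) *\<^sub>R \<tau>) \<bullet> w) *\<^sub>R p"
      unfolding capmap_cone_deriv_def Let_def r_def t_def c_def p_def \<tau>_def ..
    then show "(r * - (2 * (\<tau> \<bullet> w)) + (v \<bullet> w / r) * (1 - 2 * t)) *\<^sub>R e
      + ((2 * \<kappa> * c) *\<^sub>R perp e w + (2 * \<kappa> * (- (\<tau> \<bullet> w) / (2 * c))) *\<^sub>R p) = capmap_cone_deriv e \<kappa> v w"
      by (simp add: perp_def[of e w] inner_diff_left inner_commute[of e w] algebra_simps diff_divide_distrib)
  qed
qed

end

text \<open>\<open>C\<close> is the cosine of the angle between \<open>v\<close> and
  \<open>e\<close>. In the rank two formula all terms in \<open>t\<close> and
  \<open>C\<^sup>2\<close> cancel, leaving powers of \<kappa> and \<open>c\<close> and a single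
  factor \<open>C\<close>.\<close>

lemma det_capmap_cone_deriv:
  fixes e :: "real ^ 'm"
  assumes e: "norm e = 1" and \<kappa>: "0 < \<kappa>" "\<kappa> < 1" and n: "2 \<le> CARD('m)" and v: "v \<noteq> 0"
  shows "det (matrix (capmap_cone_deriv e \<kappa> v)) = capdens e \<kappa> (v /\<^sub>R norm v) * ((v \<bullet> e) / norm v)"
proof -
  define r where "r = norm v"
  define p where "p = perp e v"
  define t where "t = capratio e \<kappa> v"
  define c where "c = sqrt (1 - t)"
  define \<tau> where "\<tau> = (2 / r\<^sup>2) *\<^sub>R (\<kappa>\<^sup>2 *\<^sub>R p - t *\<^sub>R v)"
  define l where "l = 2 * \<kappa> * c"
  define \<alpha> where "\<alpha> = ((1 - 2 * t) / r) *\<^sub>R v - (2 * r) *\<^sub>R \<tau> - l *\<^sub>R e"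
  define \<beta> where "\<beta> = - (\<kappa> / c) *\<^sub>R \<tau>"
  define z where "z = v \<bullet> e"
  have r: "0 < r" using v by (simp add: r_def)
  have t1: "0 < 1 - t" using capratio_lt[OF e \<kappa> v] by (simp add: t_def)
  have c: "0 < c" "c * c = 1 - t" using t1 by (simp_all add: c_def)
  have l: "l \<noteq> 0" using c \<kappa> by (simp add: l_def)
  have t0: "0 \<le> t" by (simp add: t_def capratio_def)
  have pv: "p \<bullet> v = p \<bullet> p" unfolding p_def by (rule inner_perp[OF e])
  have pe: "p \<bullet> e = 0" by (simp add: p_def inner_perp_left[OF e])
  have pp: "p \<bullet> p = r\<^sup>2 - z\<^sup>2"
    using norm_perp_power2[OF e, of v] by (simp add: p_def r_def z_def power2_norm_eq_inner)
  have tr: "\<kappa>\<^sup>2 * (p \<bullet> p) = t * r\<^sup>2" using r by (simp add: t_def capratio_def r_def p_def)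
  define C where "C = z / r"
  have z: "z = C * r" using r by (simp add: C_def)
  have ee: "e \<bullet> e = 1" using e by (simp add: dot_square_norm)
  have te: "\<tau> \<bullet> e = - (2 * t * C / r)"
    using r by (simp add: \<tau>_def inner_diff_left pe z_def[symmetric] z power2_eq_square)
  have tp: "\<tau> \<bullet> p = 2 * t * C\<^sup>2"
  proof -
    have "\<tau> \<bullet> p = (2 / r\<^sup>2) * (\<kappa>\<^sup>2 * (p \<bullet> p) - t * (p \<bullet> p))"
      by (simp add: \<tau>_def inner_diff_left inner_commute[of v p] pv)
    also have "\<dots> = (2 / r\<^sup>2) * (t * r\<^sup>2 - t * (r\<^sup>2 - (C * r)\<^sup>2))" unfolding tr unfolding pp z ..
    also have "\<dots> = 2 * t * C\<^sup>2" using r by (simp add: right_diff_distrib power_mult_distrib)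
    finally show ?thesis .
  qed
  have a: "l + \<alpha> \<bullet> e = (1 + 2 * t) * C"
    using r by (simp add: \<alpha>_def inner_diff_left te ee z_def[symmetric] z algebra_simps diff_divide_distrib)
  have vp: "v \<bullet> p = r\<^sup>2 * (1 - C\<^sup>2)"
    by (simp add: inner_commute[of v p] pv pp z power_mult_distrib algebra_simps)
  have ap: "\<alpha> \<bullet> p = r * ((1 - 2 * t) * (1 - C\<^sup>2) - 4 * t * C\<^sup>2)"
    using r by (simp add: \<alpha>_def inner_diff_left tp vp inner_commute[of e p] pe power2_eq_square algebra_simps diff_divide_distrib)
  have bp: "l + \<beta> \<bullet> p = (2 * \<kappa> / c) * (1 - t - t * C\<^sup>2)"
  proof -
    have "l = (2 * \<kappa> / c) * (c * c)" using c(1) by (simp add: l_def)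
    then have "l = (2 * \<kappa> / c) * (1 - t)" by (simp only: c(2))
    then show ?thesis by (simp add: \<beta>_def tp algebra_simps diff_divide_distrib)
  qed
  have be: "\<beta> \<bullet> e = (2 * \<kappa> / c) * (t * C / r)" by (simp add: \<beta>_def te)
  have D: "capmap_cone_deriv e \<kappa> v = (\<lambda>w. l *\<^sub>R w + (\<alpha> \<bullet> w) *\<^sub>R e + (\<beta> \<bullet> w) *\<^sub>R p)"
    unfolding fun_eq_iff capmap_cone_deriv_def Let_def l_def \<alpha>_def \<beta>_def \<tau>_def r_def t_def c_def p_def by (intro allI refl)
  have dens: "capdens e \<kappa> (v /\<^sub>R norm v) = (2 * \<kappa>) ^ (CARD('m) - 1) * (c ^ (CARD('m) - 2) / c)"
    by (simp add: capdens_def cfac_radial[OF e \<kappa> v] c_def t_def)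
  have "det (matrix (capmap_cone_deriv e \<kappa> v)) = (2 * \<kappa>) ^ (CARD('m) - 1) * (c ^ (CARD('m) - 2) / c) * C"
  proof (cases "C = 0")
    case True
    have "capmap_cone_deriv e \<kappa> v e = (l + \<alpha> \<bullet> e) *\<^sub>R e + (\<beta> \<bullet> e) *\<^sub>R p" by (simp add: D algebra_simps)
    also have "\<dots> = 0" by (simp add: a be True)
    finally have z0: "capmap_cone_deriv e \<kappa> v e = 0" .
    have lin: "linear (capmap_cone_deriv e \<kappa> v)"
      unfolding D by (auto intro!: linearI simp: inner_add_right algebra_simps)
    have "\<not> inj (capmap_cone_deriv e \<kappa> v)"
      using z0 linear_0[OF lin] e by (metis injD norm_zero zero_neq_one)
    then have "det (matrix (capmap_cone_deriv e \<kappa> v)) = 0" using det_nz_iff_inj[OF lin] by simp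
    then show ?thesis using True by simp
  next
    case False
    have nz: "l + \<alpha> \<bullet> e \<noteq> 0" using False t0 by (simp add: a add_nonneg_eq_0_iff)
    have "det (matrix (capmap_cone_deriv e \<kappa> v)) = l ^ (CARD('m) - 2) *
        ((l + \<alpha> \<bullet> e) * (l + \<beta> \<bullet> p) - (\<alpha> \<bullet> p) * (\<beta> \<bullet> e))"
      unfolding D by (rule det_rank_two_update[OF l nz n])
    also have "(l + \<alpha> \<bullet> e) * (l + \<beta> \<bullet> p) - (\<alpha> \<bullet> p) * (\<beta> \<bullet> e) = (2 * \<kappa> / c) * C *
       ((1 + 2 * t) * (1 - t - t * C\<^sup>2) - ((1 - 2 * t) * (1 - C\<^sup>2) - 4 * t * C\<^sup>2) * t)"
    proof -
      have "(1 + 2 * t) * C * (K * (1 - t - t * C\<^sup>2)) - (r * X) * (K * (t * C / r))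
        = K * C * ((1 + 2 * t) * (1 - t - t * C\<^sup>2) - X * t)" for K X
        using r by (simp add: algebra_simps)
      then show ?thesis unfolding a ap bp be .
    qed
    also have "(1 + 2 * t) * (1 - t - t * C\<^sup>2) - ((1 - 2 * t) * (1 - C\<^sup>2) - 4 * t * C\<^sup>2) * t = 1"
      by (simp add: algebra_simps)
    also have "l ^ (CARD('m) - 2) * (2 * \<kappa> / c * C * 1) = ((2 * \<kappa>) ^ (CARD('m) - 2) * (2 * \<kappa>)) * (c ^ (CARD('m) - 2) / c) * C"
      by (simp add: l_def power_mult_distrib)
    also have "(2 * \<kappa>) ^ (CARD('m) - 2) * (2 * \<kappa>) = (2 * \<kappa>) ^ (CARD('m) - 1)"
    proof -
      obtain m where "CARD('m) = Suc (Suc m)" using n by (metis add_2_eq_Suc le_Suc_ex)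
      then show ?thesis by simp
    qed
    finally show ?thesis .
  qed
  then show ?thesis by (simp add: dens C_def z_def r_def)
qed

lemma capdens_nonneg: "0 < \<kappa> \<Longrightarrow> \<kappa> < 1 \<Longrightarrow> norm e = 1 \<Longrightarrow> norm x \<le> 1 \<Longrightarrow> 0 \<le> capdens e \<kappa> x"
  using cfac_bounds(3)[of e \<kappa> x] by (simp add: capdens_def)

context
  fixes e :: "real ^ 'm :: {finite, wellorder}" and \<kappa> :: real
  assumes e: "norm e = 1" and \<kappa>: "0 < \<kappa>" "\<kappa> < 1" and n: "2 \<le> CARD('m)"
begin

text \<open>Change of variables for \<open>capmap_cone\<close> on the upper half ball, where it is
  injective. As the map preserves norms and takes rays to rays, the image is the cone over the cap.
  Having the formula for every Borel set \<open>B\<close> identifies two measures, from which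
  \<open>integral_cap_wellorder\<close> obtains integrals.\<close>

lemma emeasure_capmap_cone:
  assumes B: "B \<in> sets borel"
  shows "emeasure lborel (B \<inter> {x \<in> ball 0 1 - {0}. (1 - 2 * \<kappa>\<^sup>2) * norm x \<le> x \<bullet> e}) =
    (\<integral>\<^sup>+v. ennreal (indicator {v \<in> ball 0 1 - {0}. 0 \<le> v \<bullet> e} v * (capdens e \<kappa> (v /\<^sub>R norm v) * ((v \<bullet> e) / norm v)))
      * indicator (capmap_cone e \<kappa> -` B) v \<partial>lborel)"
proof -
  define K where "K = {x \<in> ball 0 1 - {0}. (1 - 2 * \<kappa>\<^sup>2) * norm x \<le> x \<bullet> e}"
  define H where "H = {v \<in> ball 0 1 - {0}. 0 \<le> v \<bullet> e}"
  define G where "G = capmap_cone e \<kappa>"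
  define S where "S = H \<inter> G -` B"
  have Gm: "G \<in> borel_measurable borel" unfolding G_def by measurable
  have GB: "G -` B \<in> sets borel" using measurable_sets[OF Gm B] by simp
  have "closed {v :: (real, 'm) vec. 0 \<le> v \<bullet> e}" by (intro closed_Collect_le continuous_intros)
  moreover have "H = (ball 0 1 - {0}) \<inter> {v. 0 \<le> v \<bullet> e}" by (auto simp: H_def)
  ultimately have Hb: "H \<in> sets borel" by auto
  have "closed {x :: (real, 'm) vec. (1 - 2 * \<kappa>\<^sup>2) * norm x \<le> x \<bullet> e}" by (intro closed_Collect_le continuous_intros)
  moreover have "K = (ball 0 1 - {0}) \<inter> {x. (1 - 2 * \<kappa>\<^sup>2) * norm x \<le> x \<bullet> e}" by (auto simp: K_def)
  ultimately have Kb: "K \<in> sets borel" by auto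
  have S: "S \<in> sets lebesgue" unfolding S_def using Hb GB by auto
  have radial_e: "(v /\<^sub>R norm v) \<bullet> e = (v \<bullet> e) / norm v" for v by (simp add: divide_inverse mult.commute)
  have inj: "inj_on G S"
  proof (rule inj_onI)
    fix v w assume vw: "v \<in> S" "w \<in> S" "G v = G w"
    then have nz: "v \<noteq> 0" "w \<noteq> 0" by (auto simp: S_def H_def)
    have eqn: "norm v = norm w" using norm_capmap_cone[OF e \<kappa>] vw(3) unfolding G_def by metis
    then have eqc: "capmap e \<kappa> (v /\<^sub>R norm v) = capmap e \<kappa> (w /\<^sub>R norm w)"
      using vw(3) nz by (simp add: G_def capmap_cone_radial[OF e \<kappa>])
    have "0 \<le> (v /\<^sub>R norm v) \<bullet> e" "0 \<le> (w /\<^sub>R norm w) \<bullet> e"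
      using vw(1,2) by (auto simp: radial_e S_def H_def)
    moreover have "norm (v /\<^sub>R norm v) = 1" "norm (w /\<^sub>R norm w) = 1" using nz by auto
    ultimately have "v /\<^sub>R norm v = w /\<^sub>R norm w" using capmap_inj[OF e \<kappa> _ _ _ _ eqc] by blast
    then have "norm v *\<^sub>R (v /\<^sub>R norm v) = norm w *\<^sub>R (w /\<^sub>R norm w)" using eqn by simp
    then show "v = w" using nz by simp
  qed
  have im: "G ` S = B \<inter> K"
  proof
    show "G ` S \<subseteq> B \<inter> K"
    proof (rule image_subsetI)
      fix v assume v: "v \<in> S"
      then have nz: "v \<noteq> 0" by (auto simp: S_def H_def)
      have "(1 - 2 * \<kappa>\<^sup>2) * norm v \<le> (capmap e \<kappa> (v /\<^sub>R norm v) \<bullet> e) * norm v"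
        using nz by (intro mult_right_mono capmap_in_cap[OF e \<kappa>]) auto
      then have "(1 - 2 * \<kappa>\<^sup>2) * norm (G v) \<le> G v \<bullet> e"
        using nz by (simp add: G_def norm_capmap_cone[OF e \<kappa>]) (simp add: capmap_cone_radial[OF e \<kappa>] mult.commute)
      moreover have "norm (G v) = norm v" by (simp add: G_def norm_capmap_cone[OF e \<kappa>])
      ultimately show "G v \<in> B \<inter> K" using v nz by (auto simp: K_def S_def H_def)
    qed
    show "B \<inter> K \<subseteq> G ` S"
    proof
      fix x assume x: "x \<in> B \<inter> K"
      then have nz: "x \<noteq> 0" by (auto simp: K_def)
      have "norm (x /\<^sub>R norm x) = 1" "1 - 2 * \<kappa>\<^sup>2 \<le> (x /\<^sub>R norm x) \<bullet> e"
        unfolding radial_e using x nz by (auto simp: K_def pos_le_divide_eq)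
      from capmap_surj[OF e \<kappa> this] obtain y where y: "norm y = 1" "0 \<le> y \<bullet> e" "capmap e \<kappa> y = x /\<^sub>R norm x" by blast
      define v where "v = norm x *\<^sub>R y"
      have nv: "norm v = norm x" "v \<noteq> 0" "v /\<^sub>R norm v = y" using y nz by (auto simp: v_def)
      have "G v = x" unfolding G_def capmap_cone_radial[OF e \<kappa> nv(2)] nv(3) y(3) using nz nv(1) by simp
      moreover have "v \<in> H" using x nv y by (auto simp: H_def K_def v_def)
      ultimately show "x \<in> G ` S" using x by (auto simp: S_def)
    qed
  qed
  have BK: "B \<inter> K \<in> sets borel" using B Kb by auto
  have fm: "B \<inter> K \<in> fmeasurable lborel"
    by (rule fmeasurableI2[OF fmeasurableI[OF _ emeasure_lborel_ball_finite, of 0 1]]) (use BK in \<open>auto simp: K_def\<close>)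
  have lm: "G ` S \<in> lmeasurable" unfolding im
    by (rule bounded_set_imp_lmeasurable) (use BK in \<open>auto simp: K_def intro: bounded_subset[OF bounded_ball[of 0 1]]\<close>)
  have der: "(G has_derivative capmap_cone_deriv e \<kappa> x) (at x within S)" if "x \<in> S" for x
    using that capmap_cone_has_derivative[OF e \<kappa>, of x S] by (auto simp: G_def S_def H_def)
  have hi: "((\<lambda>x. \<bar>det (matrix (capmap_cone_deriv e \<kappa> x))\<bar>) has_integral measure lebesgue (G ` S)) S"
    using has_measure_differentiable_image[OF S der inj] lm by blast
  have "emeasure lborel (B \<inter> K) = ennreal (measure lborel (B \<inter> K))"
    using fmeasurableD2[OF fm] by (simp add: emeasure_eq_ennreal_measure)
  also have "measure lborel (B \<inter> K) = measure lebesgue (G ` S)"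
    using BK by (simp add: im)
  also have "ennreal \<dots> = (\<integral>\<^sup>+v. ennreal \<bar>det (matrix (capmap_cone_deriv e \<kappa> v))\<bar> * indicator S v \<partial>lborel)"
    by (rule nn_integral_has_integral_lebesgue'[OF _ hi, symmetric]) simp
  also have "\<dots> = (\<integral>\<^sup>+v. ennreal (indicator H v * (capdens e \<kappa> (v /\<^sub>R norm v) * ((v \<bullet> e) / norm v)))
      * indicator (G -` B) v \<partial>lborel)"
  proof (rule nn_integral_cong)
    fix v :: "(real, 'm) vec"
    show "ennreal \<bar>det (matrix (capmap_cone_deriv e \<kappa> v))\<bar> * indicator S v =
      ennreal (indicator H v * (capdens e \<kappa> (v /\<^sub>R norm v) * ((v \<bullet> e) / norm v))) * indicator (G -` B) v"
    proof (cases "v \<in> S")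
      case True
      then have v: "v \<noteq> 0" "v \<in> H" "v \<in> G -` B" "0 \<le> v \<bullet> e" by (auto simp: S_def H_def)
      have "0 \<le> capdens e \<kappa> (v /\<^sub>R norm v) * ((v \<bullet> e) / norm v)"
        using v capdens_nonneg[OF \<kappa> e, of "v /\<^sub>R norm v"] by simp
      then have "\<bar>det (matrix (capmap_cone_deriv e \<kappa> v))\<bar> = capdens e \<kappa> (v /\<^sub>R norm v) * ((v \<bullet> e) / norm v)"
        unfolding det_capmap_cone_deriv[OF e \<kappa> n v(1)] by (rule abs_of_nonneg)
      then show ?thesis using True v by simp
    next
      case False
      then show ?thesis by (auto simp: S_def indicator_def)
    qed
  qed
  finally show ?thesis by (simp only: K_def H_def G_def)
qed

lemma integral_cap_wellorder:
  assumes f: "f \<in> borel_measurable borel"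
  shows "(LINT y|surface_measure. indicator {y. 1 - 2 * \<kappa>\<^sup>2 \<le> y \<bullet> e} y * f y) =
    (LINT x|surface_measure. indicator {x. 0 \<le> x \<bullet> e} x * (capdens e \<kappa> x * (x \<bullet> e) * f (capmap e \<kappa> x)) :: real)"
proof -
  define K where "K = {x \<in> ball 0 1 - {0}. (1 - 2 * \<kappa>\<^sup>2) * norm x \<le> x \<bullet> e}"
  define H where "H = {v \<in> ball 0 1 - {0}. 0 \<le> v \<bullet> e}"
  define G where "G = capmap_cone e \<kappa>"
  define D where "D v = indicator H v * (capdens e \<kappa> (v /\<^sub>R norm v) * ((v \<bullet> e) / norm v))" for v
  define \<phi> where "\<phi> x = f (x /\<^sub>R norm x)" for x
  have Gm: "G \<in> borel_measurable borel" unfolding G_def by measurable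
  have \<phi>: "\<phi> \<in> borel_measurable borel" unfolding \<phi>_def by (rule measurable_compose[OF radial_measurable f])
  have c1: "{v :: (real, 'm) vec. 0 \<le> v \<bullet> e} \<in> sets borel" by (intro borel_closed closed_Collect_le continuous_intros)
  have c2: "{x :: (real, 'm) vec. (1 - 2 * \<kappa>\<^sup>2) * norm x \<le> x \<bullet> e} \<in> sets borel" by (intro borel_closed closed_Collect_le continuous_intros)
  have c3: "{x :: (real, 'm) vec. (1 - 2 * \<kappa>\<^sup>2) \<le> x \<bullet> e} \<in> sets borel" by (intro borel_closed closed_Collect_le continuous_intros)
  have "H = (ball 0 1 - {0}) \<inter> {v. 0 \<le> v \<bullet> e}" by (auto simp: H_def)
  then have Hb: "H \<in> sets borel" using c1 by auto
  have "K = (ball 0 1 - {0}) \<inter> {x. (1 - 2 * \<kappa>\<^sup>2) * norm x \<le> x \<bullet> e}" by (auto simp: K_def)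
  then have Kb: "K \<in> sets borel" using c2 by auto
  have D: "D \<in> borel_measurable borel"
    unfolding D_def
    by (intro borel_measurable_times borel_measurable_divide borel_measurable_indicator Hb
        measurable_compose[OF radial_measurable borel_capdens] borel_measurable_inner borel_measurable_norm) auto
  have D0: "0 \<le> D v" for v
    using capdens_nonneg[OF \<kappa> e, of "v /\<^sub>R norm v"] by (auto simp: D_def H_def indicator_def)
  have radial_e: "(v /\<^sub>R norm v) \<bullet> e = (v \<bullet> e) / norm v" for v by (simp add: divide_inverse mult.commute)
  have eqM: "density lborel (\<lambda>x. ennreal (indicator K x)) = distr (density lborel (\<lambda>v. ennreal (D v))) borel G"
  proof (rule measure_eqI)
    fix B assume "B \<in> sets (density lborel (\<lambda>x. ennreal (indicator K x)))"
    then have B: "B \<in> sets borel" by simp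
    have "emeasure (density lborel (\<lambda>x. ennreal (indicator K x))) B = (\<integral>\<^sup>+x. indicator (B \<inter> K) x \<partial>lborel)"
    proof -
      have "emeasure (density lborel (\<lambda>x. ennreal (indicator K x))) B
          = (\<integral>\<^sup>+x. ennreal (indicator K x) * indicator B x \<partial>lborel)"
        by (rule emeasure_density) (use B Kb in auto)
      also have "\<dots> = (\<integral>\<^sup>+x. indicator (B \<inter> K) x \<partial>lborel)"
        by (rule nn_integral_cong) (auto simp: indicator_def)
      finally show ?thesis .
    qed
    also have "\<dots> = emeasure lborel (B \<inter> K)" by (rule nn_integral_indicator) (use B Kb in auto)
    also have "\<dots> = (\<integral>\<^sup>+v. ennreal (D v) * indicator (G -` B) v \<partial>lborel)"
      unfolding K_def by (subst emeasure_capmap_cone[OF B]) (simp only: D_def H_def G_def)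
    also have "\<dots> = emeasure (distr (density lborel (\<lambda>v. ennreal (D v))) borel G) B"
      using B Gm D measurable_sets[OF Gm B] by (simp add: emeasure_distr emeasure_density)
    finally show "emeasure (density lborel (\<lambda>x. ennreal (indicator K x))) B
      = emeasure (distr (density lborel (\<lambda>v. ennreal (D v))) borel G) B" .
  qed simp
  have "(LINT x|lborel. indicator K x * \<phi> x) = (LINT x|density lborel (\<lambda>x. ennreal (indicator K x)). \<phi> x)"
    using Kb \<phi> by (subst integral_density) auto
  also have "\<dots> = (LINT v|density lborel (\<lambda>v. ennreal (D v)). \<phi> (G v))"
    unfolding eqM using Gm \<phi> by (subst integral_distr) auto
  also have "\<dots> = (LINT v|lborel. D v * \<phi> (G v))"
    using Gm \<phi> D D0 by (subst integral_density) auto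
  finally have main: "(LINT x|lborel. indicator K x * \<phi> x) = (LINT v|lborel. D v * \<phi> (G v))" .
  have "(LINT y|surface_measure. indicator {y. 1 - 2 * \<kappa>\<^sup>2 \<le> y \<bullet> e} y * f y)
     = real CARD('m) * (LINT x|lborel. indicator K x * \<phi> x)"
  proof (subst integral_surface)
    show "(\<lambda>y. indicator {y. 1 - 2 * \<kappa>\<^sup>2 \<le> y \<bullet> e} y * f y) \<in> borel_measurable borel"
      using c3 f by (intro borel_measurable_times borel_measurable_indicator) auto
    have "indicator (ball 0 1 - {0}) v * (indicator {y. 1 - 2 * \<kappa>\<^sup>2 \<le> y \<bullet> e} (v /\<^sub>R norm v) * f (v /\<^sub>R norm v))
        = indicator K v * \<phi> v" for v
    proof (cases "v = 0")
      case False
      then have "1 - 2 * \<kappa>\<^sup>2 \<le> (v /\<^sub>R norm v) \<bullet> e \<longleftrightarrow> (1 - 2 * \<kappa>\<^sup>2) * norm v \<le> v \<bullet> e"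
        unfolding radial_e by (simp add: pos_le_divide_eq)
      then show ?thesis by (auto simp: K_def \<phi>_def indicator_def)
    qed (auto simp: K_def)
    then show "real CARD('m) * (LINT v|lborel. indicator (ball 0 1 - {0}) v *
        (indicator {y. 1 - 2 * \<kappa>\<^sup>2 \<le> y \<bullet> e} (v /\<^sub>R norm v) * f (v /\<^sub>R norm v))) =
        real CARD('m) * (LINT x|lborel. indicator K x * \<phi> x)" by simp
  qed
  moreover have "(LINT x|surface_measure. indicator {x. 0 \<le> x \<bullet> e} x * (capdens e \<kappa> x * (x \<bullet> e) * f (capmap e \<kappa> x)))
     = real CARD('m) * (LINT v|lborel. D v * \<phi> (G v))"
  proof (subst integral_surface)
    show "(\<lambda>x. indicator {x. 0 \<le> x \<bullet> e} x * (capdens e \<kappa> x * (x \<bullet> e) * f (capmap e \<kappa> x))) \<in> borel_measurable borel"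
      using c1 by (intro borel_measurable_times borel_measurable_indicator borel_capdens
          measurable_compose[OF borel_capmap f] borel_measurable_inner) auto
    have "indicator (ball 0 1 - {0}) v * (indicator {x. 0 \<le> x \<bullet> e} (v /\<^sub>R norm v) *
        (capdens e \<kappa> (v /\<^sub>R norm v) * ((v /\<^sub>R norm v) \<bullet> e) * f (capmap e \<kappa> (v /\<^sub>R norm v)))) = D v * \<phi> (G v)" for v
    proof (cases "v = 0")
      case False
      then have "0 \<le> (v /\<^sub>R norm v) \<bullet> e \<longleftrightarrow> 0 \<le> v \<bullet> e"
        unfolding radial_e by (simp add: zero_le_divide_iff)
      moreover have "\<phi> (G v) = f (capmap e \<kappa> (v /\<^sub>R norm v))"
        using False by (simp add: \<phi>_def G_def norm_capmap_cone[OF e \<kappa>]) (simp add: capmap_cone_radial[OF e \<kappa>])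
      ultimately show ?thesis by (auto simp: D_def H_def indicator_def divide_inverse)
    qed (auto simp: D_def H_def)
    then show "real CARD('m) * (LINT v|lborel. indicator (ball 0 1 - {0}) v * (indicator {x. 0 \<le> x \<bullet> e} (v /\<^sub>R norm v) *
        (capdens e \<kappa> (v /\<^sub>R norm v) * ((v /\<^sub>R norm v) \<bullet> e) * f (capmap e \<kappa> (v /\<^sub>R norm v))))) =
        real CARD('m) * (LINT v|lborel. D v * \<phi> (G v))" by simp
  qed
  ultimately show ?thesis using main by simp
qed

end

section \<open>Reflection in the equator: from the hemisphere to the whole sphere\<close>

definition reflect :: "'a :: euclidean_space \<Rightarrow> 'a \<Rightarrow> 'a" where
  "reflect e x = x - (2 * (x \<bullet> e)) *\<^sub>R e"

lemma linear_reflect: "linear (reflect e)"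
  by (rule linearI) (auto simp: reflect_def inner_add_left algebra_simps)

context
  fixes e :: "'a :: euclidean_space"
  assumes e: "norm e = 1"
begin

lemma reflect_inner_e: "reflect e x \<bullet> e = - (x \<bullet> e)"
  using e by (simp add: reflect_def inner_diff_left dot_square_norm)

lemma perp_reflect: "perp e (reflect e x) = perp e x"
  unfolding perp_def reflect_inner_e by (simp add: reflect_def algebra_simps flip: scaleR_add_left)

lemma orthogonal_reflect: "orthogonal_transformation (reflect e)"
  unfolding orthogonal_transformation_def
proof (intro conjI linear_reflect allI)
  fix x y
  have "e \<bullet> e = 1" using e by (simp add: dot_square_norm)
  then show "reflect e x \<bullet> reflect e y = x \<bullet> y"
    by (simp add: reflect_def inner_diff_left inner_diff_right inner_commute[of e y] algebra_simps)
qed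

lemma norm_reflect: "norm (reflect e x) = norm x"
  using orthogonal_reflect by (simp add: orthogonal_transformation)

lemma cfac_reflect: "cfac e \<kappa> (reflect e x) = cfac e \<kappa> x"
  by (simp add: cfac_def perp_reflect)

lemma capmap_reflect: "capmap e \<kappa> (reflect e x) = capmap e \<kappa> x"
  by (simp add: capmap_def perp_reflect cfac_reflect)

lemma capdens_reflect: "capdens e \<kappa> (reflect e x) = capdens e \<kappa> x"
  by (simp add: capdens_def cfac_reflect)

end

text \<open>\<open>reflect\<close> exchanges the two closed hemispheres and leaves \<open>F\<close>
  unchanged. Their overlap, the equator, does no harm because the weight vanishes there.\<close>

lemma integral_hemisphere:
  fixes e :: "real ^ 'n" and F :: "real ^ 'n \<Rightarrow> real"
  assumes e: "norm e = 1" and F: "F \<in> borel_measurable borel"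
    and bd: "\<And>x. norm x = 1 \<Longrightarrow> \<bar>F x\<bar> \<le> C" and sym: "\<And>x. F (reflect e x) = F x"
  shows "(LINT x|surface_measure. \<bar>x \<bullet> e\<bar> * F x) = 2 * (LINT x|surface_measure. indicator {x. 0 \<le> x \<bullet> e} x * ((x \<bullet> e) * F x))"
proof -
  have c1: "{v :: real ^ 'n. 0 \<le> v \<bullet> e} \<in> sets borel" by (intro borel_closed closed_Collect_le continuous_intros)
  define h where "h x = indicator {x. 0 \<le> x \<bullet> e} x * ((x \<bullet> e) * F x)" for x
  have h: "h \<in> borel_measurable borel"
    unfolding h_def using c1 F by (intro borel_measurable_times borel_measurable_indicator borel_measurable_inner) auto
  have ie: "\<bar>x \<bullet> e\<bar> \<le> 1" if "norm x = 1" for x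
    using Cauchy_Schwarz_ineq2[of x e] e that by simp
  have hb: "\<bar>h x\<bar> \<le> 1 * (1 * C)" if "norm x = 1" for x
    unfolding h_def abs_mult using ie[OF that] bd[OF that] by (intro mult_mono) (auto simp: indicator_def)
  have hi: "integrable surface_measure h" by (rule integrable_surface_bounded[OF h hb])
  have R: "reflect e \<in> borel_measurable borel"
    using linear_reflect[of e] by (intro borel_measurable_continuous_onI linear_continuous_on)
      (simp add: linear_conv_bounded_linear)
  have hR: "(\<lambda>x. h (reflect e x)) \<in> borel_measurable borel" by (rule measurable_compose[OF R h])
  have hiR: "integrable surface_measure (\<lambda>x. h (reflect e x))"
    by (rule integrable_surface_bounded[OF hR, where C = "1 * (1 * C)"]) (use hb in \<open>simp add: norm_reflect[OF e]\<close>)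
  have "\<bar>x \<bullet> e\<bar> * F x = h x + h (reflect e x)" for x
    by (auto simp: h_def reflect_inner_e[OF e] sym indicator_def)
  then have "(LINT x|surface_measure. \<bar>x \<bullet> e\<bar> * F x) = (LINT x|surface_measure. h x) + (LINT x|surface_measure. h (reflect e x))"
    using hi hiR by simp
  also have "(LINT x|surface_measure. h (reflect e x)) = (LINT x|surface_measure. h x)"
    by (rule integral_surface_orthogonal[OF orthogonal_reflect[OF e] h])
  finally show ?thesis by (simp add: h_def)
qed

text \<open>All ingredients commute with the coordinate permutation \<open>\<psi>\<close>, so the
  formula is transferred from the well-ordered index type.\<close>

lemma integral_cap_hemisphere:
  fixes e :: "real ^ 'n" and f :: "real ^ 'n \<Rightarrow> real"
  assumes e: "norm e = 1" and \<kappa>: "0 < \<kappa>" "\<kappa> < 1" and n: "2 \<le> CARD('n)"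
    and f: "f \<in> borel_measurable borel"
  shows "(LINT y|surface_measure. indicator {y. 1 - 2 * \<kappa>\<^sup>2 \<le> y \<bullet> e} y * f y) =
    (LINT x|surface_measure. indicator {x. 0 \<le> x \<bullet> e} x * (capdens e \<kappa> x * (x \<bullet> e) * f (capmap e \<kappa> x)))"
proof -
  obtain \<phi> :: "real ^ 'n \<Rightarrow> real ^ 'n idx" and \<psi> where \<phi>: "linear \<phi>" "linear \<psi>" "\<And>x. \<psi> (\<phi> x) = x"
    "\<And>x. \<phi> (\<psi> x) = x" "\<And>x y. \<phi> x \<bullet> \<phi> y = x \<bullet> y" "\<And>x y. \<psi> x \<bullet> \<psi> y = x \<bullet> y"
    "distr lborel borel \<phi> = lborel" "distr lborel borel \<psi> = lborel"
    using wellorder_isometry by blast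
  define e' where "e' = \<phi> e"
  have e': "norm e' = 1" using e by (simp add: e'_def norm_eq_sqrt_inner \<phi>)
  have n': "2 \<le> CARD('n idx)" using n by (simp add: card_idx)
  have ps: "\<psi> x \<bullet> e = x \<bullet> e'" for x using \<phi>(6)[of x e'] by (simp add: e'_def \<phi>)
  have pe: "\<psi> e' = e" by (simp add: e'_def \<phi>)
  have perp: "perp e (\<psi> x) = \<psi> (perp e' x)" for x
    by (simp add: perp_def ps linear_diff[OF \<phi>(2)] linear_cmul[OF \<phi>(2)] pe)
  have np: "norm (\<psi> x) = norm x" for x by (simp add: norm_eq_sqrt_inner \<phi>)
  have cf: "cfac e \<kappa> (\<psi> x) = cfac e' \<kappa> x" for x by (simp add: cfac_def perp np)
  have cm: "capmap e \<kappa> (\<psi> x) = \<psi> (capmap e' \<kappa> x)" for x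
    by (simp add: capmap_def perp np cf linear_add[OF \<phi>(2)] linear_cmul[OF \<phi>(2)] pe)
  have cd: "capdens e \<kappa> (\<psi> x) = capdens e' \<kappa> x" for x by (simp add: capdens_def cf card_idx)
  have m: "\<psi> \<in> borel_measurable borel"
    using \<phi>(2) by (intro borel_measurable_continuous_onI linear_continuous_on) (simp add: linear_conv_bounded_linear)
  have c1: "{v :: real ^ 'n. 0 \<le> v \<bullet> e} \<in> sets borel" by (intro borel_closed closed_Collect_le continuous_intros)
  have c3: "{x :: real ^ 'n. (1 - 2 * \<kappa>\<^sup>2) \<le> x \<bullet> e} \<in> sets borel" by (intro borel_closed closed_Collect_le continuous_intros)
  have fp: "(\<lambda>x. f (\<psi> x)) \<in> borel_measurable borel" by (rule measurable_compose[OF m f])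
  note tr = integral_surface_transfer[OF \<phi>(2,6,8) _ card_idx]
  have "(LINT y|surface_measure. indicator {y. 1 - 2 * \<kappa>\<^sup>2 \<le> y \<bullet> e} y * f y)
    = (LINT y|surface_measure. indicator {y. 1 - 2 * \<kappa>\<^sup>2 \<le> y \<bullet> e} (\<psi> y) * f (\<psi> y))"
    by (rule tr) (use c3 f in \<open>intro borel_measurable_times borel_measurable_indicator\<close>)
  also have "\<dots> = (LINT y|surface_measure. indicator {y. 1 - 2 * \<kappa>\<^sup>2 \<le> y \<bullet> e'} y * f (\<psi> y))"
    by (simp add: indicator_def ps)
  also have "\<dots> = (LINT x|surface_measure. indicator {x. 0 \<le> x \<bullet> e'} x * (capdens e' \<kappa> x * (x \<bullet> e') * f (\<psi> (capmap e' \<kappa> x))))"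
    by (rule integral_cap_wellorder[OF e' \<kappa> n' fp])
  also have "\<dots> = (LINT x|surface_measure. indicator {x. 0 \<le> x \<bullet> e} (\<psi> x) *
      (capdens e \<kappa> (\<psi> x) * (\<psi> x \<bullet> e) * f (capmap e \<kappa> (\<psi> x))))"
    by (simp add: indicator_def ps cm cd)
  also have "\<dots> = (LINT x|surface_measure. indicator {x. 0 \<le> x \<bullet> e} x * (capdens e \<kappa> x * (x \<bullet> e) * f (capmap e \<kappa> x)))"
    by (rule tr[symmetric]) (use c1 f in \<open>intro borel_measurable_times borel_measurable_indicator borel_capdens
          measurable_compose[OF borel_capmap f] borel_measurable_inner; simp\<close>)
  finally show ?thesis .
qed

lemma capdens_le:
  assumes "norm e = 1" "0 < \<kappa>" "\<kappa> < 1" "norm x \<le> 1" "0 < m" "m \<le> sqrt (1 - \<kappa>\<^sup>2)"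
  shows "capdens e \<kappa> (x :: 'a :: euclidean_space) \<le> (2 * \<kappa>) ^ (DIM('a) - 1) / m"
    and "(2 * \<kappa>) ^ (DIM('a) - 1) * m ^ (DIM('a) - 2) \<le> capdens e \<kappa> x"
proof -
  define c where "c = cfac e \<kappa> x"
  have c: "m \<le> c" "c \<le> 1" "0 < c" using cfac_bounds[of e \<kappa> x] assms by (auto simp: c_def)
  have "c ^ (DIM('a) - 2) / c \<le> 1 / m" using c assms by (intro frac_le power_le_one) auto
  then have "(2 * \<kappa>) ^ (DIM('a) - 1) * (c ^ (DIM('a) - 2) / c) \<le> (2 * \<kappa>) ^ (DIM('a) - 1) * (1 / m)"
    using assms by (intro mult_left_mono) auto
  then show "capdens e \<kappa> x \<le> (2 * \<kappa>) ^ (DIM('a) - 1) / m" by (simp add: capdens_def c_def)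
  have "m ^ (DIM('a) - 2) * 1 \<le> c ^ (DIM('a) - 2) * (1 / c)"
    using c assms by (intro mult_mono power_mono) (auto simp: pos_le_divide_eq)
  then have "(2 * \<kappa>) ^ (DIM('a) - 1) * (m ^ (DIM('a) - 2) * 1) \<le> (2 * \<kappa>) ^ (DIM('a) - 1) * (c ^ (DIM('a) - 2) * (1 / c))"
    using assms by (intro mult_left_mono) auto
  then show "(2 * \<kappa>) ^ (DIM('a) - 1) * m ^ (DIM('a) - 2) \<le> capdens e \<kappa> x" by (simp add: capdens_def c_def)
qed

text \<open>\<open>capmap\<close> and \<open>capdens\<close> are even under \<open>reflect\<close>,
  so the integral over the hemisphere doubles to one over the whole sphere, on which rotations
  act.\<close>

lemma integral_cap:
  fixes e :: "real ^ 'n" and f :: "real ^ 'n \<Rightarrow> real"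
  assumes e: "norm e = 1" and \<kappa>: "0 < \<kappa>" "\<kappa> < 1" and n: "2 \<le> CARD('n)"
    and f: "f \<in> borel_measurable borel" and bd: "\<And>x. norm x = 1 \<Longrightarrow> \<bar>f x\<bar> \<le> C"
  shows "2 * (LINT y|surface_measure. indicator {y. 1 - 2 * \<kappa>\<^sup>2 \<le> y \<bullet> e} y * f y) =
    (LINT x|surface_measure. \<bar>x \<bullet> e\<bar> * (capdens e \<kappa> x * f (capmap e \<kappa> x)))"
proof -
  define M where "M = (2 * \<kappa>) ^ (CARD('n) - 1) / sqrt (1 - \<kappa>\<^sup>2)"
  have k: "0 < sqrt (1 - \<kappa>\<^sup>2)" using kappa_sq[OF e \<kappa>] by simp
  have "(LINT x|surface_measure. \<bar>x \<bullet> e\<bar> * (capdens e \<kappa> x * f (capmap e \<kappa> x))) =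
    2 * (LINT x|surface_measure. indicator {x. 0 \<le> x \<bullet> e} x * ((x \<bullet> e) * (capdens e \<kappa> x * f (capmap e \<kappa> x))))"
  proof (rule integral_hemisphere[OF e, where C = "M * C"])
    show "(\<lambda>x. capdens e \<kappa> x * f (capmap e \<kappa> x)) \<in> borel_measurable borel"
      by (intro borel_measurable_times borel_capdens measurable_compose[OF borel_capmap f])
    fix x :: "real ^ 'n"
    show "capdens e \<kappa> (reflect e x) * f (capmap e \<kappa> (reflect e x)) = capdens e \<kappa> x * f (capmap e \<kappa> x)"
      by (simp add: capdens_reflect[OF e] capmap_reflect[OF e])
    assume x: "norm x = 1"
    have "0 \<le> capdens e \<kappa> x" "capdens e \<kappa> x \<le> M"
      using capdens_nonneg[OF \<kappa> e, of x] capdens_le(1)[OF e \<kappa> _ k order_refl, of x] x by (auto simp: M_def)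
    then show "\<bar>capdens e \<kappa> x * f (capmap e \<kappa> x)\<bar> \<le> M * C"
      unfolding abs_mult using norm_capmap[OF e \<kappa>, of x] x by (intro mult_mono bd) auto
  qed
  then show ?thesis using integral_cap_hemisphere[OF e \<kappa> n f] by (simp add: mult_ac)
qed

subsection \<open>The metric of the cap\<close>

context
  fixes \<epsilon> :: real
  assumes eps: "0 < \<epsilon>" "\<epsilon> < 1"
begin

text \<open>One constant for the lower bounds on both functions:
  \<open>cap_lo * u \<le> sin u\<close> on [0, pi - \<epsilon>] and
  \<open>cap_lo \<le> cos u\<close> on [0, (pi - \<epsilon>) / 2]. The later constants depend on
  \<epsilon> through it.\<close>

definition cap_lo :: real where "cap_lo = sin (\<epsilon> / 2) / pi"

lemma cap_lo_pos: "0 < cap_lo"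
proof -
  have "0 < sin (\<epsilon> / 2)" by (rule sin_gt_zero) (use eps pi_gt3 in auto)
  then show ?thesis by (simp add: cap_lo_def)
qed

lemma cap_lo_le: "cap_lo \<le> 1"
proof -
  have "sin (\<epsilon> / 2) \<le> 1" by simp
  also have "1 \<le> pi" using pi_gt3 by simp
  finally show ?thesis by (simp add: cap_lo_def)
qed

lemma sin_abs_le: "sin \<bar>u\<bar> \<le> \<bar>sin u\<bar>" for u :: real
  by (cases "0 \<le> u") auto

lemma sin_lower:
  assumes "0 \<le> u" "u \<le> pi - \<epsilon>"
  shows "cap_lo * u \<le> sin u"
proof -
  have e: "\<epsilon> < pi" using eps pi_gt3 by linarith
  have "u / (pi - \<epsilon>) * sin (pi - \<epsilon>) \<le> sin u"
    using assms eps e by (intro sin_ge_chord) auto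
  moreover have "sin (\<epsilon> / 2) \<le> sin \<epsilon>"
    using eps pi_gt3 by (intro sin_monotone_2pi_le) auto
  moreover have "u / pi \<le> u / (pi - \<epsilon>)" using assms eps e by (intro divide_left_mono) auto
  ultimately have "u / pi * sin (\<epsilon> / 2) \<le> sin u"
    using assms eps e mult_mono[of "u / pi" "u / (pi - \<epsilon>)" "sin (\<epsilon> / 2)" "sin \<epsilon>"]
      sin_gt_zero[of "\<epsilon> / 2"] by auto
  then show ?thesis by (simp add: cap_lo_def mult.commute)
qed

lemma cos_lower:
  assumes "0 \<le> u" "u \<le> (pi - \<epsilon>) / 2"
  shows "cap_lo \<le> cos u"
proof -
  have "cos ((pi - \<epsilon>) / 2) \<le> cos u"
    using assms eps pi_gt3 by (intro cos_monotone_0_pi_le) auto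
  moreover have "cos ((pi - \<epsilon>) / 2) = sin (\<epsilon> / 2)"
    by (simp add: cos_sin_eq diff_divide_distrib)
  moreover have "sin (\<epsilon> / 2) / pi \<le> sin (\<epsilon> / 2)"
    using eps pi_gt3 sin_gt_zero[of "\<epsilon> / 2"] by (simp add: divide_le_eq)
  ultimately show ?thesis by (simp add: cap_lo_def)
qed

context
  fixes \<alpha> \<kappa> :: real
  assumes al: "0 < \<alpha>" "\<alpha> \<le> pi - \<epsilon>" and kap: "\<kappa> = sin (\<alpha> / 2)"
begin

lemma kappa_bounds: "\<alpha> / 4 \<le> \<kappa>" "\<kappa> \<le> \<alpha> / 2" "0 < \<kappa>" "\<kappa> < 1" "cap_lo \<le> sqrt (1 - \<kappa>\<^sup>2)"
proof -
  have "\<alpha> / 2 / (pi / 2) * sin (pi / 2) \<le> sin (\<alpha> / 2)"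
    using al eps by (intro sin_ge_chord) auto
  then have "\<alpha> / pi \<le> \<kappa>" by (simp add: kap)
  moreover have "\<alpha> / 4 \<le> \<alpha> / pi" using al pi_less_4 by (intro divide_left_mono) auto
  ultimately show 1: "\<alpha> / 4 \<le> \<kappa>" by linarith
  then show "0 < \<kappa>" using al by simp
  show "\<kappa> \<le> \<alpha> / 2" using al sin_x_le_x[of "\<alpha> / 2"] by (simp add: kap)
  have c: "cap_lo \<le> cos (\<alpha> / 2)" by (rule cos_lower) (use al in auto)
  have "1 - \<kappa>\<^sup>2 = (cos (\<alpha> / 2))\<^sup>2" by (simp add: kap cos_squared_eq)
  then have s: "sqrt (1 - \<kappa>\<^sup>2) = cos (\<alpha> / 2)" using c cap_lo_pos by simp
  then show "cap_lo \<le> sqrt (1 - \<kappa>\<^sup>2)" using c by simp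
  then have "0 < sqrt (1 - \<kappa>\<^sup>2)" using cap_lo_pos by linarith
  then have "\<kappa>\<^sup>2 < 1" by simp
  then show "\<kappa> < 1" using abs_square_less_1[of \<kappa>] by simp
qed

context
  fixes e :: "real ^ 'n"
  assumes e: "norm e = 1"
begin

definition cap_angle :: "real ^ 'n \<Rightarrow> real" where
  "cap_angle x = geod_dist (capmap e \<kappa> x) e"

lemma cap_angle:
  assumes x: "norm x = 1"
  shows "0 \<le> cap_angle x" "cap_angle x \<le> \<alpha>" "sin (cap_angle x / 2) = \<kappa> * norm (perp e x)"
proof -
  define a where "a = \<kappa> * norm (perp e x)"
  have a: "0 \<le> a" "a \<le> \<kappa>"
    using norm_perp_le[OF e, of x] x kappa_bounds(3) by (auto simp: a_def)
  have "arccos (1 - 2 * a\<^sup>2) = 2 * arcsin a"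
  proof -
    have b: "-1 \<le> a" "a \<le> 1" using a kappa_bounds(4) by auto
    have "cos (2 * arcsin a) = 1 - 2 * a\<^sup>2" using b by (simp add: cos_double_sin)
    moreover have "0 \<le> arcsin a" using arcsin_le_arcsin[of 0 a] a b by simp
    moreover have "2 * arcsin a \<le> pi" using arcsin_ubound[OF b] by simp
    ultimately show ?thesis using arccos_cos[of "2 * arcsin a"] by simp
  qed
  moreover have "capmap e \<kappa> x \<bullet> e = 1 - 2 * a\<^sup>2"
    by (simp add: capmap_inner[OF e] a_def power_mult_distrib)
  ultimately have eq: "cap_angle x = 2 * arcsin a" by (simp add: cap_angle_def geod_dist_def)
  have b: "-1 \<le> a" "a \<le> 1" using a kappa_bounds(4) by auto
  show "sin (cap_angle x / 2) = \<kappa> * norm (perp e x)" using b by (simp add: eq) (simp add: a_def)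
  show "0 \<le> cap_angle x" using arcsin_le_arcsin[of 0 a] a b by (simp add: eq)
  have "arcsin a \<le> arcsin \<kappa>" using a b kappa_bounds(4) by (intro arcsin_le_arcsin) auto
  also have "arcsin \<kappa> = \<alpha> / 2" unfolding kap using al eps by (intro arcsin_sin) auto
  finally show "cap_angle x \<le> \<alpha>" by (simp add: eq)
qed

lemma angle_lipschitz:
  assumes x: "norm x = 1" and y: "norm y = 1"
  shows "cap_lo * \<bar>cap_angle x - cap_angle y\<bar> \<le> 2 * \<alpha> * norm (perp e x - perp e y)"
proof -
  define a where "a = cap_angle x"
  define b where "b = cap_angle y"
  have ab: "0 \<le> a" "a \<le> \<alpha>" "0 \<le> b" "b \<le> \<alpha>" using cap_angle[OF x] cap_angle[OF y] by (auto simp: a_def b_def)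
  have "sin (a / 2) - sin (b / 2) = 2 * sin ((a / 2 - b / 2) / 2) * cos ((a / 2 + b / 2) / 2)"
    by (rule sin_diff_sin)
  then have eq: "\<kappa> * (norm (perp e x) - norm (perp e y)) = 2 * sin ((a - b) / 4) * cos ((a + b) / 4)"
    using cap_angle(3)[OF x] cap_angle(3)[OF y] by (simp add: a_def b_def algebra_simps add_divide_distrib diff_divide_distrib)
  have c: "cap_lo \<le> cos ((a + b) / 4)" by (rule cos_lower) (use ab al in auto)
  define w where "w = \<bar>(a - b) / 4\<bar>"
  have w: "0 \<le> w" "w \<le> pi / 2" using ab al eps by (auto simp: w_def)
  have "w / (pi / 2) * sin (pi / 2) \<le> sin w" using w by (intro sin_ge_chord) auto
  moreover have "w / 2 \<le> w / (pi / 2)" using w pi_less_4 by (intro divide_left_mono) auto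
  moreover have "sin w \<le> \<bar>sin ((a - b) / 4)\<bar>" unfolding w_def by (cases "0 \<le> a - b") (auto simp: abs_if)
  ultimately have s: "w / 2 \<le> \<bar>sin ((a - b) / 4)\<bar>" by simp
  have "2 * (w / 2) * cap_lo \<le> 2 * \<bar>sin ((a - b) / 4)\<bar> * \<bar>cos ((a + b) / 4)\<bar>"
    using s c cap_lo_pos w by (intro mult_mono) auto
  also have "\<dots> = \<kappa> * \<bar>norm (perp e x) - norm (perp e y)\<bar>"
    using arg_cong[OF eq, of abs] kappa_bounds(3) by (simp add: abs_mult)
  also have "\<dots> \<le> \<alpha> / 2 * norm (perp e x - perp e y)"
    using kappa_bounds by (intro mult_mono norm_triangle_ineq3) auto
  finally show ?thesis by (simp add: w_def a_def b_def algebra_simps)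
qed

text \<open>The root of the boundary distance of the image, as it occurs in the metric, divided by
  \<open>sqrt \<alpha>\<close>. On the upper hemisphere it is comparable to
  \<open>x \<bullet> e\<close> by \<open>inner_e_depth\<close>.\<close>

definition cap_depth :: "real ^ 'n \<Rightarrow> real" where
  "cap_depth x = sqrt (1 - cap_angle x / \<alpha>)"

lemma cap_depth_sq:
  assumes x: "norm x = 1"
  shows "(cap_depth x)\<^sup>2 = 1 - cap_angle x / \<alpha>" "0 \<le> cap_depth x"
proof -
  have "cap_angle x / \<alpha> \<le> 1" using cap_angle(2)[OF x] al by simp
  then show "(cap_depth x)\<^sup>2 = 1 - cap_angle x / \<alpha>" "0 \<le> cap_depth x" by (simp_all add: cap_depth_def)
qed

lemma sin_sq_diff: "(sin u)\<^sup>2 - (sin v)\<^sup>2 = sin (u - v) * sin (u + v)" for u v :: real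
proof -
  have "sin (u - v) * sin (u + v) = (sin u)\<^sup>2 * (cos v)\<^sup>2 - (cos u)\<^sup>2 * (sin v)\<^sup>2"
    by (simp add: sin_add sin_diff power2_eq_square algebra_simps)
  then show ?thesis by (simp add: cos_squared_eq algebra_simps)
qed

text \<open>From \<open>\<kappa> = sin (\<alpha> / 2)\<close> and the product formula for a
  difference of squared sines. The first factor is of the order of the distance to the boundary, the
  second of the order of \<alpha>; as \<kappa> is of order \<alpha> too,
  \<open>x \<bullet> e\<close> is of the order of the root of the relative distance.\<close>

lemma inner_e_sq:
  assumes x: "norm x = 1"
  shows "\<kappa>\<^sup>2 * (x \<bullet> e)\<^sup>2 = sin ((\<alpha> - cap_angle x) / 2) * sin ((\<alpha> + cap_angle x) / 2)"
proof -
  have xe: "(x \<bullet> e)\<^sup>2 = 1 - (norm (perp e x))\<^sup>2" using norm_perp_power2[OF e, of x] x by simp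
  have "\<kappa>\<^sup>2 * (x \<bullet> e)\<^sup>2 = \<kappa>\<^sup>2 - (sin (cap_angle x / 2))\<^sup>2"
    unfolding xe cap_angle(3)[OF x] by (simp add: power_mult_distrib right_diff_distrib)
  then show ?thesis unfolding kap by (simp add: sin_sq_diff diff_divide_distrib add_divide_distrib)
qed

lemma inner_e_depth:
  assumes x: "norm x = 1" "0 \<le> x \<bullet> e"
  shows "x \<bullet> e \<le> 3 * cap_depth x" "cap_lo * cap_depth x \<le> x \<bullet> e"
proof -
  define a where "a = cap_angle x"
  have a: "0 \<le> a" "a \<le> \<alpha>" using cap_angle[OF x(1)] by (auto simp: a_def)
  note q = inner_e_sq[OF x(1), folded a_def]
  note dp = cap_depth_sq[OF x(1), folded a_def]
  have k0: "0 < \<kappa>\<^sup>2" using kappa_bounds(3) by simp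
  have t: "(\<alpha> - a) = \<alpha> * (cap_depth x)\<^sup>2" using dp al by (simp add: field_simps)
  have "\<kappa>\<^sup>2 * (x \<bullet> e)\<^sup>2 \<le> ((\<alpha> - a) / 2) * ((\<alpha> + a) / 2)"
    unfolding q using a al eps by (intro mult_mono sin_x_le_x sin_ge_zero) auto
  also have "\<dots> \<le> ((\<alpha> - a) / 2) * \<alpha>" using a by (intro mult_left_mono) auto
  also have "\<dots> = \<alpha>\<^sup>2 * (cap_depth x)\<^sup>2 / 2" by (simp add: t power2_eq_square)
  also have "\<dots> \<le> (4 * \<kappa>)\<^sup>2 * (cap_depth x)\<^sup>2 / 2"
    using kappa_bounds(1) al by (intro divide_right_mono mult_right_mono power_mono) auto
  also have "\<dots> \<le> \<kappa>\<^sup>2 * (3 * cap_depth x)\<^sup>2" by (simp add: power_mult_distrib)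
  finally have "(x \<bullet> e)\<^sup>2 \<le> (3 * cap_depth x)\<^sup>2" using k0 by simp
  then show "x \<bullet> e \<le> 3 * cap_depth x" by (rule power2_le_imp_le) (use dp in auto)
  have "\<kappa>\<^sup>2 * (cap_lo * cap_depth x)\<^sup>2 \<le> (\<alpha> / 2)\<^sup>2 * (cap_lo * cap_depth x)\<^sup>2"
    using kappa_bounds(2,3) by (intro mult_right_mono power_mono) auto
  also have "\<dots> = (cap_lo * ((\<alpha> - a) / 2)) * (cap_lo * (\<alpha> / 2))"
    by (simp add: t power2_eq_square)
  also have "\<dots> \<le> (cap_lo * ((\<alpha> - a) / 2)) * (cap_lo * ((\<alpha> + a) / 2))"
    using a cap_lo_pos by (intro mult_left_mono) auto
  also have "\<dots> \<le> \<kappa>\<^sup>2 * (x \<bullet> e)\<^sup>2"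
    unfolding q using a al eps cap_lo_pos by (intro mult_mono sin_lower sin_ge_zero) auto
  finally have "(cap_lo * cap_depth x)\<^sup>2 \<le> (x \<bullet> e)\<^sup>2" using k0 by simp
  then show "cap_lo * cap_depth x \<le> x \<bullet> e" by (rule power2_le_imp_le) (use x in auto)
qed

text \<open>Heights and depths are both square roots, so their differences are compared through
  differences of squares: \<open>zw\<close> and \<open>st\<close> express these by the polar angles
  \<open>a\<close> and \<open>b\<close>, and the sums \<open>z + w\<close> and \<open>s + t\<close>
  to be divided out are comparable.\<close>

lemma inner_e_diff:
  assumes x: "norm x = 1" "0 \<le> x \<bullet> e" and y: "norm y = 1" "0 \<le> y \<bullet> e"
  shows "cap_lo * \<bar>x \<bullet> e - y \<bullet> e\<bar> \<le> 8 * \<bar>cap_depth x - cap_depth y\<bar>"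
    and "cap_lo\<^sup>2 * \<bar>cap_depth x - cap_depth y\<bar> \<le> 6 * \<bar>x \<bullet> e - y \<bullet> e\<bar> + 2 * norm (perp e x - perp e y)"
proof -
  define a b where "a = cap_angle x" and "b = cap_angle y"
  define s t where "s = cap_depth x" and "t = cap_depth y"
  define z w where "z = x \<bullet> e" and "w = y \<bullet> e"
  have a: "0 \<le> a" "a \<le> \<alpha>" using cap_angle[OF x(1)] by (auto simp: a_def)
  have b: "0 \<le> b" "b \<le> \<alpha>" using cap_angle[OF y(1)] by (auto simp: b_def)
  have s: "s\<^sup>2 = 1 - a / \<alpha>" "0 \<le> s" using cap_depth_sq[OF x(1)] by (auto simp: s_def a_def)
  have t: "t\<^sup>2 = 1 - b / \<alpha>" "0 \<le> t" using cap_depth_sq[OF y(1)] by (auto simp: t_def b_def)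
  have z: "z \<le> 3 * s" "cap_lo * s \<le> z" using inner_e_depth[OF x] by (auto simp: z_def s_def)
  have w: "w \<le> 3 * t" "cap_lo * t \<le> w" using inner_e_depth[OF y] by (auto simp: w_def t_def)
  have k0: "0 < \<kappa>\<^sup>2" using kappa_bounds(3) by simp
  have st: "b - a = \<alpha> * ((s - t) * (s + t))"
  proof -
    have "(s - t) * (s + t) = s\<^sup>2 - t\<^sup>2" by (simp add: power2_eq_square algebra_simps)
    also have "\<dots> = (b - a) / \<alpha>" unfolding s(1) t(1) by (simp add: diff_divide_distrib)
    finally show ?thesis using al by simp
  qed
  have zw: "\<kappa>\<^sup>2 * ((z - w) * (z + w)) = sin ((b - a) / 2) * sin ((b + a) / 2)"
  proof -
    have z2: "z\<^sup>2 = 1 - (norm (perp e x))\<^sup>2" and w2: "w\<^sup>2 = 1 - (norm (perp e y))\<^sup>2"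
      using norm_perp_power2[OF e, of x] norm_perp_power2[OF e, of y] x y by (simp_all add: z_def w_def)
    have "\<kappa>\<^sup>2 * (z\<^sup>2 - w\<^sup>2) = (sin (b / 2))\<^sup>2 - (sin (a / 2))\<^sup>2"
      unfolding z2 w2 a_def b_def cap_angle(3)[OF x(1)] cap_angle(3)[OF y(1)]
      by (simp add: power_mult_distrib algebra_simps)
    moreover have "z\<^sup>2 - w\<^sup>2 = (z - w) * (z + w)" by (simp add: power2_eq_square algebra_simps)
    ultimately show ?thesis by (simp add: sin_sq_diff diff_divide_distrib add_divide_distrib)
  qed
  have zw0: "0 \<le> z" "0 \<le> w" using x y by (auto simp: z_def w_def)
  have zwa: "\<kappa>\<^sup>2 * (\<bar>z - w\<bar> * (z + w)) = \<bar>sin ((b - a) / 2)\<bar> * \<bar>sin ((b + a) / 2)\<bar>"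
    using arg_cong[OF zw, of abs] zw0 by (simp add: abs_mult)
  have sta: "\<bar>b - a\<bar> = \<alpha> * (\<bar>s - t\<bar> * (s + t))"
    using arg_cong[OF st, of abs] s t al by (simp add: abs_mult)
  show "cap_lo * \<bar>x \<bullet> e - y \<bullet> e\<bar> \<le> 8 * \<bar>cap_depth x - cap_depth y\<bar>"
  proof (cases "s + t = 0")
    case True
    then have "s = 0" "t = 0" using s t by auto
    then show ?thesis using z w zw0 by (simp add: z_def w_def s_def t_def)
  next
    case False
    then have pos: "0 < s + t" using s t by auto
    have "\<bar>sin ((b - a) / 2)\<bar> * \<bar>sin ((b + a) / 2)\<bar> \<le> \<bar>(b - a) / 2\<bar> * \<bar>(b + a) / 2\<bar>"
      by (intro mult_mono abs_sin_x_le_abs_x) auto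
    also have "\<dots> \<le> \<bar>b - a\<bar> / 2 * \<alpha>" using a b by (intro mult_mono) auto
    also have "\<dots> = \<alpha>\<^sup>2 / 2 * (\<bar>s - t\<bar> * (s + t))" by (simp add: sta power2_eq_square)
    also have "\<dots> \<le> (4 * \<kappa>)\<^sup>2 / 2 * (\<bar>s - t\<bar> * (s + t))"
      using kappa_bounds(1) al pos by (intro mult_right_mono divide_right_mono power_mono) auto
    finally have "\<kappa>\<^sup>2 * (\<bar>z - w\<bar> * (z + w)) \<le> \<kappa>\<^sup>2 * (8 * (\<bar>s - t\<bar> * (s + t)))"
      unfolding zwa[symmetric] by (simp add: power_mult_distrib)
    then have "\<bar>z - w\<bar> * (z + w) \<le> 8 * \<bar>s - t\<bar> * (s + t)" using k0 by simp
    moreover have "\<bar>z - w\<bar> * (cap_lo * (s + t)) \<le> \<bar>z - w\<bar> * (z + w)"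
      using z w by (intro mult_left_mono) (auto simp: algebra_simps)
    ultimately have "(cap_lo * \<bar>z - w\<bar>) * (s + t) \<le> (8 * \<bar>s - t\<bar>) * (s + t)" by (simp add: mult_ac)
    then show ?thesis using pos by (simp add: z_def w_def s_def t_def)
  qed
  show "cap_lo\<^sup>2 * \<bar>cap_depth x - cap_depth y\<bar> \<le> 6 * \<bar>x \<bullet> e - y \<bullet> e\<bar> + 2 * norm (perp e x - perp e y)"
  \<comment> \<open>At the centre of the cap \<open>sin ((a + b) / 2)\<close> degenerates and the
    comparison fails. There both depths are at least 1/2, hence Lipschitz in the angle, and the
    angle is controlled by \<open>perp\<close>; this is the origin of the last term of the
    claim.\<close>
  proof (cases "\<alpha> / 2 \<le> a + b")
    case True
    have pos: "0 < s + t \<or> s = t" using s t by auto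
    show ?thesis
    proof (cases "s = t")
      case True
      then show ?thesis by (simp add: s_def t_def)
    next
      case False
      then have pos: "0 < s + t" using s t by auto
      have l1: "cap_lo * (\<bar>b - a\<bar> / 2) \<le> \<bar>sin ((b - a) / 2)\<bar>"
      proof -
        have "cap_lo * (\<bar>b - a\<bar> / 2) \<le> sin (\<bar>b - a\<bar> / 2)" by (rule sin_lower) (use a b al in auto)
        then show ?thesis using sin_abs_le[of "(b - a) / 2"] by simp
      qed
      have l2: "cap_lo * (\<alpha> / 4) \<le> \<bar>sin ((b + a) / 2)\<bar>"
      proof -
        have "cap_lo * (\<alpha> / 4) \<le> cap_lo * ((b + a) / 2)" using True cap_lo_pos by (intro mult_left_mono) auto
        also have "\<dots> \<le> sin ((b + a) / 2)" by (rule sin_lower) (use a b al in auto)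
        finally show ?thesis by simp
      qed
      have "(cap_lo * (\<bar>b - a\<bar> / 2)) * (cap_lo * (\<alpha> / 4)) \<le> \<kappa>\<^sup>2 * (\<bar>z - w\<bar> * (z + w))"
        unfolding zwa using cap_lo_pos al by (intro mult_mono l1 l2) auto
      also have "\<dots> \<le> (\<alpha> / 2)\<^sup>2 * (\<bar>z - w\<bar> * (3 * (s + t)))"
        using kappa_bounds(2,3) z w zw0 by (intro mult_mono power_mono) auto
      finally have "(\<alpha> / 2)\<^sup>2 * (cap_lo\<^sup>2 / 2 * \<bar>s - t\<bar> * (s + t)) \<le> (\<alpha> / 2)\<^sup>2 * (3 * \<bar>z - w\<bar> * (s + t))"
      proof -
        have "(cap_lo * (\<bar>b - a\<bar> / 2)) * (cap_lo * (\<alpha> / 4)) = (\<alpha> / 2)\<^sup>2 * (cap_lo\<^sup>2 / 2 * \<bar>s - t\<bar> * (s + t))"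
          by (simp add: sta power2_eq_square)
        moreover have "(\<alpha> / 2)\<^sup>2 * (\<bar>z - w\<bar> * (3 * (s + t))) = (\<alpha> / 2)\<^sup>2 * (3 * \<bar>z - w\<bar> * (s + t))"
          by (simp only: mult_ac)
        ultimately show "(cap_lo * (\<bar>b - a\<bar> / 2)) * (cap_lo * (\<alpha> / 4)) \<le> (\<alpha> / 2)\<^sup>2 * (\<bar>z - w\<bar> * (3 * (s + t))) \<Longrightarrow>
          (\<alpha> / 2)\<^sup>2 * (cap_lo\<^sup>2 / 2 * \<bar>s - t\<bar> * (s + t)) \<le> (\<alpha> / 2)\<^sup>2 * (3 * \<bar>z - w\<bar> * (s + t))"
          by (simp only:)
      qed
      moreover have "0 < (\<alpha> / 2)\<^sup>2" using al by simp
      ultimately have "cap_lo\<^sup>2 / 2 * \<bar>s - t\<bar> * (s + t) \<le> 3 * \<bar>z - w\<bar> * (s + t)"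
        by (rule mult_left_le_imp_le)
      then have "cap_lo\<^sup>2 / 2 * \<bar>s - t\<bar> \<le> 3 * \<bar>z - w\<bar>" by (rule mult_right_le_imp_le[OF _ pos])
      then have "cap_lo\<^sup>2 * \<bar>s - t\<bar> \<le> 6 * \<bar>z - w\<bar>" by simp
      then show ?thesis unfolding s_def t_def z_def w_def by (rule order_trans) simp
    qed
  next
    case False
    have "a / \<alpha> \<le> 1/2" "b / \<alpha> \<le> 1/2" using False a b al by (simp_all add: pos_divide_le_eq)
    then have h: "1/2 \<le> s\<^sup>2" "1/2 \<le> t\<^sup>2" unfolding s(1) t(1) by linarith+
    have "1/2 \<le> s" "1/2 \<le> t"
      using power2_le_imp_le[of "1/2" s] power2_le_imp_le[of "1/2" t] h s(2) t(2)
      by (simp_all add: power_divide)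
    then have "\<bar>s - t\<bar> * 1 \<le> \<bar>s - t\<bar> * (s + t)" by (intro mult_left_mono) auto
    then have "\<alpha> * \<bar>s - t\<bar> \<le> \<bar>a - b\<bar>" using al by (simp add: sta abs_minus_commute[of a b])
    then have "cap_lo * (\<alpha> * \<bar>s - t\<bar>) \<le> cap_lo * \<bar>a - b\<bar>" using cap_lo_pos by (intro mult_left_mono) auto
    also have "\<dots> \<le> 2 * \<alpha> * norm (perp e x - perp e y)"
      unfolding a_def b_def by (rule angle_lipschitz[OF x(1) y(1)])
    finally have "\<alpha> * (cap_lo * \<bar>s - t\<bar>) \<le> \<alpha> * (2 * norm (perp e x - perp e y))" by (simp add: mult_ac)
    then have "cap_lo * \<bar>s - t\<bar> \<le> 2 * norm (perp e x - perp e y)" using al by simp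
    moreover have "cap_lo\<^sup>2 * \<bar>s - t\<bar> \<le> cap_lo * \<bar>s - t\<bar>"
      using cap_lo_pos cap_lo_le by (intro mult_right_mono) (auto simp: power2_eq_square mult_left_le)
    ultimately have "cap_lo\<^sup>2 * \<bar>s - t\<bar> \<le> 2 * norm (perp e x - perp e y)" by (rule order_trans[rotated])
    then show ?thesis unfolding s_def t_def by (rule order_trans) simp
  qed
qed

text \<open>\<open>cfac\<close> is the root of a quantity bounded below, so the sum
  \<open>c + c'\<close> is divided out at the cost of \<open>cap_lo\<close>. The right side of the
  first bound is half the difference of the \<open>e\<close> components of the images and serves
  \<open>capmap_colipschitz\<close>; the second bound serves
  \<open>capmap_lipschitz\<close>.\<close>

lemma cfac_diff:
  assumes x: "norm x = 1" and y: "norm y = 1"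
  shows "cap_lo * \<bar>cfac e \<kappa> x - cfac e \<kappa> y\<bar> \<le> \<bar>\<kappa>\<^sup>2 * (norm (perp e x))\<^sup>2 - \<kappa>\<^sup>2 * (norm (perp e y))\<^sup>2\<bar>"
    and "cap_lo * \<bar>cfac e \<kappa> x - cfac e \<kappa> y\<bar> \<le> 2 * norm (perp e x - perp e y)"
proof -
  define c c' where "c = cfac e \<kappa> x" and "c' = cfac e \<kappa> y"
  have c: "cap_lo \<le> c" "c\<^sup>2 = 1 - \<kappa>\<^sup>2 * (norm (perp e x))\<^sup>2"
    using cfac_bounds[OF e kappa_bounds(3,4), of x] kappa_bounds(5) x by (auto simp: c_def)
  have c': "cap_lo \<le> c'" "c'\<^sup>2 = 1 - \<kappa>\<^sup>2 * (norm (perp e y))\<^sup>2"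
    using cfac_bounds[OF e kappa_bounds(3,4), of y] kappa_bounds(5) y by (auto simp: c'_def)
  have "\<bar>c - c'\<bar> * cap_lo \<le> \<bar>c - c'\<bar> * (c + c')" using c c' cap_lo_pos by (intro mult_left_mono) auto
  also have "\<dots> = \<bar>c\<^sup>2 - c'\<^sup>2\<bar>"
  proof -
    have "c\<^sup>2 - c'\<^sup>2 = (c - c') * (c + c')" by (simp add: power2_eq_square algebra_simps)
    then show ?thesis using c(1) c'(1) cap_lo_pos by (simp add: abs_mult)
  qed
  also have "\<dots> = \<bar>\<kappa>\<^sup>2 * (norm (perp e x))\<^sup>2 - \<kappa>\<^sup>2 * (norm (perp e y))\<^sup>2\<bar>" by (simp add: c c')
  finally show 1: "cap_lo * \<bar>cfac e \<kappa> x - cfac e \<kappa> y\<bar> \<le> \<bar>\<kappa>\<^sup>2 * (norm (perp e x))\<^sup>2 - \<kappa>\<^sup>2 * (norm (perp e y))\<^sup>2\<bar>"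
    by (simp add: c_def c'_def mult.commute)
  define p q where "p = norm (perp e x)" and "q = norm (perp e y)"
  have pq: "0 \<le> p" "p \<le> 1" "0 \<le> q" "q \<le> 1"
    using norm_perp_le[OF e, of x] norm_perp_le[OF e, of y] x y by (auto simp: p_def q_def)
  have k1: "\<kappa>\<^sup>2 \<le> 1" using kappa_bounds(3,4) by (simp add: power_le_one)
  have "\<bar>\<kappa>\<^sup>2 * p\<^sup>2 - \<kappa>\<^sup>2 * q\<^sup>2\<bar> = \<kappa>\<^sup>2 * (\<bar>p - q\<bar> * (p + q))"
  proof -
    have "\<kappa>\<^sup>2 * p\<^sup>2 - \<kappa>\<^sup>2 * q\<^sup>2 = \<kappa>\<^sup>2 * ((p - q) * (p + q))" by (simp add: power2_eq_square algebra_simps)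
    then show ?thesis using pq by (simp add: abs_mult)
  qed
  also have "\<dots> \<le> 1 * (norm (perp e x - perp e y) * 2)"
    using pq k1 norm_triangle_ineq3[of "perp e x" "perp e y"]
    by (intro mult_mono) (auto simp: p_def q_def)
  finally show "cap_lo * \<bar>cfac e \<kappa> x - cfac e \<kappa> y\<bar> \<le> 2 * norm (perp e x - perp e y)"
    using 1 by (simp add: p_def q_def)
qed

lemma capmap_lipschitz:
  assumes x: "norm x = 1" and y: "norm y = 1"
  shows "cap_lo * norm (capmap e \<kappa> x - capmap e \<kappa> y) \<le> 10 * \<kappa> * norm (perp e x - perp e y)"
proof -
  define p q where "p = perp e x" and "q = perp e y"
  define c c' where "c = cfac e \<kappa> x" and "c' = cfac e \<kappa> y"
  have k: "0 < \<kappa>" "\<kappa> < 1" using kappa_bounds by auto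
  have np: "norm p \<le> 1" "norm q \<le> 1"
    using norm_perp_le[OF e, of x] norm_perp_le[OF e, of y] x y by (auto simp: p_def q_def)
  have cc: "0 \<le> c" "c \<le> 1" using cfac_bounds[OF e k, of x] x by (auto simp: c_def)
  have d: "capmap e \<kappa> x - capmap e \<kappa> y = (2 * \<kappa>\<^sup>2 * ((norm q)\<^sup>2 - (norm p)\<^sup>2)) *\<^sub>R e
    + (2 * \<kappa>) *\<^sub>R (c *\<^sub>R (p - q) + (c - c') *\<^sub>R q)"
    by (simp add: capmap_def p_def q_def c_def c'_def algebra_simps)
  have "norm (capmap e \<kappa> x - capmap e \<kappa> y) \<le> norm ((2 * \<kappa>\<^sup>2 * ((norm q)\<^sup>2 - (norm p)\<^sup>2)) *\<^sub>R e)
    + norm ((2 * \<kappa>) *\<^sub>R (c *\<^sub>R (p - q) + (c - c') *\<^sub>R q))"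
    unfolding d by (rule norm_triangle_ineq)
  also have "norm ((2 * \<kappa>\<^sup>2 * ((norm q)\<^sup>2 - (norm p)\<^sup>2)) *\<^sub>R e) \<le> 4 * \<kappa> * norm (p - q)"
  proof -
    have "\<bar>(norm q)\<^sup>2 - (norm p)\<^sup>2\<bar> = \<bar>norm p - norm q\<bar> * (norm p + norm q)"
      by (simp add: power2_eq_square square_diff_square_factored abs_mult abs_minus_commute mult.commute)
    also have "\<dots> \<le> norm (p - q) * 2" using np by (intro mult_mono norm_triangle_ineq3) auto
    finally have "2 * \<kappa>\<^sup>2 * \<bar>(norm q)\<^sup>2 - (norm p)\<^sup>2\<bar> \<le> 2 * \<kappa> * (norm (p - q) * 2)"
      using k by (intro mult_mono) (auto simp: power2_eq_square)
    then show ?thesis using e by (simp add: abs_mult)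
  qed
  also have "norm ((2 * \<kappa>) *\<^sub>R (c *\<^sub>R (p - q) + (c - c') *\<^sub>R q)) \<le> 2 * \<kappa> * (norm (p - q) + \<bar>c - c'\<bar>)"
  proof -
    have "norm (c *\<^sub>R (p - q) + (c - c') *\<^sub>R q) \<le> \<bar>c\<bar> * norm (p - q) + \<bar>c - c'\<bar> * norm q"
      by (rule order_trans[OF norm_triangle_ineq]) simp
    also have "\<dots> \<le> 1 * norm (p - q) + \<bar>c - c'\<bar> * 1" using cc np by (intro add_mono mult_mono) auto
    finally show ?thesis using k by simp
  qed
  finally have "norm (capmap e \<kappa> x - capmap e \<kappa> y) \<le> 2 * \<kappa> * (3 * norm (p - q) + \<bar>c - c'\<bar>)" by (simp add: algebra_simps)
  then have "cap_lo * norm (capmap e \<kappa> x - capmap e \<kappa> y) \<le> cap_lo * (2 * \<kappa> * (3 * norm (p - q) + \<bar>c - c'\<bar>))"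
    using cap_lo_pos by (intro mult_left_mono) auto
  also have "\<dots> = 2 * \<kappa> * (cap_lo * (3 * norm (p - q)) + cap_lo * \<bar>c - c'\<bar>)" by (simp add: algebra_simps)
  also have "\<dots> \<le> 2 * \<kappa> * (1 * (3 * norm (p - q)) + 2 * norm (p - q))"
    using k cap_lo_le cfac_diff(2)[OF x y] unfolding c_def c'_def p_def q_def
    by (intro mult_left_mono add_mono mult_right_mono) auto
  finally show ?thesis by (simp add: p_def q_def)
qed

text \<open>The \<open>e\<close> component of the difference controls the change of
  \<open>cfac\<close>. The orthogonal component is \<open>2 * \<kappa>\<close> times
  \<open>c *\<^sub>R (p - q) + (c - c') *\<^sub>R q\<close>, so subtracting the part already
  controlled leaves a multiple of \<open>p - q\<close>. The factor \<kappa>, here and in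
  \<open>capmap_lipschitz\<close>, is of order \<alpha> and is cancelled by the prefactor of the
  metric.\<close>

lemma capmap_colipschitz:
  assumes x: "norm x = 1" and y: "norm y = 1"
  shows "cap_lo ^ 3 * \<kappa> * norm (perp e x - perp e y) \<le> 2 * norm (capmap e \<kappa> x - capmap e \<kappa> y)"
proof -
  define p q where "p = perp e x" and "q = perp e y"
  define c c' where "c = cfac e \<kappa> x" and "c' = cfac e \<kappa> y"
  define D where "D = norm (capmap e \<kappa> x - capmap e \<kappa> y)"
  have k: "0 < \<kappa>" "\<kappa> < 1" using kappa_bounds by auto
  have np: "norm p \<le> 1" "norm q \<le> 1"
    using norm_perp_le[OF e, of x] norm_perp_le[OF e, of y] x y by (auto simp: p_def q_def)
  have c: "cap_lo \<le> c" "0 < c"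
    using cfac_bounds[OF e k, of x] kappa_bounds(5) x by (auto simp: c_def)
  have "\<bar>(capmap e \<kappa> x - capmap e \<kappa> y) \<bullet> e\<bar> \<le> D"
    using Cauchy_Schwarz_ineq2[of "capmap e \<kappa> x - capmap e \<kappa> y" e] e by (simp add: D_def)
  moreover have "(capmap e \<kappa> x - capmap e \<kappa> y) \<bullet> e = - 2 * (\<kappa>\<^sup>2 * (norm (perp e x))\<^sup>2 - \<kappa>\<^sup>2 * (norm (perp e y))\<^sup>2)"
    by (simp add: inner_diff_left capmap_inner[OF e])
  ultimately have "2 * \<bar>\<kappa>\<^sup>2 * (norm (perp e x))\<^sup>2 - \<kappa>\<^sup>2 * (norm (perp e y))\<^sup>2\<bar> \<le> D"
    by (simp only: abs_mult abs_neg_numeral)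
  then have cd: "cap_lo * \<bar>c - c'\<bar> \<le> D / 2" using cfac_diff(1)[OF x y] by (simp add: c_def c'_def)
  have "perp e (capmap e \<kappa> x - capmap e \<kappa> y) = (2 * \<kappa> * c) *\<^sub>R p - (2 * \<kappa> * c') *\<^sub>R q"
    by (simp add: linear_diff[OF linear_perp] perp_capmap[OF e] p_def q_def c_def c'_def)
  also have "\<dots> = (2 * \<kappa>) *\<^sub>R (c *\<^sub>R (p - q)) + (2 * \<kappa> * (c - c')) *\<^sub>R q" by (simp add: algebra_simps)
  finally have "(2 * \<kappa>) *\<^sub>R (c *\<^sub>R (p - q)) = perp e (capmap e \<kappa> x - capmap e \<kappa> y) - (2 * \<kappa> * (c - c')) *\<^sub>R q"
    by simp
  then have "norm ((2 * \<kappa>) *\<^sub>R (c *\<^sub>R (p - q))) \<le> norm (perp e (capmap e \<kappa> x - capmap e \<kappa> y)) + norm ((2 * \<kappa> * (c - c')) *\<^sub>R q)"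
    by (simp only: norm_triangle_ineq4)
  also have "norm (perp e (capmap e \<kappa> x - capmap e \<kappa> y)) \<le> D" unfolding D_def by (rule norm_perp_le[OF e])
  also have "norm ((2 * \<kappa> * (c - c')) *\<^sub>R q) \<le> 2 * \<bar>c - c'\<bar>"
  proof -
    have "norm ((2 * \<kappa> * (c - c')) *\<^sub>R q) = 2 * \<kappa> * \<bar>c - c'\<bar> * norm q" using k by (simp add: abs_mult)
    also have "\<dots> \<le> 2 * 1 * \<bar>c - c'\<bar> * 1" using k np by (intro mult_mono) auto
    finally show ?thesis by simp
  qed
  finally have "2 * \<kappa> * c * norm (p - q) \<le> D + 2 * \<bar>c - c'\<bar>" using k c by simp
  moreover have "2 * \<kappa> * cap_lo * norm (p - q) \<le> 2 * \<kappa> * c * norm (p - q)"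
    using k c by (intro mult_right_mono mult_left_mono) auto
  ultimately have "cap_lo * (2 * \<kappa> * cap_lo * norm (p - q)) \<le> cap_lo * (D + 2 * \<bar>c - c'\<bar>)"
    using cap_lo_pos by (intro mult_left_mono) auto
  also have "\<dots> = cap_lo * D + 2 * (cap_lo * \<bar>c - c'\<bar>)" by (simp add: algebra_simps)
  also have "\<dots> \<le> 1 * D + 2 * (D / 2)"
    using cd cap_lo_le by (intro add_mono mult_right_mono mult_left_mono) (auto simp: D_def)
  finally have 1: "cap_lo * (2 * \<kappa> * cap_lo * norm (p - q)) \<le> 2 * D" by simp
  have "cap_lo ^ 3 * \<kappa> * norm (p - q) \<le> cap_lo\<^sup>2 * (2 * \<kappa>) * norm (p - q)"
    using cap_lo_pos cap_lo_le k
    by (intro mult_right_mono mult_mono) (auto simp: power2_eq_square power3_eq_cube mult_left_le_one_le)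
  also have "\<dots> = cap_lo * (2 * \<kappa> * cap_lo * norm (p - q))" by (simp add: power2_eq_square)
  also note 1
  finally show ?thesis by (simp add: D_def p_def q_def)
qed

section \<open>Comparison of the metric with the chordal distance on the hemisphere\<close>

lemma geod_dist_chord:
  fixes x y :: "real ^ 'n"
  assumes x: "norm x = 1" and y: "norm y = 1"
  shows "norm (x - y) \<le> geod_dist x y" "geod_dist x y \<le> 2 * norm (x - y)" "0 \<le> geod_dist x y"
proof -
  define d where "d = geod_dist x y"
  have xy: "-1 \<le> x \<bullet> y" "x \<bullet> y \<le> 1"
    using Cauchy_Schwarz_ineq2[of x y] x y by (auto simp: abs_le_iff)
  have d: "0 \<le> d" "d \<le> pi" "cos d = x \<bullet> y"
    using xy by (auto simp: d_def geod_dist_def arccos_lbound arccos_ubound)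
  show "0 \<le> geod_dist x y" using d by (simp add: d_def)
  have "x \<bullet> x = 1" "y \<bullet> y = 1" using x y by (simp_all add: dot_square_norm)
  then have "(norm (x - y))\<^sup>2 = 2 - 2 * cos d"
    unfolding power2_norm_eq_inner by (simp add: inner_diff_left inner_diff_right inner_commute[of y x] d(3))
  also have "\<dots> = (2 * sin (d / 2))\<^sup>2" using cos_double_sin[of "d / 2"] by (simp add: power_mult_distrib)
  finally have n: "norm (x - y) = 2 * sin (d / 2)"
    by (rule power2_eq_imp_eq) (use d sin_ge_zero[of "d / 2"] in auto)
  show "norm (x - y) \<le> geod_dist x y" unfolding n using sin_x_le_x[of "d / 2"] d by (simp add: d_def)
  have "d / 2 / (pi / 2) * sin (pi / 2) \<le> sin (d / 2)" using d by (intro sin_ge_chord) auto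
  then have "d / pi \<le> sin (d / 2)" by simp
  moreover have "d / 4 \<le> d / pi" using d pi_less_4 by (intro divide_left_mono) auto
  ultimately have "d \<le> 2 * (2 * sin (d / 2))" by linarith
  then show "geod_dist x y \<le> 2 * norm (x - y)" by (simp only: n d_def)
qed

text \<open>The root of the boundary distance is \<open>sqrt \<alpha> * cap_depth\<close>; with the
  \<alpha> in the metric this produces \<open>\<alpha>\<^sup>2\<close>, which the prefactor
  removes.\<close>

lemma cap_metric_eq:
  assumes x: "norm x = 1" and y: "norm y = 1"
  shows "cap_metric e \<alpha> (capmap e \<kappa> x) (capmap e \<kappa> y) =
    sqrt ((geod_dist (capmap e \<kappa> x) (capmap e \<kappa> y) / \<alpha>)\<^sup>2 + (cap_depth x - cap_depth y)\<^sup>2)"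
proof -
  have b: "sqrt (bdist e \<alpha> (capmap e \<kappa> z)) = sqrt \<alpha> * cap_depth z" for z
  proof -
    have "bdist e \<alpha> (capmap e \<kappa> z) = \<alpha> * (1 - cap_angle z / \<alpha>)"
      using al by (simp add: bdist_def cap_angle_def field_simps)
    then show ?thesis by (simp add: real_sqrt_mult cap_depth_def)
  qed
  define d where "d = geod_dist (capmap e \<kappa> x) (capmap e \<kappa> y)"
  have "d\<^sup>2 + \<alpha> * (sqrt \<alpha> * cap_depth x - sqrt \<alpha> * cap_depth y)\<^sup>2
     = \<alpha>\<^sup>2 * ((d / \<alpha>)\<^sup>2 + (cap_depth x - cap_depth y)\<^sup>2)"
  proof -
    have "(sqrt \<alpha> * cap_depth x - sqrt \<alpha> * cap_depth y)\<^sup>2 = \<alpha> * (cap_depth x - cap_depth y)\<^sup>2"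
      using al by (simp only: right_diff_distrib[symmetric] power_mult_distrib) simp
    moreover have "d\<^sup>2 + \<alpha> * (\<alpha> * X) = \<alpha>\<^sup>2 * ((d / \<alpha>)\<^sup>2 + X)" for X
      using al by (simp add: power_divide distrib_left) (simp add: power2_eq_square)
    ultimately show ?thesis by simp
  qed
  then show ?thesis
    unfolding cap_metric_def b using al by (simp add: d_def[symmetric] real_sqrt_mult)
qed

lemma cap_metric_le:
  assumes x: "norm x = 1" "0 \<le> x \<bullet> e" and y: "norm y = 1" "0 \<le> y \<bullet> e"
  shows "cap_lo\<^sup>2 * cap_metric e \<alpha> (capmap e \<kappa> x) (capmap e \<kappa> y) \<le> 20 * norm (x - y)"
proof -
  define d where "d = geod_dist (capmap e \<kappa> x) (capmap e \<kappa> y)"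
  have nx: "norm (capmap e \<kappa> x) = 1" "norm (capmap e \<kappa> y) = 1"
    using norm_capmap[OF e kappa_bounds(3,4)] x y by auto
  have d0: "0 \<le> d" using geod_dist_chord(3)[OF nx] by (simp add: d_def)
  have pxy: "norm (perp e x - perp e y) \<le> norm (x - y)"
    using norm_perp_le[OF e, of "x - y"] by (simp add: linear_diff[OF linear_perp])
  have exy: "\<bar>x \<bullet> e - y \<bullet> e\<bar> \<le> norm (x - y)"
    using Cauchy_Schwarz_ineq2[of "x - y" e] e by (simp add: inner_diff_left)
  have "cap_metric e \<alpha> (capmap e \<kappa> x) (capmap e \<kappa> y) \<le> \<bar>d / \<alpha>\<bar> + \<bar>cap_depth x - cap_depth y\<bar>"
    unfolding cap_metric_eq[OF x(1) y(1)] d_def[symmetric] by (rule sqrt_sum_squares_le_sum_abs)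
  then have "cap_lo\<^sup>2 * cap_metric e \<alpha> (capmap e \<kappa> x) (capmap e \<kappa> y)
     \<le> cap_lo\<^sup>2 * (d / \<alpha> + \<bar>cap_depth x - cap_depth y\<bar>)"
    using d0 al by (intro mult_left_mono) auto
  moreover have "cap_lo\<^sup>2 * (d / \<alpha>) \<le> 10 * norm (x - y)"
  proof -
    have "cap_lo * d \<le> cap_lo * (2 * norm (capmap e \<kappa> x - capmap e \<kappa> y))"
      using geod_dist_chord(2)[OF nx] cap_lo_pos by (intro mult_left_mono) (auto simp: d_def)
    also have "\<dots> \<le> 20 * \<kappa> * norm (perp e x - perp e y)" using capmap_lipschitz[OF x(1) y(1)] by simp
    also have "\<dots> \<le> 20 * (\<alpha> / 2) * norm (x - y)"
      using kappa_bounds pxy by (intro mult_mono) auto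
    finally have 1: "cap_lo * d / \<alpha> \<le> 10 * norm (x - y)" using al by (simp add: pos_divide_le_eq mult_ac)
    have "cap_lo * (cap_lo * d / \<alpha>) \<le> 1 * (cap_lo * d / \<alpha>)"
      using cap_lo_le cap_lo_pos d0 al by (intro mult_right_mono) auto
    with 1 show ?thesis by (simp add: power2_eq_square mult_ac)
  qed
  moreover have "cap_lo\<^sup>2 * \<bar>cap_depth x - cap_depth y\<bar> \<le> 8 * norm (x - y)"
    by (rule order_trans[OF inner_e_diff(2)[OF x y]]) (use pxy exy in simp)
  moreover have "0 \<le> norm (x - y)" by simp
  ultimately show ?thesis unfolding distrib_left by linarith
qed

text \<open>Both components of \<open>x - y\<close> are recovered, the orthogonal one from the
  geodesic part of the metric and the height from the depth part. Points of opposite hemispheres may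
  have the same image, hence the sign conditions.\<close>

lemma cap_metric_ge:
  assumes x: "norm x = 1" "0 \<le> x \<bullet> e" and y: "norm y = 1" "0 \<le> y \<bullet> e"
  shows "cap_lo ^ 3 * norm (x - y) \<le> 16 * cap_metric e \<alpha> (capmap e \<kappa> x) (capmap e \<kappa> y)"
proof -
  define d where "d = geod_dist (capmap e \<kappa> x) (capmap e \<kappa> y)"
  define R where "R = cap_metric e \<alpha> (capmap e \<kappa> x) (capmap e \<kappa> y)"
  have nx: "norm (capmap e \<kappa> x) = 1" "norm (capmap e \<kappa> y) = 1"
    using norm_capmap[OF e kappa_bounds(3,4)] x y by auto
  have d0: "0 \<le> d" using geod_dist_chord(3)[OF nx] by (simp add: d_def)
  have R: "R = sqrt ((d / \<alpha>)\<^sup>2 + (cap_depth x - cap_depth y)\<^sup>2)"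
    unfolding R_def d_def by (rule cap_metric_eq[OF x(1) y(1)])
  have R1: "d / \<alpha> \<le> R" unfolding R by (rule real_sqrt_sum_squares_ge1)
  have R2: "\<bar>cap_depth x - cap_depth y\<bar> \<le> R"
    unfolding R using real_sqrt_sum_squares_ge2[of "\<bar>cap_depth x - cap_depth y\<bar>" "d / \<alpha>"] by simp
  have 1: "cap_lo ^ 3 * norm (perp e x - perp e y) \<le> 8 * R"
  proof -
    have "cap_lo ^ 3 * (\<alpha> / 4) * norm (perp e x - perp e y) \<le> cap_lo ^ 3 * \<kappa> * norm (perp e x - perp e y)"
      using cap_lo_pos kappa_bounds(1) by (intro mult_right_mono mult_left_mono) auto
    also have "\<dots> \<le> 2 * norm (capmap e \<kappa> x - capmap e \<kappa> y)" by (rule capmap_colipschitz[OF x(1) y(1)])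
    also have "\<dots> \<le> 2 * d" using geod_dist_chord(1)[OF nx] by (simp add: d_def)
    also have "\<dots> \<le> 2 * (\<alpha> * R)" using R1 al by (simp add: divide_le_eq mult.commute)
    finally have "(\<alpha> / 4) * (cap_lo ^ 3 * norm (perp e x - perp e y)) \<le> (\<alpha> / 4) * (8 * R)" by (simp add: mult_ac)
    then show ?thesis using al by simp
  qed
  have 2: "cap_lo ^ 3 * \<bar>x \<bullet> e - y \<bullet> e\<bar> \<le> 8 * R"
  proof -
    have "cap_lo ^ 3 * \<bar>x \<bullet> e - y \<bullet> e\<bar> \<le> cap_lo ^ 1 * \<bar>x \<bullet> e - y \<bullet> e\<bar>"
      using cap_lo_pos cap_lo_le by (intro mult_right_mono power_decreasing) auto
    also have "\<dots> \<le> 8 * \<bar>cap_depth x - cap_depth y\<bar>" using inner_e_diff(1)[OF x y] by simp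
    finally show ?thesis using R2 by simp
  qed
  have "norm (x - y) \<le> \<bar>x \<bullet> e - y \<bullet> e\<bar> + norm (perp e x - perp e y)"
  proof -
    have "x - y = (x \<bullet> e - y \<bullet> e) *\<^sub>R e + (perp e x - perp e y)" by (simp add: perp_def algebra_simps)
    then have "norm (x - y) \<le> norm ((x \<bullet> e - y \<bullet> e) *\<^sub>R e) + norm (perp e x - perp e y)"
      by (metis norm_triangle_ineq)
    then show ?thesis using e by simp
  qed
  then have "cap_lo ^ 3 * norm (x - y) \<le> cap_lo ^ 3 * (\<bar>x \<bullet> e - y \<bullet> e\<bar> + norm (perp e x - perp e y))"
    using cap_lo_pos by (intro mult_left_mono) auto
  also have "\<dots> \<le> 16 * R" using 1 2 by (simp add: distrib_left)
  finally show ?thesis by (simp add: R_def)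
qed

end

end

end

subsection \<open>The weighted oscillation inequality\<close>

lemma continuous_on_linear_fun: "linear f \<Longrightarrow> continuous_on S (f :: 'a :: euclidean_space \<Rightarrow> 'b :: real_normed_vector)"
  by (simp add: linear_continuous_on linear_conv_bounded_linear)

lemma integral_surface_rot:
  fixes a b :: "real ^ 'n"
  assumes "norm a = 1" "norm b = 1" "a \<bullet> b = 0" "continuous_on UNIV F"
  shows "(LINT x|surface_measure. F (rot a b t x)) = (LINT x|surface_measure. F x :: real)"
  using assms by (intro integral_surface_orthogonal orthogonal_transformation_rot borel_measurable_continuous_onI)

lemma continuous_on_comp_rot:
  assumes "continuous_on UNIV F"
  shows "continuous_on UNIV (\<lambda>x. F (rot a b t x))"
  by (rule continuous_on_compose2[OF assms]) (auto intro!: continuous_intros)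

text \<open>A rotation by \<open>t\<close> changes \<open>x \<bullet> e\<close> by at most
  \<open>2 * \<bar>t\<bar>\<close>. Thanks to the offset \<open>1 / N\<close> the weight at
  \<open>x\<close> is at most \<open>2 * (1 + N * \<bar>t\<bar>)\<close> times the weight at the
  rotated point, whereas the bare \<open>\<bar>x \<bullet> e\<bar>\<close> may vanish there;
  rotation invariance then removes the rotation. By \<open>sum_samp_wt\<close> each plane of the
  list costs 974848 = 2 * 487424.\<close>

lemma integral_avg_le:
  fixes e :: "real ^ 'n"
  assumes e: "norm e = 1" and N: "1 \<le> N"
    and F: "continuous_on UNIV F" "\<And>x. 0 \<le> F x"
    and L: "\<And>a b. (a, b) \<in> set L \<Longrightarrow> norm a = 1 \<and> norm b = 1 \<and> a \<bullet> b = 0"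
  shows "(LINT x|surface_measure. avg N L F x * (\<bar>x \<bullet> e\<bar> + 1 / real N))
    \<le> 974848 ^ length L * (LINT x|surface_measure. F x * (\<bar>x \<bullet> e\<bar> + 1 / real N))"
  using L F
proof (induction L arbitrary: F)
  case Nil
  then show ?case by simp
next
  case (Cons ab L)
  obtain a b where ab: "ab = (a, b)" by force
  have o: "norm a = 1" "norm b = 1" "a \<bullet> b = 0" using Cons.prems(1)[of a b] by (auto simp: ab)
  define w where "w x = \<bar>x \<bullet> e\<bar> + 1 / real N" for x
  have w: "continuous_on UNIV w" unfolding w_def by (intro continuous_intros)
  have w0: "0 \<le> w x" for x by (simp add: w_def)
  note Fc = Cons.prems(2)
  have Fr: "continuous_on UNIV (\<lambda>y. F (rot a b t y))" for t by (rule continuous_on_comp_rot[OF Fc])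
  define I where "I = (LINT x|surface_measure. F x * w x)"
  have I0: "0 \<le> I" unfolding I_def using Cons.prems(3) w0 by (intro Bochner_Integration.integral_nonneg) auto
  have step: "(LINT x|surface_measure. F (rot a b t x) * w x) \<le> 2 * (1 + real N * \<bar>t\<bar>) * I" for t
  proof -
    define H where "H x = F x * (2 * (1 + real N * \<bar>t\<bar>) * w x)" for x
    have H: "continuous_on UNIV H" unfolding H_def by (intro continuous_intros Fc w)
    have "(LINT x|surface_measure. F (rot a b t x) * w x) \<le> (LINT x|surface_measure. H (rot a b t x))"
    proof (rule integral_mono)
      show "integrable surface_measure (\<lambda>x. F (rot a b t x) * w x)"
        by (intro integrable_surface_continuous continuous_intros Fr w)
      show "integrable surface_measure (\<lambda>x. H (rot a b t x))"
        by (intro integrable_surface_continuous continuous_on_comp_rot H)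
      fix x :: "real ^ 'n" assume "x \<in> space surface_measure"
      then have x: "norm x = 1" by (simp add: space_surface_measure)
      have "\<bar>x \<bullet> e\<bar> \<le> \<bar>rot a b t x \<bullet> e\<bar> + \<bar>(rot a b t x - x) \<bullet> e\<bar>" by (simp add: inner_diff_left)
      also have "\<bar>(rot a b t x - x) \<bullet> e\<bar> \<le> norm (rot a b t x - x)"
        using Cauchy_Schwarz_ineq2[of "rot a b t x - x" e] e by simp
      also have "\<dots> \<le> 2 * \<bar>t\<bar>" using norm_rot_diff_le[OF o, of t x] x by simp
      finally have "w x \<le> w (rot a b t x) + 2 * \<bar>t\<bar>" by (simp add: w_def)
      also have "2 * \<bar>t\<bar> = 2 * real N * \<bar>t\<bar> * (1 / real N)" using N by simp
      also have "\<dots> \<le> 2 * real N * \<bar>t\<bar> * w (rot a b t x)" by (intro mult_left_mono) (auto simp: w_def)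
      finally have "w x \<le> w (rot a b t x) + 2 * real N * \<bar>t\<bar> * w (rot a b t x)" by simp
      also have "\<dots> \<le> 2 * (1 + real N * \<bar>t\<bar>) * w (rot a b t x)" using w0 by (simp add: algebra_simps)
      finally show "F (rot a b t x) * w x \<le> H (rot a b t x)"
        unfolding H_def using Cons.prems(3) by (intro mult_left_mono) auto
    qed
    also have "\<dots> = (LINT x|surface_measure. H x)" by (rule integral_surface_rot[OF o H])
    also have "\<dots> = (LINT x|surface_measure. 2 * (1 + real N * \<bar>t\<bar>) * (F x * w x))"
      unfolding H_def by (rule Bochner_Integration.integral_cong) (simp_all only: mult.left_commute)
    also have "\<dots> = 2 * (1 + real N * \<bar>t\<bar>) * I" unfolding I_def by (rule integral_mult_right_zero)
    finally show ?thesis .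
  qed
  have "(LINT x|surface_measure. avg N (ab # L) F x * w x)
     = (LINT x|surface_measure. (\<Sum>k\<in>samp_set N. samp_wt N k * (avg N L (\<lambda>y. F (rot a b (samp_node N k) y)) x * w x)))"
    unfolding ab avg.simps sum_distrib_right by (simp only: mult.assoc)
  also have "\<dots> = (\<Sum>k\<in>samp_set N. samp_wt N k * (LINT x|surface_measure. avg N L (\<lambda>y. F (rot a b (samp_node N k) y)) x * w x))"
    by (subst Bochner_Integration.integral_sum)
      (auto intro!: integrable_mult_right integrable_surface_continuous continuous_on_mult continuous_on_avg Fr w)
  also have "\<dots> \<le> (\<Sum>k\<in>samp_set N. samp_wt N k * (974848 ^ length L * (2 * (1 + real N * \<bar>samp_node N k\<bar>) * I)))"
  proof (intro sum_mono mult_left_mono samp_wt_nonneg)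
    fix k
    have "(LINT x|surface_measure. avg N L (\<lambda>y. F (rot a b (samp_node N k) y)) x * w x)
      \<le> 974848 ^ length L * (LINT x|surface_measure. F (rot a b (samp_node N k) x) * w x)"
      unfolding w_def by (rule Cons.IH) (use Cons.prems Fr in auto)
    also have "\<dots> \<le> 974848 ^ length L * (2 * (1 + real N * \<bar>samp_node N k\<bar>) * I)"
      by (intro mult_left_mono step) auto
    finally show "(LINT x|surface_measure. avg N L (\<lambda>y. F (rot a b (samp_node N k) y)) x * w x)
      \<le> 974848 ^ length L * (2 * (1 + real N * \<bar>samp_node N k\<bar>) * I)" .
  qed
  also have "\<dots> = (974848 ^ length L * 2 * I) * (\<Sum>k\<in>samp_set N. samp_wt N k * (1 + real N * \<bar>samp_node N k\<bar>))"
    by (simp only: sum_distrib_left mult_ac)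
  also have "\<dots> \<le> (974848 ^ length L * 2 * I) * 487424"
    using I0 by (intro mult_left_mono sum_samp_wt N) auto
  also have "\<dots> = 974848 ^ length (ab # L) * I" by simp
  finally show ?case by (simp only: w_def I_def)
qed

text \<open>A Schur type inequality. Near the equator \<open>x \<bullet> e = 0\<close> a polynomial of degree \<open>N\<close> is compared with its
  values at points rotated away from the equator by an angle of order \<open>1 / N\<close>.\<close>

lemma integral_poly_le_weighted:
  fixes e :: "real ^ 'n"
  assumes B: "onb B" "e \<in> B" and card: "card B = CARD('n)" and N: "1 \<le> N" and p: "poly_deg N p"
  shows "(LINT x|surface_measure. \<bar>p x\<bar>) \<le>
    15597568 * real CARD('n) ^ 3 * real N * (LINT x|surface_measure. \<bar>p x\<bar> * \<bar>x \<bullet> e\<bar>)"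
proof -
  define n where "n = CARD('n)"
  have n: "1 \<le> n" by (simp add: n_def Suc_le_eq)
  have fin: "finite B" using B by (simp add: onb_def)
  \<comment> \<open>Chosen so that \<open>8 * n\<^sup>2 * c * 487424 = 1/2\<close>: this is the
    total coefficient with which the unweighted integral reappears on the right, to be absorbed at
    the end.\<close>
  define c where "c = 1 / (16 * (real n)\<^sup>2 * 487424)"
  have c0: "0 < c" using n by (simp add: c_def)
  have n2: "1 \<le> (real n)\<^sup>2" "real n \<le> (real n)\<^sup>2" using n by (auto simp: power2_eq_square intro: mult_mono[of 1 "real n" 1 "real n", simplified])
  have c1: "8 * real n * c \<le> 1"
  proof -
    have "8 * real n * c = real n / (2 * (real n)\<^sup>2 * 487424)" by (simp add: c_def)
    also have "\<dots> \<le> 1"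
    proof -
      have "real n \<le> 2 * (real n)\<^sup>2 * 487424" "0 < 2 * (real n)\<^sup>2 * 487424" using n2 by linarith+
      then show ?thesis by (simp only: divide_le_eq_1_pos)
    qed
    finally show ?thesis .
  qed
  have c2: "c \<le> 1/2"
  proof -
    have "1 * c \<le> real n * c" using n c0 by (intro mult_right_mono) auto
    moreover have "8 * (real n * c) \<le> 1" using c1 by (simp only: mult.assoc)
    ultimately show ?thesis using c0 by linarith
  qed
  \<comment> \<open>The angle is just large enough to lift a point: if
    \<open>\<bar>x \<bullet> b\<bar> \<ge> 1 / (2 * n)\<close>, the rotation in the plane of
    \<open>e\<close> and \<open>b\<close> contributes at least
    \<open>s / (4 * n) = 2 * c / N\<close> to the height, of which the old height can cancel at most
    \<open>c / N\<close>.\<close>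
  define s where "s = 8 * real n * c / real N"
  have s0: "0 < s" using n c0 N by (simp add: s_def)
  have sN: "s * real N = 8 * real n * c" using N by (simp add: s_def)
  have s1: "s \<le> 1"
  proof -
    have "s * 1 \<le> s * real N" using s0 N by (intro mult_left_mono) auto
    then show ?thesis using sN c1 by simp
  qed
  have sins: "s / 2 \<le> sin s"
  proof -
    have "s / (pi / 2) * sin (pi / 2) \<le> sin s" using s0 s1 pi_gt3 by (intro sin_ge_chord) auto
    moreover have "s / 2 \<le> s / (pi / 2)" using s0 pi_less_4 by (intro divide_left_mono) auto
    ultimately show ?thesis by simp
  qed
  have pc: "continuous_on UNIV p" by (rule continuous_on_poly_deg[OF p])
  define q where "q x = \<bar>p x\<bar> * \<bar>x \<bullet> e\<bar>" for x
  have qc: "continuous_on UNIV q" unfolding q_def by (intro continuous_intros pc)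
  have q0: "0 \<le> q x" for x by (simp add: q_def)
  have ac: "continuous_on UNIV (\<lambda>x. \<bar>p x\<bar>)" by (intro continuous_intros pc)
  define R where "R b x = real N / c * q (rot e b s x)
    + 8 * real n * c * (\<Sum>k\<in>samp_set N. samp_wt N k * \<bar>p (rot e b (samp_node N k) x)\<bar>)" for b x
  have R0: "0 \<le> R b x" for b x
    unfolding R_def using c0 q0 by (intro add_nonneg_nonneg mult_nonneg_nonneg sum_nonneg samp_wt_nonneg) auto
  have ob: "norm e = 1" "norm b = 1" "e \<bullet> b = 0" if "b \<in> B - {e}" for b
    using that onb_norm[OF B(1)] onb_orth[OF B(1)] B by auto
  have pw: "\<bar>p x\<bar> \<le> real N / c * q x + (\<Sum>b\<in>B - {e}. R b x)" if x: "norm x = 1" for x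
  proof (cases "c / real N \<le> \<bar>x \<bullet> e\<bar>")
    case True
    have "\<bar>p x\<bar> * 1 \<le> \<bar>p x\<bar> * (real N / c * \<bar>x \<bullet> e\<bar>)"
      using True c0 N by (intro mult_left_mono) (auto simp: field_simps)
    moreover have "0 \<le> (\<Sum>b\<in>B - {e}. R b x)" by (intro sum_nonneg R0)
    ultimately show ?thesis by (simp add: q_def mult_ac)
  next
    case False
    have "c / real N \<le> c / 1" using c0 N by (intro divide_left_mono) auto
    then have xe: "\<bar>x \<bullet> e\<bar> \<le> 1/2" using False c2 by simp
    have "(x \<bullet> e)\<^sup>2 \<le> (1/2)\<^sup>2" using xe by (metis abs_ge_zero power2_abs power_mono)
    then have xe2: "(x \<bullet> e)\<^sup>2 \<le> 1/4" by (simp add: power_divide)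
    have "(\<Sum>b\<in>B. (x \<bullet> b)\<^sup>2) = 1" using onb_norm_power2[OF B(1), of x] x by simp
    then have sb: "3/4 \<le> (\<Sum>b\<in>B - {e}. (x \<bullet> b)\<^sup>2)" using xe2 fin B by (simp add: sum.remove[of B e])
    \<comment> \<open>Close to the equator the other coordinates carry at least 3/4 of the squared
      norm, so they cannot all be below \<open>1 / (2 * n)\<close>.\<close>
    have "\<exists>b\<in>B - {e}. 1 / (2 * real n) \<le> \<bar>x \<bullet> b\<bar>"
    proof (rule ccontr)
      assume *: "\<not> ?thesis"
      have "(\<Sum>b\<in>B - {e}. (x \<bullet> b)\<^sup>2) \<le> (\<Sum>b\<in>B - {e}. (1 / (2 * real n))\<^sup>2)"
        using * by (intro sum_mono) (metis abs_ge_zero less_imp_le not_le power2_abs power_mono)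
      also have "\<dots> \<le> real n * (1 / (2 * real n))\<^sup>2"
        using card fin B by (auto simp: n_def intro!: mult_right_mono)
      also have "\<dots> \<le> 1/4" using n by (simp add: power2_eq_square field_simps)
      finally show False using sb by simp
    qed
    then obtain b where b: "b \<in> B - {e}" "1 / (2 * real n) \<le> \<bar>x \<bullet> b\<bar>" by blast
    define y where "y = rot e b s x"
    have "c / real N \<le> \<bar>y \<bullet> e\<bar>"
    proof -
      have "s / 2 * (1 / (2 * real n)) \<le> \<bar>sin s * (x \<bullet> b)\<bar>" unfolding abs_mult using sins s0 b n by (intro mult_mono) auto
      moreover have "s / 2 * (1 / (2 * real n)) = 2 * (c / real N)" using n by (simp add: s_def)
      moreover have "\<bar>cos s * (x \<bullet> e)\<bar> \<le> 1 * \<bar>x \<bullet> e\<bar>" unfolding abs_mult by (intro mult_right_mono) auto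
      moreover have "\<bar>v\<bar> - \<bar>u\<bar> \<le> \<bar>u - v\<bar>" for u v :: real by simp
      moreover have "y \<bullet> e = cos s * (x \<bullet> e) - sin s * (x \<bullet> b)"
        unfolding y_def by (rule inner_rot_fst[OF ob[OF b(1)]])
      ultimately show ?thesis using False by smt
    qed
    then have "\<bar>p y\<bar> * 1 \<le> \<bar>p y\<bar> * (real N / c * \<bar>y \<bullet> e\<bar>)"
      using c0 N by (intro mult_left_mono) (auto simp: field_simps)
    then have py: "\<bar>p y\<bar> \<le> real N / c * q y" by (simp add: q_def mult_ac)
    have sa: "\<bar>s\<bar> * real N \<le> 1" "real N * \<bar>s\<bar> = 8 * real n * c" using s0 sN c1 by (auto simp: mult.commute)
    have "\<bar>p y - p x\<bar> \<le> 8 * real n * c * (\<Sum>k\<in>samp_set N. samp_wt N k * \<bar>p (rot e b (samp_node N k) x)\<bar>)"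
      using poly_rot_sampling(2)[OF N p sa(1), of e b x] unfolding sa(2) y_def .
    with py have "\<bar>p x\<bar> \<le> R b x" by (simp add: R_def y_def)
    also have "R b x \<le> (\<Sum>b\<in>B - {e}. R b x)" using fin b(1) R0 by (intro member_le_sum) auto
    finally have "\<bar>p x\<bar> \<le> (\<Sum>b\<in>B - {e}. R b x)" .
    moreover have "0 \<le> real N / c * q x" using c0 q0 by simp
    ultimately show ?thesis by linarith
  qed
  have Rc: "continuous_on UNIV (R b)" for b
    unfolding R_def by (intro continuous_intros continuous_on_comp_rot[OF qc] continuous_on_comp_rot[OF ac])
  define P where "P = (LINT x|surface_measure. \<bar>p x\<bar>)"
  define Q where "Q = (LINT x|surface_measure. q x)"
  have P0: "0 \<le> P" unfolding P_def by (rule Bochner_Integration.integral_nonneg) auto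
  have IR: "(LINT x|surface_measure. R b x) \<le> real N / c * Q + 8 * real n * c * (487424 * P)" if b: "b \<in> B - {e}" for b
  proof -
    have i1: "integrable surface_measure (\<lambda>x. samp_wt N k * \<bar>p (rot e b (samp_node N k) x)\<bar>)" for k
      by (intro integrable_surface_continuous continuous_intros continuous_on_comp_rot[OF ac])
    have i2: "integrable surface_measure (\<lambda>x. q (rot e b s x))"
      by (intro integrable_surface_continuous continuous_on_comp_rot[OF qc])
    have "(LINT x|surface_measure. R b x) = real N / c * (LINT x|surface_measure. q (rot e b s x))
      + 8 * real n * c * (\<Sum>k\<in>samp_set N. samp_wt N k * (LINT x|surface_measure. \<bar>p (rot e b (samp_node N k) x)\<bar>))"
    proof -
      have "(LINT x|surface_measure. (\<Sum>k\<in>samp_set N. samp_wt N k * \<bar>p (rot e b (samp_node N k) x)\<bar>))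
        = (\<Sum>k\<in>samp_set N. samp_wt N k * (LINT x|surface_measure. \<bar>p (rot e b (samp_node N k) x)\<bar>))"
        by (subst Bochner_Integration.integral_sum[OF i1]) simp
      moreover have "(LINT x|surface_measure. R b x) = (LINT x|surface_measure. real N / c * q (rot e b s x))
        + (LINT x|surface_measure. 8 * real n * c * (\<Sum>k\<in>samp_set N. samp_wt N k * \<bar>p (rot e b (samp_node N k) x)\<bar>))"
        unfolding R_def
        by (intro Bochner_Integration.integral_add integrable_mult_right Bochner_Integration.integrable_sum i1 i2)
      ultimately show ?thesis by (simp only: integral_mult_right_zero)
    qed
    also have "\<dots> = real N / c * Q + 8 * real n * c * ((\<Sum>k\<in>samp_set N. samp_wt N k) * P)"
      using integral_surface_rot[OF ob[OF b] qc] integral_surface_rot[OF ob[OF b] ac]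
      by (simp add: P_def Q_def sum_distrib_right)
    also have "\<dots> \<le> real N / c * Q + 8 * real n * c * (487424 * P)"
    proof -
      have "(\<Sum>k\<in>samp_set N. samp_wt N k) \<le> (\<Sum>k\<in>samp_set N. samp_wt N k * (1 + real N * \<bar>samp_node N k\<bar>))"
        using samp_wt_nonneg by (intro sum_mono) (simp add: distrib_left)
      also have "\<dots> \<le> 487424" by (rule sum_samp_wt[OF N])
      finally show ?thesis using c0 P0 by (intro add_left_mono mult_left_mono mult_right_mono) auto
    qed
    finally show ?thesis .
  qed
  have "P \<le> (LINT x|surface_measure. real N / c * q x + (\<Sum>b\<in>B - {e}. R b x))"
    unfolding P_def
  proof (rule integral_mono)
    show "integrable surface_measure (\<lambda>x. \<bar>p x\<bar>)" by (rule integrable_surface_continuous[OF ac])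
    show "integrable surface_measure (\<lambda>x. real N / c * q x + (\<Sum>b\<in>B - {e}. R b x))"
      by (intro integrable_surface_continuous continuous_on_add continuous_on_mult continuous_on_const continuous_on_sum qc Rc)
    fix x :: "real ^ 'n" assume "x \<in> space surface_measure"
    then show "\<bar>p x\<bar> \<le> real N / c * q x + (\<Sum>b\<in>B - {e}. R b x)"
      by (intro pw) (simp add: space_surface_measure)
  qed
  also have "\<dots> = real N / c * Q + (\<Sum>b\<in>B - {e}. (LINT x|surface_measure. R b x))"
  proof -
    have i1: "integrable surface_measure (R b)" for b by (rule integrable_surface_continuous[OF Rc])
    have "(LINT x|surface_measure. real N / c * q x + (\<Sum>b\<in>B - {e}. R b x))
      = (LINT x|surface_measure. real N / c * q x) + (LINT x|surface_measure. (\<Sum>b\<in>B - {e}. R b x))"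
      by (intro Bochner_Integration.integral_add integrable_mult_right Bochner_Integration.integrable_sum i1
          integrable_surface_continuous[OF qc])
    then show ?thesis unfolding Q_def by (simp only: integral_mult_right_zero Bochner_Integration.integral_sum[OF i1])
  qed
  also have "\<dots> \<le> real N / c * Q + (\<Sum>b\<in>B - {e}. real N / c * Q + 8 * real n * c * (487424 * P))"
    by (intro add_left_mono sum_mono IR)
  also have "\<dots> = real N / c * Q + real (n - 1) * (real N / c * Q + 8 * real n * c * (487424 * P))"
    using card fin B by (simp add: n_def)
  also have "\<dots> \<le> real n * (real N / c * Q) + real n * (8 * real n * c * (487424 * P))"
  proof -
    have "real (n - 1) = real n - 1" using n by (simp add: of_nat_diff)
    moreover have "0 \<le> 8 * real n * c * (487424 * P)" using c0 P0 by simp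
    moreover have "a + (k - 1) * (a + b) \<le> k * a + k * b" if "0 \<le> b" for a b k :: real
      using that by (simp add: algebra_simps)
    ultimately show ?thesis by presburger
  qed
  also have "real n * (8 * real n * c * (487424 * P)) = P / 2"
  proof -
    have "real n * (8 * real n * c * (487424 * P)) = (8 * (real n)\<^sup>2 * 487424 * c) * P" by (simp add: power2_eq_square)
    also have "8 * (real n)\<^sup>2 * 487424 * c = 1/2" using n by (simp add: c_def)
    finally show ?thesis by simp
  qed
  finally have "P \<le> 2 * (real n * (real N / c * Q))" by simp
  also have "\<dots> = 15597568 * real n ^ 3 * real N * Q"
    by (simp add: c_def power2_eq_square power3_eq_cube)
  finally show ?thesis by (simp add: P_def Q_def q_def n_def)
qed

text \<open>Keeps the \<open>e\<close> component and negates the orthogonal one. It separates the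
  two summands of a pulled back polynomial by parity.\<close>

definition refl_perp :: "'a :: euclidean_space \<Rightarrow> 'a \<Rightarrow> 'a" where
  "refl_perp e x = - reflect e x"

lemma continuous_on_perp: "continuous_on S (perp e)"
  by (rule continuous_on_linear_fun[OF linear_perp])

lemma continuous_on_cfac: "continuous_on S (cfac e \<kappa>)"
  unfolding cfac_def[abs_def] by (intro continuous_intros continuous_on_perp)

lemma continuous_on_capmap: "continuous_on S (capmap e \<kappa>)"
  unfolding capmap_def[abs_def] by (intro continuous_intros continuous_on_perp continuous_on_cfac)

lemma poly_deg_norm_perp: "poly_deg 2 (\<lambda>x :: 'a :: euclidean_space. (norm (perp e x))\<^sup>2)"
proof -
  have l: "poly_deg 1 (\<lambda>x. perp e x \<bullet> b)" for b :: 'a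
    by (rule poly_deg_linear[OF poly_deg.lin linear_perp]) simp
  have "poly_deg 2 (\<lambda>x. \<Sum>b\<in>Basis. (perp e x \<bullet> b) * (perp e x \<bullet> b))"
    by (intro poly_deg_sum poly_deg.mult[OF l l]) auto
  then show ?thesis by (simp add: power2_norm_eq_inner euclidean_inner[of "perp e _" "perp e _"])
qed

text \<open>A polynomial of degree \<open>m\<close> pulled back to the hemisphere splits as \<open>p + cfac * q\<close> with polynomials \<open>p\<close>,
  even, and \<open>q\<close>, odd in the component orthogonal to \<open>e\<close>, so that both are bounded by averaging
  the pullback over \<open>refl_perp\<close>.\<close>

definition splits :: "'a :: euclidean_space \<Rightarrow> real \<Rightarrow> nat \<Rightarrow> ('a \<Rightarrow> real) \<Rightarrow> bool" where
  "splits e \<kappa> m F \<longleftrightarrow> (\<exists>p q. poly_deg m p \<and> poly_deg m q \<and>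
    (\<forall>x. p (reflect e x) = p x \<and> q (reflect e x) = q x \<and> p (refl_perp e x) = p x \<and> q (refl_perp e x) = - q x) \<and>
    (\<forall>x. norm x = 1 \<longrightarrow> F (capmap e \<kappa> x) = p x + cfac e \<kappa> x * q x))"

lemma splitsI:
  assumes "poly_deg m p" "poly_deg m q"
    "\<And>x. p (reflect e x) = p x" "\<And>x. q (reflect e x) = q x"
    "\<And>x. p (refl_perp e x) = p x" "\<And>x. q (refl_perp e x) = - q x"
    "\<And>x. norm x = 1 \<Longrightarrow> F (capmap e \<kappa> x) = p x + cfac e \<kappa> x * q x"
  shows "splits e \<kappa> m F"
  using assms unfolding splits_def by blast

lemma splits_const: "splits e \<kappa> m (\<lambda>x. c)"
  by (rule splitsI[where p = "\<lambda>x. c" and q = "\<lambda>x. 0"]) (auto intro: poly_deg.const)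

lemma splits_add:
  assumes "splits e \<kappa> m F" "splits e \<kappa> m G"
  shows "splits e \<kappa> m (\<lambda>x. F x + G x)"
proof -
  obtain p q where pq: "poly_deg m p" "poly_deg m q"
    "\<And>x. p (reflect e x) = p x" "\<And>x. q (reflect e x) = q x"
    "\<And>x. p (refl_perp e x) = p x" "\<And>x. q (refl_perp e x) = - q x"
    "\<And>x. norm x = 1 \<Longrightarrow> F (capmap e \<kappa> x) = p x + cfac e \<kappa> x * q x"
    using assms(1) unfolding splits_def by blast
  obtain p' q' where pq': "poly_deg m p'" "poly_deg m q'"
    "\<And>x. p' (reflect e x) = p' x" "\<And>x. q' (reflect e x) = q' x"
    "\<And>x. p' (refl_perp e x) = p' x" "\<And>x. q' (refl_perp e x) = - q' x"
    "\<And>x. norm x = 1 \<Longrightarrow> G (capmap e \<kappa> x) = p' x + cfac e \<kappa> x * q' x"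
    using assms(2) unfolding splits_def by blast
  show ?thesis
    by (rule splitsI[where p = "\<lambda>x. p x + p' x" and q = "\<lambda>x. q x + q' x"])
      (use pq pq' in \<open>auto intro: poly_deg.add simp: algebra_simps\<close>)
qed

lemma splits_cmult:
  assumes "splits e \<kappa> m F"
  shows "splits e \<kappa> m (\<lambda>x. c * F x)"
proof -
  obtain p q where pq: "poly_deg m p" "poly_deg m q"
    "\<And>x. p (reflect e x) = p x" "\<And>x. q (reflect e x) = q x"
    "\<And>x. p (refl_perp e x) = p x" "\<And>x. q (refl_perp e x) = - q x"
    "\<And>x. norm x = 1 \<Longrightarrow> F (capmap e \<kappa> x) = p x + cfac e \<kappa> x * q x"
    using assms(1) unfolding splits_def by blast
  show ?thesis
    by (rule splitsI[where p = "\<lambda>x. c * p x" and q = "\<lambda>x. c * q x"])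
      (use pq in \<open>auto intro: poly_deg_cmult simp: algebra_simps\<close>)
qed

lemma splits_mono: "splits e \<kappa> m F \<Longrightarrow> m \<le> k \<Longrightarrow> splits e \<kappa> k F"
  unfolding splits_def by (meson poly_deg_mono)

lemma splits_sum:
  "finite A \<Longrightarrow> (\<And>k. k \<in> A \<Longrightarrow> splits e \<kappa> m (f k)) \<Longrightarrow> splits e \<kappa> m (\<lambda>x. \<Sum>k\<in>A. f k x)"
  by (induction A rule: finite_induct) (auto intro: splits_const splits_add)

context
  fixes e :: "'a :: euclidean_space" and \<kappa> :: real
  assumes e: "norm e = 1" and \<kappa>: "0 < \<kappa>" "\<kappa> < 1"
begin

lemma perp_refl_perp: "perp e (refl_perp e x) = - perp e x"
  using perp_reflect[OF e, of x] linear_neg[OF linear_perp, of e "reflect e x"] by (simp add: refl_perp_def)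

lemma orthogonal_refl_perp: "orthogonal_transformation (refl_perp e)"
  using orthogonal_reflect[OF e] unfolding orthogonal_transformation_def refl_perp_def[abs_def]
  by (simp add: linear_compose_neg)

text \<open>A linear form pulls back to \<open>p0 + cfac * q0\<close> with \<open>p0\<close> of
  degree 2 and even, \<open>q0\<close> of degree 1 and odd, and on the sphere the square of
  \<open>cfac\<close> is the polynomial \<open>s\<close> of degree 2. Multiplying out, the worst
  term \<open>s * q * q0\<close> raises the degree by 3, and the parities persist.\<close>

lemma splits_mult_inner:
  assumes "splits e \<kappa> m F"
  shows "splits e \<kappa> (m + 3) (\<lambda>x. F x * (x \<bullet> a))"
proof -
  obtain p q where pq: "poly_deg m p" "poly_deg m q"
    "\<And>x. p (reflect e x) = p x" "\<And>x. q (reflect e x) = q x"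
    "\<And>x. p (refl_perp e x) = p x" "\<And>x. q (refl_perp e x) = - q x"
    "\<And>x. norm x = 1 \<Longrightarrow> F (capmap e \<kappa> x) = p x + cfac e \<kappa> x * q x"
    using assms(1) unfolding splits_def by blast
  define s where "s x = 1 + (- \<kappa>\<^sup>2) * (norm (perp e x))\<^sup>2" for x
  define p0 where "p0 x = (e \<bullet> a) * (1 + (- 2 * \<kappa>\<^sup>2) * (norm (perp e x))\<^sup>2)" for x
  define q0 where "q0 x = (2 * \<kappa>) * (perp e x \<bullet> a)" for x
  have s: "poly_deg 2 s" unfolding s_def[abs_def]
    by (intro poly_deg.add poly_deg.const poly_deg_cmult poly_deg_norm_perp)
  have p0: "poly_deg 2 p0" unfolding p0_def[abs_def]
    by (intro poly_deg.add poly_deg.const poly_deg_cmult poly_deg_norm_perp)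
  have q0: "poly_deg 1 q0" unfolding q0_def[abs_def]
    by (intro poly_deg_cmult poly_deg_linear[OF poly_deg.lin linear_perp]) simp
  have sq: "poly_deg (m + 2) (\<lambda>x. s x * q x)" by (rule poly_deg.mult[OF s pq(2)]) simp
  show ?thesis
  proof (rule splitsI[where p = "\<lambda>x. p x * p0 x + (s x * q x) * q0 x" and q = "\<lambda>x. p x * q0 x + q x * p0 x"])
    show "poly_deg (m + 3) (\<lambda>x. p x * p0 x + s x * q x * q0 x)"
      by (rule poly_deg.add[OF poly_deg.mult[OF pq(1) p0] poly_deg.mult[OF sq q0]]) auto
    show "poly_deg (m + 3) (\<lambda>x. p x * q0 x + q x * p0 x)"
      by (rule poly_deg.add[OF poly_deg.mult[OF pq(1) q0] poly_deg.mult[OF pq(2) p0]]) auto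
    fix x :: 'a
    have r: "s (reflect e x) = s x" "p0 (reflect e x) = p0 x" "q0 (reflect e x) = q0 x"
      by (simp_all add: s_def p0_def q0_def perp_reflect[OF e])
    have r': "s (refl_perp e x) = s x" "p0 (refl_perp e x) = p0 x" "q0 (refl_perp e x) = - q0 x"
      by (simp_all add: s_def p0_def q0_def perp_refl_perp)
    show "p (reflect e x) * p0 (reflect e x) + s (reflect e x) * q (reflect e x) * q0 (reflect e x) = p x * p0 x + s x * q x * q0 x"
      "p (reflect e x) * q0 (reflect e x) + q (reflect e x) * p0 (reflect e x) = p x * q0 x + q x * p0 x"
      "p (refl_perp e x) * p0 (refl_perp e x) + s (refl_perp e x) * q (refl_perp e x) * q0 (refl_perp e x) = p x * p0 x + s x * q x * q0 x"
      "p (refl_perp e x) * q0 (refl_perp e x) + q (refl_perp e x) * p0 (refl_perp e x) = - (p x * q0 x + q x * p0 x)"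
      by (simp_all add: r r' pq)
    assume x: "norm x = 1"
    define c where "c = cfac e \<kappa> x"
    have c: "c * c = s x" using cfac_bounds(4)[OF e \<kappa>, of x] x by (simp add: c_def s_def power2_eq_square)
    have "capmap e \<kappa> x \<bullet> a = p0 x + c * q0 x"
      by (simp add: capmap_def inner_add_left p0_def q0_def c_def algebra_simps)
    then have "F (capmap e \<kappa> x) * (capmap e \<kappa> x \<bullet> a) = (p x + c * q x) * (p0 x + c * q0 x)"
      using pq(7)[OF x] by (simp add: c_def)
    also have "\<dots> = p x * p0 x + (c * c) * q x * q0 x + c * (p x * q0 x + q x * p0 x)"
      by (simp add: algebra_simps)
    finally show "F (capmap e \<kappa> x) * (capmap e \<kappa> x \<bullet> a) =
      p x * p0 x + s x * q x * q0 x + cfac e \<kappa> x * (p x * q0 x + q x * p0 x)"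
      by (simp only: c) (simp only: c_def)
  qed
qed

lemma splits_mult_inner_power:
  assumes "splits e \<kappa> m F"
  shows "splits e \<kappa> (m + 3 * k) (\<lambda>x. F x * (x \<bullet> a) ^ k)"
proof (induction k)
  case 0
  then show ?case using assms by simp
next
  case (Suc k)
  from splits_mult_inner[OF Suc, of a] show ?case by (simp add: algebra_simps)
qed

end

lemma splits_monomial:
  fixes e :: "real ^ 'n"
  assumes e: "norm e = 1" and \<kappa>: "0 < \<kappa>" "\<kappa> < 1"
  shows "splits e \<kappa> (3 * (\<Sum>i\<in>UNIV. k i)) (\<lambda>x. \<Prod>i\<in>UNIV. (x $ i) ^ k i)"
proof -
  have "splits e \<kappa> (3 * (\<Sum>i\<in>A. k i)) (\<lambda>x. \<Prod>i\<in>A. (x $ i) ^ k i)" if "finite A" for A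
    using that
  proof induction
    case empty
    then show ?case using splits_const by simp
  next
    case (insert i A)
    from splits_mult_inner_power[OF e \<kappa> insert.IH, of "k i" "axis i 1"] insert.hyps
    show ?case by (simp add: inner_axis algebra_simps)
  qed
  then show ?thesis by simp
qed

text \<open>A representative on the whole space: members of \<open>spherical_polys\<close> are
  arbitrary off the sphere, while this function is continuous and linear in
  \<open>c\<close>.\<close>

definition multi_poly :: "nat \<Rightarrow> (('n \<Rightarrow> nat) \<Rightarrow> real) \<Rightarrow> real ^ 'n \<Rightarrow> real" where
  "multi_poly n c x = (\<Sum>k | (\<Sum>i\<in>UNIV. k i) \<le> n. c k * (\<Prod>i\<in>UNIV. (x $ i) ^ k i))"

lemma spherical_polys_iff: "f \<in> spherical_polys n \<longleftrightarrow> (\<exists>c. \<forall>x. norm x = 1 \<longrightarrow> f x = multi_poly n c x)"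
  by (auto simp: spherical_polys_def multi_poly_def)

lemma continuous_on_multi_poly: "continuous_on S (multi_poly n c)"
  unfolding multi_poly_def[abs_def] by (intro continuous_intros)

lemma splits_multi_poly:
  fixes e :: "real ^ 'n"
  assumes e: "norm e = 1" and \<kappa>: "0 < \<kappa>" "\<kappa> < 1"
  shows "splits e \<kappa> (3 * n) (multi_poly n c)"
  unfolding multi_poly_def[abs_def]
proof (rule splits_sum[OF finite_multi_indices splits_cmult])
  fix k :: "'n \<Rightarrow> nat" assume "k \<in> {k. (\<Sum>i\<in>UNIV. k i) \<le> n}"
  then show "splits e \<kappa> (3 * n) (\<lambda>x. \<Prod>i\<in>UNIV. (x $ i) ^ k i)"
    by (intro splits_mono[OF splits_monomial[OF e \<kappa>, of k]]) auto
qed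

text \<open>The Marcinkiewicz--Zygmund inequality on the cap, in the coordinates of \<open>capmap\<close>.\<close>

lemma MZ_oscillation:
  fixes \<epsilon> :: real
  assumes eps: "0 < \<epsilon>" "\<epsilon> < 1"
  shows "\<exists>C\<ge>1. \<forall>(e :: real ^ 'n) \<alpha> n c. norm e = 1 \<longrightarrow> 0 < \<alpha> \<longrightarrow> \<alpha> \<le> pi - \<epsilon> \<longrightarrow> 1 \<le> n \<longrightarrow>
    (\<exists>W. continuous_on UNIV W \<and>
      (\<forall>x y \<eta>. norm x = 1 \<longrightarrow> norm y = 1 \<longrightarrow> norm (x - y) \<le> \<eta> \<longrightarrow> C * \<eta> * real n \<le> 1 \<longrightarrow>
        \<bar>multi_poly n c (capmap e (sin (\<alpha> / 2)) y) - multi_poly n c (capmap e (sin (\<alpha> / 2)) x)\<bar> \<le> \<eta> * real n * W x) \<and>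
      (LINT x|surface_measure. \<bar>x \<bullet> e\<bar> * W x) \<le>
        C * (LINT x|surface_measure. \<bar>x \<bullet> e\<bar> * \<bar>multi_poly n c (capmap e (sin (\<alpha> / 2)) x)\<bar>))"
proof -
  define d where "d = CARD('n)"
  define m where "m = cap_lo \<epsilon>"
  have m: "0 < m" "m \<le> 1" using cap_lo_pos[OF eps] cap_lo_le[OF eps] by (auto simp: m_def)
  have d: "1 \<le> d" by (simp add: d_def Suc_le_eq)
  define A where "A = real d * (24 * (real d)\<^sup>2 * 974848 ^ d) + 6 / m"
  define S where "S = 1 + 15597568 * real d ^ 3"
  have A0: "0 \<le> A" using m by (simp add: A_def)
  have S0: "1 \<le> S" by (simp add: S_def)
  \<comment> \<open>192 is 64 times the degree factor 3, so that the smallness assumption implies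
    that of \<open>poly_osc_le\<close>; the last entry is the constant of the integral
    estimate.\<close>
  define C where "C = max (192 * (real d)\<^sup>2) (max 1 (A * S * (1 + 1 / m)))"
  show ?thesis
  proof (intro exI[of _ C] conjI allI impI)
    show "1 \<le> C" by (simp add: C_def)
    fix e :: "real ^ 'n" and \<alpha> :: real and n :: nat and c
    assume e: "norm e = 1" and al: "0 < \<alpha>" "\<alpha> \<le> pi - \<epsilon>" and n: "1 \<le> n"
    define \<kappa> where "\<kappa> = sin (\<alpha> / 2)"
    note kb = kappa_bounds[OF eps al \<kappa>_def]
    have \<kappa>: "0 < \<kappa>" "\<kappa> < 1" using kb by auto
    define F where "F x = multi_poly n c (capmap e \<kappa> x)" for x
    have Fc: "continuous_on UNIV F"
      unfolding F_def by (rule continuous_on_compose2[OF continuous_on_multi_poly continuous_on_capmap]) auto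
    define N where "N = 3 * n"
    have N: "1 \<le> N" using n by (simp add: N_def)
    obtain p q where pq: "poly_deg N p" "poly_deg N q"
      "\<And>x. p (reflect e x) = p x" "\<And>x. q (reflect e x) = q x"
      "\<And>x. p (refl_perp e x) = p x" "\<And>x. q (refl_perp e x) = - q x"
      "\<And>x. norm x = 1 \<Longrightarrow> F x = p x + cfac e \<kappa> x * q x"
      using splits_multi_poly[OF e \<kappa>, of n c] unfolding splits_def F_def N_def by blast
    have pc: "continuous_on UNIV p" "continuous_on UNIV q" using continuous_on_poly_deg pq by auto
    obtain B where B: "onb B" "e \<in> B" "card B = CARD('n)" using onb_exists[OF e] by (auto simp: d_def)
    define V where "V g x = (\<Sum>j\<in>B. avg N (pivot_list B j) (\<lambda>x. \<bar>g x\<bar>) x)" for g x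
    have Vc: "continuous_on UNIV (V g)" if "continuous_on UNIV g" for g
      unfolding V_def by (intro continuous_on_sum continuous_on_avg continuous_on_rabs that)
    have V0: "0 \<le> V g x" for g x unfolding V_def by (intro sum_nonneg avg_nonneg) auto
    \<comment> \<open>Majorant for the variation of \<open>p + cfac * q\<close>: \<open>V p\<close>
      and \<open>V q\<close> account for the polynomials, the last term for the Lipschitz variation
      of \<open>cfac\<close> multiplied by \<open>q\<close>.\<close>
    define W where "W x = 24 * (real d)\<^sup>2 * (V p x + V q x) + 6 / m * \<bar>q x\<bar>" for x
    have Wc: "continuous_on UNIV W" unfolding W_def by (intro continuous_intros Vc pc)
    have W0: "0 \<le> W x" for x unfolding W_def using m V0 by (intro add_nonneg_nonneg mult_nonneg_nonneg) auto
    have cf: "cfac e \<kappa> x \<le> 1" "m \<le> cfac e \<kappa> x" if "norm x = 1" for x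
      using cfac_bounds[OF e \<kappa>, of x] kb(5) that by (auto simp: m_def)
    have osc: "\<bar>F y - F x\<bar> \<le> \<eta> * real n * W x"
      if x: "norm x = 1" and y: "norm y = 1" and xy: "norm (x - y) \<le> \<eta>" and \<eta>: "C * \<eta> * real n \<le> 1" for x y \<eta>
    proof -
      have \<eta>0: "0 \<le> \<eta>" using xy norm_ge_zero order_trans by blast
      have "192 * (real d)\<^sup>2 * \<eta> * real n \<le> C * \<eta> * real n"
        using \<eta>0 by (intro mult_right_mono) (auto simp: C_def)
      then have small: "64 * (real (card B))\<^sup>2 * \<eta> * real N \<le> 1" using \<eta> by (simp add: N_def B(3) d_def mult_ac)
      have op: "\<bar>g y - g x\<bar> \<le> \<eta> * real n * (24 * (real d)\<^sup>2 * V g x)" if "poly_deg N g" for g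
        using poly_osc_le[OF B(1) x y xy small N that] by (simp add: V_def N_def B(3) d_def mult_ac)
      have cd: "\<bar>cfac e \<kappa> y - cfac e \<kappa> x\<bar> \<le> \<eta> * real n * (6 / m)"
      proof -
        have "m * \<bar>cfac e \<kappa> y - cfac e \<kappa> x\<bar> \<le> 2 * norm (perp e y - perp e x)"
          unfolding m_def by (rule cfac_diff(2)[OF eps al \<kappa>_def e y x])
        also have "norm (perp e y - perp e x) \<le> norm (y - x)"
          using norm_perp_le[OF e, of "y - x"] by (simp add: linear_diff[OF linear_perp])
        also have "norm (y - x) \<le> \<eta>" using xy by (simp add: norm_minus_commute)
        finally have "m * \<bar>cfac e \<kappa> y - cfac e \<kappa> x\<bar> \<le> 2 * \<eta>" by simp
        also have "\<dots> \<le> 6 * \<eta> * real n" using \<eta>0 n mult_mono[of "2 * \<eta>" "6 * \<eta>" 1 "real n"] by simp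
        finally show ?thesis using m by (simp add: pos_le_divide_eq mult_ac)
      qed
      have "F y - F x = (p y - p x) + cfac e \<kappa> y * (q y - q x) + (cfac e \<kappa> y - cfac e \<kappa> x) * q x"
        using pq(7)[OF x] pq(7)[OF y] by (simp add: algebra_simps)
      then have "\<bar>F y - F x\<bar> \<le> \<bar>p y - p x\<bar> + \<bar>cfac e \<kappa> y * (q y - q x)\<bar> + \<bar>(cfac e \<kappa> y - cfac e \<kappa> x) * q x\<bar>"
        by linarith
      also have "\<dots> \<le> \<eta> * real n * (24 * (real d)\<^sup>2 * V p x) + 1 * (\<eta> * real n * (24 * (real d)\<^sup>2 * V q x))
          + \<eta> * real n * (6 / m) * \<bar>q x\<bar>"
        unfolding abs_mult using cf[OF y] m(1) \<eta>0
        by (intro add_mono mult_mono op pq cd order_refl) auto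
      also have "\<dots> = \<eta> * real n * W x" by (simp add: W_def algebra_simps)
      finally show ?thesis .
    qed
    define nrm where "nrm g = (LINT x|surface_measure. \<bar>g x\<bar> * (\<bar>x \<bullet> e\<bar> + 1 / real N))" for g
    define I where "I g = (LINT x|surface_measure. \<bar>x \<bullet> e\<bar> * \<bar>g x\<bar>)" for g :: "real ^ 'n \<Rightarrow> real"
    have I0: "0 \<le> I g" for g unfolding I_def by (intro Bochner_Integration.integral_nonneg) auto
    \<comment> \<open>The offset \<open>1 / N\<close> needed for the rotation averages is removed
      again: \<open>integral_poly_le_weighted\<close> loses a factor \<open>N\<close>, which the
      offset compensates.\<close>
    have nrm: "nrm g \<le> S * I g" if g: "poly_deg N g" for g
    proof -
      have gc: "continuous_on UNIV g" by (rule continuous_on_poly_deg[OF g])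
      have "nrm g = (LINT x|surface_measure. \<bar>x \<bullet> e\<bar> * \<bar>g x\<bar> + 1 / real N * \<bar>g x\<bar>)"
        unfolding nrm_def by (simp add: algebra_simps)
      also have "\<dots> = I g + 1 / real N * (LINT x|surface_measure. \<bar>g x\<bar>)"
        unfolding I_def
        by (subst Bochner_Integration.integral_add) (use N in \<open>auto intro!: integrable_surface_continuous continuous_intros gc\<close>)
      also have "1 / real N * (LINT x|surface_measure. \<bar>g x\<bar>) \<le> 1 / real N * (15597568 * real d ^ 3 * real N * I g)"
        using integral_poly_le_weighted[OF B N g] by (intro mult_left_mono) (auto simp: I_def d_def mult.commute)
      also have "1 / real N * (15597568 * real d ^ 3 * real N * I g) = 15597568 * real d ^ 3 * I g" using N by simp
      finally show ?thesis by (simp add: S_def distrib_right)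
    qed
    have IV: "(LINT x|surface_measure. V g x * (\<bar>x \<bullet> e\<bar> + 1 / real N)) \<le> real d * 974848 ^ d * nrm g"
      if gc: "continuous_on UNIV g" for g
    proof -
      have nn: "0 \<le> nrm g" unfolding nrm_def by (intro Bochner_Integration.integral_nonneg) auto
      have "(LINT x|surface_measure. V g x * (\<bar>x \<bullet> e\<bar> + 1 / real N))
        = (\<Sum>j\<in>B. (LINT x|surface_measure. avg N (pivot_list B j) (\<lambda>x. \<bar>g x\<bar>) x * (\<bar>x \<bullet> e\<bar> + 1 / real N)))"
        unfolding V_def sum_distrib_right
        by (rule Bochner_Integration.integral_sum)
          (intro integrable_surface_continuous continuous_intros continuous_on_avg gc)
      also have "\<dots> \<le> (\<Sum>j\<in>B. 974848 ^ d * nrm g)"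
      proof (rule sum_mono)
        fix j assume j: "j \<in> B"
        obtain xs where xs: "pivot_list B j = map (\<lambda>i. (i, j)) xs" "distinct xs" "set xs = B - {j}" "length xs < card B"
          by (rule pivot_list[OF B(1) j])
        have o: "norm a = 1 \<and> norm b = 1 \<and> a \<bullet> b = 0" if "(a, b) \<in> set (pivot_list B j)" for a b
        proof -
          have "a \<in> B" "a \<noteq> j" "b = j" using that xs by auto
          then show ?thesis using onb_norm[OF B(1)] onb_orth[OF B(1)] j by blast
        qed
        have gc': "continuous_on UNIV (\<lambda>x. \<bar>g x\<bar>)" by (intro continuous_intros gc)
        have "(LINT x|surface_measure. avg N (pivot_list B j) (\<lambda>x. \<bar>g x\<bar>) x * (\<bar>x \<bullet> e\<bar> + 1 / real N))
          \<le> 974848 ^ length (pivot_list B j) * nrm g"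
          unfolding nrm_def
          by (rule integral_avg_le[OF e N gc' _ o]) simp_all
        also have "\<dots> \<le> 974848 ^ d * nrm g"
          using xs B(3) nn by (intro mult_right_mono power_increasing) (auto simp: d_def)
        finally show "(LINT x|surface_measure. avg N (pivot_list B j) (\<lambda>x. \<bar>g x\<bar>) x * (\<bar>x \<bullet> e\<bar> + 1 / real N))
          \<le> 974848 ^ d * nrm g" .
      qed
      also have "\<dots> = real d * 974848 ^ d * nrm g" by (simp add: B(3) d_def)
      finally show ?thesis .
    qed
    have "(LINT x|surface_measure. \<bar>x \<bullet> e\<bar> * W x) \<le> (LINT x|surface_measure. W x * (\<bar>x \<bullet> e\<bar> + 1 / real N))"
      by (rule integral_mono)
        (use W0 N in \<open>auto intro!: integrable_surface_continuous continuous_intros Wc simp: algebra_simps\<close>)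
    also have "\<dots> = 24 * (real d)\<^sup>2 * ((LINT x|surface_measure. V p x * (\<bar>x \<bullet> e\<bar> + 1 / real N))
       + (LINT x|surface_measure. V q x * (\<bar>x \<bullet> e\<bar> + 1 / real N))) + 6 / m * nrm q"
    proof -
      have "W x * (\<bar>x \<bullet> e\<bar> + 1 / real N) = 24 * (real d)\<^sup>2 * (V p x * (\<bar>x \<bullet> e\<bar> + 1 / real N) + V q x * (\<bar>x \<bullet> e\<bar> + 1 / real N))
         + 6 / m * (\<bar>q x\<bar> * (\<bar>x \<bullet> e\<bar> + 1 / real N))" for x
        by (simp only: W_def distrib_left distrib_right mult.assoc mult.left_commute)
      moreover have wc: "continuous_on UNIV (\<lambda>x. \<bar>x \<bullet> e\<bar> + 1 / real N)"
        by (intro continuous_on_add continuous_on_rabs continuous_on_inner continuous_on_id continuous_on_const)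
      moreover have "integrable surface_measure (\<lambda>x. V g x * (\<bar>x \<bullet> e\<bar> + 1 / real N))" if "continuous_on UNIV g" for g
        by (rule integrable_surface_continuous[OF continuous_on_mult[OF Vc[OF that] wc]])
      moreover have "integrable surface_measure (\<lambda>x. \<bar>q x\<bar> * (\<bar>x \<bullet> e\<bar> + 1 / real N))"
        using integrable_surface_continuous[OF continuous_on_mult[OF continuous_on_rabs[OF pc(2)] wc]] .
      ultimately show ?thesis using pc unfolding nrm_def by simp
    qed
    also have "\<dots> \<le> 24 * (real d)\<^sup>2 * (real d * 974848 ^ d * nrm p + real d * 974848 ^ d * nrm q) + 6 / m * (nrm p + nrm q)"
    proof -
      have "0 \<le> nrm p" unfolding nrm_def by (intro Bochner_Integration.integral_nonneg) auto
      then show ?thesis using m by (intro add_mono mult_left_mono IV pc) auto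
    qed
    also have "\<dots> = A * (nrm p + nrm q)" by (simp add: A_def algebra_simps)
    also have "\<dots> \<le> A * (S * I p + S * I q)" by (intro mult_left_mono add_mono nrm pq A0)
    also have "\<dots> \<le> A * (S * I F + S * (1 / m * I F))"
    proof -
      \<comment> \<open>\<open>refl_perp\<close> preserves the measure, the weight and
        \<open>cfac\<close>, and isolates \<open>p\<close> and \<open>cfac * q\<close> as half sum
        and half difference of the two values of \<open>F\<close>. Dividing by \<open>cfac\<close>
        costs \<open>1 / m\<close>.\<close>
      define G where "G x = (\<bar>F x\<bar> + \<bar>F (refl_perp e x)\<bar>) / 2" for x
      have oR: "orthogonal_transformation (refl_perp e)" by (rule orthogonal_refl_perp[OF e \<kappa>])
      have Rc: "continuous_on UNIV (refl_perp e)"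
        by (rule continuous_on_linear_fun[OF orthogonal_transformation_linear[OF oR]])
      have FRc: "continuous_on UNIV (\<lambda>x. F (refl_perp e x))"
        by (rule continuous_on_compose2[OF Fc Rc]) auto
      have Gc: "continuous_on UNIV G" unfolding G_def by (intro continuous_intros Fc FRc) auto
      have Re: "\<bar>refl_perp e x \<bullet> e\<bar> = \<bar>x \<bullet> e\<bar>" for x by (simp add: refl_perp_def reflect_inner_e[OF e])
      have "(LINT x|surface_measure. \<bar>x \<bullet> e\<bar> * \<bar>F (refl_perp e x)\<bar>) = I F"
      proof -
        define h where "h x = \<bar>x \<bullet> e\<bar> * \<bar>F x\<bar>" for x
        have "h \<in> borel_measurable borel"
          unfolding h_def by (intro borel_measurable_continuous_onI continuous_intros Fc)
        from integral_surface_orthogonal[OF oR this] show ?thesis by (simp add: h_def Re I_def)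
      qed
      then have IG: "(LINT x|surface_measure. \<bar>x \<bullet> e\<bar> * G x) = I F"
      proof -
        assume *: "(LINT x|surface_measure. \<bar>x \<bullet> e\<bar> * \<bar>F (refl_perp e x)\<bar>) = I F"
        have "(LINT x|surface_measure. \<bar>x \<bullet> e\<bar> * G x) =
          (LINT x|surface_measure. 1/2 * (\<bar>x \<bullet> e\<bar> * \<bar>F x\<bar>) + 1/2 * (\<bar>x \<bullet> e\<bar> * \<bar>F (refl_perp e x)\<bar>))"
          by (intro Bochner_Integration.integral_cong) (auto simp: G_def algebra_simps add_divide_distrib)
        also have "\<dots> = 1/2 * I F + 1/2 * (LINT x|surface_measure. \<bar>x \<bullet> e\<bar> * \<bar>F (refl_perp e x)\<bar>)"
          unfolding I_def
          by (subst Bochner_Integration.integral_add)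
            (auto intro!: integrable_surface_continuous continuous_intros Fc FRc)
        finally show ?thesis using * by simp
      qed
      have nR: "norm (refl_perp e x) = norm x" for x using oR by (simp add: orthogonal_transformation)
      have cR: "cfac e \<kappa> (refl_perp e x) = cfac e \<kappa> x" for x
        by (simp add: cfac_def perp_refl_perp[OF e \<kappa>])
      have FR: "F (refl_perp e x) = p x - cfac e \<kappa> x * q x" if "norm x = 1" for x
        using pq(7)[of "refl_perp e x"] that by (simp add: nR cR pq)
      have "I p \<le> (LINT x|surface_measure. \<bar>x \<bullet> e\<bar> * G x)"
        unfolding I_def
      proof (rule integral_mono)
        fix x :: "real ^ 'n" assume "x \<in> space surface_measure"
        then have x: "norm x = 1" by (simp add: space_surface_measure)
        have "p x = (F x + F (refl_perp e x)) / 2" using pq(7)[OF x] FR[OF x] by simp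
        then have "\<bar>p x\<bar> \<le> G x" unfolding G_def by simp
        then show "\<bar>x \<bullet> e\<bar> * \<bar>p x\<bar> \<le> \<bar>x \<bullet> e\<bar> * G x" by (intro mult_left_mono) auto
      qed (auto intro!: integrable_surface_continuous continuous_intros pc Gc)
      moreover have "I q \<le> (LINT x|surface_measure. 1 / m * (\<bar>x \<bullet> e\<bar> * G x))"
        unfolding I_def
      proof (rule integral_mono)
        fix x :: "real ^ 'n" assume "x \<in> space surface_measure"
        then have x: "norm x = 1" by (simp add: space_surface_measure)
        have "cfac e \<kappa> x * q x = (F x - F (refl_perp e x)) / 2" using pq(7)[OF x] FR[OF x] by simp
        then have "\<bar>cfac e \<kappa> x * q x\<bar> \<le> G x" unfolding G_def by simp
        moreover have "m * \<bar>q x\<bar> \<le> \<bar>cfac e \<kappa> x\<bar> * \<bar>q x\<bar>" using cf(2)[OF x] m by (intro mult_right_mono) auto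
        ultimately have "m * \<bar>q x\<bar> \<le> G x" by (simp add: abs_mult)
        then have "\<bar>q x\<bar> \<le> 1 / m * G x" using m by (simp add: pos_le_divide_eq mult.commute)
        then have "\<bar>x \<bullet> e\<bar> * \<bar>q x\<bar> \<le> \<bar>x \<bullet> e\<bar> * (1 / m * G x)" by (intro mult_left_mono) auto
        then show "\<bar>x \<bullet> e\<bar> * \<bar>q x\<bar> \<le> 1 / m * (\<bar>x \<bullet> e\<bar> * G x)" by (simp add: mult_ac)
      qed (auto intro!: integrable_surface_continuous continuous_intros pc Gc simp: less_imp_neq[OF m(1), symmetric])
      ultimately have "I p \<le> I F" "I q \<le> 1 / m * I F" using IG by auto
      then show ?thesis using A0 S0 by (intro mult_left_mono add_mono) auto
    qed
    also have "\<dots> = A * S * (1 + 1 / m) * I F" by (simp add: algebra_simps)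
    also have "\<dots> \<le> C * I F" using I0 by (intro mult_right_mono) (auto simp: C_def)
    finally have IW: "(LINT x|surface_measure. \<bar>x \<bullet> e\<bar> * W x) \<le> C * I F" .
    show "\<exists>W. continuous_on UNIV W \<and>
      (\<forall>x y \<eta>. norm x = 1 \<longrightarrow> norm y = 1 \<longrightarrow> norm (x - y) \<le> \<eta> \<longrightarrow> C * \<eta> * real n \<le> 1 \<longrightarrow>
        \<bar>multi_poly n c (capmap e (sin (\<alpha> / 2)) y) - multi_poly n c (capmap e (sin (\<alpha> / 2)) x)\<bar> \<le> \<eta> * real n * W x) \<and>
      (LINT x|surface_measure. \<bar>x \<bullet> e\<bar> * W x) \<le>
        C * (LINT x|surface_measure. \<bar>x \<bullet> e\<bar> * \<bar>multi_poly n c (capmap e (sin (\<alpha> / 2)) x)\<bar>)"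
      using Wc osc IW unfolding F_def I_def \<kappa>_def by (intro exI[of _ W]) auto
  qed
qed

subsection \<open>Quadrature\<close>

text \<open>\<open>geod_dist\<close> and \<open>cap_metric\<close> with the argument of \<open>arccos\<close> truncated to its natural domain: they agree with
  the original functions on the sphere and are continuous on the whole space.\<close>

definition geod :: "real ^ 'n \<Rightarrow> real ^ 'n \<Rightarrow> real" where
  "geod x y = arccos (max (-1) (min 1 (x \<bullet> y)))"

definition rho :: "real ^ 'n \<Rightarrow> real \<Rightarrow> real ^ 'n \<Rightarrow> real ^ 'n \<Rightarrow> real" where
  "rho e \<alpha> x y = (1 / \<alpha>) * sqrt ((geod x y)\<^sup>2 + \<alpha> * (sqrt (\<alpha> - geod x e) - sqrt (\<alpha> - geod y e))\<^sup>2)"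

lemma inner_unit_bounds:
  assumes "norm x = 1" "norm y = 1"
  shows "-1 \<le> x \<bullet> y" "x \<bullet> y \<le> 1"
  using Cauchy_Schwarz_ineq2[of x y] assms by (auto simp: abs_le_iff)

lemma geod_eq: "norm x = 1 \<Longrightarrow> norm y = 1 \<Longrightarrow> geod_dist x y = geod x y"
  using inner_unit_bounds[of x y] by (simp add: geod_def geod_dist_def)

lemma rho_eq: "norm e = 1 \<Longrightarrow> norm x = 1 \<Longrightarrow> norm y = 1 \<Longrightarrow> cap_metric e \<alpha> x y = rho e \<alpha> x y"
  by (simp add: cap_metric_def rho_def bdist_def geod_eq)

lemma continuous_on_rho: "0 < \<alpha> \<Longrightarrow> continuous_on S (\<lambda>y. rho e \<alpha> x y)"
  unfolding rho_def geod_def by (intro continuous_intros) auto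

lemma cap_eq:
  assumes e: "norm e = 1" and al: "0 < \<alpha>" "\<alpha> \<le> pi"
  shows "cap e \<alpha> = {y. norm y = 1 \<and> 1 - 2 * (sin (\<alpha> / 2))\<^sup>2 \<le> y \<bullet> e}"
proof -
  have c: "cos \<alpha> = 1 - 2 * (sin (\<alpha> / 2))\<^sup>2" using cos_double_sin[of "\<alpha> / 2"] by simp
  have "arccos (y \<bullet> e) \<le> \<alpha> \<longleftrightarrow> cos \<alpha> \<le> y \<bullet> e" if "norm y = 1" for y
  proof -
    have b: "-1 \<le> y \<bullet> e" "y \<bullet> e \<le> 1" using inner_unit_bounds[OF that e] by auto
    have "0 \<le> arccos (y \<bullet> e)" "arccos (y \<bullet> e) \<le> pi" "cos (arccos (y \<bullet> e)) = y \<bullet> e"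
      using arccos[OF b] by auto
    then show ?thesis using cos_mono_le_eq[of \<alpha> "arccos (y \<bullet> e)"] al by simp
  qed
  then show ?thesis by (auto simp: cap_def geod_dist_def c)
qed

text \<open>\<open>capmap\<close> folds the sphere onto the cap. The comparison with the metric
  holds on the upper sheet, to which every point can be moved without changing its image.\<close>

lemma reflect_unfold:
  fixes e :: "real ^ 'n"
  assumes e: "norm e = 1" and x: "norm x = 1"
  obtains y where "y = x \<or> y = reflect e x" "norm y = 1" "0 \<le> y \<bullet> e" "capmap e \<kappa> y = capmap e \<kappa> x"
proof (cases "0 \<le> x \<bullet> e")
  case True
  then show ?thesis using that[of x] x by simp
next
  case False
  then show ?thesis
    using that[of "reflect e x"] x by (simp add: norm_reflect[OF e] reflect_inner_e[OF e] capmap_reflect[OF e])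
qed

lemma reflect_reflect: "norm e = 1 \<Longrightarrow> reflect e (reflect e x) = x"
  unfolding reflect_def[of e "reflect e x"] by (simp add: reflect_inner_e) (simp add: reflect_def)

text \<open>A single \<open>K\<close> covers both directions: since
  \<open>cap_lo \<epsilon> \<le> 1\<close>, it dominates the constants of
  \<open>cap_metric_le\<close> and \<open>cap_metric_ge\<close>.\<close>

lemma rho_capmap_bounds:
  fixes e :: "real ^ 'n" and \<epsilon> :: real
  assumes eps: "0 < \<epsilon>" "\<epsilon> < 1" and al: "0 < \<alpha>" "\<alpha> \<le> pi - \<epsilon>" and e: "norm e = 1"
    and x: "norm x = 1" "0 \<le> x \<bullet> e" and y: "norm y = 1" "0 \<le> y \<bullet> e"
  defines "\<kappa> \<equiv> sin (\<alpha> / 2)" and "K \<equiv> 20 / cap_lo \<epsilon> ^ 3"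
  shows "rho e \<alpha> (capmap e \<kappa> x) (capmap e \<kappa> y) \<le> K * norm (x - y)"
    and "norm (x - y) \<le> K * rho e \<alpha> (capmap e \<kappa> x) (capmap e \<kappa> y)"
proof -
  define m where "m = cap_lo \<epsilon>"
  have m: "0 < m" "m \<le> 1" using cap_lo_pos[OF eps] cap_lo_le[OF eps] by (auto simp: m_def)
  have \<kappa>: "\<kappa> = sin (\<alpha> / 2)" by (simp add: \<kappa>_def)
  note kb = kappa_bounds[OF eps al \<kappa>]
  have nx: "norm (capmap e \<kappa> x) = 1" "norm (capmap e \<kappa> y) = 1"
    using norm_capmap[OF e kb(3,4)] x y by auto
  define R where "R = rho e \<alpha> (capmap e \<kappa> x) (capmap e \<kappa> y)"
  have R: "cap_metric e \<alpha> (capmap e \<kappa> x) (capmap e \<kappa> y) = R"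
    unfolding R_def by (rule rho_eq[OF e nx])
  have R0: "0 \<le> R" unfolding R_def rho_def using al by simp
  have 1: "m\<^sup>2 * R \<le> 20 * norm (x - y)"
    using cap_metric_le[OF eps al \<kappa> e x y] by (simp add: R m_def)
  have "m ^ 3 * R \<le> m\<^sup>2 * R" using m R0 by (intro mult_right_mono power_decreasing) auto
  then have "R * m ^ 3 \<le> 20 * norm (x - y)" using 1 by (simp add: mult.commute)
  then show "rho e \<alpha> (capmap e \<kappa> x) (capmap e \<kappa> y) \<le> K * norm (x - y)"
    using m by (simp add: R_def[symmetric] K_def m_def[symmetric] pos_le_divide_eq)
  have "m ^ 3 * norm (x - y) \<le> 16 * R"
    using cap_metric_ge[OF eps al \<kappa> e x y] by (simp add: R m_def)
  then have "norm (x - y) * m ^ 3 \<le> 20 * R" using R0 by (simp add: mult.commute)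
  then show "norm (x - y) \<le> K * rho e \<alpha> (capmap e \<kappa> x) (capmap e \<kappa> y)"
    using m by (simp add: R_def[symmetric] K_def m_def[symmetric] pos_le_divide_eq)
qed

text \<open>On the sphere the ball is comparable to chordal balls with radius of order
  \<open>r\<close>, of surface measure of order \<open>r ^ d\<close>, and the weight
  \<open>\<bar>x \<bullet> e\<bar>\<close> contributes the order \<open>z + r\<close>, where
  \<open>z\<close> is the height of the preimage of the centre. As \<open>z\<close> is comparable to
  the depth \<open>t\<close>, multiplication with the factor \<open>\<alpha> ^ d\<close> of the
  density gives \<open>tri\<close>.\<close>

lemma rho_ball_measure:
  fixes \<epsilon> :: real
  assumes eps: "0 < \<epsilon>" "\<epsilon> < 1" and card: "CARD('n) = d + 1" and d: "1 \<le> d"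
  shows "\<exists>A\<ge>1. \<forall>(e :: real ^ 'n) \<alpha> \<omega> r. norm e = 1 \<longrightarrow> 0 < \<alpha> \<longrightarrow> \<alpha> \<le> pi - \<epsilon> \<longrightarrow> \<omega> \<in> cap e \<alpha> \<longrightarrow>
    0 < r \<longrightarrow> r \<le> 1 \<longrightarrow>
    tri d e \<alpha> r \<omega> \<le> A * (LINT y|surface_measure. indicator {y. 1 - 2 * (sin (\<alpha> / 2))\<^sup>2 \<le> y \<bullet> e} y * indicator {y. rho e \<alpha> \<omega> y \<le> r} y) \<and>
    (LINT y|surface_measure. indicator {y. 1 - 2 * (sin (\<alpha> / 2))\<^sup>2 \<le> y \<bullet> e} y * indicator {y. rho e \<alpha> \<omega> y \<le> r} y) \<le> A * tri d e \<alpha> r \<omega>"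
proof -
  define n where "n = CARD('n)"
  have n: "n = d + 1" "2 \<le> n" using card d by (auto simp: n_def)
  define m where "m = cap_lo \<epsilon>"
  have m: "0 < m" "m \<le> 1" using cap_lo_pos[OF eps] cap_lo_le[OF eps] by (auto simp: m_def)
  define K where "K = 20 / m ^ 3"
  have K: "1 \<le> K"
  proof -
    have "m ^ 3 \<le> 1" using m by (simp add: power_le_one)
    then show ?thesis using m by (simp add: K_def pos_le_divide_eq)
  qed
  define A1 where "A1 = (1 / m) * (3 + K) * (2 * real n * (2 * K) ^ d)"
  define A2 where "A2 = ((1/2) ^ d * m ^ (d - 1) * (m / (16 * K)) * (real n / 4 * (1 / (64 * real n * K)) ^ d)) / 2"
  have A1: "0 \<le> A1" using m K by (simp add: A1_def)
  have A2: "0 < A2" using m K n by (simp add: A2_def)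
  define A where "A = max 1 (max A1 (1 / A2))"
  show ?thesis
  proof (intro exI[of _ A] conjI allI impI)
    show "1 \<le> A" by (simp add: A_def)
    fix e :: "real ^ 'n" and \<alpha> :: real and \<omega> :: "real ^ 'n" and r :: real
    assume e: "norm e = 1" and al: "0 < \<alpha>" "\<alpha> \<le> pi - \<epsilon>" and \<omega>: "\<omega> \<in> cap e \<alpha>" and r: "0 < r" "r \<le> 1"
    define \<kappa> where "\<kappa> = sin (\<alpha> / 2)"
    note kb = kappa_bounds[OF eps al \<kappa>_def]
    have \<kappa>: "0 < \<kappa>" "\<kappa> < 1" using kb by auto
    have "norm \<omega> = 1" "1 - 2 * \<kappa>\<^sup>2 \<le> \<omega> \<bullet> e"
      using \<omega> al eps by (auto simp: cap_eq[OF e al(1)] \<kappa>_def)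
    from capmap_surj[OF e \<kappa> this] obtain x0 where x0: "norm x0 = 1" "0 \<le> x0 \<bullet> e" "capmap e \<kappa> x0 = \<omega>" by blast
    define z where "z = x0 \<bullet> e"
    define t where "t = sqrt (1 - geod_dist \<omega> e / \<alpha>)"
    have td: "t = cap_depth \<alpha> \<kappa> e x0" unfolding t_def cap_depth_def[OF eps al \<kappa>_def e] cap_angle_def[OF eps al \<kappa>_def e] x0(3) ..
    have t0: "0 \<le> t" unfolding td by (rule cap_depth_sq(2)[OF eps al \<kappa>_def e x0(1)])
    have zt: "z \<le> 3 * t" "m * t \<le> z"
      using inner_e_depth[OF eps al \<kappa>_def e x0(1,2)] by (auto simp: z_def td m_def)
    have z0: "0 \<le> z" using x0 by (simp add: z_def)
    have tri: "tri d e \<alpha> r \<omega> = \<alpha> ^ d * r ^ d * (r + t)"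
      by (simp add: tri_def t_def algebra_simps)
    define E where "E = {y. rho e \<alpha> \<omega> y \<le> r}"
    have "closed E" unfolding E_def by (intro closed_Collect_le continuous_on_rho al continuous_on_const)
    then have Eb: "(indicator E :: real ^ 'n \<Rightarrow> real) \<in> borel_measurable borel"
      by (intro borel_measurable_indicator borel_closed)
    define V where "V = (LINT y|surface_measure. indicator {y. 1 - 2 * \<kappa>\<^sup>2 \<le> y \<bullet> e} y * indicator E y :: real)"
    define D where "D x = \<bar>x \<bullet> e\<bar> * (capdens e \<kappa> x * indicator E (capmap e \<kappa> x))" for x
    have V: "2 * V = (LINT x|surface_measure. D x)"
      unfolding V_def D_def by (rule integral_cap[OF e \<kappa> _ Eb, where C = 1]) (use n in \<open>auto simp: n_def\<close>)
    have ie: "\<bar>x \<bullet> e\<bar> \<le> 1" if "norm x = 1" for x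
      using inner_unit_bounds[OF that e] by simp
    have Dm: "D \<in> borel_measurable borel"
      unfolding D_def by (intro borel_measurable_times borel_measurable_abs borel_measurable_inner borel_capdens
        measurable_compose[OF borel_capmap Eb]) auto
    have cd: "0 \<le> capdens e \<kappa> x" "capdens e \<kappa> x \<le> \<alpha> ^ d / m" "(\<alpha> / 2) ^ d * m ^ (d - 1) \<le> capdens e \<kappa> x" if x: "norm x = 1" for x
    proof -
      have mk: "m \<le> sqrt (1 - \<kappa>\<^sup>2)" using kb(5) by (simp add: m_def)
      show "0 \<le> capdens e \<kappa> x" using capdens_nonneg[OF \<kappa> e] x by simp
      have "capdens e \<kappa> x \<le> (2 * \<kappa>) ^ d / m"
        using capdens_le(1)[OF e \<kappa> _ m(1) mk, of x] x card by simp
      also have "\<dots> \<le> \<alpha> ^ d / m" using kb \<kappa> m by (intro divide_right_mono power_mono) auto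
      finally show "capdens e \<kappa> x \<le> \<alpha> ^ d / m" .
      have "(\<alpha> / 2) ^ d * m ^ (d - 1) \<le> (2 * \<kappa>) ^ d * m ^ (d - 1)"
        using kb(1) al m by (intro mult_right_mono power_mono) auto
      also have "\<dots> \<le> capdens e \<kappa> x" using capdens_le(2)[OF e \<kappa> _ m(1) mk, of x] x card by simp
      finally show "(\<alpha> / 2) ^ d * m ^ (d - 1) \<le> capdens e \<kappa> x" .
    qed
    have Di: "integrable surface_measure D"
    proof (rule integrable_surface_bounded[OF Dm])
      fix x :: "real ^ 'n" assume x: "norm x = 1"
      have "\<bar>D x\<bar> \<le> 1 * (\<alpha> ^ d / m * 1)"
        unfolding D_def abs_mult using ie[OF x] cd[OF x] by (intro mult_mono) (auto simp: indicator_def)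
      then show "\<bar>D x\<bar> \<le> \<alpha> ^ d / m" by simp
    qed
    have bi: "integrable surface_measure (indicator (cball a s) :: real ^ 'n \<Rightarrow> real)" for a s
      by (rule integrable_surface_bounded[where C = 1]) (auto intro!: borel_measurable_indicator simp: indicator_def)
    have up: "V \<le> A1 * tri d e \<alpha> r \<omega>"
    proof -
      \<comment> \<open>The preimage of the centre on the lower sheet: on the whole sphere the ball
        has two copies.\<close>
      define x0' where "x0' = reflect e x0"
      have nx0': "norm x0' = 1" using x0 by (simp add: x0'_def norm_reflect[OF e])
      define M where "M = (z + K * r) * (\<alpha> ^ d / m)"
      have M0: "0 \<le> M" using z0 K r al m by (simp add: M_def)
      have "D x \<le> M * (indicator (cball x0 (K * r)) x + indicator (cball x0' (K * r)) x)" if x: "norm x = 1" for x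
      proof (cases "capmap e \<kappa> x \<in> E")
        case False
        then show ?thesis using M0 by (simp add: D_def)
      next
        case True
        obtain y where y: "y = x \<or> y = reflect e x" "norm y = 1" "0 \<le> y \<bullet> e" "capmap e \<kappa> y = capmap e \<kappa> x"
          using reflect_unfold[OF e x] by blast
        have "norm (x0 - y) \<le> K * rho e \<alpha> (capmap e \<kappa> x0) (capmap e \<kappa> y)"
          unfolding K_def m_def \<kappa>_def by (rule rho_capmap_bounds(2)[OF eps al e x0(1,2) y(2,3)])
        also have "\<dots> \<le> K * r" using True K by (intro mult_left_mono) (auto simp: E_def x0 y)
        finally have near: "norm (x0 - y) \<le> K * r" .
        have "\<bar>y \<bullet> e\<bar> = \<bar>x \<bullet> e\<bar>" using y(1) reflect_inner_e[OF e, of x] by auto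
        moreover have "\<bar>(x0 - y) \<bullet> e\<bar> \<le> norm (x0 - y)" using Cauchy_Schwarz_ineq2[of "x0 - y" e] e by simp
        ultimately have xe: "\<bar>x \<bullet> e\<bar> \<le> z + K * r" using near y(3) z0 by (simp add: z_def inner_diff_left)
        have ind: "1 \<le> indicator (cball x0 (K * r)) x + (indicator (cball x0' (K * r)) x :: real)"
        proof (cases "y = x")
          case True
          then show ?thesis using near by (simp add: dist_norm indicator_def)
        next
          case False
          then have "y = reflect e x" using y by simp
          then have "x0' - x = reflect e (x0 - y)"
            by (simp add: x0'_def linear_diff[OF linear_reflect] reflect_reflect[OF e])
          then have "norm (x0' - x) \<le> K * r" using near by (simp add: norm_reflect[OF e])
          then show ?thesis by (simp add: dist_norm indicator_def)
        qed
        have "D x \<le> (z + K * r) * (\<alpha> ^ d / m * 1)"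
          unfolding D_def using xe cd[OF x] z0 K r by (intro mult_mono) (auto simp: indicator_def)
        also have "\<dots> = M * 1" by (simp add: M_def)
        also have "\<dots> \<le> M * (indicator (cball x0 (K * r)) x + indicator (cball x0' (K * r)) x)"
          by (intro mult_left_mono ind M0)
        finally show ?thesis .
      qed
      then have "2 * V \<le> (LINT x|surface_measure. M * (indicator (cball x0 (K * r)) x + indicator (cball x0' (K * r)) x))"
        unfolding V
        by (intro integral_mono Di integrable_mult_right Bochner_Integration.integrable_add bi) (simp add: space_surface_measure)
      also have "\<dots> = M * ((LINT x|surface_measure. indicator (cball x0 (K * r)) x) + (LINT x|surface_measure. indicator (cball x0' (K * r)) x))"
        by (simp only: integral_mult_right_zero Bochner_Integration.integral_add[OF bi bi])
      also have "\<dots> \<le> M * (2 * real n * (2 * (K * r)) ^ d + 2 * real n * (2 * (K * r)) ^ d)"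
        using surface_ball_upper[OF x0(1), of "K * r"] surface_ball_upper[OF nx0', of "K * r"] K r card
        by (intro mult_left_mono add_mono M0) (simp_all add: n_def)
      finally have "V \<le> M * (2 * real n * (2 * K) ^ d * r ^ d)" by (simp add: power_mult_distrib mult_ac)
      also have "M \<le> ((3 + K) * (r + t)) * (\<alpha> ^ d / m)"
      proof -
        have "z + K * r \<le> 3 * t + K * r" using zt by simp
        also have "\<dots> \<le> (3 + K) * (r + t)" using K r t0 by (simp add: algebra_simps)
        finally show ?thesis unfolding M_def using al m by (intro mult_right_mono) auto
      qed
      finally have "V \<le> ((3 + K) * (r + t)) * (\<alpha> ^ d / m) * (2 * real n * (2 * K) ^ d * r ^ d)"
        using K r by (simp add: mult_right_mono)
      also have "\<dots> = A1 * tri d e \<alpha> r \<omega>" by (simp add: A1_def tri)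
      finally show ?thesis .
    qed
    have lo: "A2 * tri d e \<alpha> r \<omega> \<le> V"
    proof -
      define r' where "r' = r / K"
      have r': "0 < r'" "r' \<le> 1" "K * r' = r" using r K by (auto simp: r'_def divide_le_eq)
      \<comment> \<open>Near the equator the weight at \<open>x0\<close> itself is too small.
        Pushing the centre towards \<open>e\<close> by a quarter of the radius gives a smaller ball,
        still inside the preimage, on which the height is at least of order
        \<open>z + r'\<close>.\<close>
      define v where "v = x0 + (r' / 4) *\<^sub>R e"
      have vx: "norm (v - x0) = r' / 4" using e r' by (simp add: v_def)
      have nv: "1 \<le> norm v" "norm v \<le> 1 + r' / 4"
      proof -
        have "(norm v)\<^sup>2 = 1 + r' / 2 * z + (r' / 4)\<^sup>2"
        proof -
          have "x0 \<bullet> x0 = 1" "e \<bullet> e = 1" using x0(1) e by (simp_all add: dot_square_norm)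
          then show ?thesis unfolding power2_norm_eq_inner v_def
            by (simp add: inner_add_left inner_add_right inner_commute[of e x0] z_def power2_eq_square algebra_simps)
        qed
        then have "1\<^sup>2 \<le> (norm v)\<^sup>2" using r' z0 by simp
        then show "1 \<le> norm v" by (rule power2_le_imp_le) simp
        show "norm v \<le> 1 + r' / 4" using norm_triangle_ineq[of x0 "(r' / 4) *\<^sub>R e"] x0 e r' by (simp add: v_def)
      qed
      define x1 where "x1 = v /\<^sub>R norm v"
      have "v \<noteq> 0" using nv by auto
      then have nx1: "norm x1 = 1" by (simp add: x1_def)
      have "norm (x1 - v) = norm v - 1"
      proof -
        have "x1 - v = (1 / norm v - 1) *\<^sub>R v" by (simp add: x1_def scaleR_diff_left divide_inverse)
        moreover have "\<bar>1 / norm v - 1\<bar> = 1 - 1 / norm v" using nv by (simp add: divide_le_eq)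
        ultimately show ?thesis using \<open>v \<noteq> 0\<close> nv by (simp add: left_diff_distrib)
      qed
      then have x1x0: "norm (x1 - x0) \<le> r' / 2"
        using norm_triangle_ineq[of "x1 - v" "v - x0"] vx nv by simp
      have x1e: "(z + r' / 4) / 2 \<le> x1 \<bullet> e"
      proof -
        have "v \<bullet> e = z + r' / 4" using e by (simp add: v_def z_def inner_add_left dot_square_norm)
        then have "x1 \<bullet> e = (z + r' / 4) / norm v" by (simp add: x1_def inverse_eq_divide)
        moreover have "(z + r' / 4) / 2 \<le> (z + r' / 4) / norm v"
          using nv r' z0 by (intro divide_left_mono) auto
        ultimately show ?thesis by simp
      qed
      define M where "M = ((z + r') / 16) * ((\<alpha> / 2) ^ d * m ^ (d - 1))"
      have M0: "0 \<le> M" using z0 r' al m by (simp add: M_def)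
      have "M * indicator (cball x1 (r' / 16)) x \<le> D x" if x: "norm x = 1" for x
      proof (cases "x \<in> cball x1 (r' / 16)")
        case False
        then show ?thesis using cd(1)[OF x] by (simp add: D_def)
      next
        case True
        then have near: "norm (x1 - x) \<le> r' / 16" by (simp add: dist_norm)
        have "\<bar>(x1 - x) \<bullet> e\<bar> \<le> norm (x1 - x)" using Cauchy_Schwarz_ineq2[of "x1 - x" e] e by simp
        then have xe: "(z + r') / 16 \<le> x \<bullet> e" using near x1e z0 r' by (simp add: inner_diff_left)
        then have xe0: "0 \<le> x \<bullet> e" using z0 r' by simp
        have "norm (x0 - x) \<le> norm (x0 - x1) + norm (x1 - x)" using norm_triangle_ineq[of "x0 - x1" "x1 - x"] by simp
        then have xx: "norm (x0 - x) \<le> r'" using near x1x0 r' by (simp add: norm_minus_commute)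
        have "rho e \<alpha> (capmap e \<kappa> x0) (capmap e \<kappa> x) \<le> K * norm (x0 - x)"
          unfolding K_def m_def \<kappa>_def by (rule rho_capmap_bounds(1)[OF eps al e x0(1,2) x xe0])
        also have "\<dots> \<le> K * r'" using xx K by (intro mult_left_mono) auto
        finally have "capmap e \<kappa> x \<in> E" by (simp add: E_def x0 r')
        moreover have "M \<le> \<bar>x \<bullet> e\<bar> * capdens e \<kappa> x"
          unfolding M_def using xe xe0 cd(3)[OF x] z0 r' al m by (intro mult_mono) auto
        ultimately show ?thesis using True by (simp add: D_def)
      qed
      then have "(LINT x|surface_measure. M * indicator (cball x1 (r' / 16)) x) \<le> 2 * V"
        unfolding V by (intro integral_mono Di integrable_mult_right bi) (simp add: space_surface_measure)
      then have le: "M * (LINT x|surface_measure. indicator (cball x1 (r' / 16)) x) \<le> 2 * V"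
        by (simp only: integral_mult_right_zero)
      have "real n / 4 * (r' / 16 / (4 * real n)) ^ d \<le> (LINT x|surface_measure. indicator (cball x1 (r' / 16)) x)"
        using surface_ball_lower[OF nx1, of "r' / 16"] r' card by (simp add: n_def)
      then have "M * (real n / 4 * (r' / 16 / (4 * real n)) ^ d) \<le> 2 * V"
        using mult_left_mono[OF _ M0] le order_trans by blast
      moreover have "(m / K * (r + t)) / 16 * ((\<alpha> / 2) ^ d * m ^ (d - 1)) \<le> M"
      proof -
        have "m / K * r \<le> r'" using m K r by (simp add: r'_def divide_right_mono)
        moreover have "m / K * t \<le> z"
        proof -
          have "m * t / K \<le> m * t / 1" using m t0 K by (intro divide_left_mono) auto
          then show ?thesis using zt by simp
        qed
        ultimately have "m / K * (r + t) \<le> z + r'" by (simp only: distrib_left)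
        then show ?thesis unfolding M_def using al m by (intro mult_right_mono divide_right_mono) auto
      qed
      ultimately have "((m / K * (r + t)) / 16 * ((\<alpha> / 2) ^ d * m ^ (d - 1))) * (real n / 4 * (r' / 16 / (4 * real n)) ^ d) \<le> 2 * V"
        using r' n by (meson mult_right_mono order_trans zero_le_power divide_nonneg_nonneg mult_nonneg_nonneg of_nat_0_le_iff zero_le_numeral less_imp_le)
      moreover have "((m / K * (r + t)) / 16 * ((\<alpha> / 2) ^ d * m ^ (d - 1))) * (real n / 4 * (r' / 16 / (4 * real n)) ^ d)
        = 2 * (A2 * tri d e \<alpha> r \<omega>)"
      proof -
        have "r' / 16 / (4 * real n) = r * (1 / (64 * real n * K))" by (simp add: r'_def)
        moreover have "(\<alpha> / 2) ^ d = \<alpha> ^ d * (1/2) ^ d" by (simp add: power_divide)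
        ultimately show ?thesis unfolding A2_def tri by (simp only: power_mult_distrib) (simp add: mult_ac)
      qed
      ultimately show ?thesis by linarith
    qed
    have tri0: "0 \<le> tri d e \<alpha> r \<omega>" using al r t0 by (simp add: tri)
    have V0: "0 \<le> V" using lo A2 tri0 by (meson mult_nonneg_nonneg less_imp_le order_trans)
    have "tri d e \<alpha> r \<omega> \<le> 1 / A2 * V" using lo A2 by (simp add: pos_le_divide_eq mult.commute)
    also have "\<dots> \<le> A * V" using V0 by (intro mult_right_mono) (auto simp: A_def)
    finally show "tri d e \<alpha> r \<omega> \<le> A * (LINT y|surface_measure. indicator {y. 1 - 2 * (sin (\<alpha> / 2))\<^sup>2 \<le> y \<bullet> e} y * indicator {y. rho e \<alpha> \<omega> y \<le> r} y)"
      by (simp only: V_def E_def \<kappa>_def)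
    have "V \<le> A * tri d e \<alpha> r \<omega>"
      by (rule order_trans[OF up]) (use tri0 in \<open>auto intro!: mult_right_mono simp: A_def\<close>)
    then show "(LINT y|surface_measure. indicator {y. 1 - 2 * (sin (\<alpha> / 2))\<^sup>2 \<le> y \<bullet> e} y * indicator {y. rho e \<alpha> \<omega> y \<le> r} y) \<le> A * tri d e \<alpha> r \<omega>"
      by (simp only: V_def E_def \<kappa>_def)
  qed
qed

text \<open>Points equidistant from several nodes are shared evenly, so that the boundaries of the Voronoi cells
  need not be null sets.\<close>

definition voronoi_wt :: "(real ^ 'n) set \<Rightarrow> real ^ 'n \<Rightarrow> real \<Rightarrow> real ^ 'n \<Rightarrow> real ^ 'n \<Rightarrow> real" where
  "voronoi_wt \<Lambda> e \<alpha> \<omega> y = indicator {y. \<forall>\<omega>'\<in>\<Lambda>. rho e \<alpha> \<omega> y \<le> rho e \<alpha> \<omega>' y} y /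
     (\<Sum>\<omega>\<in>\<Lambda>. indicator {y. \<forall>\<omega>'\<in>\<Lambda>. rho e \<alpha> \<omega> y \<le> rho e \<alpha> \<omega>' y} y)"

lemma
  fixes \<Lambda> :: "(real ^ 'n) set"
  assumes fin: "finite \<Lambda>"
  shows voronoi_wt_nonneg: "0 \<le> voronoi_wt \<Lambda> e \<alpha> \<omega> y"
    and voronoi_wt_le_1: "\<omega> \<in> \<Lambda> \<Longrightarrow> voronoi_wt \<Lambda> e \<alpha> \<omega> y \<le> 1"
    and sum_voronoi_wt: "\<Lambda> \<noteq> {} \<Longrightarrow> (\<Sum>\<omega>\<in>\<Lambda>. voronoi_wt \<Lambda> e \<alpha> \<omega> y) = 1"
    and borel_voronoi_wt: "0 < \<alpha> \<Longrightarrow> voronoi_wt \<Lambda> e \<alpha> \<omega> \<in> borel_measurable borel"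
proof -
  define A where "A \<omega> = {y. \<forall>\<omega>'\<in>\<Lambda>. rho e \<alpha> \<omega> y \<le> rho e \<alpha> \<omega>' y}" for \<omega>
  have eq: "voronoi_wt \<Lambda> e \<alpha> \<omega> y = indicator (A \<omega>) y / (\<Sum>\<omega>\<in>\<Lambda>. indicator (A \<omega>) y)" for \<omega> y
    by (simp add: voronoi_wt_def A_def)
  have s0: "0 \<le> (\<Sum>\<omega>\<in>\<Lambda>. indicator (A \<omega>) y :: real)" for y by (intro sum_nonneg) auto
  show "0 \<le> voronoi_wt \<Lambda> e \<alpha> \<omega> y" unfolding eq using s0 by (intro divide_nonneg_nonneg) auto
  show "voronoi_wt \<Lambda> e \<alpha> \<omega> y \<le> 1" if "\<omega> \<in> \<Lambda>"
  proof -
    have "indicator (A \<omega>) y \<le> (\<Sum>\<omega>\<in>\<Lambda>. indicator (A \<omega>) y :: real)"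
      using that fin by (intro member_le_sum) auto
    then show ?thesis unfolding eq using s0[of y] by (auto simp: divide_le_eq_1)
  qed
  show "(\<Sum>\<omega>\<in>\<Lambda>. voronoi_wt \<Lambda> e \<alpha> \<omega> y) = 1" if "\<Lambda> \<noteq> {}"
  proof -
    have "Min ((\<lambda>\<omega>. rho e \<alpha> \<omega> y) ` \<Lambda>) \<in> (\<lambda>\<omega>. rho e \<alpha> \<omega> y) ` \<Lambda>"
      using fin that by (intro Min_in) auto
    then obtain \<omega> where \<omega>: "\<omega> \<in> \<Lambda>" "rho e \<alpha> \<omega> y = Min ((\<lambda>\<omega>. rho e \<alpha> \<omega> y) ` \<Lambda>)" by auto
    then have "y \<in> A \<omega>" using fin by (auto simp: A_def)
    then have "1 \<le> (\<Sum>\<omega>\<in>\<Lambda>. indicator (A \<omega>) y :: real)"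
      using member_le_sum[of \<omega> \<Lambda> "\<lambda>\<omega>. indicator (A \<omega>) y :: real"] \<omega> fin by simp
    then show ?thesis unfolding eq sum_divide_distrib[symmetric] by simp
  qed
  show "voronoi_wt \<Lambda> e \<alpha> \<omega> \<in> borel_measurable borel" if al: "0 < \<alpha>"
  proof -
    have "closed (A \<omega>)" for \<omega>
    proof -
      have "A \<omega> = (\<Inter>\<omega>'\<in>\<Lambda>. {y. rho e \<alpha> \<omega> y \<le> rho e \<alpha> \<omega>' y})" by (auto simp: A_def)
      then show ?thesis by (auto intro!: closed_Collect_le continuous_on_rho al)
    qed
    then have "(indicator (A \<omega>) :: real ^ 'n \<Rightarrow> real) \<in> borel_measurable borel" for \<omega>
      by (intro borel_measurable_indicator borel_closed)
    then show ?thesis unfolding eq[abs_def] by (intro borel_measurable_divide borel_measurable_sum)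
  qed
qed

lemma continuous_bounded_sphere:
  fixes f :: "'a::euclidean_space \<Rightarrow> real"
  assumes "continuous_on UNIV f"
  obtains M where "\<And>y. norm y = 1 \<Longrightarrow> \<bar>f y\<bar> \<le> M"
proof -
  have "continuous_on (sphere 0 1) f" using assms continuous_on_subset by blast
  then have "compact (f ` sphere 0 1)" by (rule compact_continuous_image[OF _ compact_sphere])
  from compact_imp_bounded[OF this] obtain M where "\<forall>y\<in>f ` sphere 0 1. norm y \<le> M"
    unfolding bounded_iff ..
  then show ?thesis using that[of M] by auto
qed

theorem corollary1p2:
  fixes d :: nat and \<epsilon> :: real
  assumes "d \<ge> 1" and "CARD('n :: finite) = d + 1" and "0 < \<epsilon>" and "\<epsilon> < 1"
  shows "\<exists>\<delta>\<^sub>0 C :: real. 0 < \<delta>\<^sub>0 \<and> \<delta>\<^sub>0 < 1 \<and> C \<ge> 1 \<and>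
    (\<forall>(e :: real ^ 'n) (\<alpha> :: real) (n :: nat) (\<delta> :: real) (\<Lambda> :: (real ^ 'n) set).
      e \<in> sphere 0 1 \<longrightarrow> 0 < \<alpha> \<longrightarrow> \<alpha> \<le> pi - \<epsilon> \<longrightarrow> n \<ge> 1 \<longrightarrow> 0 < \<delta> \<longrightarrow> \<delta> < \<delta>\<^sub>0 \<longrightarrow>
      maximal_separable e \<alpha> (\<delta> / n) \<Lambda> \<longrightarrow>
      (\<exists>w :: real ^ 'n \<Rightarrow> real.
        (\<forall>\<omega>\<in>\<Lambda>. w \<omega> > 0 \<and>
          equiv_with_const C (w \<omega>) (tri d e \<alpha> (\<delta> / n) \<omega>) \<and>
          equiv_with_const C (tri d e \<alpha> (\<delta> / n) \<omega>)
            (measure surface_measure (cap_metric_ball e \<alpha> \<omega> (\<delta> / n)))) \<and>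
        (\<forall>f\<in>spherical_polys n.
          (LINT y:cap e \<alpha>|surface_measure. f y) = (\<Sum>\<omega>\<in>\<Lambda>. w \<omega> * f \<omega>))))"
proof -
  note eps = assms(3,4)
  define m where "m = cap_lo \<epsilon>"
  have m: "0 < m" "m \<le> 1" using cap_lo_pos[OF eps] cap_lo_le[OF eps] by (auto simp: m_def)
  define K where "K = 20 / m ^ 3"
  have K: "1 \<le> K"
  proof -
    have "m ^ 3 \<le> 1" using m by (simp add: power_le_one)
    then show ?thesis using m by (simp add: K_def pos_le_divide_eq)
  qed
  have n2: "2 \<le> CARD('n)" using assms by simp
  obtain C1 where C1: "1 \<le> C1" and MZ: "\<And>(e :: real ^ 'n) \<alpha> n c. norm e = 1 \<Longrightarrow> 0 < \<alpha> \<Longrightarrow> \<alpha> \<le> pi - \<epsilon> \<Longrightarrow> 1 \<le> n \<Longrightarrow>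
    (\<exists>W. continuous_on UNIV W \<and>
      (\<forall>x y \<eta>. norm x = 1 \<longrightarrow> norm y = 1 \<longrightarrow> norm (x - y) \<le> \<eta> \<longrightarrow> C1 * \<eta> * real n \<le> 1 \<longrightarrow>
        \<bar>multi_poly n c (capmap e (sin (\<alpha> / 2)) y) - multi_poly n c (capmap e (sin (\<alpha> / 2)) x)\<bar> \<le> \<eta> * real n * W x) \<and>
      (LINT x|surface_measure. \<bar>x \<bullet> e\<bar> * W x) \<le>
        C1 * (LINT x|surface_measure. \<bar>x \<bullet> e\<bar> * \<bar>multi_poly n c (capmap e (sin (\<alpha> / 2)) x)\<bar>))"
    using MZ_oscillation[OF eps] by blast
  obtain A where A: "1 \<le> A" and vol: "\<And>(e :: real ^ 'n) \<alpha> \<omega> r. norm e = 1 \<Longrightarrow> 0 < \<alpha> \<Longrightarrow> \<alpha> \<le> pi - \<epsilon> \<Longrightarrow> \<omega> \<in> cap e \<alpha> \<Longrightarrow>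
    0 < r \<Longrightarrow> r \<le> 1 \<Longrightarrow>
    tri d e \<alpha> r \<omega> \<le> A * (LINT y|surface_measure. indicator {y. 1 - 2 * (sin (\<alpha> / 2))\<^sup>2 \<le> y \<bullet> e} y * indicator {y. rho e \<alpha> \<omega> y \<le> r} y) \<and>
    (LINT y|surface_measure. indicator {y. 1 - 2 * (sin (\<alpha> / 2))\<^sup>2 \<le> y \<bullet> e} y * indicator {y. rho e \<alpha> \<omega> y \<le> r} y) \<le> A * tri d e \<alpha> r \<omega>"
    using rho_ball_measure[OF eps assms(2,1)] by blast
  \<comment> \<open>The factor in the error estimate \<open>IE \<le> Q * \<delta> * If\<close>:
    \<open>K\<close> compares the distances, \<open>C1\<close> belongs to the oscillation
    inequality, and \<open>1 / m ^ d\<close> is the ratio of the upper to the lower bound for the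
    density.\<close>
  define Q where "Q = K * C1 / m ^ d"
  have Q: "1 \<le> Q"
  proof -
    have "m ^ d \<le> 1" using m by (simp add: power_le_one)
    moreover have "1 * 1 \<le> K * C1" using K C1 by (intro mult_mono) auto
    ultimately show ?thesis using m by (simp add: Q_def pos_le_divide_eq)
  qed
  \<comment> \<open>Through chordal distances on the hemisphere a triangle inequality holds up to
    the factor \<open>K\<^sup>2\<close>. With \<open>K\<^sup>2 * \<eta> = 1/4\<close> the ball of
    radius \<open>\<eta> * s\<close> around a node lies inside its cell.\<close>
  define \<eta> where "\<eta> = 1 / (4 * K\<^sup>2)"
  have K2: "1 \<le> K\<^sup>2" using K by (simp add: one_le_power)
  have \<eta>: "0 < \<eta>" "\<eta> \<le> 1" using K2 by (auto simp: \<eta>_def divide_le_eq)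
  \<comment> \<open>\<open>\<eta> ^ (d + 1)\<close> pays for shrinking the radius in
    \<open>tri\<close> by \<eta>, the 2 for the weights, which stay between half and twice the cell
    measures.\<close>
  define C where "C = 2 * A / \<eta> ^ (d + 1)"
  have \<eta>d: "0 < \<eta> ^ (d + 1)" "\<eta> ^ (d + 1) \<le> 1" using \<eta> power_le_one[of \<eta> "d + 1"] by auto
  have C: "2 * A \<le> C" using \<eta>d A unfolding C_def by (simp add: pos_le_divide_eq mult_left_le)
  \<comment> \<open>Makes the oscillation integral \<open>IE\<close> at most a quarter of the
    integral of \<open>\<bar>f\<bar>\<close> over the cap.\<close>
  define \<delta>\<^sub>0 where "\<delta>\<^sub>0 = 1 / (4 * Q)"
  have \<delta>0: "0 < \<delta>\<^sub>0" "\<delta>\<^sub>0 < 1" using Q by (auto simp: \<delta>\<^sub>0_def divide_less_eq)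
  show ?thesis
  proof (rule exI[of _ \<delta>\<^sub>0], rule exI[of _ C], intro conjI allI impI)
    show "0 < \<delta>\<^sub>0" "\<delta>\<^sub>0 < 1" by fact+
    show "1 \<le> C" using C A by simp
    fix e :: "real ^ 'n" and \<alpha> :: real and n :: nat and \<delta> :: real and \<Lambda> :: "(real ^ 'n) set"
    assume e': "e \<in> sphere 0 1" and al: "0 < \<alpha>" "\<alpha> \<le> pi - \<epsilon>" and n: "1 \<le> n" and \<delta>: "0 < \<delta>" "\<delta> < \<delta>\<^sub>0"
      and max: "maximal_separable e \<alpha> (\<delta> / n) \<Lambda>"
    have e: "norm e = 1" using e' by simp
    have al': "\<alpha> \<le> pi" using al eps by simp
    define \<kappa> where "\<kappa> = sin (\<alpha> / 2)"
    note kb = kappa_bounds[OF eps al \<kappa>_def]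
    have \<kappa>: "0 < \<kappa>" "\<kappa> < 1" using kb by auto
    define s where "s = \<delta> / real n"
    have sn: "s * real n = \<delta>" using n by (simp add: s_def)
    have s: "0 < s" "s \<le> 1"
    proof -
      show "0 < s" using \<delta> n by (simp add: s_def)
      then have "s * 1 \<le> s * real n" using n by (intro mult_left_mono) auto
      then show "s \<le> 1" using sn \<delta> \<delta>0 by simp
    qed
    have cap: "cap e \<alpha> = {y. norm y = 1 \<and> 1 - 2 * \<kappa>\<^sup>2 \<le> y \<bullet> e}"
      unfolding \<kappa>_def by (rule cap_eq[OF e al(1) al'])
    have fin: "finite \<Lambda>" and sub: "\<Lambda> \<subseteq> cap e \<alpha>"
      and sep: "\<And>\<xi> \<xi>'. \<xi> \<in> \<Lambda> \<Longrightarrow> \<xi>' \<in> \<Lambda> \<Longrightarrow> \<xi> \<noteq> \<xi>' \<Longrightarrow> s \<le> cap_metric e \<alpha> \<xi> \<xi>'"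
      and cover: "cap e \<alpha> = (\<Union>\<xi>\<in>\<Lambda>. cap_metric_ball e \<alpha> \<xi> s)"
      using max unfolding maximal_separable_def separable_def s_def by auto
    have \<Lambda>1: "norm \<omega> = 1" "1 - 2 * \<kappa>\<^sup>2 \<le> \<omega> \<bullet> e" if "\<omega> \<in> \<Lambda>" for \<omega> using that sub by (auto simp: cap)
    have "e \<in> cap e \<alpha>" using e by (simp add: cap dot_square_norm)
    then have ne: "\<Lambda> \<noteq> {}" using cover by auto
    \<comment> \<open>The half space that cuts out the cap: a Borel function on the whole space
      agreeing with the indicator of the cap on the sphere.\<close>
    define hh where "hh = (indicator {y. 1 - 2 * \<kappa>\<^sup>2 \<le> y \<bullet> e} :: real ^ 'n \<Rightarrow> real)"
    have hh01: "0 \<le> hh y" "hh y \<le> 1" for y by (auto simp: hh_def indicator_def)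
    have hhb: "hh \<in> borel_measurable borel"
      unfolding hh_def by (intro borel_measurable_indicator borel_closed closed_Collect_le continuous_intros)
    have hhcap: "hh y = indicator (cap e \<alpha>) y" if "norm y = 1" for y
      using that by (simp add: hh_def cap indicator_def)
    have lift: "\<exists>x. norm x = 1 \<and> 0 \<le> x \<bullet> e \<and> capmap e \<kappa> x = y" if "norm y = 1" "1 - 2 * \<kappa>\<^sup>2 \<le> y \<bullet> e" for y
      using capmap_surj[OF e \<kappa> that] .
    have rle: "rho e \<alpha> (capmap e \<kappa> x) (capmap e \<kappa> y) \<le> K * norm (x - y)"
      and rge: "norm (x - y) \<le> K * rho e \<alpha> (capmap e \<kappa> x) (capmap e \<kappa> y)"
      if "norm x = 1" "0 \<le> x \<bullet> e" "norm y = 1" "0 \<le> y \<bullet> e" for x y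
      using rho_capmap_bounds[OF eps al e that] unfolding K_def m_def \<kappa>_def by auto
    define \<psi> where "\<psi> = voronoi_wt \<Lambda> e \<alpha>"
    have \<psi>0: "0 \<le> \<psi> \<omega> y" for \<omega> y unfolding \<psi>_def by (rule voronoi_wt_nonneg[OF fin])
    have \<psi>1: "\<psi> \<omega> y \<le> 1" if "\<omega> \<in> \<Lambda>" for \<omega> y unfolding \<psi>_def by (rule voronoi_wt_le_1[OF fin that])
    have \<psi>s: "(\<Sum>\<omega>\<in>\<Lambda>. \<psi> \<omega> y) = 1" for y unfolding \<psi>_def by (rule sum_voronoi_wt[OF fin ne])
    have \<psi>b: "\<psi> \<omega> \<in> borel_measurable borel" for \<omega> unfolding \<psi>_def by (rule borel_voronoi_wt[OF fin al(1)])
    \<comment> \<open>Only a nearest node has positive weight at \<open>y\<close>, and by maximality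
      some node is within \<open>s\<close> of \<open>y\<close>.\<close>
    have \<psi>supp: "rho e \<alpha> \<omega> y \<le> s" if \<omega>: "\<omega> \<in> \<Lambda>" and y: "norm y = 1" "1 - 2 * \<kappa>\<^sup>2 \<le> y \<bullet> e" and nz: "\<psi> \<omega> y \<noteq> 0" for \<omega> y
    proof -
      have le: "rho e \<alpha> \<omega> y \<le> rho e \<alpha> \<omega>' y" if "\<omega>' \<in> \<Lambda>" for \<omega>'
        using nz that by (auto simp: \<psi>_def voronoi_wt_def indicator_def split: if_splits)
      have "y \<in> cap e \<alpha>" using y by (simp add: cap)
      then have "y \<in> (\<Union>\<xi>\<in>\<Lambda>. cap_metric_ball e \<alpha> \<xi> s)" by (simp only: cover)
      then obtain \<omega>' where "\<omega>' \<in> \<Lambda>" "cap_metric e \<alpha> \<omega>' y \<le> s" by (auto simp: cap_metric_ball_def)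
      then show ?thesis using le[of \<omega>'] rho_eq[OF e \<Lambda>1(1) y(1), of \<omega>'] by simp
    qed
    \<comment> \<open>So close to a node no other node can be nearest or even tie: the separation is
      carried to the hemisphere, where the Euclidean triangle inequality applies, and back.\<close>
    have \<psi>near: "\<psi> \<omega> y = 1" if \<omega>: "\<omega> \<in> \<Lambda>" and y: "norm y = 1" "1 - 2 * \<kappa>\<^sup>2 \<le> y \<bullet> e" and r: "rho e \<alpha> \<omega> y \<le> \<eta> * s" for \<omega> y
    proof -
      obtain x0 where x0: "norm x0 = 1" "0 \<le> x0 \<bullet> e" "capmap e \<kappa> x0 = \<omega>" using lift \<Lambda>1[OF \<omega>] by blast
      obtain y0 where y0: "norm y0 = 1" "0 \<le> y0 \<bullet> e" "capmap e \<kappa> y0 = y" using lift y by blast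
      have far: "rho e \<alpha> \<omega> y < rho e \<alpha> \<omega>' y" if \<omega>': "\<omega>' \<in> \<Lambda>" "\<omega>' \<noteq> \<omega>" for \<omega>'
      proof -
        obtain x1 where x1: "norm x1 = 1" "0 \<le> x1 \<bullet> e" "capmap e \<kappa> x1 = \<omega>'" using lift \<Lambda>1[OF \<omega>'(1)] by blast
        have "s \<le> rho e \<alpha> \<omega> \<omega>'" using sep[OF \<omega> \<omega>'(1)] \<omega>' rho_eq[OF e \<Lambda>1(1)[OF \<omega>] \<Lambda>1(1)[OF \<omega>'(1)]] by simp
        also have "\<dots> \<le> K * norm (x0 - x1)" using rle[OF x0(1,2) x1(1,2)] by (simp add: x0 x1)
        finally have "s \<le> K * norm (x0 - x1)" .
        moreover have "norm (x0 - x1) \<le> norm (x0 - y0) + norm (x1 - y0)"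
          using norm_triangle_ineq4[of "x0 - y0" "x1 - y0"] by simp
        moreover have "norm (x0 - y0) \<le> K * rho e \<alpha> \<omega> y" using rge[OF x0(1,2) y0(1,2)] by (simp add: x0 y0)
        moreover have "K * rho e \<alpha> \<omega> y \<le> K * (\<eta> * s)" using r K by (intro mult_left_mono) auto
        moreover have "norm (x1 - y0) \<le> K * rho e \<alpha> \<omega>' y" using rge[OF x1(1,2) y0(1,2)] by (simp add: x1 y0)
        ultimately have "s \<le> K * (K * (\<eta> * s) + K * rho e \<alpha> \<omega>' y)"
          using mult_left_mono[of "norm (x0 - x1)" "K * (\<eta> * s) + K * rho e \<alpha> \<omega>' y" K] K by linarith
        also have "\<dots> = K\<^sup>2 * \<eta> * s + K\<^sup>2 * rho e \<alpha> \<omega>' y" by (simp add: power2_eq_square algebra_simps)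
        also have "K\<^sup>2 * \<eta> = 1/4" using K by (simp add: \<eta>_def)
        finally have "3/4 * s \<le> K\<^sup>2 * rho e \<alpha> \<omega>' y" by simp
        moreover have "K\<^sup>2 * (\<eta> * s) = s / 4" using K by (simp add: \<eta>_def)
        ultimately have "K\<^sup>2 * (\<eta> * s) < K\<^sup>2 * rho e \<alpha> \<omega>' y" using s by linarith
        then have "\<eta> * s < rho e \<alpha> \<omega>' y" using K by (simp add: mult_less_cancel_left_pos)
        then show ?thesis using r by simp
      qed
      have i: "indicator {y. \<forall>\<omega>''\<in>\<Lambda>. rho e \<alpha> \<omega>' y \<le> rho e \<alpha> \<omega>'' y} y = (if \<omega>' = \<omega> then 1 else 0 :: real)" if "\<omega>' \<in> \<Lambda>" for \<omega>'
        using far that \<omega> by (force simp: indicator_def)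
      have "(\<Sum>\<omega>'\<in>\<Lambda>. indicator {y. \<forall>\<omega>''\<in>\<Lambda>. rho e \<alpha> \<omega>' y \<le> rho e \<alpha> \<omega>'' y} y) = (\<Sum>\<omega>'\<in>\<Lambda>. if \<omega>' = \<omega> then 1 else 0 :: real)"
        by (intro sum.cong refl i)
      also have "\<dots> = 1" using fin \<omega> by simp
      finally show ?thesis unfolding \<psi>_def voronoi_wt_def using i[OF \<omega>] by simp
    qed
    have int: "integrable surface_measure (\<lambda>y. hh y * g y)"
      if "g \<in> borel_measurable borel" "\<And>y. norm y = 1 \<Longrightarrow> \<bar>g y\<bar> \<le> M" for g and M :: real
    proof (rule integrable_surface_bounded[where C = "1 * M"])
      show "(\<lambda>y. hh y * g y) \<in> borel_measurable borel" using hhb that(1) by (rule borel_measurable_times)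
      fix y :: "real ^ 'n" assume y: "norm y = 1"
      show "\<bar>hh y * g y\<bar> \<le> 1 * M" unfolding abs_mult using hh01[of y] that(2)[OF y] by (intro mult_mono) auto
    qed
    define V where "V r \<omega> = (LINT y|surface_measure. hh y * indicator {y. rho e \<alpha> \<omega> y \<le> r} y)" for r \<omega>
    have Vtri: "tri d e \<alpha> r \<omega> \<le> A * V r \<omega>" "V r \<omega> \<le> A * tri d e \<alpha> r \<omega>" if "\<omega> \<in> \<Lambda>" "0 < r" "r \<le> 1" for r \<omega>
      using vol[OF e al _ that(2,3), of \<omega>] that(1) sub unfolding V_def hh_def \<kappa>_def by auto
    have Eb: "(indicator {y. rho e \<alpha> \<omega> y \<le> r} :: real ^ 'n \<Rightarrow> real) \<in> borel_measurable borel" for \<omega> r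
      by (intro borel_measurable_indicator borel_closed closed_Collect_le continuous_on_rho al continuous_on_const)
    have iE: "integrable surface_measure (\<lambda>y. hh y * indicator {y. rho e \<alpha> \<omega> y \<le> r} y)" for \<omega> r
      by (rule int[OF Eb, where M = 1]) (simp add: indicator_def)
    have i\<psi>: "integrable surface_measure (\<lambda>y. hh y * \<psi> \<omega> y)" if "\<omega> \<in> \<Lambda>" for \<omega>
      by (rule int[OF \<psi>b, where M = 1]) (use \<psi>0 \<psi>1[OF that] in simp)
    define \<mu> where "\<mu> \<omega> = (LINT y|surface_measure. hh y * \<psi> \<omega> y)" for \<omega>
    have \<mu>up: "\<mu> \<omega> \<le> V s \<omega>" if \<omega>: "\<omega> \<in> \<Lambda>" for \<omega>
      unfolding \<mu>_def V_def
    proof (rule integral_mono[OF i\<psi>[OF \<omega>] iE])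
      fix y :: "real ^ 'n" assume "y \<in> space surface_measure"
      then have y: "norm y = 1" by (simp add: space_surface_measure)
      show "hh y * \<psi> \<omega> y \<le> hh y * indicator {y. rho e \<alpha> \<omega> y \<le> s} y"
      proof (cases "1 - 2 * \<kappa>\<^sup>2 \<le> y \<bullet> e \<and> \<psi> \<omega> y \<noteq> 0")
        case True
        then have "rho e \<alpha> \<omega> y \<le> s" using \<psi>supp[OF \<omega> y] by blast
        then show ?thesis using \<psi>1[OF \<omega>, of y] hh01[of y] by (intro mult_left_mono) auto
      next
        case False
        then have "hh y = 0 \<or> \<psi> \<omega> y = 0" by (auto simp: hh_def indicator_def)
        then show ?thesis using hh01[of y] by auto
      qed
    qed
    have \<mu>lo: "V (\<eta> * s) \<omega> \<le> \<mu> \<omega>" if \<omega>: "\<omega> \<in> \<Lambda>" for \<omega>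
      unfolding \<mu>_def V_def
    proof (rule integral_mono[OF iE i\<psi>[OF \<omega>]])
      fix y :: "real ^ 'n" assume "y \<in> space surface_measure"
      then have y: "norm y = 1" by (simp add: space_surface_measure)
      show "hh y * indicator {y. rho e \<alpha> \<omega> y \<le> \<eta> * s} y \<le> hh y * \<psi> \<omega> y"
      proof (cases "1 - 2 * \<kappa>\<^sup>2 \<le> y \<bullet> e \<and> rho e \<alpha> \<omega> y \<le> \<eta> * s")
        case True
        then have "\<psi> \<omega> y = 1" using \<psi>near[OF \<omega> y] by blast
        then show ?thesis using hh01[of y] by (simp add: indicator_def)
      next
        case False
        then show ?thesis using hh01[of y] \<psi>0[of \<omega> y] by (auto simp: hh_def indicator_def)
      qed
    qed
    \<comment> \<open>\<open>tri\<close> is a sum of terms in \<open>r ^ (d + 1)\<close> and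
      \<open>r ^ d\<close>; since \<open>\<eta> \<le> 1\<close>, the higher power bounds the loss
      for both.\<close>
    have tri_pos: "0 < tri d e \<alpha> s \<omega>" and tri_scale: "\<eta> ^ (d + 1) * tri d e \<alpha> s \<omega> \<le> tri d e \<alpha> (\<eta> * s) \<omega>" if \<omega>: "\<omega> \<in> \<Lambda>" for \<omega>
    proof -
      have "geod_dist \<omega> e \<le> \<alpha>" using \<omega> sub by (auto simp: cap_def)
      then have t: "0 \<le> sqrt (1 - geod_dist \<omega> e / \<alpha>)" using al by simp
      have "0 < s ^ (d + 1) + s ^ d * sqrt (1 - geod_dist \<omega> e / \<alpha>)"
        using s t by (intro add_pos_nonneg) auto
      then show "0 < tri d e \<alpha> s \<omega>" using al unfolding tri_def by simp
      have "\<eta> ^ (d + 1) \<le> \<eta> ^ d" using \<eta> by (intro power_decreasing) auto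
      then have "\<eta> ^ (d + 1) * (s ^ d * sqrt (1 - geod_dist \<omega> e / \<alpha>)) \<le> \<eta> ^ d * (s ^ d * sqrt (1 - geod_dist \<omega> e / \<alpha>))"
        using s t by (intro mult_right_mono) auto
      then have "\<alpha> ^ d * (\<eta> ^ (d + 1) * s ^ (d + 1) + \<eta> ^ (d + 1) * (s ^ d * sqrt (1 - geod_dist \<omega> e / \<alpha>)))
        \<le> \<alpha> ^ d * (\<eta> ^ (d + 1) * s ^ (d + 1) + \<eta> ^ d * (s ^ d * sqrt (1 - geod_dist \<omega> e / \<alpha>)))"
        using al by (intro mult_left_mono) auto
      then show "\<eta> ^ (d + 1) * tri d e \<alpha> s \<omega> \<le> tri d e \<alpha> (\<eta> * s) \<omega>"
        unfolding tri_def power_mult_distrib by (simp only: distrib_left mult_ac)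
    qed
    have \<mu>tri: "\<eta> ^ (d + 1) * tri d e \<alpha> s \<omega> \<le> A * \<mu> \<omega>" "\<mu> \<omega> \<le> A * tri d e \<alpha> s \<omega>" if \<omega>: "\<omega> \<in> \<Lambda>" for \<omega>
    proof -
      have es: "0 < \<eta> * s" "\<eta> * s \<le> 1" using \<eta> s by (auto intro: mult_le_one)
      have "\<eta> ^ (d + 1) * tri d e \<alpha> s \<omega> \<le> A * V (\<eta> * s) \<omega>"
        using tri_scale[OF \<omega>] Vtri(1)[OF \<omega> es] by linarith
      also have "\<dots> \<le> A * \<mu> \<omega>" using \<mu>lo[OF \<omega>] A by (intro mult_left_mono) auto
      finally show "\<eta> ^ (d + 1) * tri d e \<alpha> s \<omega> \<le> A * \<mu> \<omega>" .
      show "\<mu> \<omega> \<le> A * tri d e \<alpha> s \<omega>" using \<mu>up[OF \<omega>] Vtri(2)[OF \<omega> s] by linarith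
    qed
    have \<mu>pos: "0 < \<mu> \<omega>" if \<omega>: "\<omega> \<in> \<Lambda>" for \<omega>
    proof -
      have "0 < A * \<mu> \<omega>" using \<mu>tri(1)[OF \<omega>] mult_pos_pos[OF \<eta>d(1) tri_pos[OF \<omega>]] by linarith
      then show ?thesis using A by (simp add: zero_less_mult_iff)
    qed
    define L where "L f = (LINT y|surface_measure. hh y * f y) - (\<Sum>\<omega>\<in>\<Lambda>. \<mu> \<omega> * f \<omega>)" for f
    have key: "\<bar>L (multi_poly n c)\<bar> \<le> (\<Sum>\<omega>\<in>\<Lambda>. \<mu> \<omega> / 2 * \<bar>multi_poly n c \<omega>\<bar>)" for c
    proof -
      define f where "f = (multi_poly n c :: real ^ 'n \<Rightarrow> real)"
      have fc: "continuous_on UNIV f" unfolding f_def by (rule continuous_on_multi_poly)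
      have fb: "f \<in> borel_measurable borel" using fc by (rule borel_measurable_continuous_onI)
      obtain M where M: "\<And>y. norm y = 1 \<Longrightarrow> \<bar>f y\<bar> \<le> M"
        by (rule continuous_bounded_sphere[OF fc]) blast
      obtain W where W: "continuous_on UNIV W"
        "\<And>x y \<eta>. norm x = 1 \<Longrightarrow> norm y = 1 \<Longrightarrow> norm (x - y) \<le> \<eta> \<Longrightarrow> C1 * \<eta> * real n \<le> 1 \<Longrightarrow>
          \<bar>f (capmap e \<kappa> y) - f (capmap e \<kappa> x)\<bar> \<le> \<eta> * real n * W x"
        "(LINT x|surface_measure. \<bar>x \<bullet> e\<bar> * W x) \<le> C1 * (LINT x|surface_measure. \<bar>x \<bullet> e\<bar> * \<bar>f (capmap e \<kappa> x)\<bar>)"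
        using MZ[OF e al n, of c] unfolding f_def \<kappa>_def by blast
      \<comment> \<open>The pointwise error of replacing \<open>f\<close> by its values at the
        nodes, averaged with the cell weights.\<close>
      define E where "E y = (\<Sum>\<omega>\<in>\<Lambda>. \<psi> \<omega> y * \<bar>f y - f \<omega>\<bar>)" for y
      have Eb: "E \<in> borel_measurable borel"
        unfolding E_def by (intro borel_measurable_sum borel_measurable_times \<psi>b borel_measurable_abs borel_measurable_diff fb borel_measurable_const)
      have E0: "0 \<le> E y" for y unfolding E_def by (intro sum_nonneg mult_nonneg_nonneg \<psi>0) auto
      have fd: "\<bar>f y - f \<omega>\<bar> \<le> 2 * M" if "norm y = 1" "\<omega> \<in> \<Lambda>" for y \<omega>
        using M[OF that(1)] M[OF \<Lambda>1(1)[OF that(2)]] by linarith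
      have EM: "E y \<le> 2 * M" if y: "norm y = 1" for y
      proof -
        have "E y \<le> (\<Sum>\<omega>\<in>\<Lambda>. \<psi> \<omega> y * (2 * M))"
          unfolding E_def by (intro sum_mono mult_left_mono fd y \<psi>0)
        also have "\<dots> = 2 * M" by (simp only: sum_distrib_right[symmetric] \<psi>s mult_1)
        finally show ?thesis .
      qed
      define IE where "IE = (LINT y|surface_measure. hh y * E y)"
      define If where "If = (LINT y|surface_measure. hh y * \<bar>f y\<bar>)"
      have If0: "0 \<le> If" unfolding If_def using hh01 by (intro Bochner_Integration.integral_nonneg) auto
      have osc: "E (capmap e \<kappa> x) \<le> (K * \<delta>) * W x" if x: "norm x = 1" for x
      proof -
        have ny: "norm (capmap e \<kappa> x) = 1" "1 - 2 * \<kappa>\<^sup>2 \<le> capmap e \<kappa> x \<bullet> e"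
          using norm_capmap[OF e \<kappa>, of x] capmap_in_cap[OF e \<kappa>, of x] x by auto
        have trm: "\<psi> \<omega> (capmap e \<kappa> x) * \<bar>f (capmap e \<kappa> x) - f \<omega>\<bar> \<le> \<psi> \<omega> (capmap e \<kappa> x) * (K * \<delta> * W x)" if \<omega>: "\<omega> \<in> \<Lambda>" for \<omega>
        proof (cases "\<psi> \<omega> (capmap e \<kappa> x) = 0")
          case False
          then have r: "rho e \<alpha> \<omega> (capmap e \<kappa> x) \<le> s" by (rule \<psi>supp[OF \<omega> ny])
          obtain x0 where x0: "norm x0 = 1" "0 \<le> x0 \<bullet> e" "capmap e \<kappa> x0 = \<omega>" using lift \<Lambda>1[OF \<omega>] by blast
          obtain y where y: "y = x \<or> y = reflect e x" "norm y = 1" "0 \<le> y \<bullet> e" "capmap e \<kappa> y = capmap e \<kappa> x"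
            using reflect_unfold[OF e x] by blast
          have "norm (x0 - y) \<le> K * rho e \<alpha> \<omega> (capmap e \<kappa> x)" using rge[OF x0(1,2) y(2,3)] by (simp add: x0 y)
          also have "\<dots> \<le> K * s" using r K by (intro mult_left_mono) auto
          finally have near: "norm (x0 - y) \<le> K * s" .
          \<comment> \<open>The preimage of the node is taken on the same sheet as \<open>x\<close>,
            by reflecting \<open>x0\<close> when \<open>x\<close> was reflected, so that the two
            points are close on the sphere and the oscillation bound applies.\<close>
          have "\<exists>x1. norm x1 = 1 \<and> capmap e \<kappa> x1 = \<omega> \<and> norm (x - x1) \<le> K * s"
          proof (cases "y = x")
            case True
            then show ?thesis using near x0 by (intro exI[of _ x0]) (simp add: norm_minus_commute)
          next
            case False
            then have "x = reflect e y" using y(1) reflect_reflect[OF e] by metis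
            then have "x - reflect e x0 = reflect e (y - x0)" by (simp add: linear_diff[OF linear_reflect])
            then have "norm (x - reflect e x0) \<le> K * s" using near by (simp add: norm_reflect[OF e] norm_minus_commute)
            then show ?thesis using x0
              by (intro exI[of _ "reflect e x0"]) (simp add: norm_reflect[OF e] capmap_reflect[OF e])
          qed
          then obtain x1 where x1: "norm x1 = 1" "capmap e \<kappa> x1 = \<omega>" "norm (x - x1) \<le> K * s" by blast
          have "C1 * (K * s) * real n = C1 * K * \<delta>" using sn by (simp add: mult_ac)
          also have "\<dots> \<le> Q * \<delta>"
          proof -
            have "m ^ d \<le> 1" using m by (simp add: power_le_one)
            then have "K * C1 / 1 \<le> Q" unfolding Q_def using K C1 m by (intro divide_left_mono) auto
            then show ?thesis using \<delta> by (intro mult_right_mono) (auto simp: mult.commute)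
          qed
          also have "\<dots> \<le> Q * \<delta>\<^sub>0" using \<delta> Q by (intro mult_left_mono) auto
          also have "\<dots> \<le> 1" using Q by (simp add: \<delta>\<^sub>0_def)
          finally have "\<bar>f (capmap e \<kappa> x1) - f (capmap e \<kappa> x)\<bar> \<le> (K * s) * real n * W x"
            by (rule W(2)[OF x x1(1,3)])
          also have "(K * s) * real n = K * \<delta>" using sn by (simp add: mult.assoc)
          finally have "\<bar>f (capmap e \<kappa> x) - f \<omega>\<bar> \<le> K * \<delta> * W x" by (simp add: x1 abs_minus_commute)
          then show ?thesis by (intro mult_left_mono \<psi>0)
        qed simp
        have "E (capmap e \<kappa> x) \<le> (\<Sum>\<omega>\<in>\<Lambda>. \<psi> \<omega> (capmap e \<kappa> x) * (K * \<delta> * W x))"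
          unfolding E_def by (intro sum_mono trm)
        also have "\<dots> = K * \<delta> * W x" by (simp only: sum_distrib_right[symmetric] \<psi>s mult_1)
        finally show ?thesis .
      qed
      define Dm where "Dm = (2 * \<kappa>) ^ d"
      have Dm: "0 < Dm" using \<kappa> by (simp add: Dm_def)
      have mk: "m \<le> sqrt (1 - \<kappa>\<^sup>2)" using kb(5) by (simp add: m_def)
      have cd: "0 \<le> capdens e \<kappa> x" "capdens e \<kappa> x \<le> Dm / m" "Dm * m ^ (d - 1) \<le> capdens e \<kappa> x" if x: "norm x = 1" for x
        using capdens_nonneg[OF \<kappa> e, of x] capdens_le[OF e \<kappa> _ m(1) mk, of x] x assms(2) by (auto simp: Dm_def)
      \<comment> \<open>Both integrals over the cap are expressed on the sphere, where the density
        lies between \<open>Dm * m ^ (d - 1)\<close> and \<open>Dm / m\<close>. The factor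
        \<open>Dm\<close>, which carries the size of the cap, cancels.\<close>
      have IEle: "IE \<le> Q * \<delta> * If"
      proof -
        have lowf: "(LINT x|surface_measure. \<bar>x \<bullet> e\<bar> * \<bar>f (capmap e \<kappa> x)\<bar>) \<le> 1 / (Dm * m ^ (d - 1)) * (2 * If)"
        proof -
          have ab: "(\<lambda>y. \<bar>f y\<bar>) \<in> borel_measurable borel" using fb by (rule borel_measurable_abs)
          have "(LINT x|surface_measure. (Dm * m ^ (d - 1)) * (\<bar>x \<bullet> e\<bar> * \<bar>f (capmap e \<kappa> x)\<bar>))
            \<le> (LINT x|surface_measure. \<bar>x \<bullet> e\<bar> * (capdens e \<kappa> x * \<bar>f (capmap e \<kappa> x)\<bar>))"
          proof (rule integral_mono)
            have "continuous_on UNIV (\<lambda>x. f (capmap e \<kappa> x))"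
              by (rule continuous_on_compose2[OF fc continuous_on_capmap]) auto
            then show "integrable surface_measure (\<lambda>x. (Dm * m ^ (d - 1)) * (\<bar>x \<bullet> e\<bar> * \<bar>f (capmap e \<kappa> x)\<bar>))"
              by (intro integrable_mult_right integrable_surface_continuous continuous_intros)
            show "integrable surface_measure (\<lambda>x. \<bar>x \<bullet> e\<bar> * (capdens e \<kappa> x * \<bar>f (capmap e \<kappa> x)\<bar>))"
            proof (rule integrable_surface_bounded[where C = "1 * (Dm / m * M)"])
              show "(\<lambda>x. \<bar>x \<bullet> e\<bar> * (capdens e \<kappa> x * \<bar>f (capmap e \<kappa> x)\<bar>)) \<in> borel_measurable borel"
                by (intro borel_measurable_times borel_measurable_abs borel_measurable_inner borel_capdens
                    measurable_compose[OF borel_capmap fb]) auto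
              fix x :: "real ^ 'n" assume x: "norm x = 1"
              show "\<bar>\<bar>x \<bullet> e\<bar> * (capdens e \<kappa> x * \<bar>f (capmap e \<kappa> x)\<bar>)\<bar> \<le> 1 * (Dm / m * M)"
                unfolding abs_mult using cd[OF x] M[of "capmap e \<kappa> x"] norm_capmap[OF e \<kappa>, of x] x inner_unit_bounds[OF x e] Dm m
                by (intro mult_mono) auto
            qed
            fix x :: "real ^ 'n" assume "x \<in> space surface_measure"
            then have x: "norm x = 1" by (simp add: space_surface_measure)
            have "\<bar>x \<bullet> e\<bar> * ((Dm * m ^ (d - 1)) * \<bar>f (capmap e \<kappa> x)\<bar>) \<le> \<bar>x \<bullet> e\<bar> * (capdens e \<kappa> x * \<bar>f (capmap e \<kappa> x)\<bar>)"
              using cd(3)[OF x] by (intro mult_left_mono mult_right_mono) auto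
            then show "(Dm * m ^ (d - 1)) * (\<bar>x \<bullet> e\<bar> * \<bar>f (capmap e \<kappa> x)\<bar>) \<le> \<bar>x \<bullet> e\<bar> * (capdens e \<kappa> x * \<bar>f (capmap e \<kappa> x)\<bar>)"
              by (simp only: mult_ac)
          qed
          also have "\<dots> = 2 * If"
            unfolding If_def hh_def by (rule integral_cap[OF e \<kappa> n2 ab, where C = M, symmetric]) (use M in simp)
          finally have "(Dm * m ^ (d - 1)) * (LINT x|surface_measure. \<bar>x \<bullet> e\<bar> * \<bar>f (capmap e \<kappa> x)\<bar>) \<le> 2 * If"
            by (simp only: integral_mult_right_zero)
          moreover have "0 < Dm * m ^ (d - 1)" using Dm m by simp
          ultimately show ?thesis by (simp add: pos_le_divide_eq mult.commute)
        qed
        have "2 * IE = (LINT x|surface_measure. \<bar>x \<bullet> e\<bar> * (capdens e \<kappa> x * E (capmap e \<kappa> x)))"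
          unfolding IE_def hh_def
          by (rule integral_cap[OF e \<kappa> n2 Eb, where C = "2 * M"]) (use E0 EM in simp)
        also have "\<dots> \<le> (LINT x|surface_measure. Dm / m * (K * \<delta>) * (\<bar>x \<bullet> e\<bar> * W x))"
        proof (rule integral_mono)
          show "integrable surface_measure (\<lambda>x. Dm / m * (K * \<delta>) * (\<bar>x \<bullet> e\<bar> * W x))"
            by (intro integrable_mult_right integrable_surface_continuous continuous_intros W)
          show "integrable surface_measure (\<lambda>x. \<bar>x \<bullet> e\<bar> * (capdens e \<kappa> x * E (capmap e \<kappa> x)))"
          proof (rule integrable_surface_bounded[where C = "1 * (Dm / m * (2 * M))"])
            show "(\<lambda>x. \<bar>x \<bullet> e\<bar> * (capdens e \<kappa> x * E (capmap e \<kappa> x))) \<in> borel_measurable borel"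
              by (intro borel_measurable_times borel_measurable_abs borel_measurable_inner borel_capdens
                  measurable_compose[OF borel_capmap Eb]) auto
            fix x :: "real ^ 'n" assume x: "norm x = 1"
            show "\<bar>\<bar>x \<bullet> e\<bar> * (capdens e \<kappa> x * E (capmap e \<kappa> x))\<bar> \<le> 1 * (Dm / m * (2 * M))"
              unfolding abs_mult using cd[OF x] E0 EM[of "capmap e \<kappa> x"] norm_capmap[OF e \<kappa>, of x] x inner_unit_bounds[OF x e] Dm m
              by (intro mult_mono) auto
          qed
          fix x :: "real ^ 'n" assume "x \<in> space surface_measure"
          then have x: "norm x = 1" by (simp add: space_surface_measure)
          have "capdens e \<kappa> x * E (capmap e \<kappa> x) \<le> Dm / m * ((K * \<delta>) * W x)"
            using cd[OF x] osc[OF x] E0 Dm m by (intro mult_mono) auto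
          then have "\<bar>x \<bullet> e\<bar> * (capdens e \<kappa> x * E (capmap e \<kappa> x)) \<le> \<bar>x \<bullet> e\<bar> * (Dm / m * ((K * \<delta>) * W x))"
            by (intro mult_left_mono) auto
          then show "\<bar>x \<bullet> e\<bar> * (capdens e \<kappa> x * E (capmap e \<kappa> x)) \<le> Dm / m * (K * \<delta>) * (\<bar>x \<bullet> e\<bar> * W x)"
            by (simp only: mult_ac)
        qed
        also have "\<dots> = Dm / m * (K * \<delta>) * (LINT x|surface_measure. \<bar>x \<bullet> e\<bar> * W x)"
          by (rule integral_mult_right_zero)
        also have "\<dots> \<le> Dm / m * (K * \<delta>) * (C1 * (LINT x|surface_measure. \<bar>x \<bullet> e\<bar> * \<bar>f (capmap e \<kappa> x)\<bar>))"
          using Dm m K \<delta> by (intro mult_left_mono W(3)) auto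
        also have "\<dots> \<le> Dm / m * (K * \<delta>) * (C1 * (1 / (Dm * m ^ (d - 1)) * (2 * If)))"
          using Dm m K \<delta> C1 by (intro mult_left_mono lowf) auto
        also have "\<dots> = 2 * (Q * \<delta> * If)"
        proof -
          have "m * m ^ (d - 1) = m ^ d" using assms(1) by (simp add: power_eq_if)
          then have mm: "m ^ d = m * m ^ (d - 1)" by simp
          show ?thesis unfolding Q_def mm using Dm m by (simp add: divide_simps)
        qed
        finally show ?thesis by simp
      qed
      have "Q * \<delta> \<le> Q * \<delta>\<^sub>0" using \<delta> Q by (intro mult_left_mono) auto
      also have "\<dots> = 1/4" using Q by (simp add: \<delta>\<^sub>0_def)
      finally have "Q * \<delta> * If \<le> 1/4 * If" using If0 by (intro mult_right_mono)
      with IEle have IE4: "IE \<le> If / 4" by simp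
      have if\<psi>: "integrable surface_measure (\<lambda>y. hh y * (\<psi> \<omega> y * g y))"
        if "\<omega> \<in> \<Lambda>" "g \<in> borel_measurable borel" "\<And>y. norm y = 1 \<Longrightarrow> \<bar>g y\<bar> \<le> M'" for \<omega> g and M' :: real
      proof (rule int[where M = "1 * M'"])
        show "(\<lambda>y. \<psi> \<omega> y * g y) \<in> borel_measurable borel" using \<psi>b that(2) by (rule borel_measurable_times)
        fix y :: "real ^ 'n" assume y: "norm y = 1"
        show "\<bar>\<psi> \<omega> y * g y\<bar> \<le> 1 * M'" unfolding abs_mult using \<psi>0[of \<omega> y] \<psi>1[OF that(1), of y] that(3)[OF y] by (intro mult_mono) auto
      qed
      have split: "(LINT y|surface_measure. hh y * g y) - (\<Sum>\<omega>\<in>\<Lambda>. \<mu> \<omega> * g \<omega>)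
          = (\<Sum>\<omega>\<in>\<Lambda>. (LINT y|surface_measure. hh y * (\<psi> \<omega> y * (g y - g \<omega>))))"
        if gb: "g \<in> borel_measurable borel" and gM: "\<And>y. norm y = 1 \<Longrightarrow> \<bar>g y\<bar> \<le> M" for g
      proof -
        have "hh y * g y = (\<Sum>\<omega>\<in>\<Lambda>. hh y * (\<psi> \<omega> y * g y))" for y
          by (simp only: sum_distrib_left[symmetric] sum_distrib_right[symmetric] \<psi>s mult_1)
        then have "(LINT y|surface_measure. hh y * g y) = (\<Sum>\<omega>\<in>\<Lambda>. (LINT y|surface_measure. hh y * (\<psi> \<omega> y * g y)))"
          by (simp only: Bochner_Integration.integral_sum[OF if\<psi>[OF _ gb gM]])
        moreover have "(\<Sum>\<omega>\<in>\<Lambda>. \<mu> \<omega> * g \<omega>) = (\<Sum>\<omega>\<in>\<Lambda>. (LINT y|surface_measure. hh y * \<psi> \<omega> y * g \<omega>))"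
          by (simp add: \<mu>_def)
        ultimately have "(LINT y|surface_measure. hh y * g y) - (\<Sum>\<omega>\<in>\<Lambda>. \<mu> \<omega> * g \<omega>)
          = (\<Sum>\<omega>\<in>\<Lambda>. (LINT y|surface_measure. hh y * (\<psi> \<omega> y * g y)) - (LINT y|surface_measure. hh y * \<psi> \<omega> y * g \<omega>))"
          by (simp add: sum_subtractf)
        also have "\<dots> = (\<Sum>\<omega>\<in>\<Lambda>. (LINT y|surface_measure. hh y * (\<psi> \<omega> y * (g y - g \<omega>))))"
        proof (rule sum.cong[OF refl])
          fix \<omega> assume \<omega>: "\<omega> \<in> \<Lambda>"
          have "(LINT y|surface_measure. hh y * (\<psi> \<omega> y * g y)) - (LINT y|surface_measure. hh y * \<psi> \<omega> y * g \<omega>)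
            = (LINT y|surface_measure. hh y * (\<psi> \<omega> y * g y) - hh y * \<psi> \<omega> y * g \<omega>)"
            using Bochner_Integration.integral_diff[OF if\<psi>[OF \<omega> gb gM] integrable_mult_left[OF i\<psi>[OF \<omega>], of "g \<omega>"]] by simp
          then show "(LINT y|surface_measure. hh y * (\<psi> \<omega> y * g y)) - (LINT y|surface_measure. hh y * \<psi> \<omega> y * g \<omega>)
            = (LINT y|surface_measure. hh y * (\<psi> \<omega> y * (g y - g \<omega>)))" by (simp add: algebra_simps)
        qed
        finally show ?thesis .
      qed
      \<comment> \<open>Formulated for every \<open>g\<close> that varies no more than
        \<open>f\<close>, because it is used twice: for \<open>f\<close> it bounds the quadrature
        error, for \<open>\<bar>f\<bar>\<close> it compares the integral with the sum over the
        nodes.\<close>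
      have bound: "\<bar>(LINT y|surface_measure. hh y * g y) - (\<Sum>\<omega>\<in>\<Lambda>. \<mu> \<omega> * g \<omega>)\<bar> \<le> IE"
        if gb: "g \<in> borel_measurable borel" and gM: "\<And>y. norm y = 1 \<Longrightarrow> \<bar>g y\<bar> \<le> M"
          and gf: "\<And>y \<omega>. \<bar>g y - g \<omega>\<bar> \<le> \<bar>f y - f \<omega>\<bar>" for g
      proof -
        have ie: "integrable surface_measure (\<lambda>y. hh y * (\<psi> \<omega> y * \<bar>f y - f \<omega>\<bar>))" if "\<omega> \<in> \<Lambda>" for \<omega>
          by (rule if\<psi>[OF that, where M' = "2 * M"]) (use fb fd[OF _ that] in auto)
        have "\<bar>(LINT y|surface_measure. hh y * g y) - (\<Sum>\<omega>\<in>\<Lambda>. \<mu> \<omega> * g \<omega>)\<bar>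
          \<le> (\<Sum>\<omega>\<in>\<Lambda>. \<bar>LINT y|surface_measure. hh y * (\<psi> \<omega> y * (g y - g \<omega>))\<bar>)"
          by (subst split) (fact gb, erule gM, rule sum_abs)
        also have "\<dots> \<le> (\<Sum>\<omega>\<in>\<Lambda>. (LINT y|surface_measure. hh y * (\<psi> \<omega> y * \<bar>f y - f \<omega>\<bar>)))"
        proof (rule sum_mono)
          fix \<omega> assume \<omega>: "\<omega> \<in> \<Lambda>"
          have gi: "integrable surface_measure (\<lambda>y. hh y * (\<psi> \<omega> y * (g y - g \<omega>)))"
          proof (rule if\<psi>[OF \<omega>, where M' = "2 * M"])
            show "(\<lambda>y. g y - g \<omega>) \<in> borel_measurable borel" using gb by simp
            show "\<bar>g y - g \<omega>\<bar> \<le> 2 * M" if "norm y = 1" for y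
              using gM[OF that] gM[OF \<Lambda>1(1)[OF \<omega>]] by linarith
          qed
          have "norm (LINT y|surface_measure. hh y * (\<psi> \<omega> y * (g y - g \<omega>)))
            \<le> (LINT y|surface_measure. norm (hh y * (\<psi> \<omega> y * (g y - g \<omega>))))"
            by (intro integral_norm_bound)
          also have "\<dots> \<le> (LINT y|surface_measure. hh y * (\<psi> \<omega> y * \<bar>f y - f \<omega>\<bar>))"
            by (rule integral_mono[OF integrable_norm[OF gi] ie[OF \<omega>]])
              (use hh01 \<psi>0 gf in \<open>auto simp: abs_mult intro!: mult_left_mono\<close>)
          finally show "\<bar>LINT y|surface_measure. hh y * (\<psi> \<omega> y * (g y - g \<omega>))\<bar> \<le> (LINT y|surface_measure. hh y * (\<psi> \<omega> y * \<bar>f y - f \<omega>\<bar>))"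
            by simp
        qed
        also have "\<dots> = (LINT y|surface_measure. (\<Sum>\<omega>\<in>\<Lambda>. hh y * (\<psi> \<omega> y * \<bar>f y - f \<omega>\<bar>)))"
          by (rule Bochner_Integration.integral_sum[symmetric]) (rule ie)
        also have "\<dots> = IE" unfolding IE_def E_def by (simp only: sum_distrib_left)
        finally show ?thesis .
      qed
      have "\<bar>If - (\<Sum>\<omega>\<in>\<Lambda>. \<mu> \<omega> * \<bar>f \<omega>\<bar>)\<bar> \<le> IE"
        unfolding If_def by (rule bound) (use fb M in auto)
      \<comment> \<open>\<open>If\<close> exceeds the sum by at most \<open>IE\<close>, and
        \<open>IE \<le> If / 4\<close>; absorbing gives a third of the sum, hence less than the half
        needed for positive weights.\<close>
      then have "IE \<le> (\<Sum>\<omega>\<in>\<Lambda>. \<mu> \<omega> * \<bar>f \<omega>\<bar>) / 2" using IE4 If0 by linarith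
      moreover have "\<bar>L f\<bar> \<le> IE" unfolding L_def by (rule bound) (use fb M in auto)
      ultimately show ?thesis by (simp add: f_def[symmetric] sum_divide_distrib)
    qed
    \<comment> \<open>The continuous representatives: on them the integral in \<open>L\<close> is
      additive, and their values at the nodes are those of the spherical polynomials.\<close>
    define U where "U = range (multi_poly n :: _ \<Rightarrow> real ^ 'n \<Rightarrow> real)"
    have addU: "(\<lambda>x. multi_poly n c x + multi_poly n c' x) = multi_poly n (\<lambda>k. c k + c' k)" for c c' and x :: "real ^ 'n"
      by (simp add: fun_eq_iff multi_poly_def sum.distrib distrib_right)
    have scaleU: "(\<lambda>x :: real ^ 'n. t * multi_poly n c x) = multi_poly n (\<lambda>k. t * c k)" for c t
      by (simp add: fun_eq_iff multi_poly_def sum_distrib_left mult.assoc)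
    have iU: "integrable surface_measure (\<lambda>y. hh y * multi_poly n c y)" for c
    proof -
      obtain M where M: "\<And>y :: real ^ 'n. norm y = 1 \<Longrightarrow> \<bar>multi_poly n c y\<bar> \<le> M"
        by (rule continuous_bounded_sphere[OF continuous_on_multi_poly]) blast
      show ?thesis
        by (rule int[OF borel_measurable_continuous_onI[OF continuous_on_multi_poly] M])
    qed
    have "\<exists>\<nu>. (\<forall>\<omega>\<in>\<Lambda>. \<bar>\<nu> \<omega>\<bar> \<le> \<mu> \<omega> / 2) \<and> (\<forall>f\<in>U. L f = (\<Sum>\<omega>\<in>\<Lambda>. \<nu> \<omega> * f \<omega>))"
    proof (rule finite_Hahn_Banach[OF fin])
      show "0 \<le> \<mu> \<omega> / 2" if "\<omega> \<in> \<Lambda>" for \<omega> using \<mu>pos[OF that] by simp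
      show "\<bar>L f\<bar> \<le> (\<Sum>\<omega>\<in>\<Lambda>. \<mu> \<omega> / 2 * \<bar>f \<omega>\<bar>)" if "f \<in> U" for f using that key by (auto simp: U_def)
      show "(\<lambda>x. c * f x) \<in> U" if "f \<in> U" for c f using that by (auto simp: U_def scaleU)
      show "L (\<lambda>x. c * f x) = c * L f" for c f
      proof -
        have "(LINT y|surface_measure. hh y * (c * f y)) = (LINT y|surface_measure. c * (hh y * f y))"
          by (simp only: mult.left_commute)
        then show ?thesis unfolding L_def by (simp add: right_diff_distrib sum_distrib_left mult.left_commute)
      qed
      fix f g assume "f \<in> U" "g \<in> U"
      then obtain c c' where fg: "f = multi_poly n c" "g = multi_poly n c'" by (auto simp: U_def)
      show "(\<lambda>x. f x + g x) \<in> U" unfolding fg addU U_def by simp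
      show "L (\<lambda>x. f x + g x) = L f + L g"
        unfolding L_def fg distrib_left sum.distrib Bochner_Integration.integral_add[OF iU iU] by simp
    qed
    then obtain \<nu> where \<nu>: "\<And>\<omega>. \<omega> \<in> \<Lambda> \<Longrightarrow> \<bar>\<nu> \<omega>\<bar> \<le> \<mu> \<omega> / 2" "\<And>f. f \<in> U \<Longrightarrow> L f = (\<Sum>\<omega>\<in>\<Lambda>. \<nu> \<omega> * f \<omega>)"
      by blast
    define w where "w \<omega> = \<mu> \<omega> + \<nu> \<omega>" for \<omega>
    show "\<exists>w :: real ^ 'n \<Rightarrow> real.
        (\<forall>\<omega>\<in>\<Lambda>. w \<omega> > 0 \<and>
          equiv_with_const C (w \<omega>) (tri d e \<alpha> (\<delta> / n) \<omega>) \<and>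
          equiv_with_const C (tri d e \<alpha> (\<delta> / n) \<omega>)
            (measure surface_measure (cap_metric_ball e \<alpha> \<omega> (\<delta> / n)))) \<and>
        (\<forall>f\<in>spherical_polys n.
          (LINT y:cap e \<alpha>|surface_measure. f y) = (\<Sum>\<omega>\<in>\<Lambda>. w \<omega> * f \<omega>))"
      unfolding s_def[symmetric]
    proof (intro exI[of _ w] conjI ballI)
      fix \<omega> assume \<omega>: "\<omega> \<in> \<Lambda>"
      have wb: "\<mu> \<omega> / 2 \<le> w \<omega>" "w \<omega> \<le> 2 * \<mu> \<omega>" using \<nu>(1)[OF \<omega>] \<mu>pos[OF \<omega>] by (auto simp: w_def abs_le_iff)
      show "0 < w \<omega>" using wb \<mu>pos[OF \<omega>] by simp
      define T where "T = tri d e \<alpha> s \<omega>"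
      have T: "0 < T" using tri_pos[OF \<omega>] by (simp add: T_def)
      have C0: "0 < C" using C A by simp
      have CA: "A \<le> C" using C A by simp
      have iC: "inverse C * x \<le> y" if "x \<le> C * y" for x y
        using that C0 by (simp add: field_simps)
      have "T \<le> C * w \<omega>"
      proof -
        have "\<eta> ^ (d + 1) * T \<le> A * \<mu> \<omega>" using \<mu>tri(1)[OF \<omega>] by (simp add: T_def)
        also have "\<dots> \<le> A * (2 * w \<omega>)" using wb A by (intro mult_left_mono) auto
        finally have "T * \<eta> ^ (d + 1) \<le> 2 * A * w \<omega>" by (simp only: mult_ac)
        then have "T \<le> 2 * A * w \<omega> / \<eta> ^ (d + 1)" using \<eta>d(1) by (simp only: pos_le_divide_eq)
        then show ?thesis by (simp add: C_def)
      qed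
      moreover have "w \<omega> \<le> C * T"
      proof -
        have "w \<omega> \<le> 2 * (A * T)" using wb \<mu>tri(2)[OF \<omega>] by (simp add: T_def)
        also have "\<dots> = (2 * A) * T" by simp
        also have "\<dots> \<le> C * T" using C T by (intro mult_right_mono) auto
        finally show ?thesis .
      qed
      ultimately show "equiv_with_const C (w \<omega>) (tri d e \<alpha> s \<omega>)"
        unfolding equiv_with_const_def T_def[symmetric] using iC by blast
      have meas: "measure surface_measure (cap_metric_ball e \<alpha> \<omega> s) = V s \<omega>"
      proof -
        have eq: "cap_metric_ball e \<alpha> \<omega> s = ({y. 1 - 2 * \<kappa>\<^sup>2 \<le> y \<bullet> e} \<inter> {y. rho e \<alpha> \<omega> y \<le> s}) \<inter> sphere 0 1"
          using rho_eq[OF e \<Lambda>1(1)[OF \<omega>]] by (auto simp: cap_metric_ball_def cap)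
        have "{y. 1 - 2 * \<kappa>\<^sup>2 \<le> y \<bullet> e} \<inter> {y. rho e \<alpha> \<omega> y \<le> s} \<in> sets borel"
          by (intro sets.Int borel_closed closed_Collect_le continuous_on_rho al continuous_intros)
        then have "cap_metric_ball e \<alpha> \<omega> s \<in> sets surface_measure"
          unfolding eq sets_surface_measure sets_restrict_space by auto
        then have "measure surface_measure (cap_metric_ball e \<alpha> \<omega> s) = (LINT y|surface_measure. indicator (cap_metric_ball e \<alpha> \<omega> s) y)"
          using sets.sets_into_space by (simp add: Int_absorb2)
        also have "\<dots> = V s \<omega>"
          unfolding V_def
          by (rule Bochner_Integration.integral_cong) (auto simp: eq hh_def indicator_def space_surface_measure)
        finally show ?thesis .
      qed
      have V0: "0 \<le> V s \<omega>" using meas measure_nonneg by metis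
      have "T \<le> C * V s \<omega>"
        using Vtri(1)[OF \<omega> s] mult_right_mono[OF CA V0] by (simp add: T_def)
      moreover have "V s \<omega> \<le> C * T"
        using Vtri(2)[OF \<omega> s] mult_right_mono[OF CA less_imp_le[OF T]] unfolding T_def by linarith
      ultimately show "equiv_with_const C (tri d e \<alpha> s \<omega>) (measure surface_measure (cap_metric_ball e \<alpha> \<omega> s))"
        unfolding equiv_with_const_def meas T_def[symmetric] using iC by blast
    next
      fix f :: "real ^ 'n \<Rightarrow> real" assume "f \<in> spherical_polys n"
      then obtain c where c: "\<And>x. norm x = 1 \<Longrightarrow> f x = multi_poly n c x" by (auto simp: spherical_polys_iff)
      have "(LINT y:cap e \<alpha>|surface_measure. f y) = (LINT y|surface_measure. hh y * multi_poly n c y)"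
        unfolding set_lebesgue_integral_def
        by (rule Bochner_Integration.integral_cong) (auto simp: space_surface_measure hhcap c)
      also have "\<dots> = L (multi_poly n c) + (\<Sum>\<omega>\<in>\<Lambda>. \<mu> \<omega> * multi_poly n c \<omega>)" by (simp add: L_def)
      also have "L (multi_poly n c) = (\<Sum>\<omega>\<in>\<Lambda>. \<nu> \<omega> * multi_poly n c \<omega>)" by (rule \<nu>(2)) (simp add: U_def)
      also have "(\<Sum>\<omega>\<in>\<Lambda>. \<nu> \<omega> * multi_poly n c \<omega>) + (\<Sum>\<omega>\<in>\<Lambda>. \<mu> \<omega> * multi_poly n c \<omega>) = (\<Sum>\<omega>\<in>\<Lambda>. w \<omega> * multi_poly n c \<omega>)"
        by (simp add: w_def distrib_right sum.distrib)
      also have "\<dots> = (\<Sum>\<omega>\<in>\<Lambda>. w \<omega> * f \<omega>)" by (intro sum.cong) (auto simp: c \<Lambda>1)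
      finally show "(LINT y:cap e \<alpha>|surface_measure. f y) = (\<Sum>\<omega>\<in>\<Lambda>. w \<omega> * f \<omega>)" .
    qed
  qed
qed

end
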